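(* Let $0<3\alpha<\beta<1$. Let $u\in L^\infty((0,T);H^{\alpha+}(\mathbb{T}^3))\cap L^3((0,T);B^\beta_{3,\infty}(\mathbb{T}^3))$ be a given divergence-free velocity field, and let $B\in L^\infty((0,T);H^{-\alpha}(\mathbb{T}^3))$ be a functional weak solution of the kinematic dynamo equation for the velocity field $u$, such that $B\in L^3((0,T);B^{-\alpha}_{3,\infty}(\mathbb{T}^3))$. Let $A=\nabla\times(-\Delta)^{-1}B$ be the corresponding magnetic potential. Then the functional weak solution conserves magnetic helicity, that is, $$\langle B,A\rangle(t_1)=\langle B,A\rangle(t_2)$$ for almost all times $t_1,t_2\in(0,T)$.
   Context: $\mathbb{T}^3$ is the three-dimensional torus, $T>0$, $\mathcal{D}$ denotes $C_c^\infty$, $B^s_{p,q}$ are Besov spaces, $\langle\cdot,\cdot\rangle$ is the spatial distributional duality bracket. $H^{\alpha+}$ means $H^{\alpha+\epsilon_0}$ for some $\epsilon_0>0$. The kinematic dynamo (induction) equation is $\partial_tB+\nabla\times(B\times u)=0$, $\nabla\cdot B=0$, with $u$ given and divergence-free. For $\alpha>0$ and given $u\in L^\infty((0,T);H^{\alpha+}(\mathbb{T}^3))$, a functional weak solution is $B\in L^\infty((0,T);H^{-\alpha}(\mathbb{T}^3))$ such that for all $\psi\in\mathcal{D}(\mathbb{T}^3\times(0,T);\mathbb{R}^3)$ $$\int_0^T\langle B,\partial_t\psi\rangle dt-\int_0^T\langle B\times u,\nabla\times\psi\rangle dt=0,$$ and $\int_0^T\langle B,\nabla\varphi\rangle dt=0$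 for all $\varphi\in\mathcal{D}(\mathbb{T}^3\times(0,T);\mathbb{R})$. The product $B\times u$ is understood as a Bony paraproduct, i.e. as the continuous extension of the pointwise product (equivalently the limit of products of mollified functions). Standing assumption: $B$ is mean-free, and $(-\Delta)^{-1}B$ is taken mean-free. *)

theory Defs
  imports "HOL-Analysis.Analysis"
begin

text \<open>The torus is $(\mathbf{R}/2\pi\mathbf{Z})^3$; functions on it are $2\pi$-periodic functions
  on \<^typ>\<open>real^3\<close>, and integrals over it are integrals over one period cell.\<close>

definition dir_deriv :: "'a::euclidean_space \<Rightarrow> ('a \<Rightarrow> 'b::real_normed_vector) \<Rightarrow> 'a \<Rightarrow> 'b" where
  "dir_deriv v f = (\<lambda>x. frechet_derivative f (at x) v)"

definition smooth :: "('a::euclidean_space \<Rightarrow> 'b::real_normed_vector) \<Rightarrow> bool" where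
  "smooth f \<longleftrightarrow> (\<forall>vs. set vs \<subseteq> Basis \<longrightarrow> foldr dir_deriv vs f differentiable_on UNIV)"

definition period_cell :: "(real^3) set" where
  "period_cell = cbox 0 (\<chi> i. 2 * pi)"

definition torus_periodic :: "(real^3 \<Rightarrow> 'b) \<Rightarrow> bool" where
  "torus_periodic f \<longleftrightarrow> (\<forall>x i. f (x + axis i (2 * pi)) = f x)"

definition torus_test :: "(real^3 \<Rightarrow> 'b::real_normed_vector) \<Rightarrow> bool" where
  "torus_test \<phi> \<longleftrightarrow> smooth \<phi> \<and> torus_periodic \<phi>"

text \<open>Space-time test functions \<open>\<psi> (t, x)\<close>: smooth in all variables, periodic in \<open>x\<close>,
  compactly supported in \<open>t \<in> (0,T)\<close>.\<close>

definition spacetime_test :: "real \<Rightarrow> (real \<times> (real^3) \<Rightarrow> 'b::real_normed_vector) \<Rightarrow> bool" where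
  "spacetime_test T \<psi> \<longleftrightarrow> smooth \<psi> \<and> (\<forall>t. torus_periodic (\<lambda>x. \<psi> (t, x))) \<and>
     (\<exists>a b. 0 < a \<and> b < T \<and> (\<forall>t x. t \<notin> {a..b} \<longrightarrow> \<psi> (t, x) = 0))"

definition gradient :: "(real^3 \<Rightarrow> real) \<Rightarrow> real^3 \<Rightarrow> real^3" where
  "gradient \<phi> x = (\<chi> i. dir_deriv (axis i 1) \<phi> x)"

text \<open>Indices in type \<open>3\<close> are added modulo 3, so \<open>(i, i+1, i+2)\<close> is always a cyclic permutation
  of \<open>(1, 2, 3)\<close>.\<close>

definition curl :: "(real^3 \<Rightarrow> real^3) \<Rightarrow> real^3 \<Rightarrow> real^3" where
  "curl \<psi> x = (\<chi> i. dir_deriv (axis (i + 1) 1) (\<lambda>y. \<psi> y $ (i + 2)) x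
                   - dir_deriv (axis (i + 2) 1) (\<lambda>y. \<psi> y $ (i + 1)) x)"

text \<open>Real scalar and vector distributions on the torus. Only the values on test functions are
  meaningful.\<close>

type_synonym dist = "(real^3 \<Rightarrow> real) \<Rightarrow> real"
type_synonym vdist = "dist^3"

definition torus_distribution :: "dist \<Rightarrow> bool" where
  "torus_distribution f \<longleftrightarrow>
     (\<forall>\<phi> \<psi> a b. torus_test \<phi> \<and> torus_test \<psi> \<longrightarrow>
        f (\<lambda>x. a * \<phi> x + b * \<psi> x) = a * f \<phi> + b * f \<psi>) \<and>
     (\<exists>C n. \<forall>\<phi> M. torus_test \<phi> \<and>
        (\<forall>vs x. set vs \<subseteq> Basis \<and> length vs \<le> n \<longrightarrow> \<bar>foldr dir_deriv vs \<phi> x\<bar> \<le> M) \<longrightarrow>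
        \<bar>f \<phi>\<bar> \<le> C * M)"

definition dist_of :: "(real^3 \<Rightarrow> real) \<Rightarrow> dist" where
  "dist_of g = (\<lambda>\<phi>. LINT x:period_cell|lebesgue. g x * \<phi> x)"

definition pairing :: "vdist \<Rightarrow> (real^3 \<Rightarrow> real^3) \<Rightarrow> real" where
  "pairing f \<psi> = (\<Sum>i\<in>UNIV. (f $ i) (\<lambda>x. \<psi> x $ i))"

definition curl_dist :: "vdist \<Rightarrow> vdist" where
  "curl_dist F = (\<chi> i. (\<lambda>\<phi>. - (F $ (i + 2)) (dir_deriv (axis (i + 1) 1) \<phi>)
                          + (F $ (i + 1)) (dir_deriv (axis (i + 2) 1) \<phi>)))"

definition divergence_free :: "vdist \<Rightarrow> bool" where
  "divergence_free F \<longleftrightarrow> (\<forall>\<phi>. torus_test \<phi> \<longrightarrow> pairing F (gradient \<phi>) = 0)"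

definition mean_free :: "vdist \<Rightarrow> bool" where
  "mean_free F \<longleftrightarrow> (\<forall>i. (F $ i) (\<lambda>x. 1) = 0)"

definition wavevec :: "int^3 \<Rightarrow> real^3" where
  "wavevec k = (\<chi> i. of_int (k $ i))"

text \<open>$\hat f(k) = (2\pi)^{-3} \langle f, e^{-ik\cdot x}\rangle$.\<close>

definition fourier_coeff :: "dist \<Rightarrow> int^3 \<Rightarrow> complex" where
  "fourier_coeff f k = Complex (f (\<lambda>x. cos (wavevec k \<bullet> x))) (- f (\<lambda>x. sin (wavevec k \<bullet> x)))
                         / of_real ((2 * pi) ^ 3)"

text \<open>The Fourier multiplier $\sum_k m(k) \hat f(k) e^{ik\cdot x}$ with an even real symbol \<open>m\<close>;
  for such \<open>m\<close> the sum is real, so taking real parts termwise changes nothing.\<close>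

definition fourier_multiplier :: "(int^3 \<Rightarrow> real) \<Rightarrow> dist \<Rightarrow> real^3 \<Rightarrow> real" where
  "fourier_multiplier m f x = (\<Sum>\<^sub>\<infinity>k. m k * Re (fourier_coeff f k * cis (wavevec k \<bullet> x)))"

text \<open>The mean-free inverse of \<open>-\<Delta>\<close> has symbol $|k|^{-2}$ for $k \neq 0$ and $0$ for $k = 0$. It is
  self-adjoint, and so acts on distributions by transposition.\<close>

definition inv_neg_laplacian :: "dist \<Rightarrow> dist" where
  "inv_neg_laplacian f =
     (\<lambda>\<phi>. f (fourier_multiplier (\<lambda>k. if k = 0 then 0 else 1 / (norm (wavevec k))\<^sup>2) (dist_of \<phi>)))"

definition magnetic_potential :: "vdist \<Rightarrow> vdist" where
  "magnetic_potential B = curl_dist (\<chi> i. inv_neg_laplacian (B $ i))"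

text \<open>Littlewood--Paley theory. The symbol $\xi \mapsto \eta(|\xi|)$ is the low-frequency cut-off.
  Block \<open>j\<close> is the operator usually written $\Delta_{j-1}$ ($j - 1 \geq -1$):
  $\Delta_{-1} = \eta(|D|)$ and
  $\Delta_q = \eta(2^{-q-1}|D|) - \eta(2^{-q}|D|)$ for $q \geq 0$.\<close>

definition lp_cutoff :: "(real \<Rightarrow> real) \<Rightarrow> bool" where
  "lp_cutoff \<eta> \<longleftrightarrow> smooth \<eta> \<and> (\<forall>r. 0 \<le> \<eta> r \<and> \<eta> r \<le> 1) \<and>
     (\<forall>r. \<bar>r\<bar> \<le> 3/4 \<longrightarrow> \<eta> r = 1) \<and> (\<forall>r. \<bar>r\<bar> \<ge> 4/3 \<longrightarrow> \<eta> r = 0)"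

definition lp_symbol :: "(real \<Rightarrow> real) \<Rightarrow> nat \<Rightarrow> int^3 \<Rightarrow> real" where
  "lp_symbol \<eta> j k =
     (if j = 0 then \<eta> (norm (wavevec k))
      else \<eta> (norm (wavevec k) / 2 ^ j) - \<eta> (norm (wavevec k) / 2 ^ (j - 1)))"

definition lp_block :: "(real \<Rightarrow> real) \<Rightarrow> nat \<Rightarrow> dist \<Rightarrow> real^3 \<Rightarrow> real" where
  "lp_block \<eta> j f = fourier_multiplier (lp_symbol \<eta> j) f"

text \<open>The Bony product $T_f g + T_g f + R(f, g)$, with $T_f g = \sum_j S_{j-1} f \Delta_j g$,
  $S_{j-1} = \sum_{i \leq j-2} \Delta_i$, and
  $R(f, g) = \sum_{|i - j| \leq 1} \Delta_i f \Delta_j g$, the series converging in the sense of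
  distributions.\<close>

definition paraproduct :: "(real \<Rightarrow> real) \<Rightarrow> dist \<Rightarrow> dist \<Rightarrow> dist" where
  "paraproduct \<eta> f g =
     (\<lambda>\<phi>. \<Sum>j. dist_of (\<lambda>x. (\<Sum>i | i + 2 \<le> j. lp_block \<eta> i f x) * lp_block \<eta> j g x) \<phi>)"

definition resonant_product :: "(real \<Rightarrow> real) \<Rightarrow> dist \<Rightarrow> dist \<Rightarrow> dist" where
  "resonant_product \<eta> f g =
     (\<lambda>\<phi>. \<Sum>j. dist_of (\<lambda>x. (\<Sum>i | i \<le> j + 1 \<and> j \<le> i + 1. lp_block \<eta> i f x) * lp_block \<eta> j g x) \<phi>)"

definition bony_product :: "(real \<Rightarrow> real) \<Rightarrow> dist \<Rightarrow> dist \<Rightarrow> dist" where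
  "bony_product \<eta> f g =
     (\<lambda>\<phi>. paraproduct \<eta> f g \<phi> + paraproduct \<eta> g f \<phi> + resonant_product \<eta> f g \<phi>)"

definition bony_cross :: "(real \<Rightarrow> real) \<Rightarrow> vdist \<Rightarrow> vdist \<Rightarrow> vdist" where
  "bony_cross \<eta> F G = (\<chi> i. (\<lambda>\<phi>. bony_product \<eta> (F $ (i + 1)) (G $ (i + 2)) \<phi>
                              - bony_product \<eta> (F $ (i + 2)) (G $ (i + 1)) \<phi>))"

text \<open>The bracket of two distributions, $\langle f, g\rangle = \lim_N \langle f, S_N g\rangle$: the
  continuous extension, from smooth \<open>g\<close> to $g \in H^s$, of the duality bracket with $f \in H^{-s}$.\<close>

definition dual_bracket :: "(real \<Rightarrow> real) \<Rightarrow> vdist \<Rightarrow> vdist \<Rightarrow> real" where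
  "dual_bracket \<eta> F G = lim (\<lambda>N. pairing F (\<lambda>x. \<chi> i. \<Sum>j<N. lp_block \<eta> j (G $ i) x))"

definition sobolev_space :: "real \<Rightarrow> dist set" where
  "sobolev_space s = {f. torus_distribution f \<and>
     (\<lambda>k. (1 + (norm (wavevec k))\<^sup>2) powr s * (cmod (fourier_coeff f k))\<^sup>2) summable_on UNIV}"

definition sobolev_norm :: "real \<Rightarrow> dist \<Rightarrow> real" where
  "sobolev_norm s f =
     sqrt (\<Sum>\<^sub>\<infinity>k. (1 + (norm (wavevec k))\<^sup>2) powr s * (cmod (fourier_coeff f k))\<^sup>2)"

definition torus_Lp_norm :: "real \<Rightarrow> (real^3 \<Rightarrow> real) \<Rightarrow> real" where
  "torus_Lp_norm p g = (LINT x:period_cell|lebesgue. \<bar>g x\<bar> powr p) powr (1 / p)"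

text \<open>$B^s_{p,\infty}$.\<close>

definition besov_space :: "(real \<Rightarrow> real) \<Rightarrow> real \<Rightarrow> real \<Rightarrow> dist set" where
  "besov_space \<eta> s p = {f. torus_distribution f \<and>
     bdd_above (range (\<lambda>j. 2 powr (s * (real j - 1)) * torus_Lp_norm p (lp_block \<eta> j f)))}"

definition besov_norm :: "(real \<Rightarrow> real) \<Rightarrow> real \<Rightarrow> real \<Rightarrow> dist \<Rightarrow> real" where
  "besov_norm \<eta> s p f = (SUP j. 2 powr (s * (real j - 1)) * torus_Lp_norm p (lp_block \<eta> j f))"

definition vec_space :: "dist set \<Rightarrow> vdist set" where
  "vec_space X = {F. \<forall>i. F $ i \<in> X}"

definition vec_norm :: "(dist \<Rightarrow> real) \<Rightarrow> vdist \<Rightarrow> real" where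
  "vec_norm nrm F = (\<Sum>i\<in>UNIV. nrm (F $ i))"

text \<open>Bochner spaces on \<open>(0,T)\<close> with values in a space \<open>X\<close> normed by \<open>nrm\<close>.\<close>

definition strongly_measurable ::
  "real \<Rightarrow> 'd set \<Rightarrow> ('d::minus \<Rightarrow> real) \<Rightarrow> (real \<Rightarrow> 'd) \<Rightarrow> bool" where
  "strongly_measurable T X nrm f \<longleftrightarrow>
     (AE t in lebesgue_on {0<..<T}. f t \<in> X) \<and>
     (\<exists>s. (\<forall>n. simple_function (lebesgue_on {0<..<T}) (s n) \<and> range (s n) \<subseteq> X) \<and>
          (AE t in lebesgue_on {0<..<T}. (\<lambda>n. nrm (s n t - f t)) \<longlonglongrightarrow> 0))"

definition bochner_L :: "real \<Rightarrow> real \<Rightarrow> 'd set \<Rightarrow> ('d::minus \<Rightarrow> real) \<Rightarrow> (real \<Rightarrow> 'd) \<Rightarrow> bool" where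
  "bochner_L p T X nrm f \<longleftrightarrow> strongly_measurable T X nrm f \<and>
     integrable (lebesgue_on {0<..<T}) (\<lambda>t. nrm (f t) powr p)"

definition bochner_Linf :: "real \<Rightarrow> 'd set \<Rightarrow> ('d::minus \<Rightarrow> real) \<Rightarrow> (real \<Rightarrow> 'd) \<Rightarrow> bool" where
  "bochner_Linf T X nrm f \<longleftrightarrow> strongly_measurable T X nrm f \<and>
     (\<exists>C. AE t in lebesgue_on {0<..<T}. nrm (f t) \<le> C)"

definition Linf_sobolev :: "real \<Rightarrow> real \<Rightarrow> (real \<Rightarrow> vdist) \<Rightarrow> bool" where
  "Linf_sobolev T s f \<longleftrightarrow>
     bochner_Linf T (vec_space (sobolev_space s)) (vec_norm (sobolev_norm s)) f"

definition L3_besov :: "(real \<Rightarrow> real) \<Rightarrow> real \<Rightarrow> real \<Rightarrow> (real \<Rightarrow> vdist) \<Rightarrow> bool" where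
  "L3_besov \<eta> T s f \<longleftrightarrow>
     bochner_L 3 T (vec_space (besov_space \<eta> s 3)) (vec_norm (besov_norm \<eta> s 3)) f"

text \<open>Functional weak solutions of $\partial_t B + \nabla\times(B\times u) = 0$, $\nabla\cdot B = 0$.\<close>

definition functional_weak_solution ::
  "(real \<Rightarrow> real) \<Rightarrow> real \<Rightarrow> real \<Rightarrow> (real \<Rightarrow> vdist) \<Rightarrow> (real \<Rightarrow> vdist) \<Rightarrow> bool" where
  "functional_weak_solution \<eta> T \<alpha> u B \<longleftrightarrow>
     Linf_sobolev T (- \<alpha>) B \<and>
     (\<forall>\<psi> :: real \<times> (real^3) \<Rightarrow> real^3. spacetime_test T \<psi> \<longrightarrow>
        (LINT t|lebesgue_on {0<..<T}. pairing (B t) (\<lambda>x. dir_deriv (1, 0) \<psi> (t, x)))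
        - (LINT t|lebesgue_on {0<..<T}. pairing (bony_cross \<eta> (B t) (u t)) (curl (\<lambda>x. \<psi> (t, x))))
        = 0) \<and>
     (\<forall>\<phi> :: real \<times> (real^3) \<Rightarrow> real. spacetime_test T \<phi> \<longrightarrow>
        (LINT t|lebesgue_on {0<..<T}. pairing (B t) (gradient (\<lambda>x. \<phi> (t, x)))) = 0)"

end

theory Submission
  imports Defs
begin

text \<open>The helicity is regularised by the Fourier weights of a Jackson kernel $K_n$, $n = 2^N$; as $\nabla\cdot B = 0$, its
  time derivative is $-2\int (B\times u)\cdot (K_n * B)$. On low frequencies $K_n * B$ is a convex combination of
  translates of $B$, and $(B(x)\times u(x))\cdot B(x+y)$ changes sign when the two values of $B$ are exchanged, so that
  only increments of $u$ contribute. Bernstein's inequality and the $L^3$ Besov bounds make this contribution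
  $O(2^{(2\alpha-\beta)N})$; high frequency blocks interact with $K_n * B$ only if they are adjacent and satisfy the same bound.
  Hence the production of regularised helicity, integrated in time, tends to $0$. The argument is rigorous in time because
  the weak formulation, tested with single trigonometric modes, makes every Fourier coefficient of $B$ almost everywhere
  equal to a Lipschitz primitive.\<close>

section \<open>Smooth and test functions\<close>

text \<open>The kernel has to satisfy three demands at once. It is nonnegative, so that convolution
  is a mean of translations and does not increase L^3 norms. It has finite spectrum, so that the
  regularised helicity is a finite sum of modes and distant blocks decouple. Its first moment is
  O(1/n), so that an increment of u regains the derivative lost in Bernstein's inequality. The Fejer
  kernel fails the last demand (its first moment is of order log n / n); its normalised square meets
  it. The count of powers is then: 2^(\<alpha> N) for each of two factors B, 2^((1 - \<beta>) N) for
  a differentiated u, and 2^(-N) from the kernel. The main obstacle is that B x u exists only as a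
  Bony product, that is, as a limit. The flux is therefore estimated for low-pass filtered fields,
  which are trigonometric polynomials, with a bound independent of the filter. In time nothing but
  the scalar modes is regular, so each regularised helicity is handled as a finite bilinear
  expression in modes. The bracket itself is defined with other weights than those of the kernel;
  both regularisations have the same limit because the series of modes converges absolutely.\<close>

lemma dir_deriv_eqI: "(f has_derivative f') (at x) \<Longrightarrow> dir_deriv v f x = f' v"
  unfolding dir_deriv_def by (metis frechet_derivative_at)

text \<open>Smoothness quantifies over all words of partial derivatives, so it follows from
  membership in any class of differentiable functions that is closed under the basis derivatives.
  Concrete smooth functions are treated by exhibiting such a class.\<close>

lemma smooth_coinduct:
  assumes "f \<in> C" and "\<And>g. g \<in> C \<Longrightarrow> g differentiable_on UNIV"
    and "\<And>g v. g \<in> C \<Longrightarrow> v \<in> Basis \<Longrightarrow> dir_deriv v g \<in> C"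
  shows "smooth f"
proof -
  have "foldr dir_deriv vs f \<in> C" if "set vs \<subseteq> Basis" for vs
    using that by (induction vs) (auto intro: assms)
  then show ?thesis unfolding smooth_def using assms(2) by blast
qed

lemma smooth_differentiable_on: "smooth f \<Longrightarrow> f differentiable_on UNIV"
  unfolding smooth_def by (drule spec[of _ "[]"]) simp

lemma smooth_differentiable: "smooth f \<Longrightarrow> f differentiable (at x)"
  using smooth_differentiable_on by (auto simp: differentiable_on_def)

lemma smooth_dir_deriv: "smooth f \<Longrightarrow> v \<in> Basis \<Longrightarrow> smooth (dir_deriv v f)"
  unfolding smooth_def
proof (intro allI impI)
  fix vs :: "'a list" assume a: "\<forall>vs. set vs \<subseteq> Basis \<longrightarrow> foldr dir_deriv vs f differentiable_on UNIV"
    and v: "v \<in> Basis" "set vs \<subseteq> Basis"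
  show "foldr dir_deriv vs (dir_deriv v f) differentiable_on UNIV"
    using a[rule_format, of "vs @ [v]"] v by simp
qed

lemma smooth_real_derivative:
  fixes f :: "real \<Rightarrow> real"
  assumes "smooth f"
  shows "(f has_real_derivative dir_deriv 1 f x) (at x)"
proof -
  obtain d where d: "(f has_real_derivative d) (at x)"
    using smooth_differentiable[OF assms] real_differentiable_def by blast
  then have "dir_deriv 1 f x = d"
    using dir_deriv_eqI[of f "(*) d" x 1] by (simp add: has_field_derivative_def)
  with d show ?thesis by simp
qed

lemma smooth_real_continuous: "smooth (f :: real \<Rightarrow> real) \<Longrightarrow> continuous_on S f"
  by (meson DERIV_isCont continuous_at_imp_continuous_on smooth_real_derivative)

lemma smooth_realI:
  fixes f :: "real \<Rightarrow> real"
  assumes "f \<in> C"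
    and "\<And>g. g \<in> C \<Longrightarrow> \<exists>g' \<in> C. \<forall>x. (g has_real_derivative g' x) (at x)"
  shows "smooth f"
proof (rule smooth_coinduct[where C = C])
  fix g assume g: "g \<in> C"
  then obtain g' where g': "g' \<in> C" "\<And>x. (g has_real_derivative g' x) (at x)"
    using assms(2) by blast
  show "g differentiable_on UNIV"
    using g'(2) by (meson differentiable_at_imp_differentiable_on real_differentiable_def)
  have "dir_deriv 1 g = g'"
  proof
    show "dir_deriv 1 g x = g' x" for x
      using dir_deriv_eqI[of g "(*) (g' x)" x 1] g'(2)[of x] by (simp add: has_field_derivative_def)
  qed
  then show "dir_deriv v g \<in> C" if "v \<in> Basis" for v using that g' by simp
qed (rule assms(1))

lemma dir_deriv_linear:
  fixes f g :: "'a::euclidean_space \<Rightarrow> real"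
  assumes "smooth f" "smooth g"
  shows "dir_deriv v (\<lambda>x. a * f x + b * g x) = (\<lambda>x. a * dir_deriv v f x + b * dir_deriv v g x)"
proof
  fix x
  obtain f' g' where d: "(f has_derivative f') (at x)" "(g has_derivative g') (at x)"
    using smooth_differentiable assms unfolding differentiable_def by metis
  have "((\<lambda>x. a * f x + b * g x) has_derivative (\<lambda>h. a * f' h + b * g' h)) (at x)"
    by (intro has_derivative_add has_derivative_mult_right d)
  from dir_deriv_eqI[OF this] dir_deriv_eqI[OF d(1)] dir_deriv_eqI[OF d(2)]
  show "dir_deriv v (\<lambda>x. a * f x + b * g x) x = a * dir_deriv v f x + b * dir_deriv v g x" by simp
qed

lemma smooth_linear:
  fixes f g :: "'a::euclidean_space \<Rightarrow> real"
  assumes "smooth f" "smooth g"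
  shows "smooth (\<lambda>x. a * f x + b * g x)"
proof (rule smooth_coinduct[where C = "{(\<lambda>x. a * f x + b * g x) | f g. smooth f \<and> smooth g}"])
  fix h :: "'a \<Rightarrow> real" and v :: 'a
  assume "h \<in> {(\<lambda>x. a * f x + b * g x) | f g. smooth f \<and> smooth g}"
  then obtain f g where h: "h = (\<lambda>x. a * f x + b * g x)" "smooth f" "smooth g" by auto
  show "h differentiable_on UNIV"
    unfolding h differentiable_on_def using smooth_differentiable[OF h(2)] smooth_differentiable[OF h(3)]
    by (auto intro!: differentiable_add differentiable_mult)
  assume "v \<in> Basis"
  then show "dir_deriv v h \<in> {(\<lambda>x. a * f x + b * g x) | f g. smooth f \<and> smooth g}"
    using dir_deriv_linear[OF h(2,3)] h smooth_dir_deriv by blast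
qed (use assms in blast)

lemma smooth_affine:
  fixes f :: "real \<Rightarrow> real"
  assumes "smooth f"
  shows "smooth (\<lambda>t. f (c * t + d))"
proof (rule smooth_realI[where C = "{(\<lambda>t. e * f (c * t + d)) | e f. smooth f}"])
  fix g :: "real \<Rightarrow> real" assume "g \<in> {(\<lambda>t. e * f (c * t + d)) | e f. smooth f}"
  then obtain e f where g: "g = (\<lambda>t. e * f (c * t + d))" "smooth f" by auto
  have "(g has_real_derivative (e * c) * dir_deriv 1 f (c * t + d)) (at t)" for t
  proof -
    have "((\<lambda>t. c * t + d) has_real_derivative c) (at t)" by (auto intro!: derivative_eq_intros)
    from DERIV_chain2[OF smooth_real_derivative[OF g(2)] this]
    have "((\<lambda>t. f (c * t + d)) has_real_derivative dir_deriv 1 f (c * t + d) * c) (at t)" .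
    then show ?thesis unfolding g by (auto intro!: derivative_eq_intros)
  qed
  moreover have "(\<lambda>t. (e * c) * dir_deriv 1 f (c * t + d)) \<in> {(\<lambda>t. e * f (c * t + d)) | e f. smooth f}"
    using smooth_dir_deriv[OF g(2), of 1] by auto
  ultimately show "\<exists>g'\<in>{(\<lambda>t. e * f (c * t + d)) | e f. smooth f}. \<forall>x. (g has_real_derivative g' x) (at x)"
    by (intro bexI[where x = "\<lambda>t. (e * c) * dir_deriv 1 f (c * t + d)"] allI)
qed (use assms in \<open>auto intro!: exI[of _ 1]\<close>)

lemma smooth_antiderivative:
  fixes f :: "real \<Rightarrow> real"
  assumes "smooth f" "\<And>x. (F has_real_derivative f x) (at x)"
  shows "smooth F"
proof (rule smooth_realI[where C = "insert F {g. smooth g}"])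
  fix g assume "g \<in> insert F {g. smooth g}"
  then show "\<exists>g'\<in>insert F {g. smooth g}. \<forall>x. (g has_real_derivative g' x) (at x)"
    using assms smooth_dir_deriv[of g 1] smooth_real_derivative[of g] by auto
qed simp

text \<open>Turns a cut-off that is constant near the origin into a one-sided smooth step, the
  building block of the time test functions in \<open>fundamental_lemma\<close>. The class used is
  stable because the derivative is again constant near 0, with value 0.\<close>

lemma smooth_glue_const:
  fixes f :: "real \<Rightarrow> real"
  assumes "smooth f" "\<And>r. \<bar>r\<bar> \<le> 1/2 \<Longrightarrow> f r = c"
  shows "smooth (\<lambda>r. if r \<ge> 0 then f r else c)"
proof (rule smooth_realI[where C = "{(\<lambda>r. if r \<ge> 0 then f r else c) | f c. smooth f \<and> (\<forall>r. \<bar>r\<bar> < 1/2 \<longrightarrow> f r = c)}"])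
  fix g :: "real \<Rightarrow> real"
  let ?C = "{(\<lambda>r. if r \<ge> 0 then f r else c) | f c. smooth (f :: real \<Rightarrow> real) \<and> (\<forall>r. \<bar>r\<bar> < 1/2 \<longrightarrow> f r = c)}"
  assume "g \<in> ?C"
  then obtain f c where g: "g = (\<lambda>r. if r \<ge> 0 then f r else c)" "smooth f" "\<And>r. \<bar>r\<bar> < 1/2 \<Longrightarrow> f r = c" by auto
  let ?f' = "dir_deriv 1 f"
  have loc: "(h has_real_derivative d) (at x)"
    if "open S" "x \<in> S" "\<And>y. y \<in> S \<Longrightarrow> h y = k y" "(k has_real_derivative d) (at x)" for h k :: "real \<Rightarrow> real" and x d S
    using that by (metis has_field_derivative_transform_within_open)
  have z: "?f' x = 0" if "\<bar>x\<bar> < 1/2" for x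
  proof -
    have "(f has_real_derivative 0) (at x)"
      by (rule loc[of "{-1/2<..<1/2}" x f "\<lambda>_. c" 0]) (use that g(3) in auto)
    then show ?thesis using smooth_real_derivative[OF g(2)] DERIV_unique by blast
  qed
  have "(g has_real_derivative (if x \<ge> 0 then ?f' x else 0)) (at x)" for x
  proof -
    consider "x > 0" | "x < 0" | "x = 0" by linarith
    then show ?thesis
    proof cases
      case 1
      then show ?thesis using smooth_real_derivative[OF g(2)]
        by (intro loc[of "{0<..}" x g f]) (auto simp: g(1))
    next
      case 2
      then show ?thesis by (intro loc[of "{..<0}" x g "\<lambda>_. c"]) (auto simp: g(1))
    next
      case 3
      then show ?thesis using z by (intro loc[of "{-1/2<..<1/2}" x g "\<lambda>_. c"]) (auto simp: g(1,3))
    qed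
  qed
  moreover have "(\<lambda>x. if x \<ge> 0 then ?f' x else 0) \<in> ?C"
    using smooth_dir_deriv[OF g(2), of 1] z by fastforce
  ultimately show "\<exists>g'\<in>?C. \<forall>x. (g has_real_derivative g' x) (at x)" by (intro bexI[where x = "\<lambda>x. if x \<ge> 0 then ?f' x else 0"] allI) blast+
qed (use assms in fastforce)

section \<open>Trigonometric modes as test functions on the torus and in space-time\<close>

abbreviation cosm :: "int^3 \<Rightarrow> real^3 \<Rightarrow> real" where "cosm k \<equiv> \<lambda>x. cos (wavevec k \<bullet> x)"
abbreviation sinm :: "int^3 \<Rightarrow> real^3 \<Rightarrow> real" where "sinm k \<equiv> \<lambda>x. sin (wavevec k \<bullet> x)"

lemma wavevec_nth [simp]: "wavevec k $ i = of_int (k $ i)"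
  by (simp add: wavevec_def)

lemma wavevec_inner_axis [simp]: "wavevec k \<bullet> axis i c = of_int (k $ i) * c"
  by (simp add: inner_axis)

lemma dir_deriv_trig:
  "dir_deriv v (\<lambda>x. a * cos (w \<bullet> x) + b * sin (w \<bullet> x)) =
    (\<lambda>x. (b * (w \<bullet> v)) * cos (w \<bullet> x) + (- a * (w \<bullet> v)) * sin (w \<bullet> x))"
  (is "dir_deriv v ?f = ?g")
proof
  fix x
  have "(?f has_derivative (\<lambda>h. (b * (w \<bullet> h)) * cos (w \<bullet> x) + (- a * (w \<bullet> h)) * sin (w \<bullet> x))) (at x)"
    by (auto intro!: derivative_eq_intros simp: algebra_simps)
  from dir_deriv_eqI[OF this] show "dir_deriv v ?f x = ?g x" by simp
qed

lemma dir_deriv_cosm: "dir_deriv v (cosm k) = (\<lambda>x. - (wavevec k \<bullet> v) * sin (wavevec k \<bullet> x))"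
  using dir_deriv_trig[of v 1 "wavevec k" 0] by simp

lemma dir_deriv_sinm: "dir_deriv v (sinm k) = (\<lambda>x. (wavevec k \<bullet> v) * cos (wavevec k \<bullet> x))"
  using dir_deriv_trig[of v 0 "wavevec k" 1] by simp

lemma smooth_trig: "smooth (\<lambda>x. a * cos (w \<bullet> x) + b * sin (w \<bullet> x))"
proof (rule smooth_coinduct[where C = "range (\<lambda>(a, b) x. a * cos (w \<bullet> x) + b * sin (w \<bullet> x))"])
  fix g v assume "g \<in> range (\<lambda>(a, b) x. a * cos (w \<bullet> x) + b * sin (w \<bullet> x))"
  then obtain a b where g: "g = (\<lambda>x. a * cos (w \<bullet> x) + b * sin (w \<bullet> x))" by auto
  have "(g has_derivative (\<lambda>h. (b * (w \<bullet> h)) * cos (w \<bullet> x) + (- a * (w \<bullet> h)) * sin (w \<bullet> x))) (at x)" for x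
    unfolding g by (auto intro!: derivative_eq_intros simp: algebra_simps)
  then show "g differentiable_on UNIV" by (auto simp: differentiable_on_def differentiable_def)
  show "dir_deriv v g \<in> range (\<lambda>(a, b) x. a * cos (w \<bullet> x) + b * sin (w \<bullet> x))"
    unfolding g dir_deriv_trig by (rule range_eqI[where x = "(b * (w \<bullet> v), - a * (w \<bullet> v))"]) simp
qed (auto intro: range_eqI[where x = "(a, b)"])

lemma cos_sin_period: "cos (wavevec k \<bullet> (x + axis i (2 * pi))) = cos (wavevec k \<bullet> x)"
   "sin (wavevec k \<bullet> (x + axis i (2 * pi))) = sin (wavevec k \<bullet> x)"
  by (simp_all add: inner_add_right cos_add sin_add mult.commute[of "of_int _"] )

lemma torus_test_trig: "torus_test (\<lambda>x. a * cosm k x + b * sinm k x)"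
  unfolding torus_test_def torus_periodic_def
  by (auto simp: smooth_trig cos_sin_period)

lemma torus_test_cosm [simp]: "torus_test (cosm k)"
  using torus_test_trig[of 1 k 0] by simp

lemma torus_test_sinm [simp]: "torus_test (sinm k)"
  using torus_test_trig[of 0 k 1] by simp

lemma torus_test_zero [simp]: "torus_test (\<lambda>x. 0::real)"
  using torus_test_trig[of 0 0 0] by simp

lemma torus_test_linear:
  fixes f g :: "real^3 \<Rightarrow> real"
  shows "torus_test f \<Longrightarrow> torus_test g \<Longrightarrow> torus_test (\<lambda>x. a * f x + b * g x)"
  unfolding torus_test_def by (auto intro: smooth_linear simp: torus_periodic_def)

lemma torus_test_sum:
  fixes f :: "'i \<Rightarrow> real^3 \<Rightarrow> real"
  assumes "\<And>k. k \<in> S \<Longrightarrow> torus_test (f k)"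
  shows "torus_test (\<lambda>x. \<Sum>k\<in>S. c k * f k x)"
  using assms
proof (induction S rule: infinite_finite_induct)
  case (insert k S)
  then show ?case using torus_test_linear[of "f k" "\<lambda>x. \<Sum>k\<in>S. c k * f k x" "c k" 1] by simp
qed auto

lemma torus_distribution_linear:
  "torus_distribution f \<Longrightarrow> torus_test \<phi> \<Longrightarrow> torus_test \<psi> \<Longrightarrow>
    f (\<lambda>x. a * \<phi> x + b * \<psi> x) = a * f \<phi> + b * f \<psi>"
  unfolding torus_distribution_def by blast

lemma torus_distribution_zero: "torus_distribution f \<Longrightarrow> f (\<lambda>x. 0) = 0"
  using torus_distribution_linear[of f "\<lambda>x. 0" "\<lambda>x. 0" 0 0] by simp

lemma torus_distribution_scale:
  "torus_distribution f \<Longrightarrow> torus_test \<phi> \<Longrightarrow> f (\<lambda>x. a * \<phi> x) = a * f \<phi>"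
  using torus_distribution_linear[of f \<phi> \<phi> a 0] by simp

lemma torus_distribution_sum:
  assumes "torus_distribution f" "\<And>k. k \<in> S \<Longrightarrow> torus_test (\<phi> k)"
  shows "f (\<lambda>x. \<Sum>k\<in>S. c k * \<phi> k x) = (\<Sum>k\<in>S. c k * f (\<phi> k))"
  using assms(2)
proof (induction S rule: infinite_finite_induct)
  case (insert k S)
  then show ?case
    using torus_distribution_linear[OF assms(1), of "\<phi> k" "\<lambda>x. \<Sum>k\<in>S. c k * \<phi> k x" "c k" 1]
      torus_test_sum[of S \<phi> c] by simp
qed (auto simp: torus_distribution_zero[OF assms(1)])

lemma torus_distribution_trig:
  assumes "torus_distribution f"
  shows "f (\<lambda>x. a * cosm k x + b * sinm k x) = a * f (cosm k) + b * f (sinm k)"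
  using torus_distribution_linear[OF assms] by simp

lemma has_derivative_spacetime_trig:
  fixes \<theta> :: "real \<Rightarrow> real" and v :: "'b::real_normed_vector"
  assumes "smooth \<theta>"
  shows "((\<lambda>(t, x). (\<theta> t * (c * cosm k x + d * sinm k x)) *\<^sub>R v) has_derivative
     (\<lambda>(s, h). (s * dir_deriv 1 \<theta> (fst p) * (c * cosm k (snd p) + d * sinm k (snd p))
       + \<theta> (fst p) * ((d * (wavevec k \<bullet> h)) * cosm k (snd p) + (- c * (wavevec k \<bullet> h)) * sinm k (snd p))) *\<^sub>R v)) (at p)"
proof -
  have *: "((\<lambda>p. \<theta> (fst p)) has_derivative (\<lambda>h. fst h * dir_deriv 1 \<theta> (fst p))) (at p)" for p :: "real \<times> (real^3)"
    using has_derivative_compose[OF has_derivative_fst[OF has_derivative_ident] smooth_real_derivative[OF assms, unfolded has_field_derivative_def], of p UNIV]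
    by (simp add: mult.commute)
  show ?thesis
    unfolding case_prod_unfold
    by (rule has_derivative_eq_rhs, rule has_derivative_scaleR_left, rule has_derivative_mult[OF *])
       (auto intro!: derivative_eq_intros simp: fun_eq_iff algebra_simps)
qed

text \<open>A time derivative changes only \<open>\<theta>\<close> and a space derivative only the
  pair \<open>(c, d)\<close>, so the class of such products is closed. These are the only space-time
  test functions that the proof inserts into the weak formulation.\<close>

lemma spacetime_test_trig:
  fixes \<theta> :: "real \<Rightarrow> real" and v :: "'b::real_normed_vector"
  assumes "smooth \<theta>" "0 < a" "b < T" "\<And>t. t \<notin> {a..b} \<Longrightarrow> \<theta> t = 0"
  shows "spacetime_test T (\<lambda>(t, x). (\<theta> t * (c * cosm k x + d * sinm k x)) *\<^sub>R v)"
proof -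
  let ?F = "\<lambda>\<theta> c d (t::real, x). (\<theta> t * (c * cosm k x + d * sinm k x)) *\<^sub>R v"
  let ?C = "{?F \<theta> c d | \<theta> c d. smooth \<theta>}"
  have "smooth (?F \<theta> c d)"
  proof (rule smooth_coinduct[where C = ?C])
    show "?F \<theta> c d \<in> ?C" using assms by blast
  next
    fix g assume "g \<in> ?C"
    then obtain \<theta> c d where g: "g = ?F \<theta> c d" "smooth \<theta>" by blast
    show "g differentiable_on UNIV" using has_derivative_spacetime_trig[OF g(2)] unfolding g differentiable_on_def differentiable_def by blast
    fix w :: "real \<times> (real^3)" assume w: "w \<in> Basis"
    have dd: "dir_deriv w g p = (fst w * dir_deriv 1 \<theta> (fst p) * (c * cosm k (snd p) + d * sinm k (snd p))
       + \<theta> (fst p) * ((d * (wavevec k \<bullet> snd w)) * cosm k (snd p) + (- c * (wavevec k \<bullet> snd w)) * sinm k (snd p))) *\<^sub>R v" for p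
      using dir_deriv_eqI[OF has_derivative_spacetime_trig[OF g(2), where c=c and d=d and p=p], of w] unfolding g by (simp add: case_prod_unfold)
    from w consider "w = (1, 0)" | h where "w = (0, h)" by (auto simp: Basis_prod_def)
    then show "dir_deriv w g \<in> ?C"
    proof cases
      case 1
      have "dir_deriv w g = ?F (dir_deriv 1 \<theta>) c d"
        by (auto simp: fun_eq_iff dd[unfolded 1] 1)
      then show ?thesis using smooth_dir_deriv[OF g(2), of 1] by auto
    next
      case 2
      have "dir_deriv w g = ?F \<theta> (d * (wavevec k \<bullet> h)) (- c * (wavevec k \<bullet> h))"
        by (auto simp: fun_eq_iff dd[unfolded 2] 2)
      then show ?thesis using g(2) by blast
    qed
  qed
  then show ?thesis
    unfolding spacetime_test_def torus_periodic_def using assms(2-4)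
    by (auto simp: cos_sin_period)
qed

lemma dir_deriv_spacetime_trig:
  fixes \<theta> :: "real \<Rightarrow> real" and v :: "'b::real_normed_vector"
  assumes "smooth \<theta>"
  shows "dir_deriv (1, 0) (\<lambda>(t, x). (\<theta> t * (c * cosm k x + d * sinm k x)) *\<^sub>R v) (t, x)
    = (dir_deriv 1 \<theta> t * (c * cosm k x + d * sinm k x)) *\<^sub>R v"
  using dir_deriv_eqI[OF has_derivative_spacetime_trig[OF assms, where c=c and d=d and k=k and v=v and p="(t, x)"]] by simp

section \<open>Integrals and trigonometric polynomials on the torus\<close>

abbreviation tint :: "(real^3 \<Rightarrow> 'b::euclidean_space) \<Rightarrow> 'b" where
  "tint f \<equiv> set_lebesgue_integral lebesgue period_cell f"

lemma set_integrable_period_cell: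
  fixes f :: "real^3 \<Rightarrow> 'b::euclidean_space"
  assumes "continuous_on UNIV f"
  shows "set_integrable lebesgue period_cell f"
  unfolding period_cell_def
  using assms continuous_on_subset by (intro absolutely_integrable_continuous) blast

lemma tint_eq_integral:
  fixes f :: "real^3 \<Rightarrow> 'b::euclidean_space"
  assumes "continuous_on UNIV f"
  shows "tint f = integral period_cell f"
  using set_lebesgue_integral_eq_integral(2)[OF set_integrable_period_cell[OF assms]] .

lemma tint_add:
  fixes f g :: "real^3 \<Rightarrow> 'b::euclidean_space"
  assumes "continuous_on UNIV f" "continuous_on UNIV g"
  shows "tint (\<lambda>x. f x + g x) = tint f + tint g"
  using set_integral_add(2)[OF assms[THEN set_integrable_period_cell]] .

lemma tint_diff:
  fixes f g :: "real^3 \<Rightarrow> 'b::euclidean_space"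
  assumes "continuous_on UNIV f" "continuous_on UNIV g"
  shows "tint (\<lambda>x. f x - g x) = tint f - tint g"
  using set_integral_diff(2)[OF assms[THEN set_integrable_period_cell]] .

lemma tint_sum:
  fixes f :: "'i \<Rightarrow> real^3 \<Rightarrow> 'b::euclidean_space"
  assumes "\<And>i. i \<in> S \<Longrightarrow> continuous_on UNIV (f i)"
  shows "tint (\<lambda>x. \<Sum>i\<in>S. f i x) = (\<Sum>i\<in>S. tint (f i))"
  using assms
proof (induction S rule: infinite_finite_induct)
  case (insert k S)
  then have "tint (\<lambda>x. f k x + (\<Sum>i\<in>S. f i x)) = tint (f k) + tint (\<lambda>x. \<Sum>i\<in>S. f i x)"
    by (intro tint_add continuous_intros) auto
  then show ?case using insert by simp
qed (auto simp: set_lebesgue_integral_def)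

section \<open>Translation invariance and orthogonality over the period cell\<close>

lemma torus_periodic_int:
  assumes "torus_periodic f"
  shows "f (x + axis i (2 * pi * of_int m)) = f x"
proof -
  have n: "f (x + axis i (2 * pi * real n)) = f x" for n x
  proof (induction n)
    case 0
    have "x + axis i (2 * pi * real 0) = x" by (simp add: vec_eq_iff axis_def)
    then show ?case by (simp only:)
  next
    case (Suc n)
    have "x + axis i (2 * pi * real (Suc n)) = (x + axis i (2 * pi * real n)) + axis i (2 * pi)"
      by (simp add: vec_eq_iff axis_def algebra_simps)
    then show ?case using Suc assms unfolding torus_periodic_def by metis
  qed
  show ?thesis
  proof (cases "m \<ge> 0")
    case True
    then show ?thesis using n[of x "nat m"] by simp
  next
    case False
    have "x = (x + axis i (2 * pi * of_int m)) + axis i (2 * pi * real (nat (- m)))"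
      using False by (simp add: vec_eq_iff axis_def algebra_simps)
    then show ?thesis using n[of "x + axis i (2 * pi * of_int m)" "nat (- m)"] by (simp only: )
  qed
qed

lemma torus_periodic_shift: "torus_periodic f \<Longrightarrow> torus_periodic (\<lambda>x. f (x + z))"
  unfolding torus_periodic_def by (metis add.commute add.left_commute)

lemma cbox_split_axis:
  fixes a b :: "real^'n"
  shows "cbox a b \<inter> {x. x \<bullet> axis i 1 \<le> c} = cbox a (\<chi> j. if j = i then min (b $ j) c else b $ j)"
    and "cbox a b \<inter> {x. x \<bullet> axis i 1 \<ge> c} = cbox (\<chi> j. if j = i then max (a $ j) c else a $ j) b"
  by (auto simp: mem_box_cart inner_axis split: if_splits)

text \<open>The cell stretched by \<open>h\<close> along axis \<open>i\<close> is cut once at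
  \<open>h\<close> and once at \<open>2 * pi\<close>. Each cut leaves a copy of the cell (shifted or
  not) and a slab, and the two slabs carry the same integral by periodicity.\<close>

lemma integral_cell_shift_axis:
  fixes f :: "real^3 \<Rightarrow> 'b::euclidean_space"
  assumes "continuous_on UNIV f" "torus_periodic f" "0 \<le> h" "h \<le> 2 * pi"
  shows "integral period_cell (\<lambda>x. f (x + axis i h)) = integral period_cell f"
proof -
  define b :: "real^3" where "b = (\<chi> i. 2 * pi)"
  have e: "axis i (1::real) \<in> Basis" by simp
  have int: "f integrable_on cbox u v" for u v
    using assms(1) by (meson continuous_on_subset integrable_continuous subset_UNIV)
  let ?big = "cbox 0 (b + axis i h)"
  let ?slab = "cbox 0 (\<chi> j. if j = i then h else 2 * pi)"
  have s1: "?big \<inter> {x. x \<bullet> axis i 1 \<le> h} = ?slab"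
    and s2: "?big \<inter> {x. x \<bullet> axis i 1 \<ge> h} = cbox (axis i h) (b + axis i h)"
    and s3: "?big \<inter> {x. x \<bullet> axis i 1 \<le> 2 * pi} = cbox 0 b"
    and s4: "?big \<inter> {x. x \<bullet> axis i 1 \<ge> 2 * pi} = cbox (axis i (2 * pi)) ((\<chi> j. if j = i then h else 2 * pi) + axis i (2 * pi))"
    unfolding cbox_split_axis using assms(3,4)
    by (auto simp: b_def axis_def vec_eq_iff intro!: arg_cong2[where f = cbox])
  have "integral (cbox 0 b) (\<lambda>x. f (x + axis i h)) = integral (cbox (axis i h) (b + axis i h)) f"
    using integral_shift_cbox[of "axis i h" "axis i h" "b + axis i h" f] by simp
  moreover have "integral ?slab f = integral (cbox (axis i (2 * pi)) ((\<chi> j. if j = i then h else 2 * pi) + axis i (2 * pi))) f"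
    using integral_shift_cbox[of "axis i (2*pi)" "axis i (2*pi)" "(\<chi> j. if j = i then h else 2 * pi) + axis i (2 * pi)" f] assms(2)
    by (simp add: torus_periodic_def)
  moreover note integral_split[OF int e, of 0 "b + axis i h" h, unfolded s1 s2]
     integral_split[OF int e, of 0 "b + axis i h" "2 * pi", unfolded s3 s4]
  ultimately show ?thesis unfolding period_cell_def b_def[symmetric] by simp
qed

lemma tint_shift:
  fixes f :: "real^3 \<Rightarrow> 'b::euclidean_space"
  assumes "continuous_on UNIV f" "torus_periodic f"
  shows "tint (\<lambda>x. f (x + z)) = tint f"
proof -
  have cont: "continuous_on UNIV (\<lambda>x. g (x + z))" if "continuous_on UNIV g" for g :: "real^3 \<Rightarrow> 'b" and z
    by (rule continuous_on_compose2[OF that]) (auto intro!: continuous_intros)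
  have ax: "integral period_cell (\<lambda>x. f (x + axis i h)) = integral period_cell f"
    if f: "continuous_on UNIV f" "torus_periodic f" for f :: "real^3 \<Rightarrow> 'b" and i h
  proof -
    \<comment> \<open>Whole periods are removed, so that the remaining shift lies between 0 and
      \<open>2 * pi\<close>.\<close>
    define m where "m = \<lfloor>h / (2 * pi)\<rfloor>"
    have "of_int m \<le> h / (2 * pi)" "h / (2 * pi) < of_int m + 1" unfolding m_def by linarith+
    then have m: "0 \<le> h - 2 * pi * of_int m" "h - 2 * pi * of_int m \<le> 2 * pi"
      by (auto simp: field_simps)
    have "f (x + axis i h) = f (x + axis i (h - 2 * pi * of_int m))" for x
    proof -
      have "x + axis i h = (x + axis i (h - 2 * pi * of_int m)) + axis i (2 * pi * of_int m)"
        by (simp add: vec_eq_iff axis_def)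
      then show ?thesis using torus_periodic_int[OF f(2)] by metis
    qed
    then show ?thesis using integral_cell_shift_axis[OF f m] by simp
  qed
  have z: "z = axis 1 (z $ 1) + axis 2 (z $ 2) + axis 3 (z $ 3)"
    by (simp add: vec_eq_iff forall_3 axis_def)
  have "integral period_cell (\<lambda>x. f (x + z)) = integral period_cell (\<lambda>x. f ((x + axis 3 (z $ 3)) + (axis 1 (z $ 1) + axis 2 (z $ 2))))"
    by (subst z) (simp add: add_ac)
  also have "\<dots> = integral period_cell (\<lambda>x. f (x + (axis 1 (z $ 1) + axis 2 (z $ 2))))"
    by (rule ax[of "\<lambda>x. f (x + (axis 1 (z $ 1) + axis 2 (z $ 2)))"]) (intro cont assms torus_periodic_shift)+
  also have "\<dots> = integral period_cell (\<lambda>x. f ((x + axis 2 (z $ 2)) + axis 1 (z $ 1)))"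
    by (simp add: add_ac)
  also have "\<dots> = integral period_cell (\<lambda>x. f (x + axis 1 (z $ 1)))"
    by (rule ax[of "\<lambda>x. f (x + axis 1 (z $ 1))"]) (intro cont assms torus_periodic_shift)+
  also have "\<dots> = integral period_cell f"
    by (rule ax) (intro assms)+
  finally show ?thesis using tint_eq_integral[OF assms(1)] tint_eq_integral[OF cont[OF assms(1)]] by metis
qed

lemma wavevec_add: "wavevec (k + l) = wavevec k + wavevec l"
  and wavevec_minus: "wavevec (- k) = - wavevec k"
  and wavevec_diff: "wavevec (k - l) = wavevec k - wavevec l"
  and wavevec_zero [simp]: "wavevec 0 = 0"
  by (simp_all add: vec_eq_iff)

abbreviation cism :: "int^3 \<Rightarrow> real^3 \<Rightarrow> complex" where "cism k \<equiv> \<lambda>x. cis (wavevec k \<bullet> x)"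

lemma torus_periodic_cism: "torus_periodic (cism k)"
  unfolding torus_periodic_def complex_eq_iff by (simp add: cos_sin_period)

lemma continuous_on_cis' [continuous_intros]:
  fixes g :: "'a::topological_space \<Rightarrow> real"
  shows "continuous_on S g \<Longrightarrow> continuous_on S (\<lambda>x. cis (g x))"
  by (rule continuous_on_cis)

lemma tint_cism: "tint (cism k) = (if k = 0 then of_real ((2 * pi) ^ 3) else 0)"
proof (cases "k = 0")
  case True
  have b: "(\<chi> i. 2 * pi) \<bullet> b = 2 * pi" if "b \<in> Basis" for b :: "real^3"
    using that by (auto simp: Basis_vec_def inner_axis)
  have "measure lebesgue period_cell = (2 * pi) ^ 3"
    unfolding period_cell_def by (simp add: content_cbox_if b box_eq_empty)
  then show ?thesis using True
    using tint_eq_integral[of "\<lambda>_. 1 :: complex"] by (simp add: period_cell_def scaleR_conv_of_real)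
next
  case False
  then obtain i where i: "k $ i \<noteq> 0" by (auto simp: vec_eq_iff)
  \<comment> \<open>Half a period of the mode in a direction in which its wave number is nonzero:
    this translation multiplies the mode by -1, while the integral is invariant.\<close>
  define z :: "real^3" where "z = axis i (pi / of_int (k $ i))"
  have "wavevec k \<bullet> z = pi" using i by (simp add: z_def)
  then have "cism k (x + z) = (- 1) * cism k x" for x
    by (simp add: inner_add_right flip: cis_mult)
  then have "tint (cism k) = tint (\<lambda>x. (- 1) * cism k x)"
    using tint_shift[of "cism k" z] torus_periodic_cism[of k] by (simp add: continuous_intros)
  also have "\<dots> = - tint (cism k)" using set_integral_mult_right[of lebesgue period_cell "- 1" "cism k"] by simp
  finally show ?thesis using False by simp
qed

lemma tint_trig_sum:
  assumes "finite S"
  shows "tint (\<lambda>x. \<Sum>k\<in>S. c k * cism (\<kappa> k) x) = of_real ((2 * pi) ^ 3) * (\<Sum>k\<in>S. if \<kappa> k = 0 then c k else 0)"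
  by (subst tint_sum) (auto intro!: continuous_intros sum.cong simp: tint_cism sum_distrib_left set_integral_mult_right)

lemma tint_triple:
  assumes "finite S1" "finite S2" "finite S3"
  shows "tint (\<lambda>x. (\<Sum>k\<in>S1. a k * cism k x) * (\<Sum>k\<in>S2. b k * cism k x) * (\<Sum>k\<in>S3. c k * cism k x))
    = of_real ((2 * pi) ^ 3) * (\<Sum>(k, l, m)\<in>S1 \<times> S2 \<times> S3. if k + l + m = 0 then a k * b l * c m else 0)"
proof -
  have "(\<Sum>k\<in>S1. a k * cism k x) * (\<Sum>k\<in>S2. b k * cism k x) * (\<Sum>k\<in>S3. c k * cism k x)
     = (\<Sum>p\<in>S1 \<times> S2 \<times> S3. (a (fst p) * b (fst (snd p)) * c (snd (snd p))) * cism (fst p + fst (snd p) + snd (snd p)) x)" for x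
  proof -
    have "(\<Sum>k\<in>S1. A k) * (\<Sum>k\<in>S2. B k) * (\<Sum>k\<in>S3. C k) = (\<Sum>k\<in>S1. \<Sum>l\<in>S2. \<Sum>m\<in>S3. A k * B l * C m)"
      for A B C :: "int^3 \<Rightarrow> complex"
      by (simp add: sum_distrib_left[symmetric] sum_distrib_right[symmetric])
    then show ?thesis
      by (simp add: sum.cartesian_product case_prod_unfold wavevec_add inner_add_left mult_ac flip: cis_mult)
  qed
  then show ?thesis
    using tint_trig_sum[of "S1 \<times> S2 \<times> S3" "\<lambda>p. a (fst p) * b (fst (snd p)) * c (snd (snd p))" "\<lambda>p. fst p + fst (snd p) + snd (snd p)"] assms
    by (simp add: case_prod_unfold)
qed

section \<open>Real trigonometric polynomials with prescribed spectrum, and the Hoelder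
  inequality\<close>

definition trigpoly :: "(int^3) set \<Rightarrow> (real^3 \<Rightarrow> real) \<Rightarrow> bool" where
  "trigpoly S f \<longleftrightarrow> finite S \<and> (\<exists>c. \<forall>x. complex_of_real (f x) = (\<Sum>k\<in>S. c k * cism k x))"

lemma trigpoly_finite: "trigpoly S f \<Longrightarrow> finite S"
  by (simp add: trigpoly_def)

lemma trigpolyE:
  assumes "trigpoly S f"
  obtains c where "\<forall>x. complex_of_real (f x) = (\<Sum>k\<in>S. c k * cism k x)"
  using assms unfolding trigpoly_def by (elim conjE exE) (rule that)

lemma trigpolyI:
  assumes "finite S" "\<And>x. complex_of_real (f x) = (\<Sum>k\<in>S. c k * cism k x)"
  shows "trigpoly S f"
  unfolding trigpoly_def by (intro conjI assms exI[of _ c] allI)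

lemma trigpoly_continuous:
  assumes "trigpoly S f"
  shows "continuous_on T f"
proof -
  obtain c where "\<forall>x. complex_of_real (f x) = (\<Sum>k\<in>S. c k * cism k x)" by (rule trigpolyE[OF assms])
  note c = this[rule_format]
  have "f = (\<lambda>x. Re (\<Sum>k\<in>S. c k * cism k x))" unfolding c[symmetric] by simp
  moreover have "continuous_on T (\<lambda>x. Re (\<Sum>k\<in>S. c k * cism k x))" by (intro continuous_intros)
  ultimately show ?thesis by (simp only:)
qed

lemma trigpoly_periodic:
  assumes "trigpoly S f"
  shows "torus_periodic f"
proof -
  obtain c where "\<forall>x. complex_of_real (f x) = (\<Sum>k\<in>S. c k * cism k x)" by (rule trigpolyE[OF assms])
  note c = this[rule_format]
  have "complex_of_real (f (x + axis i (2 * pi))) = complex_of_real (f x)" for x i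
    unfolding c using torus_periodic_cism[unfolded torus_periodic_def] by (simp only:)
  then show ?thesis unfolding torus_periodic_def of_real_eq_iff by blast
qed

lemma trigpoly_mono:
  assumes "trigpoly S f" "S \<subseteq> S'" "finite S'"
  shows "trigpoly S' f"
proof -
  obtain c where "\<forall>x. complex_of_real (f x) = (\<Sum>k\<in>S. c k * cism k x)" by (rule trigpolyE[OF assms(1)])
  note c = this[rule_format]
  have "(\<Sum>k\<in>S. c k * cism k x) = (\<Sum>k\<in>S'. (if k \<in> S then c k else 0) * cism k x)" for x
    using assms(2,3) by (intro sum.mono_neutral_cong_left) auto
  then show ?thesis
    unfolding c[symmetric] by (intro trigpolyI assms(3))
qed

lemma trigpoly_linear:
  assumes "trigpoly S f" "trigpoly S g"
  shows "trigpoly S (\<lambda>x. a * f x + b * g x)"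
proof -
  obtain c where "\<forall>x. complex_of_real (f x) = (\<Sum>k\<in>S. c k * cism k x)" by (rule trigpolyE[OF assms(1)])
  note c = this[rule_format]
  obtain d where "\<forall>x. complex_of_real (g x) = (\<Sum>k\<in>S. d k * cism k x)" by (rule trigpolyE[OF assms(2)])
  note d = this[rule_format]
  have "complex_of_real (a * f x + b * g x) = (\<Sum>k\<in>S. (a * c k + b * d k) * cism k x)" for x
    unfolding of_real_add of_real_mult c d sum_distrib_left sum.distrib[symmetric]
    by (intro sum.cong refl) (simp only: distrib_right mult.assoc)
  with trigpoly_finite[OF assms(1)] show ?thesis by (rule trigpolyI)
qed

lemma trigpoly_sum:
  assumes "finite S" "\<And>i. i \<in> I \<Longrightarrow> trigpoly S (f i)"
  shows "trigpoly S (\<lambda>x. \<Sum>i\<in>I. f i x)"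
  using assms(2)
proof (induction I rule: infinite_finite_induct)
  case (insert i I)
  then show ?case using trigpoly_linear[of S "f i" "\<lambda>x. \<Sum>i\<in>I. f i x" 1 1] by simp
qed (use trigpolyI[OF assms(1), of "\<lambda>_. 0" "\<lambda>_. 0"] in simp_all)

text \<open>The integral of a triple product sees only frequency triples with sum 0. Only the
  spectra matter here, which is why \<open>trigpoly\<close> keeps the frequency set and hides the
  coefficients.\<close>

lemma trigpoly_triple_zero:
  assumes "trigpoly S1 f" "trigpoly S2 g" "trigpoly S3 h"
    and z: "\<And>k l m. k \<in> S1 \<Longrightarrow> l \<in> S2 \<Longrightarrow> m \<in> S3 \<Longrightarrow> k + l + m \<noteq> 0"
  shows "tint (\<lambda>x. f x * g x * h x) = 0"
proof -
  obtain a where "\<forall>x. complex_of_real (f x) = (\<Sum>k\<in>S1. a k * cism k x)" by (rule trigpolyE[OF assms(1)])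
  note a = this[rule_format]
  obtain b where "\<forall>x. complex_of_real (g x) = (\<Sum>k\<in>S2. b k * cism k x)" by (rule trigpolyE[OF assms(2)])
  note b = this[rule_format]
  obtain c where "\<forall>x. complex_of_real (h x) = (\<Sum>k\<in>S3. c k * cism k x)" by (rule trigpolyE[OF assms(3)])
  note c = this[rule_format]
  have "complex_of_real (tint (\<lambda>x. f x * g x * h x)) = tint (\<lambda>x. complex_of_real (f x * g x * h x))"
    by (rule set_integral_complex_of_real[symmetric])
  also have "\<dots> = 0"
    unfolding of_real_mult a b c tint_triple[OF assms(1-3)[THEN trigpoly_finite]]
    by (subst sum.neutral) (auto simp: z)
  finally show ?thesis by simp
qed

text \<open>Hoelder's inequality with exponents 3, 3, 3, by integrating the inequality of arithmetic
  and geometric means for \<open>\<bar>f\<bar> / a\<close>, \<open>\<bar>g\<bar> / b\<close>,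
  \<open>\<bar>h\<bar> / c\<close>. The divisions require positive bounds; this positivity is
  carried on to \<open>L3_le\<close> and to the constants \<open>X\<close>, \<open>Y\<close> of the
  flux estimate.\<close>

lemma Holder3_scalar:
  fixes f g h :: "real^3 \<Rightarrow> real"
  assumes cont: "continuous_on UNIV f" "continuous_on UNIV g" "continuous_on UNIV h"
    and pos: "0 < a" "0 < b" "0 < c"
    and le: "tint (\<lambda>x. \<bar>f x\<bar> ^ 3) \<le> a ^ 3" "tint (\<lambda>x. \<bar>g x\<bar> ^ 3) \<le> b ^ 3" "tint (\<lambda>x. \<bar>h x\<bar> ^ 3) \<le> c ^ 3"
  shows "\<bar>tint (\<lambda>x. f x * g x * h x)\<bar> \<le> a * b * c"
proof -
  have amgm: "x * y * z \<le> (x ^ 3 + y ^ 3 + z ^ 3) / 3" if "x \<ge> 0" "y \<ge> 0" "z \<ge> 0" for x y z :: real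
  proof -
    have "x ^ 3 + y ^ 3 + z ^ 3 - 3 * (x * y * z) = (x + y + z) * ((x - y)\<^sup>2 + (y - z)\<^sup>2 + (z - x)\<^sup>2) / 2"
      by (simp add: power2_eq_square power3_eq_cube field_simps)
    moreover have "\<dots> \<ge> 0" using that by simp
    ultimately show ?thesis by simp
  qed
  let ?F = "\<lambda>x. \<bar>f x\<bar> ^ 3" and ?G = "\<lambda>x. \<bar>g x\<bar> ^ 3" and ?H = "\<lambda>x. \<bar>h x\<bar> ^ 3"
  let ?R = "\<lambda>x. (b * c / (3 * a\<^sup>2)) * ?F x + (a * c / (3 * b\<^sup>2)) * ?G x + (a * b / (3 * c\<^sup>2)) * ?H x"
  have pt: "\<bar>f x * g x * h x\<bar> \<le> ?R x" for x
  proof -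
    have "a * b * c * (\<bar>f x\<bar> / a * (\<bar>g x\<bar> / b) * (\<bar>h x\<bar> / c)) \<le> a * b * c * (((\<bar>f x\<bar> / a) ^ 3 + (\<bar>g x\<bar> / b) ^ 3 + (\<bar>h x\<bar> / c) ^ 3) / 3)"
      using pos by (intro mult_left_mono amgm divide_nonneg_pos mult_nonneg_nonneg less_imp_le abs_ge_zero)
    moreover have "a * b * c * (\<bar>f x\<bar> / a * (\<bar>g x\<bar> / b) * (\<bar>h x\<bar> / c)) = \<bar>f x * g x * h x\<bar>"
      using pos by (simp add: abs_mult)
    moreover have "a * b * c * ((F / a) ^ 3 / 3) = b * c / (3 * a\<^sup>2) * F ^ 3"
      "a * b * c * ((F / b) ^ 3 / 3) = a * c / (3 * b\<^sup>2) * F ^ 3"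
      "a * b * c * ((F / c) ^ 3 / 3) = a * b / (3 * c\<^sup>2) * F ^ 3" for F
      using pos by (simp_all add: field_simps power2_eq_square power3_eq_cube)
    ultimately show ?thesis
      by (simp only: distrib_left add_divide_distrib)
  qed
  have cc: "continuous_on UNIV ?F" "continuous_on UNIV ?G" "continuous_on UNIV ?H"
    by (intro continuous_intros cont)+
  have lin: "tint (\<lambda>x. A * ?F x + B * ?G x + C * ?H x) = A * tint ?F + B * tint ?G + C * tint ?H" for A B C
    by (simp add: tint_add continuous_intros cc cont set_integral_mult_right)
  have "\<bar>tint (\<lambda>x. f x * g x * h x)\<bar> \<le> tint (\<lambda>x. \<bar>f x * g x * h x\<bar>)"
    using set_integral_norm_bound[OF set_integrable_period_cell, of "\<lambda>x. f x * g x * h x"]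
    by (simp add: continuous_intros cont)
  also have "\<dots> \<le> tint ?R"
    by (intro set_integral_mono set_integrable_period_cell continuous_intros cont cc pt)
  also have "\<dots> = (b * c / (3 * a\<^sup>2)) * tint ?F + (a * c / (3 * b\<^sup>2)) * tint ?G + (a * b / (3 * c\<^sup>2)) * tint ?H"
    by (rule lin)
  also have "\<dots> \<le> (b * c / (3 * a\<^sup>2)) * a ^ 3 + (a * c / (3 * b\<^sup>2)) * b ^ 3 + (a * b / (3 * c\<^sup>2)) * c ^ 3"
    using pos le by (intro add_mono mult_left_mono) auto
  also have "\<dots> = a * b * c" using pos by (simp add: field_simps power2_eq_square power3_eq_cube)
  finally show ?thesis .
qed

section \<open>Bernstein inequality and Jackson kernel\<close>

text \<open>Multiplication by the root of unity that belongs to \<open>j\<close> permutes the grid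
  cyclically, so the sum is fixed by a factor different from 1. The range \<open>2 * K\<close> is
  exact: the next frequency that the grid confuses with 0 is \<open>2 * K + 1\<close>.\<close>

lemma sum_roots_of_unity:
  fixes K j :: int
  assumes "0 \<le> K" "\<bar>j\<bar> \<le> 2 * K"
  shows "(\<Sum>m\<in>{-K..K}. cis (2 * pi * of_int m / of_int (2 * K + 1) * of_int j)) = (if j = 0 then of_int (2 * K + 1) else 0)"
proof (cases "j = 0")
  case True
  then show ?thesis using assms by (simp add: nat_add_distrib)
next
  case False
  define L where "L = 2 * K + 1"
  define g where "g m = cis (2 * pi * of_int m / of_int L * of_int j)" for m :: int
  define w where "w = cis (2 * pi * of_int j / of_int L)"
  have L: "L > 0" using assms by (simp add: L_def)
  have step: "w * g m = g (m + 1)" for m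
    using L by (simp add: w_def g_def cis_mult field_simps)
  have per: "g (K + 1) = g (- K)"
  proof -
    have "2 * pi * of_int (K + 1) / of_int L * of_int j = 2 * pi * of_int (- K) / of_int L * of_int j + 2 * pi * of_int j"
      using L by (simp add: L_def field_simps)
    moreover have "cis (2 * pi * of_int j) = 1" by (rule cis_multiple_2pi) simp
    ultimately show ?thesis unfolding g_def by (simp only: cis_mult[symmetric] mult_1_right)
  qed
  have "w * (\<Sum>m\<in>{-K..K}. g m) = (\<Sum>m\<in>{-K..K}. g (m + 1))"
    by (simp add: sum_distrib_left step)
  also have "\<dots> = (\<Sum>m\<in>{-K+1..K+1}. g m)"
    by (rule sum.reindex_bij_witness[of _ "\<lambda>m. m - 1" "\<lambda>m. m + 1"]) auto
  also have "{-K+1..K+1} = insert (K + 1) {-K+1..K}" using assms by auto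
  also have "(\<Sum>m\<in>insert (K + 1) {-K+1..K}. g m) = g (- K) + (\<Sum>m\<in>{-K+1..K}. g m)" using per by simp
  also have "\<dots> = (\<Sum>m\<in>insert (- K) {-K+1..K}. g m)" by simp
  also have "insert (- K) {-K+1..K} = {-K..K}" using assms by auto
  finally have "(w - 1) * (\<Sum>m\<in>{-K..K}. g m) = 0" by (simp add: algebra_simps)
  moreover have "w \<noteq> 1"
  proof
    assume "w = 1"
    then have "cos (2 * pi * of_int j / of_int L) = 1" by (simp add: w_def complex_eq_iff)
    then obtain n :: int where "2 * pi * of_int j / of_int L = of_int n * 2 * pi" using cos_one_2pi_int by auto
    then have "real_of_int j = of_int n * of_int L" using L by (simp add: field_simps)
    then have "j = n * L" by (metis of_int_eq_iff of_int_mult)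
    then show False using assms(2) False L zdvd_imp_le[of L "\<bar>j\<bar>"] by (simp add: L_def)
  qed
  ultimately show ?thesis using False by (simp add: g_def L_def)
qed

definition gridpt :: "int \<Rightarrow> int \<Rightarrow> real" where
  "gridpt K m = 2 * pi * of_int m / of_int (2 * K + 1)"

lemma gridpt_sum:
  "0 \<le> K \<Longrightarrow> \<bar>j\<bar> \<le> 2 * K \<Longrightarrow> (\<Sum>m\<in>{-K..K}. cis (gridpt K m * of_int j)) = (if j = 0 then of_int (2 * K + 1) else 0)"
  unfolding gridpt_def by (rule sum_roots_of_unity)

lemma abs_gridpt_le: "m \<in> {-K..K} \<Longrightarrow> \<bar>gridpt K m\<bar> \<le> pi"
proof -
  assume m: "m \<in> {-K..K}"
  then have "\<bar>2 * real_of_int m\<bar> \<le> real_of_int (2 * K + 1)" by auto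
  then have "pi * \<bar>2 * real_of_int m\<bar> \<le> pi * real_of_int (2 * K + 1)" by (intro mult_left_mono) auto
  then show ?thesis using m by (auto simp: gridpt_def abs_mult field_simps)
qed

lemma norm_cis_sum_squared:
  fixes a :: "int \<Rightarrow> real"
  assumes "finite S"
  shows "complex_of_real ((cmod (\<Sum>s\<in>S. of_real (a s) * cis (t * of_int s)))\<^sup>2)
    = (\<Sum>s\<in>S. \<Sum>r\<in>S. of_real (a s * a r) * cis (t * of_int (s - r)))"
  unfolding complex_norm_square
  by (simp add: sum_product cis_cnj cis_mult algebra_simps)

text \<open>The squared modulus of a trigonometric sum has the autocorrelation of \<open>a\<close>
  as Fourier coefficients, and the grid reproduces them exactly as long as no occurring frequency is
  aliased. Fejer kernel (\<open>a\<close> constant) and Jackson kernel (\<open>a\<close> a tent) are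
  both instances.\<close>

lemma grid_fejer_sum:
  fixes a :: "int \<Rightarrow> real"
  assumes "finite S" "0 \<le> K" "\<And>s r. s \<in> S \<Longrightarrow> r \<in> S \<Longrightarrow> \<bar>s - r + k\<bar> \<le> 2 * K"
  shows "(\<Sum>m\<in>{-K..K}. of_real ((cmod (\<Sum>s\<in>S. of_real (a s) * cis (gridpt K m * of_int s)))\<^sup>2) * cis (gridpt K m * of_int k))
    = of_int (2 * K + 1) * of_real (\<Sum>s\<in>S. if s + k \<in> S then a s * a (s + k) else 0)"
proof -
  have "(\<Sum>m\<in>{-K..K}. of_real ((cmod (\<Sum>s\<in>S. of_real (a s) * cis (gridpt K m * of_int s)))\<^sup>2) * cis (gridpt K m * of_int k))
    = (\<Sum>m\<in>{-K..K}. \<Sum>s\<in>S. \<Sum>r\<in>S. of_real (a s * a r) * cis (gridpt K m * of_int (s - r + k)))"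
    unfolding norm_cis_sum_squared[OF assms(1)] sum_distrib_right
    by (intro sum.cong refl) (simp add: mult.assoc cis_mult distrib_left)
  also have "\<dots> = (\<Sum>s\<in>S. \<Sum>r\<in>S. of_real (a s * a r) * (\<Sum>m\<in>{-K..K}. cis (gridpt K m * of_int (s - r + k))))"
    unfolding sum_distrib_left
    by (subst sum.swap, rule sum.cong[OF refl], subst sum.swap, rule refl)
  also have "\<dots> = (\<Sum>s\<in>S. \<Sum>r\<in>S. if r = s + k then of_int (2 * K + 1) * of_real (a s * a r) else 0)"
    by (intro sum.cong refl, subst gridpt_sum) (use assms in auto)
  also have "\<dots> = (\<Sum>s\<in>S. if s + k \<in> S then of_int (2 * K + 1) * of_real (a s * a (s + k)) else 0)"
    using assms(1) by (simp add: sum.delta)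
  also have "\<dots> = of_int (2 * K + 1) * of_real (\<Sum>s\<in>S. if s + k \<in> S then a s * a (s + k) else 0)"
    unfolding of_real_sum sum_distrib_left by (intro sum.cong refl) auto
  finally show ?thesis .
qed

text \<open>A discrete form of M. Riesz's interpolation formula: on frequencies of modulus at most \<open>N\<close>,
  differentiation is convolution with the kernel \<open>2 N sin (N t) F\<^sub>N (t)\<close>, where \<open>F\<^sub>N\<close> is the Fejer kernel.\<close>

lemma riesz_interpolation:
  fixes N :: nat
  assumes "N \<ge> 1"
  obtains c :: "int \<Rightarrow> real" where
    "(\<Sum>m\<in>{-(2 * int N)..2 * int N}. \<bar>c m\<bar>) \<le> 2 * real N"
    "\<forall>k. \<bar>k\<bar> \<le> int N \<longrightarrow> (\<Sum>m\<in>{-(2 * int N)..2 * int N}. of_real (c m) * cis (gridpt (2 * int N) m * of_int k)) = \<i> * of_int k"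
proof -
  \<comment> \<open>Differences of modulus below \<open>N\<close> meet frequencies up to
    \<open>2 * N\<close>; the range \<open>2 * K = 4 * N\<close> has room for their sum.\<close>
  define K where "K = 2 * int N"
  define S where "S = {0..<int N}"
  define F where "F m = (cmod (\<Sum>s\<in>S. of_real (1::real) * cis (gridpt K m * of_int s)))\<^sup>2" for m
  define c where "c m = 2 / of_int (2 * K + 1) * sin (N * gridpt K m) * F m" for m
  have K: "0 \<le> K" by (simp add: K_def)
  have cnt: "(\<Sum>s\<in>S. if s + d \<in> S then 1 * 1 else 0) = real_of_int (max 0 (int N - \<bar>d\<bar>))" for d
  proof -
    have "(\<Sum>s\<in>S. if s + d \<in> S then 1 * 1 else (0::real)) = (\<Sum>s\<in>S \<inter> {s. s + d \<in> S}. 1)"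
      by (subst sum.inter_restrict) (auto simp: S_def intro!: sum.cong)
    also have "S \<inter> {s. s + d \<in> S} = {max 0 (- d)..<min (int N) (int N - d)}" by (auto simp: S_def)
    finally show ?thesis by (auto simp: max_def min_def)
  qed
  have F: "(\<Sum>m\<in>{-K..K}. of_real (F m) * cis (gridpt K m * of_int k)) = of_int (2 * K + 1) * of_real (of_int (max 0 (int N - \<bar>k\<bar>)))"
    if "\<bar>k\<bar> \<le> 2 * int N" for k
  proof -
    have "\<bar>s - r + k\<bar> \<le> 2 * K" if "s \<in> S" "r \<in> S" for s r
      using that \<open>\<bar>k\<bar> \<le> 2 * int N\<close> by (auto simp: S_def K_def)
    from grid_fejer_sum[of S K k "\<lambda>_. 1", unfolded cnt, OF _ K this] show ?thesis
      unfolding F_def by (simp add: S_def)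
  qed
  note that = that[of c, folded K_def]
  show thesis
  proof (rule that)
    have "\<bar>c m\<bar> \<le> 2 / of_int (2 * K + 1) * F m" for m
    proof -
      have "\<bar>c m\<bar> = 2 / of_int (2 * K + 1) * F m * \<bar>sin (N * gridpt K m)\<bar>"
        using K by (simp add: c_def abs_mult F_def)
      also have "\<dots> \<le> 2 / of_int (2 * K + 1) * F m * 1"
        using K by (intro mult_left_mono) (auto simp: F_def)
      finally show ?thesis by simp
    qed
    then have "(\<Sum>m\<in>{-K..K}. \<bar>c m\<bar>) \<le> (\<Sum>m\<in>{-K..K}. 2 / of_int (2 * K + 1) * F m)" by (rule sum_mono)
    also have "\<dots> = 2 / of_int (2 * K + 1) * (\<Sum>m\<in>{-K..K}. F m)" by (simp only: sum_distrib_left)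
    also have "(\<Sum>m\<in>{-K..K}. F m) = of_int (2 * K + 1) * real N"
    proof -
      have "complex_of_real (\<Sum>m\<in>{-K..K}. F m) = complex_of_real (of_int (2 * K + 1) * real N)"
        using F[of 0] by simp
      then show ?thesis unfolding of_real_eq_iff .
    qed
    also have "2 / of_int (2 * K + 1) * (of_int (2 * K + 1) * real N) = 2 * real N" using K by simp
    finally show "(\<Sum>m\<in>{-K..K}. \<bar>c m\<bar>) \<le> 2 * real N" .
    have "(\<Sum>m\<in>{-K..K}. of_real (c m) * cis (gridpt K m * of_int k)) = \<i> * of_int k" if k: "\<bar>k\<bar> \<le> int N" for k
    proof -
    have s: "complex_of_real (sin (N * gridpt K m)) = (cis (gridpt K m * of_int (int N)) - cis (gridpt K m * of_int (- int N))) / (2 * \<i>)" for m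
    proof -
      have "cis x - cis (- x) = 2 * \<i> * complex_of_real (sin x)" for x
        by (simp add: complex_eq_iff)
      from this[of "N * gridpt K m"] show ?thesis by (simp add: mult.commute)
    qed
    have alg: "(2 / L) * ((a - b) / (2 * \<i>)) * f * e = (1 / (\<i> * L)) * (f * (e * a) - f * (e * b))" for L a b f e :: complex
      by (cases "L = 0") (simp_all add: field_simps)
    have "(\<Sum>m\<in>{-K..K}. of_real (c m) * cis (gridpt K m * of_int k))
      = (\<Sum>m\<in>{-K..K}. (1 / (\<i> * of_int (2 * K + 1))) * (of_real (F m) * cis (gridpt K m * of_int (k + int N)) - of_real (F m) * cis (gridpt K m * of_int (k - int N))))"
    proof (intro sum.cong refl)
      fix m
      let ?c = "\<lambda>j. cis (gridpt K m * of_int j)"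
      have "?c (k + int N) = ?c k * ?c (int N)" "?c (k - int N) = ?c k * ?c (- int N)"
        by (simp_all add: cis_mult algebra_simps)
      moreover have "of_real (c m) * ?c k = (2 / of_int (2 * K + 1)) * ((?c (int N) - ?c (- int N)) / (2 * \<i>)) * of_real (F m) * ?c k"
        unfolding c_def of_real_mult s by simp
      ultimately show "of_real (c m) * ?c k = (1 / (\<i> * of_int (2 * K + 1))) * (of_real (F m) * ?c (k + int N) - of_real (F m) * ?c (k - int N))"
        using alg[of "of_int (2 * K + 1)" "?c (int N)" "?c (- int N)" "of_real (F m)" "?c k"] by (simp only: )
    qed
    also have "\<dots> = (1 / (\<i> * of_int (2 * K + 1))) * (of_int (2 * K + 1) * of_real (of_int (max 0 (int N - \<bar>k + int N\<bar>))) - of_int (2 * K + 1) * of_real (of_int (max 0 (int N - \<bar>k - int N\<bar>))))"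
      unfolding sum_distrib_left[symmetric] sum_subtractf by (subst (1 2) F) (use k in auto)
    also have "\<dots> = (1 / \<i>) * (of_int (max 0 (int N - \<bar>k + int N\<bar>) - max 0 (int N - \<bar>k - int N\<bar>)))"
    proof -
      have "complex_of_int (2 * K + 1) \<noteq> 0" using K by (simp only: of_int_eq_0_iff)
      then show ?thesis by (simp add: field_simps del: of_int_add of_int_mult)
    qed
    \<comment> \<open>The factor \<open>sin (N * t)\<close> moves the tent of Fejer coefficients to
      the centres \<open>- N\<close> and \<open>N\<close>. Between the centres the difference of the
      two tents is linear, and this is the symbol of the derivative.\<close>
    also have "max 0 (int N - \<bar>k + int N\<bar>) - max 0 (int N - \<bar>k - int N\<bar>) = - k" using k by auto
    finally show ?thesis
      by simp
    qed
    then show "\<forall>k. \<bar>k\<bar> \<le> int N \<longrightarrow> (\<Sum>m\<in>{-K..K}. of_real (c m) * cis (gridpt K m * of_int k)) = \<i> * of_int k"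
      by blast
  qed
qed

text \<open>The derivative of \<open>G\<close> is a combination of translates of \<open>G\<close>
  with coefficients of total mass at most \<open>2 * N\<close>; the mean value theorem does the
  rest. The map \<open>p\<close> need not be injective, because it will be one component of a
  three-dimensional wave vector.\<close>

lemma bernstein_trig:
  fixes d :: "'i \<Rightarrow> complex" and p :: "'i \<Rightarrow> int" and N :: nat and S :: "'i set"
  defines "G \<equiv> \<lambda>s. Re (\<Sum>k\<in>S. d k * cis (s * of_int (p k)))"
  assumes "N \<ge> 1" "\<And>k. k \<in> S \<Longrightarrow> \<bar>p k\<bar> \<le> int N" "\<And>s. \<bar>G s\<bar> \<le> C"
  shows "\<bar>G s - G 0\<bar> \<le> 2 * real N * C * \<bar>s\<bar>"
proof -
  obtain c :: "int \<Rightarrow> real" where c: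
    "(\<Sum>m\<in>{-(2 * int N)..2 * int N}. \<bar>c m\<bar>) \<le> 2 * real N"
    "\<forall>k. \<bar>k\<bar> \<le> int N \<longrightarrow> (\<Sum>m\<in>{-(2 * int N)..2 * int N}. of_real (c m) * cis (gridpt (2 * int N) m * of_int k)) = \<i> * of_int k"
    by (rule riesz_interpolation[OF assms(2)])
  let ?I = "{-(2 * int N)..2 * int N}"
  let ?t = "gridpt (2 * int N)"
  have C: "0 \<le> C" using assms(4)[of 0] by linarith
  have der: "(G has_real_derivative (\<Sum>m\<in>?I. c m * G (s + ?t m))) (at s)" for s
  proof -
    have 1: "((\<lambda>s. d k * cis (s * of_int (p k))) has_vector_derivative d k * (cis (s * of_int (p k)) * (\<i> * of_int (p k)))) (at s)" for k
    proof -
      have "((\<lambda>s. cis (s * of_int (p k))) has_vector_derivative cis (s * of_int (p k)) * (\<i> * of_int (p k))) (at s)"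
        unfolding has_vector_derivative_def
        by (rule has_derivative_eq_rhs, rule has_derivative_cis)
           (auto intro!: derivative_eq_intros simp: fun_eq_iff scaleR_conv_of_real)
      then show ?thesis by (rule has_vector_derivative_mult_right)
    qed
    have "((\<lambda>s. \<Sum>k\<in>S. d k * cis (s * of_int (p k))) has_vector_derivative (\<Sum>k\<in>S. d k * (cis (s * of_int (p k)) * (\<i> * of_int (p k))))) (at s)"
      by (intro has_vector_derivative_sum 1)
    then have "(G has_real_derivative Re (\<Sum>k\<in>S. d k * (cis (s * of_int (p k)) * (\<i> * of_int (p k))))) (at s)"
      unfolding G_def has_real_derivative_iff_has_vector_derivative by (rule bounded_linear.has_vector_derivative[OF bounded_linear_Re])
    also have "(\<Sum>k\<in>S. d k * (cis (s * of_int (p k)) * (\<i> * of_int (p k))))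
      = (\<Sum>k\<in>S. d k * (cis (s * of_int (p k)) * (\<Sum>m\<in>?I. of_real (c m) * cis (?t m * of_int (p k)))))"
      by (intro sum.cong refl) (simp only: c(2)[rule_format, OF assms(3)])
    also have "\<dots> = (\<Sum>k\<in>S. \<Sum>m\<in>?I. of_real (c m) * (d k * cis ((s + ?t m) * of_int (p k))))"
    proof -
      have "cis ((s + ?t m) * of_int (p k)) = cis (s * of_int (p k)) * cis (?t m * of_int (p k))" for m k
        by (simp only: distrib_right cis_mult)
      then show ?thesis
        unfolding sum_distrib_left by (intro sum.cong refl) (simp only: mult_ac)
    qed
    also have "\<dots> = (\<Sum>m\<in>?I. of_real (c m) * (\<Sum>k\<in>S. d k * cis ((s + ?t m) * of_int (p k))))"
      unfolding sum_distrib_left by (rule sum.swap)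
    finally show ?thesis unfolding G_def by simp
  qed
  have b: "\<bar>\<Sum>m\<in>?I. c m * G (s + ?t m)\<bar> \<le> 2 * real N * C" for s
  proof -
    have "\<bar>\<Sum>m\<in>?I. c m * G (s + ?t m)\<bar> \<le> (\<Sum>m\<in>?I. \<bar>c m * G (s + ?t m)\<bar>)" by (rule sum_abs)
    also have "\<dots> \<le> (\<Sum>m\<in>?I. \<bar>c m\<bar> * C)" unfolding abs_mult by (intro sum_mono mult_left_mono assms(4)) auto
    also have "\<dots> \<le> 2 * real N * C" unfolding sum_distrib_right[symmetric] using c(1) C by (rule mult_right_mono)
    finally show ?thesis .
  qed
  show ?thesis
    using field_differentiable_bound[of UNIV G "\<lambda>s. \<Sum>m\<in>?I. c m * G (s + ?t m)" "2 * real N * C" s 0] der b by simp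
qed

section \<open>The one-dimensional Jackson kernel: coefficients, positivity and first moment\<close>

definition hat :: "nat \<Rightarrow> int \<Rightarrow> real" where
  "hat n s = of_int (max 0 (int n - \<bar>s\<bar>))"

text \<open>The Fourier coefficients of the Jackson kernel, a normalised square of the Fejer kernel.\<close>

definition jackson1 :: "nat \<Rightarrow> int \<Rightarrow> real" where
  "jackson1 n k = (\<Sum>s\<in>{-int n..int n}. hat n s * hat n (s + k)) / (\<Sum>s\<in>{-int n..int n}. (hat n s)\<^sup>2)"

text \<open>Values of the Jackson kernel at the grid points. Sums over a grid that is fine enough for the frequencies
  involved replace the convolution integral exactly.\<close>

definition jackson_weight :: "nat \<Rightarrow> int \<Rightarrow> int \<Rightarrow> real" where
  "jackson_weight n K m = (cmod (\<Sum>s\<in>{-int n..int n}. of_real (hat n s) * cis (gridpt K m * of_int s)))\<^sup>2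
     / (of_int (2 * K + 1) * (\<Sum>s\<in>{-int n..int n}. (hat n s)\<^sup>2))"

lemma hat_nonneg: "0 \<le> hat n s" by (simp add: hat_def)

text \<open>One side of the tent already contributes the sum of the squares up to \<open>n\<close>.
  The order \<open>n ^ 3\<close>, set against the order \<open>n\<close> of the squared increments,
  produces the rate in \<open>jackson1_one_ge\<close>.\<close>

lemma hat_norm_ge: "real n ^ 3 / 3 \<le> (\<Sum>s\<in>{-int n..int n}. (hat n s)\<^sup>2)"
proof -
  have "real n ^ 3 / 3 \<le> (\<Sum>j\<le>n. (real j)\<^sup>2)"
  proof (induction n)
    case (Suc n)
    have "real (Suc n) ^ 3 / 3 \<le> real n ^ 3 / 3 + (real (Suc n))\<^sup>2"
      by (simp add: power2_eq_square power3_eq_cube algebra_simps)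
    then show ?case using Suc by simp
  qed simp
  also have "(\<Sum>j\<le>n. (real j)\<^sup>2) = (\<Sum>s\<in>{0..int n}. (hat n s)\<^sup>2)"
    by (rule sum.reindex_bij_witness[of _ "\<lambda>s. nat (int n - s)" "\<lambda>j. int n - int j"]) (auto simp: hat_def of_nat_diff)
  also have "\<dots> \<le> (\<Sum>s\<in>{-int n..int n}. (hat n s)\<^sup>2)"
    by (rule sum_mono2) auto
  finally show ?thesis .
qed

lemma hat_norm_pos: "n \<ge> 1 \<Longrightarrow> 0 < (\<Sum>s\<in>{-int n..int n}. (hat n s)\<^sup>2)"
  by (rule less_le_trans[OF _ hat_norm_ge]) simp

lemma jackson_weight_nonneg: "0 \<le> K \<Longrightarrow> 0 \<le> jackson_weight n K m"
  unfolding jackson_weight_def by (intro divide_nonneg_nonneg mult_nonneg_nonneg sum_nonneg) auto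

text \<open>The kernel has frequencies up to \<open>2 * n\<close>, so its product with the frequency
  \<open>k\<close> is resolved without aliasing under the stated condition on
  \<open>K\<close>.\<close>

lemma jackson_weight_sum:
  assumes "n \<ge> 1" "\<bar>k\<bar> + 2 * int n \<le> 2 * K"
  shows "(\<Sum>m\<in>{-K..K}. of_real (jackson_weight n K m) * cis (gridpt K m * of_int k)) = of_real (jackson1 n k)"
proof -
  let ?S = "{-int n..int n}" and ?Z = "\<Sum>s\<in>{-int n..int n}. (hat n s)\<^sup>2"
  have K: "0 \<le> K" using assms by linarith
  have b: "\<bar>s - r + k\<bar> \<le> 2 * K" if "s \<in> ?S" "r \<in> ?S" for s r using that assms(2) by auto
  have "(\<Sum>m\<in>{-K..K}. of_real (jackson_weight n K m) * cis (gridpt K m * of_int k))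
    = (\<Sum>m\<in>{-K..K}. of_real ((cmod (\<Sum>s\<in>?S. of_real (hat n s) * cis (gridpt K m * of_int s)))\<^sup>2) * cis (gridpt K m * of_int k)) / of_real (of_int (2 * K + 1) * ?Z)"
    unfolding sum_divide_distrib jackson_weight_def of_real_divide by (intro sum.cong refl) (simp only: times_divide_eq_left)
  also have "\<dots> = of_int (2 * K + 1) * of_real (\<Sum>s\<in>?S. if s + k \<in> ?S then hat n s * hat n (s + k) else 0) / of_real (of_int (2 * K + 1) * ?Z)"
    by (subst grid_fejer_sum[OF _ K b]) auto
  also have "(\<Sum>s\<in>?S. if s + k \<in> ?S then hat n s * hat n (s + k) else 0) = (\<Sum>s\<in>?S. hat n s * hat n (s + k))"
    by (intro sum.cong refl) (auto simp: hat_def)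
  also have "of_int (2 * K + 1) * of_real X / of_real (of_int (2 * K + 1) * ?Z) = complex_of_real (X / ?Z)" for X
  proof -
    have "complex_of_int (2 * K + 1) \<noteq> 0" using K by (simp only: of_int_eq_0_iff)
    then show ?thesis by (simp add: del: of_int_add of_int_mult)
  qed
  finally show ?thesis unfolding jackson1_def .
qed

lemma jackson1_zero: "n \<ge> 1 \<Longrightarrow> jackson1 n 0 = 1"
  using hat_norm_pos[of n] by (simp add: jackson1_def power2_eq_square)

lemma jackson_weight_total: "n \<ge> 1 \<Longrightarrow> int n \<le> K \<Longrightarrow> (\<Sum>m\<in>{-K..K}. jackson_weight n K m) = 1"
proof -
  assume a: "n \<ge> 1" "int n \<le> K"
  then have "complex_of_real (\<Sum>m\<in>{-K..K}. jackson_weight n K m) = complex_of_real 1"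
    using jackson_weight_sum[of n 0 K] jackson1_zero[of n] by simp
  then show ?thesis unfolding of_real_eq_iff .
qed

lemma jackson1_outside: "2 * int n \<le> \<bar>k\<bar> \<Longrightarrow> jackson1 n k = 0"
proof -
  assume "2 * int n \<le> \<bar>k\<bar>"
  then have "hat n s * hat n (s + k) = 0" for s by (auto simp: hat_def)
  then show ?thesis unfolding jackson1_def by (simp only: sum.neutral_const div_0)
qed

lemma jackson1_nonneg: "0 \<le> jackson1 n k"
  unfolding jackson1_def by (intro divide_nonneg_nonneg sum_nonneg mult_nonneg_nonneg hat_nonneg) auto

lemma jackson1_cos_sum:
  assumes "n \<ge> 1" "\<bar>k\<bar> + 2 * int n \<le> 2 * K"
  shows "jackson1 n k = (\<Sum>m\<in>{-K..K}. jackson_weight n K m * cos (gridpt K m * of_int k))"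
  using arg_cong[OF jackson_weight_sum[OF assms], of Re] by simp

lemma jackson1_le_1:
  assumes "n \<ge> 1" shows "jackson1 n k \<le> 1"
proof -
  define K where "K = \<bar>k\<bar> + int n"
  have "jackson1 n k = (\<Sum>m\<in>{-K..K}. jackson_weight n K m * cos (gridpt K m * of_int k))"
    by (rule jackson1_cos_sum) (use assms in \<open>auto simp: K_def\<close>)
  also have "\<dots> \<le> (\<Sum>m\<in>{-K..K}. jackson_weight n K m * 1)"
    by (intro sum_mono mult_left_mono jackson_weight_nonneg cos_le_one) (simp add: K_def)
  also have "\<dots> = 1" using jackson_weight_total[OF assms, of K] by (simp add: K_def)
  finally show ?thesis .
qed

text \<open>The defect at frequency 1 is half the squared norm of the increments of the tent,
  divided by its squared norm. The increments are at most 1 on at most \<open>3 * n\<close> points,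
  whence \<open>(3 * n / 2) / (n ^ 3 / 3)\<close>. For the Fejer kernel itself this defect is only
  \<open>1 / n\<close>.\<close>

lemma jackson1_one_ge:
  assumes "n \<ge> 1"
  shows "1 - jackson1 n 1 \<le> 9 / (2 * (real n)\<^sup>2)"
proof -
  let ?S = "{-int n..int n}" and ?Z = "\<Sum>s\<in>{-int n..int n}. (hat n s)\<^sup>2"
  have Z: "?Z > 0" by (rule hat_norm_pos[OF assms])
  have "(\<Sum>s\<in>?S. (hat n (s + 1))\<^sup>2) = (\<Sum>s\<in>{-int n+1..int n+1}. (hat n s)\<^sup>2)"
    by (rule sum.reindex_bij_witness[of _ "\<lambda>s. s - 1" "\<lambda>s. s + 1"]) auto
  also have "\<dots> = (\<Sum>s\<in>{-int n+1..int n}. (hat n s)\<^sup>2)"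
    by (rule sum.mono_neutral_right) (auto simp: hat_def)
  also have "\<dots> = ?Z"
    by (rule sum.mono_neutral_left) (auto simp: hat_def)
  finally have sh: "(\<Sum>s\<in>?S. (hat n (s + 1))\<^sup>2) = ?Z" .
  have "2 * ?Z - 2 * (\<Sum>s\<in>?S. hat n s * hat n (s + 1)) = ?Z + (\<Sum>s\<in>?S. (hat n (s + 1))\<^sup>2) - (\<Sum>s\<in>?S. 2 * (hat n s * hat n (s + 1)))"
    unfolding sh by (simp add: sum_distrib_left)
  also have "\<dots> = (\<Sum>s\<in>?S. (hat n s - hat n (s + 1))\<^sup>2)"
    unfolding sum.distrib[symmetric] sum_subtractf[symmetric] by (intro sum.cong refl) (simp add: power2_diff)
  also have "\<dots> \<le> (\<Sum>s\<in>?S. 1)"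
  proof (rule sum_mono)
    fix s
    have "\<bar>hat n s - hat n (s + 1)\<bar> \<le> 1" unfolding hat_def of_int_diff[symmetric] of_int_abs[symmetric] by simp
    then show "(hat n s - hat n (s + 1))\<^sup>2 \<le> 1" by (simp add: abs_square_le_1)
  qed
  also have "\<dots> \<le> 3 * real n" using assms by simp
  finally have "?Z - (\<Sum>s\<in>?S. hat n s * hat n (s + 1)) \<le> 3 * real n / 2" by simp
  moreover have "1 - jackson1 n 1 = (?Z - (\<Sum>s\<in>?S. hat n s * hat n (s + 1))) / ?Z"
    unfolding jackson1_def using Z by (simp add: diff_divide_distrib)
  ultimately have "1 - jackson1 n 1 \<le> (3 * real n / 2) / ?Z"
    using Z by (simp only: divide_right_mono less_imp_le)
  also have "\<dots> \<le> (3 * real n / 2) / (real n ^ 3 / 3)"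
    by (rule divide_left_mono[OF hat_norm_ge]) (use Z assms in auto)
  also have "\<dots> = 9 / (2 * (real n)\<^sup>2)" using assms by (simp add: power2_eq_square power3_eq_cube)
  finally show ?thesis .
qed

lemma sin_ge_half:
  assumes "0 \<le> s" "s \<le> pi / 2" shows "s / 2 \<le> sin s"
proof (cases "s \<le> pi / 3")
  case True
  show ?thesis
  proof (cases "s = 0")
    case False
    then have "0 < s" using assms by simp
    then obtain z where z: "0 < z" "z < s" "sin s - sin 0 = (s - 0) * cos z"
      using MVT2[of 0 s sin cos] DERIV_sin by blast
    have "cos (pi / 3) \<le> cos z" using z True pi_gt_zero by (intro cos_monotone_0_pi_le) auto
    then have "s * (1 / 2) \<le> s * cos z" using assms by (intro mult_left_mono) (auto simp: cos_60)
    then show ?thesis using z by simp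
  qed simp
next
  case False
  have "sin (pi / 3) \<le> sin s" using False assms by (intro sin_monotone_2pi_le) auto
  \<comment> \<open>Beyond \<open>pi / 3\<close> constants suffice: the sine is at least 0.86, while
    \<open>s / 2\<close> is at most \<open>pi / 4\<close>, which is below 0.8.\<close>
  moreover have "sin (pi / 3) \<ge> 0.86" unfolding sin_60 using real_le_rsqrt[of "1.72" 3] by (simp add: power2_eq_square)
  moreover have "s / 2 \<le> 0.8" using assms pi_less_4 pi_approx by simp
  ultimately show ?thesis by simp
qed

lemma square_le_cos: "\<bar>t\<bar> \<le> pi \<Longrightarrow> t\<^sup>2 \<le> 8 * (1 - cos t)"
proof -
  assume t: "\<bar>t\<bar> \<le> pi"
  have "\<bar>t\<bar> / 2 / 2 \<le> sin (\<bar>t\<bar> / 2)" by (rule sin_ge_half) (use t in auto)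
  then have "(\<bar>t\<bar> / 2 / 2)\<^sup>2 \<le> (sin (\<bar>t\<bar> / 2))\<^sup>2" by (intro power_mono) auto
  moreover have "cos t = 1 - 2 * (sin (\<bar>t\<bar> / 2))\<^sup>2" using cos_double_sin[of "\<bar>t\<bar> / 2"] by simp
  ultimately show ?thesis by (simp add: power_divide)
qed

text \<open>The inequality \<open>2 * n * \<bar>t\<bar> \<le> n\<^sup>2 * t\<^sup>2 + 1\<close>
  trades the first moment for the second, and \<open>square_le_cos\<close> bounds the second by the
  defect at frequency 1, of order \<open>1 / n\<^sup>2\<close>. The constant is 18 + 1/2, rounded
  up.\<close>

lemma jackson_first_moment:
  assumes "n \<ge> 1" "int n < K"
  shows "(\<Sum>m\<in>{-K..K}. jackson_weight n K m * \<bar>gridpt K m\<bar>) \<le> 19 / real n"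
proof -
  have K: "0 \<le> K" using assms by linarith
  have "(\<Sum>m\<in>{-K..K}. jackson_weight n K m * \<bar>gridpt K m\<bar>)
     \<le> (\<Sum>m\<in>{-K..K}. (4 * real n) * (jackson_weight n K m - jackson_weight n K m * cos (gridpt K m * of_int 1)) + (1 / (2 * real n)) * jackson_weight n K m)"
  proof (rule sum_mono)
    fix m assume m: "m \<in> {-K..K}"
    let ?t = "gridpt K m"
    have "0 \<le> (real n * \<bar>?t\<bar> - 1)\<^sup>2" by simp
    then have "2 * real n * \<bar>?t\<bar> \<le> (real n)\<^sup>2 * ?t\<^sup>2 + 1" by (simp add: power2_eq_square algebra_simps)
    then have "\<bar>?t\<bar> \<le> real n / 2 * ?t\<^sup>2 + 1 / (2 * real n)" using assms(1) by (simp add: field_simps power2_eq_square)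
    also have "\<dots> \<le> real n / 2 * (8 * (1 - cos ?t)) + 1 / (2 * real n)"
      by (intro add_right_mono mult_left_mono square_le_cos abs_gridpt_le m) auto
    finally have "jackson_weight n K m * \<bar>?t\<bar> \<le> jackson_weight n K m * (real n / 2 * (8 * (1 - cos ?t)) + 1 / (2 * real n))"
      by (rule mult_left_mono[OF _ jackson_weight_nonneg[OF K]])
    then show "jackson_weight n K m * \<bar>?t\<bar> \<le> (4 * real n) * (jackson_weight n K m - jackson_weight n K m * cos (?t * of_int 1)) + (1 / (2 * real n)) * jackson_weight n K m"
      by (simp add: algebra_simps)
  qed
  also have "\<dots> = (4 * real n) * (1 - jackson1 n 1) + (1 / (2 * real n))"
    unfolding sum.distrib sum_distrib_left[symmetric] sum_subtractf
    using jackson_weight_total[OF assms(1), of K] jackson1_cos_sum[OF assms(1), of 1 K] assms(2) by simp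
  also have "\<dots> \<le> (4 * real n) * (9 / (2 * (real n)\<^sup>2)) + (1 / (2 * real n))"
    by (intro add_right_mono mult_left_mono jackson1_one_ge assms) auto
  also have "\<dots> \<le> 19 / real n" using assms(1) by (simp add: field_simps power2_eq_square)
  finally show ?thesis .
qed

text \<open>Since \<open>1 - cos x \<le> \<bar>x\<bar>\<close>, the defect at a fixed frequency is
  at most the modulus of this frequency times the first moment.\<close>

lemma jackson1_tendsto: "(\<lambda>n. jackson1 n k) \<longlonglongrightarrow> 1"
proof -
  have b: "1 - jackson1 n k \<le> 19 * \<bar>of_int k\<bar> / real n" if n: "n \<ge> 1" for n
  proof -
    define K where "K = \<bar>k\<bar> + int n + 1"
    have "1 - jackson1 n k = (\<Sum>m\<in>{-K..K}. jackson_weight n K m * (1 - cos (gridpt K m * of_int k)))"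
      using jackson1_cos_sum[OF n, of k K] jackson_weight_total[OF n, of K]
      by (simp add: K_def right_diff_distrib sum_subtractf)
    also have "\<dots> \<le> (\<Sum>m\<in>{-K..K}. \<bar>of_int k\<bar> * (jackson_weight n K m * \<bar>gridpt K m\<bar>))"
    proof (rule sum_mono)
      fix m assume "m \<in> {-K..K}"
      have c: "1 - cos x \<le> \<bar>x\<bar>" for x :: real
      proof -
        have "\<bar>sin (x / 2)\<bar> * \<bar>sin (x / 2)\<bar> \<le> \<bar>x / 2\<bar> * 1"
          by (intro mult_mono abs_sin_x_le_abs_x) auto
        then have "(sin (x / 2))\<^sup>2 \<le> \<bar>x / 2\<bar>" by (simp add: power2_eq_square flip: abs_mult)
        then show ?thesis using cos_double_sin[of "x / 2"] by simp
      qed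
      have "jackson_weight n K m * (1 - cos (gridpt K m * of_int k)) \<le> jackson_weight n K m * \<bar>gridpt K m * of_int k\<bar>"
        by (intro mult_left_mono c jackson_weight_nonneg) (simp add: K_def)
      then show "jackson_weight n K m * (1 - cos (gridpt K m * of_int k)) \<le> \<bar>of_int k\<bar> * (jackson_weight n K m * \<bar>gridpt K m\<bar>)"
        by (simp add: abs_mult mult_ac)
    qed
    also have "\<dots> \<le> \<bar>of_int k\<bar> * (19 / real n)"
      unfolding sum_distrib_left[symmetric] by (intro mult_left_mono jackson_first_moment n) (auto simp: K_def)
    finally show ?thesis by (simp add: mult_ac)
  qed
  have "(\<lambda>n. 1 - jackson1 n k) \<longlonglongrightarrow> 0"
  proof (rule tendsto_sandwich)
    show "\<forall>\<^sub>F n in sequentially. 0 \<le> 1 - jackson1 n k"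
      using eventually_ge_at_top[of 1] by eventually_elim (use jackson1_le_1 in auto)
    show "\<forall>\<^sub>F n in sequentially. 1 - jackson1 n k \<le> 19 * \<bar>of_int k\<bar> / real n"
      using eventually_ge_at_top[of 1] by eventually_elim (use b in auto)
    show "(\<lambda>n. 19 * \<bar>of_int k\<bar> / real n) \<longlonglongrightarrow> 0" by (rule lim_const_over_n)
  qed simp
  from tendsto_diff[OF tendsto_const this, of 1] show ?thesis by simp
qed

section \<open>The three-dimensional Jackson kernel as a tensor product\<close>

definition jackson :: "nat \<Rightarrow> int^3 \<Rightarrow> real" where
  "jackson n k = (\<Prod>i\<in>UNIV. jackson1 n (k $ i))"

lemma jackson_bounds: "n \<ge> 1 \<Longrightarrow> 0 \<le> jackson n k \<and> jackson n k \<le> 1"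
  unfolding jackson_def by (intro conjI prod_nonneg prod_le_1) (auto simp: jackson1_nonneg jackson1_le_1)

lemma jackson_outside: "2 * int n \<le> \<bar>k $ i\<bar> \<Longrightarrow> jackson n k = 0"
  unfolding jackson_def using jackson1_outside[of n "k $ i"] by (intro prod_zero) auto

lemma jackson_tendsto: "(\<lambda>n. jackson n k) \<longlonglongrightarrow> 1"
proof -
  have "(\<lambda>n. jackson n k) \<longlonglongrightarrow> (\<Prod>i\<in>(UNIV :: 3 set). 1)"
    unfolding jackson_def by (intro tendsto_prod jackson1_tendsto)
  then show ?thesis by simp
qed

lemma prod_cis_3: "(\<Prod>i\<in>(UNIV :: 3 set). cis (f i)) = cis (\<Sum>i\<in>UNIV. f i)"
  unfolding UNIV_3 by (simp add: cis_mult)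

lemma cis_inner_prod: "cis (x \<bullet> y) = (\<Prod>i\<in>UNIV. cis (y $ i * x $ i))" for x y :: "real^3"
  unfolding prod_cis_3 inner_vec_def by (simp add: mult.commute)

lemma sum_prod_grid:
  fixes f :: "3 \<Rightarrow> int \<Rightarrow> 'b::comm_semiring_1"
  shows "(\<Sum>g\<in>PiE UNIV (\<lambda>_. {-K..K}). \<Prod>i\<in>UNIV. f i (g i)) = (\<Prod>i\<in>UNIV. \<Sum>m\<in>{-K..K}. f i m)"
  by (rule prod_sum_PiE[symmetric]) auto

text \<open>Tensor product of the kernel and of its grid. One grid serves all frequencies up to
  \<open>D\<close>, so that convolution becomes a single finite mean of translations whose average
  length is of order \<open>1 / n\<close>. The constant 57 is 3 times 19.\<close>

lemma jackson_mollifier: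
  fixes n :: nat and D :: int
  assumes "n \<ge> 1"
  obtains I :: "(3 \<Rightarrow> int) set" and \<kappa> :: "(3 \<Rightarrow> int) \<Rightarrow> real" and y :: "(3 \<Rightarrow> int) \<Rightarrow> real^3"
  where "finite I" "\<forall>g. 0 \<le> \<kappa> g" "(\<Sum>g\<in>I. \<kappa> g) = 1"
    "\<forall>k. (\<forall>i. \<bar>k $ i\<bar> \<le> D) \<longrightarrow> (\<Sum>g\<in>I. of_real (\<kappa> g) * cis (wavevec k \<bullet> y g)) = of_real (jackson n k)"
    "(\<Sum>g\<in>I. \<kappa> g * (\<Sum>i\<in>UNIV. \<bar>y g $ i\<bar>)) \<le> 57 / real n"
proof -
  define K where "K = \<bar>D\<bar> + int n + 1"
  have K: "0 \<le> K" by (simp add: K_def)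
  define I where "I = PiE (UNIV :: 3 set) (\<lambda>_. {-K..K})"
  define \<kappa> where "\<kappa> g = (\<Prod>i\<in>UNIV. jackson_weight n K (g i))" for g :: "3 \<Rightarrow> int"
  define y where "y g = (\<chi> i. gridpt K (g i))" for g :: "3 \<Rightarrow> int"
  have tot: "(\<Sum>m\<in>{-K..K}. jackson_weight n K m) = 1"
    using jackson_weight_total[OF assms, of K] by (simp add: K_def)
  note P = sum_prod_grid[where K = K, folded I_def]
  show thesis
  proof (rule that[of I \<kappa> y])
    show "finite I" unfolding I_def by (intro finite_PiE) auto
    show "\<forall>g. 0 \<le> \<kappa> g" unfolding \<kappa>_def by (intro allI prod_nonneg jackson_weight_nonneg K)
    show "(\<Sum>g\<in>I. \<kappa> g) = 1" unfolding \<kappa>_def P[of "\<lambda>i. jackson_weight n K"] tot by simp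
    show "\<forall>k. (\<forall>i. \<bar>k $ i\<bar> \<le> D) \<longrightarrow> (\<Sum>g\<in>I. of_real (\<kappa> g) * cis (wavevec k \<bullet> y g)) = of_real (jackson n k)"
    proof (intro allI impI)
      fix k :: "int^3" assume k: "\<forall>i. \<bar>k $ i\<bar> \<le> D"
      have "(\<Sum>g\<in>I. of_real (\<kappa> g) * cis (wavevec k \<bullet> y g)) = (\<Sum>g\<in>I. \<Prod>i\<in>UNIV. of_real (jackson_weight n K (g i)) * cis (gridpt K (g i) * of_int (k $ i)))"
        unfolding \<kappa>_def y_def cis_inner_prod prod.distrib of_real_prod
        by (simp only: wavevec_nth vec_lambda_beta mult.commute)
      also have "\<dots> = (\<Prod>i\<in>UNIV. complex_of_real (jackson1 n (k $ i)))"
        unfolding P[of "\<lambda>i m. of_real (jackson_weight n K m) * cis (gridpt K m * of_int (k $ i))"]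
        by (intro prod.cong refl jackson_weight_sum assms) (use k in \<open>auto simp: K_def intro: order_trans\<close>)
      finally show "(\<Sum>g\<in>I. of_real (\<kappa> g) * cis (wavevec k \<bullet> y g)) = of_real (jackson n k)"
        unfolding jackson_def of_real_prod .
    qed
    have "(\<Sum>g\<in>I. \<kappa> g * \<bar>y g $ i\<bar>) \<le> 19 / real n" for i
    proof -
      have "(\<Sum>g\<in>I. \<kappa> g * \<bar>y g $ i\<bar>) = (\<Sum>g\<in>I. \<Prod>j\<in>UNIV. jackson_weight n K (g j) * (if j = i then \<bar>gridpt K (g j)\<bar> else 1))"
        unfolding \<kappa>_def prod.distrib by (simp add: y_def)
      also have "\<dots> = (\<Prod>j\<in>UNIV. if j = i then \<Sum>m\<in>{-K..K}. jackson_weight n K m * \<bar>gridpt K m\<bar> else 1)"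
        unfolding P[of "\<lambda>j m. jackson_weight n K m * (if j = i then \<bar>gridpt K m\<bar> else 1)"]
        by (intro prod.cong refl) (auto simp: tot)
      also have "\<dots> = (\<Sum>m\<in>{-K..K}. jackson_weight n K m * \<bar>gridpt K m\<bar>)" by simp
      also have "\<dots> \<le> 19 / real n" by (rule jackson_first_moment[OF assms]) (simp add: K_def)
      finally show ?thesis .
    qed
    then have "(\<Sum>i\<in>(UNIV :: 3 set). \<Sum>g\<in>I. \<kappa> g * \<bar>y g $ i\<bar>) \<le> (\<Sum>i\<in>(UNIV :: 3 set). 19 / real n)"
      by (intro sum_mono)
    then show "(\<Sum>g\<in>I. \<kappa> g * (\<Sum>i\<in>UNIV. \<bar>y g $ i\<bar>)) \<le> 57 / real n"
      unfolding sum_distrib_left by (subst sum.swap) simp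
  qed
qed

section \<open>Littlewood--Paley blocks\<close>

abbreviation cellvol :: real where "cellvol \<equiv> (2 * pi) ^ 3"

definition freqs :: "real \<Rightarrow> (int^3) set" where
  "freqs R = {k. norm (wavevec k) \<le> R}"

lemma finite_freqs [simp]: "finite (freqs R)"
proof -
  let ?A = "{-\<lceil>R\<rceil>..\<lceil>R\<rceil>}"
  have "freqs R \<subseteq> (\<lambda>g. \<chi> i. g i) ` (PiE UNIV (\<lambda>_. ?A))"
  proof
    fix k assume "k \<in> freqs R"
    then have "\<bar>real_of_int (k $ i)\<bar> \<le> R" for i
      using component_le_norm_cart[of "wavevec k" i] by (simp add: freqs_def)
    then have "k $ i \<in> ?A" for i by (smt (verit) atLeastAtMost_iff le_of_int_ceiling of_int_le_iff of_int_minus)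
    then have "($) k \<in> PiE UNIV (\<lambda>_. ?A)" by auto
    moreover have "k = (\<chi> i. k $ i)" by simp
    ultimately show "k \<in> (\<lambda>g. \<chi> i. g i) ` (PiE UNIV (\<lambda>_. ?A))" by blast
  qed
  then show ?thesis by (rule finite_subset) (intro finite_imageI finite_PiE, auto)
qed

lemma uminus_freqs [simp]: "- k \<in> freqs R \<longleftrightarrow> k \<in> freqs R"
  by (simp add: freqs_def wavevec_minus)

lemma freqs_mono: "R \<le> R' \<Longrightarrow> freqs R \<subseteq> freqs R'"
  by (auto simp: freqs_def)

lemma sum_freqs_uminus: "(\<Sum>k\<in>freqs R. f (- k)) = (\<Sum>k\<in>freqs R. f k)"
  by (rule sum.reindex_bij_witness[of _ uminus uminus]) auto

lemma cosm_uminus: "cosm (- k) = cosm k"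
  and sinm_uminus: "sinm (- k) = (\<lambda>x. (- 1) * sinm k x)"
  by (auto simp: wavevec_minus)

lemma torus_distribution_sinm_uminus:
  "torus_distribution f \<Longrightarrow> f (sinm (- k)) = - f (sinm k)"
  unfolding sinm_uminus by (subst torus_distribution_scale) auto

lemma fourier_coeff_uminus:
  assumes "torus_distribution f"
  shows "fourier_coeff f (- k) = cnj (fourier_coeff f k)"
  unfolding fourier_coeff_def cosm_uminus torus_distribution_sinm_uminus[OF assms]
  by (simp add: complex_eq_iff)

lemma Re_fourier_coeff_cis:
  "Re (fourier_coeff f k * cis t) = (f (cosm k) * cos t + f (sinm k) * sin t) / cellvol"
  unfolding fourier_coeff_def by (simp add: Re_divide_of_real add_divide_distrib)

lemma fourier_multiplier_finite:
  assumes "finite S" "\<And>k. k \<notin> S \<Longrightarrow> m k = 0"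
  shows "fourier_multiplier m f x = (\<Sum>k\<in>S. m k * Re (fourier_coeff f k * cism k x))"
proof -
  have "fourier_multiplier m f x = (\<Sum>\<^sub>\<infinity>k\<in>S. m k * Re (fourier_coeff f k * cism k x))"
    unfolding fourier_multiplier_def by (rule infsum_cong_neutral) (auto simp: assms(2))
  then show ?thesis using assms(1) by simp
qed

lemma fourier_multiplier_trig:
  assumes "finite S" "\<And>k. k \<notin> S \<Longrightarrow> m k = 0"
  shows "fourier_multiplier m f x = (\<Sum>k\<in>S. m k / cellvol * (f (cosm k) * cosm k x + f (sinm k) * sinm k x))"
proof -
  have "fourier_multiplier m f x = (\<Sum>k\<in>S. m k * Re (fourier_coeff f k * cism k x))"
    by (rule fourier_multiplier_finite[OF assms])
  then show ?thesis unfolding Re_fourier_coeff_cis by (simp only: times_divide_eq_right times_divide_eq_left)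
qed

lemma Re_mult_of_real: "Re (of_real a * z) = a * Re z"
  by simp

lemma fourier_multiplier_complex:
  assumes "torus_distribution f" "\<And>k. m (- k) = m k" "\<And>k. k \<notin> freqs R \<Longrightarrow> m k = 0"
  shows "complex_of_real (fourier_multiplier m f x) = (\<Sum>k\<in>freqs R. (of_real (m k) * fourier_coeff f k) * cism k x)"
proof -
  let ?z = "\<lambda>k. (of_real (m k) * fourier_coeff f k) * cism k x"
  have z: "?z (- k) = cnj (?z k)" for k
    by (simp add: assms(2) fourier_coeff_uminus[OF assms(1)] wavevec_minus cis_cnj)
  have "(\<Sum>k\<in>freqs R. ?z k) = (\<Sum>k\<in>freqs R. cnj (?z k))"
    unfolding z[symmetric] by (rule sum_freqs_uminus[symmetric])
  then have "(\<Sum>k\<in>freqs R. ?z k) = cnj (\<Sum>k\<in>freqs R. ?z k)" unfolding cnj_sum .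
  then have i: "Im (\<Sum>k\<in>freqs R. ?z k) = 0" by (metis complex_is_Real_iff Reals_cnj_iff)
  have "fourier_multiplier m f x = Re (\<Sum>k\<in>freqs R. ?z k)"
  proof -
    have "fourier_multiplier m f x = (\<Sum>k\<in>freqs R. m k * Re (fourier_coeff f k * cism k x))"
      by (rule fourier_multiplier_finite[OF finite_freqs assms(3)])
    also have "\<dots> = Re (\<Sum>k\<in>freqs R. ?z k)"
      unfolding Re_sum mult.assoc by (intro sum.cong refl) (rule Re_mult_of_real[symmetric])
    finally show ?thesis .
  qed
  with i show ?thesis by (simp only: complex_eq_iff Re_complex_of_real Im_complex_of_real)
qed

lemma trigpoly_fourier_multiplier:
  assumes "torus_distribution f" "\<And>k. m (- k) = m k" "\<And>k. k \<notin> freqs R \<Longrightarrow> m k = 0"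
  shows "trigpoly (freqs R) (fourier_multiplier m f)"
  by (rule trigpolyI[OF finite_freqs fourier_multiplier_complex[where m = m, OF assms]])

text \<open>Every component is below \<open>2 * n\<close> in modulus, so the norm is at most
  \<open>sqrt 3 * 2 * n\<close>, which is rounded up.\<close>

lemma jackson_support:
  assumes "jackson n k \<noteq> 0"
  shows "norm (wavevec k) \<le> 4 * real n"
proof -
  have c: "\<bar>k $ i\<bar> < 2 * int n" for i using jackson_outside[of n k i] assms by force
  have "\<bar>real_of_int (k $ i)\<bar> \<le> 2 * real n" for i
  proof -
    have "real_of_int \<bar>k $ i\<bar> \<le> real_of_int (2 * int n)" using c[of i] by linarith
    then show ?thesis by simp
  qed
  then have sq: "(real_of_int (k $ i))\<^sup>2 \<le> (2 * real n)\<^sup>2" for i by (subst abs_le_square_iff[symmetric]) simp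
  have "(norm (wavevec k))\<^sup>2 = (\<Sum>i\<in>UNIV. (real_of_int (k $ i))\<^sup>2)"
    unfolding power2_norm_eq_inner inner_vec_def by (simp add: power2_eq_square)
  also have "\<dots> \<le> (\<Sum>i\<in>(UNIV :: 3 set). (2 * real n)\<^sup>2)" by (intro sum_mono sq)
  also have "\<dots> \<le> (4 * real n)\<^sup>2" by (simp add: power_mult_distrib)
  finally show ?thesis by (rule power2_le_imp_le) simp
qed

lemma jackson_uminus: "jackson n (- k) = jackson n k"
proof -
  have "jackson1 n (- j) = jackson1 n j" for j
  proof -
    have "(\<Sum>s\<in>{-int n..int n}. hat n s * hat n (s + - j)) = (\<Sum>s\<in>{-int n..int n}. hat n s * hat n (s + j))"
      by (rule sum.reindex_bij_witness[of _ uminus uminus]) (auto simp: hat_def abs_minus_commute)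
    then show ?thesis unfolding jackson1_def by simp
  qed
  then show ?thesis by (simp add: jackson_def)
qed

section \<open>Supports of the Littlewood-Paley symbols and low-pass filters\<close>

context
  fixes \<eta> :: "real \<Rightarrow> real"
  assumes eta: "lp_cutoff \<eta>"
begin

lemma eta_bounds: "0 \<le> \<eta> r" "\<eta> r \<le> 1"
  and eta_one: "\<bar>r\<bar> \<le> 3/4 \<Longrightarrow> \<eta> r = 1"
  and eta_zero: "4/3 \<le> \<bar>r\<bar> \<Longrightarrow> \<eta> r = 0"
  using eta by (auto simp: lp_cutoff_def)

lemma lp_symbol_uminus: "lp_symbol \<eta> j (- k) = lp_symbol \<eta> j k"
  by (simp add: lp_symbol_def wavevec_minus)

lemma abs_lp_symbol_le_1: "\<bar>lp_symbol \<eta> j k\<bar> \<le> 1"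
  using eta_bounds[of "norm (wavevec k)"] eta_bounds[of "norm (wavevec k) / 2 ^ j"] eta_bounds[of "norm (wavevec k) / 2 ^ (j - 1)"]
  by (auto simp: lp_symbol_def)

lemma lp_symbol_upper:
  assumes "lp_symbol \<eta> j k \<noteq> 0" shows "norm (wavevec k) < 4/3 * 2 ^ j"
proof (rule ccontr)
  assume a: "\<not> ?thesis"
  have "\<eta> (norm (wavevec k) / 2 ^ j) = 0" using a by (intro eta_zero) (simp add: field_simps)
  moreover have "\<eta> (norm (wavevec k) / 2 ^ (j - 1)) = 0" if "j \<noteq> 0"
  proof (rule eta_zero)
    have "(2::real) ^ (j - 1) \<le> 2 ^ j" by (rule power_increasing) auto
    then have "4/3 * 2 ^ (j - 1) \<le> norm (wavevec k)" using a by linarith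
    then show "4/3 \<le> \<bar>norm (wavevec k) / 2 ^ (j - 1)\<bar>" by (simp add: field_simps)
  qed
  ultimately show False using assms by (auto simp: lp_symbol_def split: if_splits)
qed

lemma lp_symbol_lower:
  assumes "lp_symbol \<eta> j k \<noteq> 0" "j \<noteq> 0" shows "3/8 * 2 ^ j < norm (wavevec k)"
proof (rule ccontr)
  assume a: "\<not> ?thesis"
  have e: "(2::real) ^ j = 2 * 2 ^ (j - 1)" using assms(2) by (simp flip: power_Suc)
  have "\<eta> (norm (wavevec k) / 2 ^ (j - 1)) = 1" using a by (intro eta_one) (simp add: field_simps e)
  moreover have "\<eta> (norm (wavevec k) / 2 ^ j) = 1"
  proof (rule eta_one)
    have "norm (wavevec k) \<le> 3/4 * 2 ^ j" using a zero_less_power[of "2::real" j] by linarith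
    then show "\<bar>norm (wavevec k) / 2 ^ j\<bar> \<le> 3/4" by (simp add: field_simps)
  qed
  ultimately show False using assms by (auto simp: lp_symbol_def split: if_splits)
qed

text \<open>The shell of block \<open>j\<close> begins at \<open>3/8 * 2 ^ j\<close>. For
  \<open>j = i + 2\<close> this is \<open>3/2 * 2 ^ i\<close>, beyond the end
  \<open>4/3 * 2 ^ i\<close> of block \<open>i\<close>.\<close>

lemma lp_symbol_adjacent_aux:
  assumes "lp_symbol \<eta> i k \<noteq> 0" "lp_symbol \<eta> j k \<noteq> 0" shows "j \<le> Suc i"
proof (rule ccontr)
  assume "\<not> ?thesis"
  then have ij: "i + 2 \<le> j" by simp
  then have "(2::real) ^ (i + 2) \<le> 2 ^ j" by (intro power_increasing) auto
  then have "4 * 2 ^ i \<le> (2::real) ^ j" by (simp add: power_add)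
  moreover have "3/8 * 2 ^ j < norm (wavevec k)" using lp_symbol_lower[OF assms(2)] ij by simp
  moreover have "norm (wavevec k) < 4/3 * 2 ^ i" by (rule lp_symbol_upper[OF assms(1)])
  moreover have "0 < (2::real) ^ i" by simp
  ultimately show False by linarith
qed

lemma sum_lp_symbol: "(\<Sum>j<Suc N. lp_symbol \<eta> j k) = \<eta> (norm (wavevec k) / 2 ^ N)"
  by (induction N) (auto simp: lp_symbol_def)

text \<open>A frequency meets at most two blocks, and each symbol is at most 1 in modulus. This
  uniform count is what makes the Bony series converge absolutely against a mode.\<close>

lemma sum_abs_lp_symbol: "finite J \<Longrightarrow> (\<Sum>j\<in>J. \<bar>lp_symbol \<eta> j k\<bar>) \<le> 2"
proof -
  assume J: "finite J"
  show ?thesis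
  proof (cases "\<exists>j\<in>J. lp_symbol \<eta> j k \<noteq> 0")
    case True
    define j0 where "j0 = (LEAST j. j \<in> J \<and> lp_symbol \<eta> j k \<noteq> 0)"
    have j0: "lp_symbol \<eta> j0 k \<noteq> 0" unfolding j0_def using True by (metis (mono_tags, lifting) LeastI_ex)
    have min: "j0 \<le> j" if "j \<in> J" "lp_symbol \<eta> j k \<noteq> 0" for j unfolding j0_def using that by (intro Least_le) auto
    have "(\<Sum>j\<in>J. \<bar>lp_symbol \<eta> j k\<bar>) = (\<Sum>j\<in>J \<inter> {j0, Suc j0}. \<bar>lp_symbol \<eta> j k\<bar>)"
      using J min lp_symbol_adjacent_aux[OF j0] by (intro sum.mono_neutral_right) (auto, force)
    also have "\<dots> \<le> (\<Sum>j\<in>{j0, Suc j0}. \<bar>lp_symbol \<eta> j k\<bar>)" by (rule sum_mono2) auto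
    also have "\<dots> \<le> 2" using abs_lp_symbol_le_1[of j0 k] abs_lp_symbol_le_1[of "Suc j0" k] by simp
    finally show ?thesis .
  qed simp
qed

lemma lp_symbol_eq_0: "k \<notin> freqs (4/3 * 2 ^ j) \<Longrightarrow> lp_symbol \<eta> j k = 0"
  using lp_symbol_upper[of j k] by (force simp: freqs_def)

definition lp_support :: "nat \<Rightarrow> (int^3) set" where
  "lp_support j = {k. lp_symbol \<eta> j k \<noteq> 0}"

lemma lp_support_subset: "lp_support j \<subseteq> freqs (4/3 * 2 ^ j)"
  using lp_symbol_eq_0 by (auto simp: lp_support_def)

lemma lp_block_complex:
  assumes "torus_distribution f" "lp_support j \<subseteq> freqs R"
  shows "complex_of_real (lp_block \<eta> j f x) = (\<Sum>k\<in>freqs R. (of_real (lp_symbol \<eta> j k) * fourier_coeff f k) * cism k x)"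
  unfolding lp_block_def
proof (rule fourier_multiplier_complex[where m = "lp_symbol \<eta> j", OF assms(1) lp_symbol_uminus])
  show "lp_symbol \<eta> j k = 0" if "k \<notin> freqs R" for k
    using that assms(2) by (auto simp: lp_support_def)
qed

lemma trigpoly_lp_block:
  assumes "torus_distribution f"
  shows "trigpoly (lp_support j) (lp_block \<eta> j f)"
proof (rule trigpolyI)
  show "finite (lp_support j)" by (rule finite_subset[OF lp_support_subset finite_freqs])
  show "complex_of_real (lp_block \<eta> j f x) = (\<Sum>k\<in>lp_support j. (of_real (lp_symbol \<eta> j k) * fourier_coeff f k) * cism k x)" for x
    unfolding lp_block_complex[OF assms lp_support_subset]
    by (rule sum.mono_neutral_right[OF finite_freqs lp_support_subset]) (auto simp: lp_support_def)
qed

definition lp_partial :: "nat \<Rightarrow> dist \<Rightarrow> real^3 \<Rightarrow> real" where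
  "lp_partial N f x = (\<Sum>j<N. lp_block \<eta> j f x)"

lemma lp_support_freqs: "j \<le> N \<Longrightarrow> lp_support j \<subseteq> freqs (4/3 * 2 ^ N)"
proof -
  assume "j \<le> N"
  then have "(2::real) ^ j \<le> 2 ^ N" by (intro power_increasing) auto
  then show ?thesis using lp_support_subset[of j] freqs_mono[of "4/3 * 2 ^ j" "4/3 * 2 ^ N"] by auto
qed

lemma trigpoly_lp_partial: "torus_distribution f \<Longrightarrow> trigpoly (freqs (4/3 * 2 ^ N)) (lp_partial N f)"
  unfolding lp_partial_def
proof (rule trigpoly_sum[OF finite_freqs])
  assume f: "torus_distribution f"
  fix j assume "j \<in> {..<N}"
  then have "lp_support j \<subseteq> freqs (4/3 * 2 ^ N)" by (intro lp_support_freqs) simp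
  then show "trigpoly (freqs (4/3 * 2 ^ N)) (lp_block \<eta> j f)"
    by (rule trigpoly_mono[OF trigpoly_lp_block[OF f] _ finite_freqs])
qed

lemma lp_partial_complex:
  assumes "torus_distribution f"
  shows "complex_of_real (lp_partial N f x) = (\<Sum>k\<in>freqs (4/3 * 2 ^ N). (of_real (\<Sum>j<N. lp_symbol \<eta> j k) * fourier_coeff f k) * cism k x)"
proof -
  have "complex_of_real (lp_partial N f x) = (\<Sum>j<N. \<Sum>k\<in>freqs (4/3 * 2 ^ N). (of_real (lp_symbol \<eta> j k) * fourier_coeff f k) * cism k x)"
    unfolding lp_partial_def of_real_sum
    by (rule sum.cong[OF refl], rule lp_block_complex[OF assms], rule lp_support_freqs) simp
  also have "\<dots> = (\<Sum>k\<in>freqs (4/3 * 2 ^ N). \<Sum>j<N. (of_real (lp_symbol \<eta> j k) * fourier_coeff f k) * cism k x)"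
    by (rule sum.swap)
  finally show ?thesis unfolding of_real_sum sum_distrib_right .
qed

text \<open>The sum telescopes to the cut-off at scale \<open>2 ^ (M - 1)\<close>, which is 1 up to
  \<open>3/4 * 2 ^ (M - 1)\<close>, that is, \<open>3/8 * 2 ^ M\<close>.\<close>

lemma sum_lp_symbol_one:
  assumes "M \<ge> 1" "norm (wavevec k) \<le> 3/8 * 2 ^ M"
  shows "(\<Sum>j<M. lp_symbol \<eta> j k) = 1"
proof -
  have "(2::real) ^ M = 2 * 2 ^ (M - 1)" using assms(1) by (simp flip: power_Suc)
  then have "norm (wavevec k) / 2 ^ (M - 1) \<le> 3/4" using assms(2) by (simp add: pos_divide_le_eq)
  then have "(\<Sum>j<Suc (M - 1). lp_symbol \<eta> j k) = 1"
    unfolding sum_lp_symbol by (intro eta_one) simp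
  then show ?thesis using assms(1) by simp
qed

lemma sum_lp_symbol_bounds: "0 \<le> (\<Sum>j<N. lp_symbol \<eta> j k)" "(\<Sum>j<N. lp_symbol \<eta> j k) \<le> 1"
proof -
  have "0 \<le> (\<Sum>j<N. lp_symbol \<eta> j k) \<and> (\<Sum>j<N. lp_symbol \<eta> j k) \<le> 1"
  proof (cases N)
    case (Suc M)
    show ?thesis unfolding Suc sum_lp_symbol by (intro conjI eta_bounds)
  qed simp
  then show "0 \<le> (\<Sum>j<N. lp_symbol \<eta> j k)" "(\<Sum>j<N. lp_symbol \<eta> j k) \<le> 1" by blast+
qed

lemma sum_lp_symbol_tendsto: "(\<lambda>N. \<Sum>j<N. lp_symbol \<eta> j k) \<longlonglongrightarrow> 1"
proof -
  obtain M0 where M0: "norm (wavevec k) / (3/8) < 2 ^ M0" using real_arch_pow[of 2 "norm (wavevec k) / (3/8)"] by auto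
  have "\<forall>\<^sub>F N in sequentially. (\<Sum>j<N. lp_symbol \<eta> j k) = 1"
    using eventually_ge_at_top[of "Suc M0"]
  proof eventually_elim
    case (elim N)
    have "(2::real) ^ M0 \<le> 2 ^ N" using elim by (intro power_increasing) auto
    then have "norm (wavevec k) / (3/8) \<le> 2 ^ N" using M0 by linarith
    then show ?case using elim by (intro sum_lp_symbol_one) (auto simp: field_simps)
  qed
  then show ?thesis by (rule tendsto_eventually)
qed

text \<open>Convolution with the Jackson kernel acts on a low-pass filtered distribution as a finite
  convex combination of translations.\<close>

lemma jackson_translates:
  assumes f: "torus_distribution f" and n: "n \<ge> 1" and M: "M \<ge> 1" "4 * real n \<le> 3/8 * 2 ^ M"
    and \<kappa>: "\<forall>k. (\<forall>i. \<bar>k $ i\<bar> \<le> \<lceil>4/3 * 2 ^ M :: real\<rceil>) \<longrightarrow> (\<Sum>g\<in>I. of_real (\<kappa> g) * cis (wavevec k \<bullet> y g)) = of_real (jackson n k)"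
  shows "(\<Sum>g\<in>I. \<kappa> g * lp_partial M f (x + y g)) = fourier_multiplier (jackson n) f x"
    and "(\<Sum>g\<in>I. \<kappa> g * lp_partial M f (x - y g)) = fourier_multiplier (jackson n) f x"
proof -
  let ?R = "4/3 * 2 ^ M :: real"
  note supp = jackson_support and je = jackson_uminus
  have j0: "jackson n k = 0" if "k \<notin> freqs ?R" for k
    using supp[where n = n and k = k] that M(2) by (force simp: freqs_def)
  have comp: "\<bar>k $ i\<bar> \<le> \<lceil>?R\<rceil>" if "k \<in> freqs ?R" for k i
  proof -
    have "\<bar>real_of_int (k $ i)\<bar> \<le> ?R"
      using component_le_norm_cart[of "wavevec k" i] that by (simp add: freqs_def)
    then have "real_of_int \<bar>k $ i\<bar> \<le> real_of_int \<lceil>?R\<rceil>" by (metis of_int_abs le_of_int_ceiling order_trans)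
    then show ?thesis by (simp only: of_int_le_iff)
  qed
  have main: "complex_of_real (\<Sum>g\<in>I. \<kappa> g * lp_partial M f (x + s *\<^sub>R y g)) = complex_of_real (fourier_multiplier (jackson n) f x)"
    if s: "\<And>k. k \<in> freqs ?R \<Longrightarrow> (\<Sum>g\<in>I. of_real (\<kappa> g) * cism k (s *\<^sub>R y g)) = of_real (jackson n k)" for s
  proof -
    let ?\<sigma> = "\<lambda>k. complex_of_real (\<Sum>j<M. lp_symbol \<eta> j k)"
    have "complex_of_real (\<Sum>g\<in>I. \<kappa> g * lp_partial M f (x + s *\<^sub>R y g))
      = (\<Sum>g\<in>I. \<Sum>k\<in>freqs ?R. (?\<sigma> k * fourier_coeff f k * cism k x) * (of_real (\<kappa> g) * cism k (s *\<^sub>R y g)))"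
      unfolding of_real_sum of_real_mult lp_partial_complex[OF f, unfolded of_real_sum] inner_add_right cis_mult[symmetric] sum_distrib_left
      by (intro sum.cong refl) (simp only: mult_ac)
    also have "\<dots> = (\<Sum>k\<in>freqs ?R. (?\<sigma> k * fourier_coeff f k * cism k x) * (\<Sum>g\<in>I. of_real (\<kappa> g) * cism k (s *\<^sub>R y g)))"
      unfolding sum_distrib_left by (rule sum.swap)
    also have "\<dots> = (\<Sum>k\<in>freqs ?R. (of_real (jackson n k) * fourier_coeff f k) * cism k x)"
    proof (intro sum.cong refl)
      fix k assume k: "k \<in> freqs ?R"
      \<comment> \<open>The low-pass filter is 1 at every frequency that survives the kernel, so
        filtering before the convolution changes nothing.\<close>
      have "?\<sigma> k * of_real (jackson n k) = of_real (jackson n k)"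
      proof (cases "jackson n k = 0")
        case False
        then have "?\<sigma> k = 1" using supp[OF False] M by (subst sum_lp_symbol_one) auto
        then show ?thesis by simp
      qed simp
      then show "(?\<sigma> k * fourier_coeff f k * cism k x) * (\<Sum>g\<in>I. of_real (\<kappa> g) * cism k (s *\<^sub>R y g)) = (of_real (jackson n k) * fourier_coeff f k) * cism k x"
      proof -
        assume e: "?\<sigma> k * of_real (jackson n k) = of_real (jackson n k)"
        have "(?\<sigma> k * fourier_coeff f k * cism k x) * of_real (jackson n k) = (?\<sigma> k * of_real (jackson n k) * fourier_coeff f k) * cism k x"
          by (simp only: mult_ac)
        then show ?thesis unfolding s[OF k] e .
      qed
    qed
    also have "\<dots> = complex_of_real (fourier_multiplier (jackson n) f x)"
      by (rule fourier_multiplier_complex[where m = "jackson n", OF f je j0, symmetric])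
    finally show ?thesis .
  qed
  have k1: "(\<Sum>g\<in>I. of_real (\<kappa> g) * cism k (y g)) = of_real (jackson n k)" if "k \<in> freqs ?R" for k
    using \<kappa> comp[OF that] by blast
  \<comment> \<open>The kernel is even, so the same weights also serve the opposite
    translations.\<close>
  have k2: "(\<Sum>g\<in>I. of_real (\<kappa> g) * cism k (- y g)) = of_real (jackson n k)" if "k \<in> freqs ?R" for k
    using k1[of "- k"] that by (simp add: wavevec_minus je)
  show "(\<Sum>g\<in>I. \<kappa> g * lp_partial M f (x + y g)) = fourier_multiplier (jackson n) f x"
    using main[of 1] k1 unfolding of_real_eq_iff by simp
  show "(\<Sum>g\<in>I. \<kappa> g * lp_partial M f (x - y g)) = fourier_multiplier (jackson n) f x"
    using main[of "-1"] k2 unfolding of_real_eq_iff by simp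
qed

lemma besov_block_bound:
  assumes "f \<in> besov_space \<eta> s 3"
  shows "tint (\<lambda>x. \<bar>lp_block \<eta> j f x\<bar> ^ 3) \<le> (2 powr (- s * (real j - 1)) * besov_norm \<eta> s 3 f) ^ 3"
    and "0 \<le> besov_norm \<eta> s 3 f"
proof -
  let ?I = "tint (\<lambda>x. \<bar>lp_block \<eta> j f x\<bar> ^ 3)"
  have p: "a powr 3 = a ^ 3" if "0 \<le> a" for a :: real using that by (cases "a = 0") (auto simp: powr_numeral)
  have bdd: "bdd_above (range (\<lambda>j. 2 powr (s * (real j - 1)) * torus_Lp_norm 3 (lp_block \<eta> j f)))"
    using assms by (simp add: besov_space_def)
  have le: "2 powr (s * (real j - 1)) * torus_Lp_norm 3 (lp_block \<eta> j f) \<le> besov_norm \<eta> s 3 f" for j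
    unfolding besov_norm_def by (rule cSUP_upper[OF _ bdd]) auto
  have "0 \<le> 2 powr (s * (real 0 - 1)) * torus_Lp_norm 3 (lp_block \<eta> 0 f)" by (simp add: torus_Lp_norm_def)
  with le[of 0] show nn: "0 \<le> besov_norm \<eta> s 3 f" by linarith
  have "2 powr (- s * (real j - 1)) * (2 powr (s * (real j - 1)) * torus_Lp_norm 3 (lp_block \<eta> j f)) \<le> 2 powr (- s * (real j - 1)) * besov_norm \<eta> s 3 f"
    by (intro mult_left_mono le) auto
  moreover have "2 powr (- s * (real j - 1)) * (2 powr (s * (real j - 1)) * t) = t" for t :: real
  proof -
    have "2 powr (- X) * 2 powr X = (1::real)" for X by (simp add: powr_minus)
    then show ?thesis by (simp only: mult_minus_left mult.assoc[symmetric] mult_1_left)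
  qed
  ultimately have N: "torus_Lp_norm 3 (lp_block \<eta> j f) \<le> 2 powr (- s * (real j - 1)) * besov_norm \<eta> s 3 f" by (simp only:)
  have I: "0 \<le> ?I" unfolding set_lebesgue_integral_def by (intro integral_nonneg_AE) auto
  have "torus_Lp_norm 3 (lp_block \<eta> j f) = ?I powr (1/3)"
    unfolding torus_Lp_norm_def by (simp only: p[OF abs_ge_zero])
  moreover have "(?I powr (1/3)) ^ 3 = ?I" using I p[of "?I powr (1/3)"] by (simp add: powr_powr)
  ultimately have "?I = torus_Lp_norm 3 (lp_block \<eta> j f) ^ 3" by (simp only:)
  also have "\<dots> \<le> (2 powr (- s * (real j - 1)) * besov_norm \<eta> s 3 f) ^ 3"
    by (rule power_mono[OF N]) (simp add: torus_Lp_norm_def)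
  finally show "?I \<le> (2 powr (- s * (real j - 1)) * besov_norm \<eta> s 3 f) ^ 3" .
qed

end

section \<open>The Bony product\<close>

text \<open>With m = - k - l one has 1 + |l|^2 \<le> 2 (1 + |k|^2) (1 + |m|^2): for a fixed test
  frequency \<open>k\<close>, the negative weight of \<open>f\<close> is transferred to
  \<open>g\<close> at the price of a constant depending on \<open>k\<close>. The product is then
  split by \<open>x * y \<le> x\<^sup>2 / s + s * y\<^sup>2\<close>.\<close>

lemma sobolev_convolution:
  fixes f g :: dist and k :: "int^3"
  assumes f: "f \<in> sobolev_space (- a)" and g: "g \<in> sobolev_space b" and ab: "0 \<le> a" "a \<le> b"
  defines "c \<equiv> \<lambda>l. cmod (fourier_coeff f l) * cmod (fourier_coeff g (- k - l))"
  shows "c summable_on UNIV"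
    and "infsum c UNIV \<le> (sobolev_norm (- a) f)\<^sup>2 + (2 * (1 + (norm (wavevec k))\<^sup>2)) powr a * (sobolev_norm b g)\<^sup>2"
proof -
  let ?w = "\<lambda>l. 1 + (norm (wavevec l))\<^sup>2"
  let ?K = "(2 * ?w k) powr a"
  let ?f = "\<lambda>l. ?w l powr (- a) * (cmod (fourier_coeff f l))\<^sup>2"
  let ?g = "\<lambda>l. ?w l powr b * (cmod (fourier_coeff g l))\<^sup>2"
  have w1: "1 \<le> ?w l" for l by simp
  have sf: "?f summable_on UNIV" using f by (simp add: sobolev_space_def)
  have sg: "?g summable_on UNIV" using g by (simp add: sobolev_space_def)
  have bij: "bij_betw (\<lambda>l. - k - l) UNIV (UNIV :: (int^3) set)"
    by (rule bij_betwI[of _ _ _ "\<lambda>l. - k - l"]) auto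
  have sg': "(\<lambda>l. ?g (- k - l)) summable_on UNIV"
    using summable_on_reindex_bij_betw[OF bij, of ?g] sg by simp
  have ig': "infsum (\<lambda>l. ?g (- k - l)) UNIV = infsum ?g UNIV"
    by (rule infsum_reindex_bij_betw[OF bij])
  have Nf: "(sobolev_norm (- a) f)\<^sup>2 = infsum ?f UNIV"
    unfolding sobolev_norm_def by (intro real_sqrt_pow2 infsum_nonneg mult_nonneg_nonneg) auto
  have Ng: "(sobolev_norm b g)\<^sup>2 = infsum ?g UNIV"
    unfolding sobolev_norm_def by (intro real_sqrt_pow2 infsum_nonneg mult_nonneg_nonneg) auto
  have le: "c l \<le> ?f l + ?K * ?g (- k - l)" for l
  proof -
    let ?m = "- k - l"
    define s where "s = ?w l powr a"
    have s: "s > 0" using w1[of l] unfolding s_def powr_gt_zero by linarith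
    let ?x = "cmod (fourier_coeff f l)" and ?y = "cmod (fourier_coeff g ?m)"
    have "norm (wavevec l) \<le> norm (wavevec k) + norm (wavevec ?m)"
    proof -
      have "wavevec l = - (wavevec k + wavevec ?m)" by (simp add: wavevec_diff wavevec_minus)
      then show ?thesis using norm_triangle_ineq[of "wavevec k" "wavevec ?m"] by (metis norm_minus_cancel)
    qed
    then have "(norm (wavevec l))\<^sup>2 \<le> (norm (wavevec k) + norm (wavevec ?m))\<^sup>2" by (intro power_mono) auto
    also have "\<dots> \<le> 2 * (norm (wavevec k))\<^sup>2 + 2 * (norm (wavevec ?m))\<^sup>2"
      using zero_le_power2[of "norm (wavevec k) - norm (wavevec ?m)"] by (simp add: power2_eq_square algebra_simps)
    finally have "?w l \<le> 1 + 2 * (norm (wavevec k))\<^sup>2 + 2 * (norm (wavevec ?m))\<^sup>2" by simp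
    also have "\<dots> \<le> (2 * ?w k) * ?w ?m"
      by (simp add: algebra_simps)
    finally have "s \<le> ((2 * ?w k) * ?w ?m) powr a" unfolding s_def using ab by (intro powr_mono2) auto
    also have "\<dots> = ?K * ?w ?m powr a" by (rule powr_mult)
    also have "\<dots> \<le> ?K * ?w ?m powr b" using ab w1[of ?m] by (intro mult_left_mono powr_mono) auto
    finally have s2: "s \<le> ?K * ?w ?m powr b" .
    have "0 \<le> (?x - s * ?y)\<^sup>2 / s" using s by simp
    also have "\<dots> = ?x\<^sup>2 / s + s * ?y\<^sup>2 - 2 * (?x * ?y)" using s by (simp add: power2_eq_square field_simps)
    finally have "?x * ?y \<le> ?x\<^sup>2 / s + s * ?y\<^sup>2 - ?x * ?y" by simp
    also have "\<dots> \<le> ?x\<^sup>2 / s + s * ?y\<^sup>2" by simp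
    also have "?x\<^sup>2 / s = ?f l" by (simp add: s_def powr_minus divide_inverse mult.commute)
    also have "s * ?y\<^sup>2 \<le> (?K * ?w ?m powr b) * ?y\<^sup>2" by (rule mult_right_mono[OF s2]) simp
    finally show ?thesis unfolding c_def by (simp only: mult.assoc)
  qed
  have S: "(\<lambda>l. ?f l + ?K * ?g (- k - l)) summable_on UNIV"
    by (intro summable_on_add sf summable_on_cmult_right sg')
  show sc: "c summable_on UNIV"
    by (rule summable_on_comparison_test[OF S]) (use le in \<open>auto simp: c_def\<close>)
  have "infsum c UNIV \<le> infsum (\<lambda>l. ?f l + ?K * ?g (- k - l)) UNIV"
    by (rule infsum_mono[OF sc S le])
  also have "\<dots> = infsum ?f UNIV + ?K * infsum ?g UNIV"
    by (subst infsum_add[OF sf summable_on_cmult_right[OF sg']]) (simp only: infsum_cmult_right' ig')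
  finally show "infsum c UNIV \<le> (sobolev_norm (- a) f)\<^sup>2 + ?K * (sobolev_norm b g)\<^sup>2"
    unfolding Nf Ng .
qed

lemma norm_tint_trig_product:
  assumes "finite S1" "finite S2"
  shows "cmod (tint (\<lambda>x. (\<Sum>l\<in>S1. A l * cism l x) * (\<Sum>m\<in>S2. B m * cism m x) * cism k x))
    \<le> cellvol * (\<Sum>l\<in>S1. cmod (A l) * cmod (B (- k - l)))"
proof -
  have "tint (\<lambda>x. (\<Sum>l\<in>S1. A l * cism l x) * (\<Sum>m\<in>S2. B m * cism m x) * cism k x)
     = tint (\<lambda>x. (\<Sum>l\<in>S1. A l * cism l x) * (\<Sum>m\<in>S2. B m * cism m x) * (\<Sum>m\<in>{k}. 1 * cism m x))"
  proof -
    have "(\<Sum>m\<in>{k}. 1 * cism m x) = cism k x" for x by simp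
    then show ?thesis by (simp only:)
  qed
  also have "\<dots> = of_real cellvol * (\<Sum>(l, m, j)\<in>S1 \<times> S2 \<times> {k}. if l + m + j = 0 then A l * B m * 1 else 0)"
    by (rule tint_triple) (use assms in auto)
  also have "(\<Sum>(l, m, j)\<in>S1 \<times> S2 \<times> {k}. if l + m + j = 0 then A l * B m * 1 else 0)
     = (\<Sum>l\<in>S1. \<Sum>m\<in>S2. if m = - k - l then A l * B m else 0)"
  proof -
    have "l + m + k = 0 \<longleftrightarrow> m = - k - l" for l m :: "int^3"
      unfolding vec_eq_iff by (rule iff_allI) auto
    then have "(\<Sum>(l, m, j)\<in>S1 \<times> S2 \<times> {k}. if l + m + j = 0 then A l * B m * 1 else 0)
      = (\<Sum>l\<in>S1. \<Sum>m\<in>S2. \<Sum>j\<in>{k}. if m = - j - l then A l * B m else 0)"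
      unfolding sum.cartesian_product by (intro sum.cong refl) auto
    then show ?thesis by simp
  qed
  also have "\<dots> = (\<Sum>l\<in>S1. if - k - l \<in> S2 then A l * B (- k - l) else 0)"
    using assms(2) by (simp add: sum.delta)
  finally have "cmod (tint (\<lambda>x. (\<Sum>l\<in>S1. A l * cism l x) * (\<Sum>m\<in>S2. B m * cism m x) * cism k x))
    = cellvol * cmod (\<Sum>l\<in>S1. if - k - l \<in> S2 then A l * B (- k - l) else 0)"
    by (simp only: norm_mult norm_of_real) simp
  also have "\<dots> \<le> cellvol * (\<Sum>l\<in>S1. cmod (if - k - l \<in> S2 then A l * B (- k - l) else 0))"
    by (intro mult_left_mono norm_sum) simp
  also have "\<dots> \<le> cellvol * (\<Sum>l\<in>S1. cmod (A l) * cmod (B (- k - l)))"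
    by (intro mult_left_mono sum_mono) (auto simp: norm_mult)
  finally show ?thesis .
qed

text \<open>Against the mode \<open>k\<close>, the frequency \<open>l\<close> of one factor meets
  only \<open>- k - l\<close> of the other. The sum over blocks can therefore be taken inside, where
  the symbols add up to at most 4 for each pair of frequencies. Convergence comes from this counting
  and from the summability of \<open>c\<close>, not from decay in \<open>j\<close>.\<close>

lemma product_series_bound:
  fixes F G :: "nat \<Rightarrow> real^3 \<Rightarrow> real" and a b :: "nat \<Rightarrow> int^3 \<Rightarrow> real"
    and f g :: dist and k :: "int^3" and R :: "nat \<Rightarrow> real"
  defines "c \<equiv> \<lambda>l. cmod (fourier_coeff f l) * cmod (fourier_coeff g (- k - l))"
  assumes c: "c summable_on UNIV"
    and F: "\<And>j x. complex_of_real (F j x) = (\<Sum>l\<in>freqs (R j). (of_real (a j l) * fourier_coeff f l) * cism l x)"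
    and G: "\<And>j x. complex_of_real (G j x) = (\<Sum>l\<in>freqs (R j). (of_real (b j l) * fourier_coeff g l) * cism l x)"
    and bd: "\<And>J l m. finite J \<Longrightarrow> (\<Sum>j\<in>J. \<bar>a j l\<bar> * \<bar>b j m\<bar>) \<le> 4"
  defines "z \<equiv> \<lambda>j. tint (\<lambda>x. complex_of_real (F j x * G j x) * cism k x)"
  shows "summable (\<lambda>j. cmod (z j))" "(\<Sum>j. cmod (z j)) \<le> 4 * cellvol * infsum c UNIV"
proof -
  have c0: "0 \<le> c l" for l by (simp add: c_def)
  have part: "(\<Sum>j<N. cmod (z j)) \<le> 4 * cellvol * infsum c UNIV" for N
  proof -
    define T where "T = (\<Union>j<N. freqs (R j))"
    have T: "finite T" by (simp add: T_def)
    have "(\<Sum>j<N. cmod (z j)) \<le> (\<Sum>j<N. cellvol * (\<Sum>l\<in>T. (\<bar>a j l\<bar> * \<bar>b j (- k - l)\<bar>) * c l))"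
    proof (rule sum_mono)
      fix j assume j: "j \<in> {..<N}"
      have "cmod (z j) \<le> cellvol * (\<Sum>l\<in>freqs (R j). cmod (of_real (a j l) * fourier_coeff f l) * cmod (of_real (b j (- k - l)) * fourier_coeff g (- k - l)))"
        unfolding z_def of_real_mult F G by (rule norm_tint_trig_product) auto
      also have "\<dots> = cellvol * (\<Sum>l\<in>freqs (R j). (\<bar>a j l\<bar> * \<bar>b j (- k - l)\<bar>) * c l)"
        unfolding c_def norm_mult norm_of_real by (simp only: mult_ac)
      also have "\<dots> \<le> cellvol * (\<Sum>l\<in>T. (\<bar>a j l\<bar> * \<bar>b j (- k - l)\<bar>) * c l)"
        using j c0 by (intro mult_left_mono sum_mono2 T) (auto simp: T_def)
      finally show "cmod (z j) \<le> cellvol * (\<Sum>l\<in>T. (\<bar>a j l\<bar> * \<bar>b j (- k - l)\<bar>) * c l)" .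
    qed
    also have "\<dots> = cellvol * (\<Sum>l\<in>T. (\<Sum>j<N. \<bar>a j l\<bar> * \<bar>b j (- k - l)\<bar>) * c l)"
      unfolding sum_distrib_left[symmetric] sum_distrib_right by (subst sum.swap) (rule refl)
    also have "\<dots> \<le> cellvol * (\<Sum>l\<in>T. 4 * c l)"
      by (intro mult_left_mono sum_mono mult_right_mono bd c0) auto
    also have "\<dots> = 4 * cellvol * sum c T" by (simp add: sum_distrib_left[symmetric])
    also have "\<dots> \<le> 4 * cellvol * infsum c UNIV"
      by (intro mult_left_mono finite_sum_le_infsum c T) (use c0 in auto)
    finally show ?thesis .
  qed
  show s: "summable (\<lambda>j. cmod (z j))"
    by (rule summableI_nonneg_bounded[OF _ part]) simp
  show "(\<Sum>j. cmod (z j)) \<le> 4 * cellvol * infsum c UNIV"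
    by (rule suminf_le_const[OF s part])
qed

lemma tint_mult_cism:
  assumes "continuous_on UNIV h"
  shows "tint (\<lambda>x. complex_of_real (h x) * cism k x) = Complex (tint (\<lambda>x. h x * cosm k x)) (tint (\<lambda>x. h x * sinm k x))"
proof -
  have "tint (\<lambda>x. complex_of_real (h x) * cism k x) = tint (\<lambda>x. complex_of_real (h x * cosm k x) + \<i> * complex_of_real (h x * sinm k x))"
    by (intro arg_cong[where f = tint]) (auto simp: complex_eq_iff fun_eq_iff)
  also have "\<dots> = tint (\<lambda>x. complex_of_real (h x * cosm k x)) + tint (\<lambda>x. \<i> * complex_of_real (h x * sinm k x))"
    by (intro tint_add continuous_intros assms)
  also have "\<dots> = complex_of_real (tint (\<lambda>x. h x * cosm k x)) + \<i> * complex_of_real (tint (\<lambda>x. h x * sinm k x))"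
    by (simp only: set_integral_mult_right set_integral_complex_of_real)
  finally show ?thesis by (simp add: complex_eq_iff)
qed

lemma dist_of_trig:
  assumes "continuous_on UNIV h"
  shows "dist_of h (\<lambda>x. a * cosm k x + b * sinm k x)
    = a * Re (tint (\<lambda>x. complex_of_real (h x) * cism k x)) + b * Im (tint (\<lambda>x. complex_of_real (h x) * cism k x))"
proof -
  have "dist_of h (\<lambda>x. a * cosm k x + b * sinm k x) = tint (\<lambda>x. a * (h x * cosm k x) + b * (h x * sinm k x))"
    unfolding dist_of_def by (simp add: algebra_simps)
  also have "\<dots> = tint (\<lambda>x. a * (h x * cosm k x)) + tint (\<lambda>x. b * (h x * sinm k x))"
    by (intro tint_add continuous_intros assms)
  also have "\<dots> = a * tint (\<lambda>x. h x * cosm k x) + b * tint (\<lambda>x. h x * sinm k x)"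
    by (simp only: set_integral_mult_right)
  finally show ?thesis unfolding tint_mult_cism[OF assms] by simp
qed

text \<open>Up to index \<open>N\<close> the three Bony sums contain each pair of blocks with both
  indices at most \<open>N\<close> exactly once, and one further pair, because the resonant sum at
  \<open>j = N\<close> reaches one block ahead.\<close>

lemma bony_partial_sum:
  fixes A B :: "nat \<Rightarrow> real"
  shows "(\<Sum>j<Suc N. (\<Sum>i | i + 2 \<le> j. A i) * B j + (\<Sum>i | i + 2 \<le> j. B i) * A j + (\<Sum>i | i \<le> j + 1 \<and> j \<le> i + 1. A i) * B j)
    = (\<Sum>i<Suc N. A i) * (\<Sum>i<Suc N. B i) + A (Suc N) * B N"
proof (induction N)
  case 0
  have "{i. i \<le> Suc 0} = {0, 1}" by auto
  then show ?case by (simp add: algebra_simps)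
next
  case (Suc N)
  have s1: "{i. i + 2 \<le> Suc N} = {..<N}" by auto
  have s2: "{i. i \<le> Suc N + 1 \<and> Suc N \<le> i + 1} = {N, Suc N, Suc (Suc N)}" by auto
  have s3: "(\<Sum>i\<in>{N, Suc N, Suc (Suc N)}. A i) = A N + A (Suc N) + A (Suc (Suc N))" by simp
  show ?case
    unfolding sum.lessThan_Suc[where n = "Suc N"] Suc s1 s2 s3 by (simp add: algebra_simps)
qed

context
  fixes \<eta> :: "real \<Rightarrow> real"
  assumes eta: "lp_cutoff \<eta>"
begin

lemma lp_sum_complex:
  assumes "torus_distribution f" "\<And>i. i \<in> I \<Longrightarrow> i \<le> N"
  shows "complex_of_real (\<Sum>i\<in>I. lp_block \<eta> i f x) = (\<Sum>k\<in>freqs (4/3 * 2 ^ N). (of_real (\<Sum>i\<in>I. lp_symbol \<eta> i k) * fourier_coeff f k) * cism k x)"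
proof -
  have "complex_of_real (\<Sum>i\<in>I. lp_block \<eta> i f x) = (\<Sum>i\<in>I. \<Sum>k\<in>freqs (4/3 * 2 ^ N). (of_real (lp_symbol \<eta> i k) * fourier_coeff f k) * cism k x)"
    unfolding of_real_sum
    by (rule sum.cong[OF refl], rule lp_block_complex[OF eta assms(1)], rule lp_support_freqs[OF eta], rule assms(2))
  also have "\<dots> = (\<Sum>k\<in>freqs (4/3 * 2 ^ N). \<Sum>i\<in>I. (of_real (lp_symbol \<eta> i k) * fourier_coeff f k) * cism k x)"
    by (rule sum.swap)
  finally show ?thesis unfolding of_real_sum sum_distrib_right .
qed

lemma abs_sum_lp_symbol: "finite I \<Longrightarrow> \<bar>\<Sum>i\<in>I. lp_symbol \<eta> i k\<bar> \<le> 2"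
  using sum_abs[of "\<lambda>i. lp_symbol \<eta> i k" I] sum_abs_lp_symbol[OF eta, of I k] by linarith

lemma sum_symbol_product:
  assumes "finite J" "\<And>j. j \<in> J \<Longrightarrow> \<bar>a j\<bar> \<le> 2"
  shows "(\<Sum>j\<in>J. \<bar>a j\<bar> * \<bar>lp_symbol \<eta> j m\<bar>) \<le> 4"
proof -
  have "(\<Sum>j\<in>J. \<bar>a j\<bar> * \<bar>lp_symbol \<eta> j m\<bar>) \<le> (\<Sum>j\<in>J. 2 * \<bar>lp_symbol \<eta> j m\<bar>)"
    by (intro sum_mono mult_right_mono assms) auto
  also have "\<dots> \<le> 2 * 2"
    unfolding sum_distrib_left[symmetric] by (intro mult_left_mono sum_abs_lp_symbol[OF eta] assms(1)) auto
  finally show ?thesis by simp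
qed

lemma continuous_lp_block: "torus_distribution f \<Longrightarrow> continuous_on S (lp_block \<eta> j f)"
  by (rule trigpoly_continuous[OF trigpoly_lp_block[OF eta]])

lemma continuous_lp_partial: "torus_distribution f \<Longrightarrow> continuous_on S (lp_partial \<eta> j f)"
  by (rule trigpoly_continuous[OF trigpoly_lp_partial[OF eta]])

text \<open>Tested with a mode, the Bony product is the limit of products of low-pass filtered
  functions, so that the flux can be computed with trigonometric polynomials. The surplus pair of
  \<open>bony_partial_sum\<close> is the general term of a summable series and tends to 0. The
  second claim later gives boundedness in time.\<close>

lemma bony_product_limit:
  fixes f g :: dist and a b :: real and k :: "int^3"
  assumes f: "f \<in> sobolev_space (- s)" and g: "g \<in> sobolev_space r" and sr: "0 \<le> s" "s \<le> r"
  defines "\<phi> \<equiv> \<lambda>x. a * cosm k x + b * sinm k x"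
  shows "(\<lambda>N. tint (\<lambda>x. lp_partial \<eta> N f x * lp_partial \<eta> N g x * \<phi> x)) \<longlonglongrightarrow> bony_product \<eta> f g \<phi>"
    and "\<bar>bony_product \<eta> f g \<phi>\<bar> \<le> 12 * cellvol * (\<bar>a\<bar> + \<bar>b\<bar>) *
      ((sobolev_norm (- s) f)\<^sup>2 + (2 * (1 + (norm (wavevec k))\<^sup>2)) powr s * (sobolev_norm r g)\<^sup>2)"
proof -
  define c where "c = (\<lambda>l. cmod (fourier_coeff f l) * cmod (fourier_coeff g (- k - l)))"
  have c: "c summable_on UNIV" unfolding c_def by (rule sobolev_convolution[OF f g sr])
  have cb: "infsum c UNIV \<le> (sobolev_norm (- s) f)\<^sup>2 + (2 * (1 + (norm (wavevec k))\<^sup>2)) powr s * (sobolev_norm r g)\<^sup>2"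
    unfolding c_def by (rule sobolev_convolution[OF f g sr])
  have tf: "torus_distribution f" and tg: "torus_distribution g" using f g by (auto simp: sobolev_space_def)
  note cont = continuous_lp_block[OF tf] continuous_lp_block[OF tg]
  define L where "L = (\<lambda>z::complex. a * Re z + b * Im z)"
  define Z where "Z = (\<lambda>h. tint (\<lambda>x. complex_of_real (h x) * cism k x))"
  have dL: "dist_of h \<phi> = L (Z h)" if "continuous_on UNIV h" for h
    unfolding \<phi>_def L_def Z_def by (rule dist_of_trig[OF that])
  have Lb: "\<bar>L z\<bar> \<le> (\<bar>a\<bar> + \<bar>b\<bar>) * cmod z" for z
  proof -
    have "\<bar>L z\<bar> \<le> \<bar>a\<bar> * \<bar>Re z\<bar> + \<bar>b\<bar> * \<bar>Im z\<bar>" unfolding L_def by (metis abs_mult abs_triangle_ineq)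
    also have "\<dots> \<le> \<bar>a\<bar> * cmod z + \<bar>b\<bar> * cmod z"
      by (intro add_mono mult_left_mono abs_Re_le_cmod abs_Im_le_cmod) auto
    finally show ?thesis by (simp add: distrib_right)
  qed
  have ser: "summable (\<lambda>j. L (Z (h j))) \<and> \<bar>\<Sum>j. L (Z (h j))\<bar> \<le> (\<bar>a\<bar> + \<bar>b\<bar>) * (4 * cellvol * infsum c UNIV)"
    if s: "summable (\<lambda>j. cmod (Z (h j)))" "(\<Sum>j. cmod (Z (h j))) \<le> 4 * cellvol * infsum c UNIV" for h
  proof -
    have s2: "summable (\<lambda>j. (\<bar>a\<bar> + \<bar>b\<bar>) * cmod (Z (h j)))" by (rule summable_mult[OF s(1)])
    have s3: "summable (\<lambda>j. \<bar>L (Z (h j))\<bar>)"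
      by (rule summable_comparison_test[OF _ s2]) (use Lb in auto)
    have "\<bar>\<Sum>j. L (Z (h j))\<bar> \<le> (\<Sum>j. \<bar>L (Z (h j))\<bar>)" by (rule summable_rabs[OF s3])
    also have "\<dots> \<le> (\<Sum>j. (\<bar>a\<bar> + \<bar>b\<bar>) * cmod (Z (h j)))" by (rule suminf_le[OF Lb s3 s2])
    also have "\<dots> = (\<bar>a\<bar> + \<bar>b\<bar>) * (\<Sum>j. cmod (Z (h j)))" by (rule suminf_mult[OF s(1)])
    also have "\<dots> \<le> (\<bar>a\<bar> + \<bar>b\<bar>) * (4 * cellvol * infsum c UNIV)" by (rule mult_left_mono[OF s(2)]) simp
    finally show ?thesis using summable_rabs_cancel[OF s3] by blast
  qed
  define P1 where "P1 = (\<lambda>j x. (\<Sum>i | i + 2 \<le> j. lp_block \<eta> i f x) * lp_block \<eta> j g x)"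
  define P2 where "P2 = (\<lambda>j x. (\<Sum>i | i + 2 \<le> j. lp_block \<eta> i g x) * lp_block \<eta> j f x)"
  define P3 where "P3 = (\<lambda>j x. (\<Sum>i | i \<le> j + 1 \<and> j \<le> i + 1. lp_block \<eta> i f x) * lp_block \<eta> j g x)"
  define P4 where "P4 = (\<lambda>j x. lp_block \<eta> (Suc j) f x * lp_block \<eta> j g x)"
  have fin1: "finite {i. i + 2 \<le> j}" for j :: nat by (rule finite_subset[of _ "{..j}"]) auto
  have fin2: "finite {i. i \<le> j + 1 \<and> j \<le> i + 1}" for j :: nat by (rule finite_subset[of _ "{..j+1}"]) auto
  have blk: "complex_of_real (lp_block \<eta> j h x) = (\<Sum>l\<in>freqs (4/3 * 2 ^ Suc j). (of_real (lp_symbol \<eta> j l) * fourier_coeff h l) * cism l x)"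
    if "torus_distribution h" for j h x
    by (rule lp_block_complex[OF eta that lp_support_freqs[OF eta]]) simp
  have sm1: "complex_of_real (\<Sum>i | i + 2 \<le> j. lp_block \<eta> i h x) = (\<Sum>l\<in>freqs (4/3 * 2 ^ Suc j). (of_real (\<Sum>i | i + 2 \<le> j. lp_symbol \<eta> i l) * fourier_coeff h l) * cism l x)"
    if "torus_distribution h" for j h x
    by (rule lp_sum_complex[OF that]) auto
  have sm2: "complex_of_real (\<Sum>i | i \<le> j + 1 \<and> j \<le> i + 1. lp_block \<eta> i h x) = (\<Sum>l\<in>freqs (4/3 * 2 ^ Suc j). (of_real (\<Sum>i | i \<le> j + 1 \<and> j \<le> i + 1. lp_symbol \<eta> i l) * fourier_coeff h l) * cism l x)"
    if "torus_distribution h" for j h x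
    by (rule lp_sum_complex[OF that]) auto
  have 1: "summable (\<lambda>j. cmod (Z (P1 j)))" "(\<Sum>j. cmod (Z (P1 j))) \<le> 4 * cellvol * infsum c UNIV"
    unfolding Z_def P1_def c_def
    by (rule product_series_bound[OF c[unfolded c_def] sm1[OF tf] blk[OF tg]], rule sum_symbol_product, assumption, rule abs_sum_lp_symbol[OF fin1])+
  have 3: "summable (\<lambda>j. cmod (Z (P3 j)))" "(\<Sum>j. cmod (Z (P3 j))) \<le> 4 * cellvol * infsum c UNIV"
    unfolding Z_def P3_def c_def
    by (rule product_series_bound[OF c[unfolded c_def] sm2[OF tf] blk[OF tg]], rule sum_symbol_product, assumption, rule abs_sum_lp_symbol[OF fin2])+
  have "(\<Sum>j\<in>J. \<bar>lp_symbol \<eta> j l\<bar> * \<bar>\<Sum>i | i + 2 \<le> j. lp_symbol \<eta> i m\<bar>) \<le> 4" if "finite J" for J l m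
    using sum_symbol_product[OF that, of "\<lambda>j. \<Sum>i | i + 2 \<le> j. lp_symbol \<eta> i m" l, OF abs_sum_lp_symbol[OF fin1]] by (simp only: mult.commute)
  note sw = this
  have P2': "P2 = (\<lambda>j x. lp_block \<eta> j f x * (\<Sum>i | i + 2 \<le> j. lp_block \<eta> i g x))"
    unfolding P2_def by (simp only: mult.commute)
  have 2: "summable (\<lambda>j. cmod (Z (P2 j)))" "(\<Sum>j. cmod (Z (P2 j))) \<le> 4 * cellvol * infsum c UNIV"
    unfolding Z_def P2' c_def
    by (rule product_series_bound[OF c[unfolded c_def] blk[OF tf] sm1[OF tg] sw], assumption)+
  have blk4: "complex_of_real (lp_block \<eta> (Suc j) f x) = (\<Sum>l\<in>freqs (4/3 * 2 ^ Suc j). (of_real (lp_symbol \<eta> (Suc j) l) * fourier_coeff f l) * cism l x)" for j x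
    by (rule lp_block_complex[OF eta tf lp_support_freqs[OF eta]]) simp
  have ab4: "\<bar>lp_symbol \<eta> (Suc j) l\<bar> \<le> 2" for j l using abs_lp_symbol_le_1[OF eta, of "Suc j" l] by linarith
  have 4: "summable (\<lambda>j. cmod (Z (P4 j)))" "(\<Sum>j. cmod (Z (P4 j))) \<le> 4 * cellvol * infsum c UNIV"
    unfolding Z_def P4_def c_def
    by (rule product_series_bound[OF c[unfolded c_def] blk4 blk[OF tg]], rule sum_symbol_product, assumption, rule ab4)+
  have cP: "continuous_on UNIV (P1 j)" "continuous_on UNIV (P2 j)" "continuous_on UNIV (P3 j)" "continuous_on UNIV (P4 j)" for j
    unfolding P1_def P2_def P3_def P4_def by (intro continuous_intros cont)+
  have bony: "bony_product \<eta> f g \<phi> = (\<Sum>j. L (Z (P1 j))) + (\<Sum>j. L (Z (P2 j))) + (\<Sum>j. L (Z (P3 j)))"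
    unfolding bony_product_def paraproduct_def resonant_product_def dL[OF cP(1), symmetric] dL[OF cP(2), symmetric] dL[OF cP(3), symmetric]
    unfolding P1_def P2_def P3_def ..
  have "\<bar>bony_product \<eta> f g \<phi>\<bar> \<le> (\<bar>a\<bar> + \<bar>b\<bar>) * (4 * cellvol * infsum c UNIV) + (\<bar>a\<bar> + \<bar>b\<bar>) * (4 * cellvol * infsum c UNIV) + (\<bar>a\<bar> + \<bar>b\<bar>) * (4 * cellvol * infsum c UNIV)"
    unfolding bony using ser[OF 1] ser[OF 2] ser[OF 3] by linarith
  also have "\<dots> = 12 * cellvol * (\<bar>a\<bar> + \<bar>b\<bar>) * infsum c UNIV" by (simp only: mult_ac)
  also have "\<dots> \<le> 12 * cellvol * (\<bar>a\<bar> + \<bar>b\<bar>) * ((sobolev_norm (- s) f)\<^sup>2 + (2 * (1 + (norm (wavevec k))\<^sup>2)) powr s * (sobolev_norm r g)\<^sup>2)"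
    by (rule mult_left_mono[OF cb]) simp
  finally show "\<bar>bony_product \<eta> f g \<phi>\<bar> \<le> 12 * cellvol * (\<bar>a\<bar> + \<bar>b\<bar>) * ((sobolev_norm (- s) f)\<^sup>2 + (2 * (1 + (norm (wavevec k))\<^sup>2)) powr s * (sobolev_norm r g)\<^sup>2)" .
  have "(\<lambda>N. (\<Sum>j<N. L (Z (P1 j))) + (\<Sum>j<N. L (Z (P2 j))) + (\<Sum>j<N. L (Z (P3 j)))) \<longlonglongrightarrow> bony_product \<eta> f g \<phi>"
    unfolding bony using ser[OF 1] ser[OF 2] ser[OF 3] by (intro tendsto_add summable_LIMSEQ) auto
  then have l1: "(\<lambda>N. (\<Sum>j<Suc N. L (Z (P1 j))) + (\<Sum>j<Suc N. L (Z (P2 j))) + (\<Sum>j<Suc N. L (Z (P3 j)))) \<longlonglongrightarrow> bony_product \<eta> f g \<phi>"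
    by (rule LIMSEQ_Suc)
  have l2: "(\<lambda>N. L (Z (P4 N))) \<longlonglongrightarrow> 0"
    using ser[OF 4] by (intro summable_LIMSEQ_zero) auto
  have cphi: "continuous_on UNIV \<phi>" unfolding \<phi>_def by (intro continuous_intros)
  have id: "tint (\<lambda>x. lp_partial \<eta> (Suc N) f x * lp_partial \<eta> (Suc N) g x * \<phi> x)
     = (\<Sum>j<Suc N. L (Z (P1 j))) + (\<Sum>j<Suc N. L (Z (P2 j))) + (\<Sum>j<Suc N. L (Z (P3 j))) - L (Z (P4 N))" for N
  proof -
    have e: "lp_partial \<eta> (Suc N) f x * lp_partial \<eta> (Suc N) g x = (\<Sum>j<Suc N. P1 j x + P2 j x + P3 j x) - P4 N x" for x
      unfolding lp_partial_def[OF eta] P1_def P2_def P3_def P4_def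
      using bony_partial_sum[of "\<lambda>i. lp_block \<eta> i f x" "\<lambda>i. lp_block \<eta> i g x" N] by linarith
    have "tint (\<lambda>x. lp_partial \<eta> (Suc N) f x * lp_partial \<eta> (Suc N) g x * \<phi> x)
      = tint (\<lambda>x. (\<Sum>j<Suc N. P1 j x * \<phi> x + P2 j x * \<phi> x + P3 j x * \<phi> x) - P4 N x * \<phi> x)"
      unfolding e by (simp only: left_diff_distrib sum_distrib_right distrib_right)
    also have "\<dots> = (\<Sum>j<Suc N. tint (\<lambda>x. P1 j x * \<phi> x) + tint (\<lambda>x. P2 j x * \<phi> x) + tint (\<lambda>x. P3 j x * \<phi> x)) - tint (\<lambda>x. P4 N x * \<phi> x)"
      by (subst tint_diff, (intro continuous_intros cP cphi)+, subst tint_sum, (intro continuous_intros cP cphi)+)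
         (simp only: tint_add cP cphi continuous_on_mult continuous_on_add)
    also have "\<dots> = (\<Sum>j<Suc N. L (Z (P1 j))) + (\<Sum>j<Suc N. L (Z (P2 j))) + (\<Sum>j<Suc N. L (Z (P3 j))) - L (Z (P4 N))"
      unfolding dL[OF cP(1), symmetric] dL[OF cP(2), symmetric] dL[OF cP(3), symmetric] dL[OF cP(4), symmetric] dist_of_def
      by (simp only: sum.distrib)
    finally show ?thesis .
  qed
  have "(\<lambda>N. tint (\<lambda>x. lp_partial \<eta> (Suc N) f x * lp_partial \<eta> (Suc N) g x * \<phi> x)) \<longlonglongrightarrow> bony_product \<eta> f g \<phi> - 0"
    unfolding id by (intro tendsto_diff l1 l2)
  then show "(\<lambda>N. tint (\<lambda>x. lp_partial \<eta> N f x * lp_partial \<eta> N g x * \<phi> x)) \<longlonglongrightarrow> bony_product \<eta> f g \<phi>"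
    by (subst (asm) filterlim_sequentially_Suc) simp
qed

end

section \<open>The flux estimate\<close>

definition L3_le :: "(real^3 \<Rightarrow> real) \<Rightarrow> real \<Rightarrow> bool" where
  "L3_le f a \<longleftrightarrow> continuous_on UNIV f \<and> torus_periodic f \<and> 0 < a \<and> tint (\<lambda>x. \<bar>f x\<bar> ^ 3) \<le> a ^ 3"

lemma L3_le_cont: "L3_le f a \<Longrightarrow> continuous_on S f"
  by (auto simp: L3_le_def intro: continuous_on_subset)

lemma continuous_on_shift:
  fixes f :: "real^3 \<Rightarrow> 'b::topological_space"
  shows "continuous_on UNIV f \<Longrightarrow> continuous_on UNIV (\<lambda>x. f (x + z))"
  by (rule continuous_on_compose2[of UNIV f]) (auto intro!: continuous_intros)

lemma L3_le_shift:
  assumes "L3_le f a" shows "L3_le (\<lambda>x. f (x + z)) a"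
proof -
  have c: "continuous_on UNIV f" and p: "torus_periodic f" using assms by (auto simp: L3_le_def)
  have "torus_periodic (\<lambda>x. \<bar>f x\<bar> ^ 3)" using p by (simp add: torus_periodic_def)
  then have "tint (\<lambda>x. \<bar>f (x + z)\<bar> ^ 3) = tint (\<lambda>x. \<bar>f x\<bar> ^ 3)"
    by (intro tint_shift continuous_intros c)
  then show ?thesis using assms continuous_on_shift[OF c] torus_periodic_shift[OF p]
    by (simp add: L3_le_def)
qed

lemma L3_le_Holder:
  "L3_le f a \<Longrightarrow> L3_le g b \<Longrightarrow> L3_le h c \<Longrightarrow> \<bar>tint (\<lambda>x. f x * g x * h x)\<bar> \<le> a * b * c"
  by (rule Holder3_scalar) (auto simp: L3_le_def)

text \<open>Bernstein's inequality in L^3 by duality: the integral of a translate of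
  \<open>f\<close> against fixed \<open>g\<close> and \<open>h\<close> is a trigonometric polynomial
  in the translation parameter \<open>s\<close>, bounded uniformly in \<open>s\<close> by Hoelder's
  inequality. The scalar inequality for the sup norm is applied to this function of
  \<open>s\<close>.\<close>

lemma translate_difference_axis:
  assumes f: "L3_le f b" "trigpoly S f" and g: "L3_le g a" and h: "L3_le h c"
    and N: "N \<ge> 1" "\<And>k. k \<in> S \<Longrightarrow> \<bar>k $ i\<bar> \<le> int N"
  shows "\<bar>tint (\<lambda>x. g x * (f (x + w + axis i s) - f (x + w)) * h x)\<bar> \<le> 2 * real N * (a * b * c) * \<bar>s\<bar>"
proof -
  obtain e where "\<forall>x. complex_of_real (f x) = (\<Sum>k\<in>S. e k * cism k x)" by (rule trigpolyE[OF f(2)])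
  note e = this[rule_format]
  note cont = L3_le_cont[OF f(1)] L3_le_cont[OF g] L3_le_cont[OF h]
  define d where "d = (\<lambda>k. e k * cism k w * tint (\<lambda>x. complex_of_real (g x * h x) * cism k x))"
  define G where "G = (\<lambda>s. tint (\<lambda>x. g x * f (x + w + axis i s) * h x))"
  have G: "G s = Re (\<Sum>k\<in>S. d k * cis (s * of_int (k $ i)))" for s
  proof -
    have "complex_of_real (G s) = tint (\<lambda>x. complex_of_real (g x * f (x + w + axis i s) * h x))"
      unfolding G_def by (rule set_integral_complex_of_real[symmetric])
    also have "\<dots> = tint (\<lambda>x. \<Sum>k\<in>S. (e k * cism k w * cis (s * of_int (k $ i))) * (complex_of_real (g x * h x) * cism k x))"
    proof (rule arg_cong[where f = tint], rule ext)
      fix x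
      have "complex_of_real (g x * f (x + w + axis i s) * h x) = complex_of_real (g x * h x) * (\<Sum>k\<in>S. e k * cism k (x + w + axis i s))"
        unfolding e[symmetric] of_real_mult by (simp only: mult_ac)
      also have "\<dots> = (\<Sum>k\<in>S. (e k * cism k w * cis (s * of_int (k $ i))) * (complex_of_real (g x * h x) * cism k x))"
        unfolding inner_add_right wavevec_inner_axis cis_mult[symmetric] sum_distrib_left
        by (intro sum.cong refl) (simp only: mult_ac)
      finally show "complex_of_real (g x * f (x + w + axis i s) * h x) = (\<Sum>k\<in>S. (e k * cism k w * cis (s * of_int (k $ i))) * (complex_of_real (g x * h x) * cism k x))" .
    qed
    also have "\<dots> = (\<Sum>k\<in>S. tint (\<lambda>x. (e k * cism k w * cis (s * of_int (k $ i))) * (complex_of_real (g x * h x) * cism k x)))"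
      by (intro tint_sum continuous_intros cont)
    also have "\<dots> = (\<Sum>k\<in>S. d k * cis (s * of_int (k $ i)))"
      unfolding set_integral_mult_right d_def by (intro sum.cong refl) (simp only: mult_ac)
    finally have "Re (complex_of_real (G s)) = Re (\<Sum>k\<in>S. d k * cis (s * of_int (k $ i)))" by (simp only:)
    then show ?thesis by (simp only: Re_complex_of_real)
  qed
  have bd: "\<bar>G s\<bar> \<le> a * b * c" for s
    unfolding G_def add.assoc using L3_le_Holder[OF g L3_le_shift[OF f(1)] h] .
  have "\<bar>G s - G 0\<bar> \<le> 2 * real N * (a * b * c) * \<bar>s\<bar>"
    unfolding G by (rule bernstein_trig[OF N(1), of S "\<lambda>k. k $ i" d]) (use N(2) bd in \<open>simp_all only: G[symmetric]\<close>)
  also have "G s - G 0 = tint (\<lambda>x. g x * f (x + w + axis i s) * h x - g x * f (x + w + axis i 0) * h x)"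
    unfolding G_def add.assoc by (intro tint_diff[symmetric] continuous_intros cont continuous_on_shift)
  also have "axis i 0 = (0 :: real^3)" by (simp add: axis_eq_0_iff)
  finally show ?thesis by (simp only: add_0_right right_diff_distrib left_diff_distrib)
qed

lemma translate_difference:
  assumes f: "L3_le f b" "trigpoly S f" and g: "L3_le g a" and h: "L3_le h c"
    and N: "N \<ge> 1" "\<And>k i. k \<in> S \<Longrightarrow> \<bar>k $ i\<bar> \<le> int N"
  shows "\<bar>tint (\<lambda>x. g x * (f (x + y) - f x) * h x)\<bar> \<le> 2 * real N * (a * b * c) * (\<Sum>i\<in>UNIV. \<bar>y $ i\<bar>)"
proof -
  note cont = L3_le_cont[OF f(1)] L3_le_cont[OF g] L3_le_cont[OF h]
  let ?e = "\<lambda>i. axis i (y $ i)"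
  let ?w1 = "0 :: real^3" and ?w2 = "?e 1" and ?w3 = "?e 1 + ?e 2"
  have y: "y = ?e 1 + ?e 2 + ?e 3"
    by (simp add: vec_eq_iff forall_3 axis_def)
  let ?D = "\<lambda>w i x. g x * (f (x + w + ?e i) - f (x + w)) * h x"
  have c: "continuous_on UNIV (?D w i)" for w i
    unfolding add.assoc by (intro continuous_intros cont continuous_on_shift)
  have ax: "\<bar>tint (?D w i)\<bar> \<le> 2 * real N * (a * b * c) * \<bar>y $ i\<bar>" for w i
    by (rule translate_difference_axis[OF f g h N(1)]) (rule N(2))
  have "tint (\<lambda>x. g x * (f (x + y) - f x) * h x) = tint (\<lambda>x. ?D ?w1 1 x + ?D ?w2 2 x + ?D ?w3 3 x)"
    by (subst y) (rule arg_cong[where f = tint], simp add: algebra_simps fun_eq_iff)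
  also have "\<dots> = tint (?D ?w1 1) + tint (?D ?w2 2) + tint (?D ?w3 3)"
    by (simp only: tint_add c continuous_on_add)
  finally have "\<bar>tint (\<lambda>x. g x * (f (x + y) - f x) * h x)\<bar> \<le> \<bar>tint (?D ?w1 1)\<bar> + \<bar>tint (?D ?w2 2)\<bar> + \<bar>tint (?D ?w3 3)\<bar>"
    by linarith
  also have "\<dots> \<le> 2 * real N * (a * b * c) * \<bar>y $ 1\<bar> + 2 * real N * (a * b * c) * \<bar>y $ 2\<bar> + 2 * real N * (a * b * c) * \<bar>y $ 3\<bar>"
    by (intro add_mono ax)
  also have "\<dots> = 2 * real N * (a * b * c) * (\<Sum>i\<in>UNIV. \<bar>y $ i\<bar>)" by (simp add: sum_3 distrib_left)
  finally show ?thesis .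
qed

text \<open>The mixed product \<open>(p \<times> q) \<bullet> r\<close>. Its antisymmetry in
  \<open>p\<close> and \<open>r\<close> is the sign change on which the cancellation in the flux
  rests.\<close>

definition triple :: "(3 \<Rightarrow> real) \<Rightarrow> (3 \<Rightarrow> real) \<Rightarrow> (3 \<Rightarrow> real) \<Rightarrow> real" where
  "triple p q r = (\<Sum>i\<in>UNIV. (p (i + 1) * q (i + 2) - p (i + 2) * q (i + 1)) * r i)"

lemma ring_3: "(1::3) + 1 = 2" "(1::3) + 2 = 3" "(2::3) + 1 = 3" "(2::3) + 2 = 1" "(3::3) + 1 = 1" "(3::3) + 2 = 2"
  by simp_all

lemma triple_3: "triple p q r = (p 2 * q 3 - p 3 * q 2) * r 1 + (p 3 * q 1 - p 1 * q 3) * r 2 + (p 1 * q 2 - p 2 * q 1) * r 3"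
  unfolding triple_def sum_3 ring_3 ..

lemma triple_antisym: "triple p q r = - triple r q p"
  unfolding triple_3 by (simp add: algebra_simps)

lemma triple_diff2: "triple p (\<lambda>i. q i - q' i) r = triple p q r - triple p q' r"
  unfolding triple_3 by (simp add: algebra_simps)

lemma triple_sum3: "triple p q (\<lambda>i. \<Sum>g\<in>I. \<kappa> g * r g i) = (\<Sum>g\<in>I. \<kappa> g * triple p q (r g))"
  unfolding triple_3 distrib_left sum.distrib sum_distrib_left by (simp only: mult_ac)

lemma continuous_on_triple:
  assumes "\<And>i. continuous_on S (\<lambda>x. p x i)" "\<And>i. continuous_on S (\<lambda>x. q x i)" "\<And>i. continuous_on S (\<lambda>x. r x i)"
  shows "continuous_on S (\<lambda>x. triple (p x) (q x) (r x))"
  unfolding triple_3 by (intro continuous_intros assms)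

lemma tint_triple_expand:
  fixes p q r :: "3 \<Rightarrow> real^3 \<Rightarrow> real"
  assumes c: "\<And>i. continuous_on UNIV (p i)" "\<And>i. continuous_on UNIV (q i)" "\<And>i. continuous_on UNIV (r i)"
  defines "T \<equiv> \<lambda>i j k. tint (\<lambda>x. p i x * q j x * r k x)"
  shows "tint (\<lambda>x. triple (\<lambda>i. p i x) (\<lambda>i. q i x) (\<lambda>i. r i x)) = (T 2 3 1 - T 3 2 1) + (T 3 1 2 - T 1 3 2) + (T 1 2 3 - T 2 1 3)"
proof -
  let ?t = "\<lambda>i j k x. p i x * q j x * r k x"
  have cc: "continuous_on UNIV (?t i j k)" for i j k by (intro continuous_intros c)
  have "tint (\<lambda>x. triple (\<lambda>i. p i x) (\<lambda>i. q i x) (\<lambda>i. r i x)) = tint (\<lambda>x. (?t 2 3 1 x - ?t 3 2 1 x) + (?t 3 1 2 x - ?t 1 3 2 x) + (?t 1 2 3 x - ?t 2 1 3 x))"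
    unfolding triple_3 by (simp only: left_diff_distrib)
  also have "\<dots> = (T 2 3 1 - T 3 2 1) + (T 3 1 2 - T 1 3 2) + (T 1 2 3 - T 2 1 3)"
    unfolding T_def by (simp only: tint_add tint_diff cc continuous_on_add continuous_on_diff)
  finally show ?thesis .
qed

lemma tint_triple_bound:
  fixes p q r :: "real^3 \<Rightarrow> 3 \<Rightarrow> real"
  assumes c: "\<And>i. continuous_on UNIV (\<lambda>x. p x i)" "\<And>i. continuous_on UNIV (\<lambda>x. q x i)" "\<And>i. continuous_on UNIV (\<lambda>x. r x i)"
    and bd: "\<And>i j k. \<bar>tint (\<lambda>x. p x i * q x j * r x k)\<bar> \<le> C"
  shows "\<bar>tint (\<lambda>x. triple (p x) (q x) (r x))\<bar> \<le> 6 * C"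
  using tint_triple_expand[of "\<lambda>i x. p x i" "\<lambda>i x. q x i" "\<lambda>i x. r x i", OF c]
    bd[of 2 3 1] bd[of 3 2 1] bd[of 3 1 2] bd[of 1 3 2] bd[of 1 2 3] bd[of 2 1 3] by linarith

lemma geometric_sum_le:
  assumes "1 < (q::real)" shows "(\<Sum>i<M. q ^ i) \<le> q ^ M / (q - 1)"
  using assms geometric_sum[of q M] by (simp add: divide_right_mono)

lemma powr_mult_nat: "(2::real) powr (a * real j) = (2 powr a) ^ j"
  by (simp add: powr_powr[symmetric] powr_realpow)

section \<open>Flux estimates for fields with prescribed L^3 block bounds\<close>

context
  fixes \<eta> :: "real \<Rightarrow> real" and \<alpha> \<beta> X Y :: real and B u :: vdist
  assumes eta: "lp_cutoff \<eta>" and XY: "0 < X" "0 < Y"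
    and B: "\<And>i. torus_distribution (B $ i)" and u: "\<And>i. torus_distribution (u $ i)"
    and LB: "\<And>i j. tint (\<lambda>x. \<bar>lp_block \<eta> j (B $ i) x\<bar> ^ 3) \<le> ((2 powr \<alpha>) ^ j * X) ^ 3"
    and Lu: "\<And>i j. tint (\<lambda>x. \<bar>lp_block \<eta> j (u $ i) x\<bar> ^ 3) \<le> ((2 powr (- \<beta>)) ^ j * Y) ^ 3"
begin

abbreviation "blk \<equiv> lp_block \<eta>"
abbreviation "par \<equiv> lp_partial \<eta>"

lemma L3_B: "L3_le (blk j (B $ i)) ((2 powr \<alpha>) ^ j * X)"
  unfolding L3_le_def using trigpoly_continuous[OF trigpoly_lp_block[OF eta B]] trigpoly_periodic[OF trigpoly_lp_block[OF eta B]] LB XY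
  by (auto intro!: mult_pos_pos)

lemma L3_u: "L3_le (blk j (u $ i)) ((2 powr (- \<beta>)) ^ j * Y)"
  unfolding L3_le_def using trigpoly_continuous[OF trigpoly_lp_block[OF eta u]] trigpoly_periodic[OF trigpoly_lp_block[OF eta u]] Lu XY
  by (auto intro!: mult_pos_pos)

lemma cont_par: "continuous_on UNIV (par N (B $ i))" "continuous_on UNIV (par N (u $ i))"
  by (rule continuous_lp_partial[OF eta B], rule continuous_lp_partial[OF eta u])

lemma cont_blk: "continuous_on UNIV (blk j (B $ i))" "continuous_on UNIV (blk j (u $ i))"
  by (rule continuous_lp_block[OF eta B], rule continuous_lp_block[OF eta u])

lemma trigpoly_jackson: "trigpoly (freqs (4 * real n)) (fourier_multiplier (jackson n) (B $ i))"
proof (rule trigpoly_fourier_multiplier[where m = "jackson n", OF B jackson_uminus])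
  fix k assume "k \<notin> freqs (4 * real n)"
  then have "\<not> norm (wavevec k) \<le> 4 * real n" by (simp add: freqs_def)
  then show "jackson n k = 0" using jackson_support by blast
qed

lemma cont_jackson: "continuous_on UNIV (fourier_multiplier (jackson n) (B $ i))"
  by (rule trigpoly_continuous[OF trigpoly_jackson])

text \<open>Block \<open>j\<close> of \<open>u\<close> has frequencies up to
  \<open>4/3 * 2 ^ j\<close>, rounded up to \<open>2 * 2 ^ j\<close> as Bernstein factor. One
  derivative combined with the decay \<open>2 powr (- \<beta>)\<close> per block gives the growth
  \<open>2 powr (1 - \<beta>)\<close>.\<close>

lemma blk_difference:
  "\<bar>tint (\<lambda>x. blk i (B $ p) x * (blk j (u $ q) (x + y) - blk j (u $ q) x) * blk l (B $ r) (x + y))\<bar>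
    \<le> 4 * X\<^sup>2 * Y * (\<Sum>i\<in>UNIV. \<bar>y $ i\<bar>) * ((2 powr \<alpha>) ^ i * (2 powr (1 - \<beta>)) ^ j * (2 powr \<alpha>) ^ l)"
proof -
  have N: "\<bar>k $ i\<bar> \<le> int (2 * 2 ^ j)" if k: "k \<in> lp_support \<eta> j" for k i
  proof -
    have "\<bar>real_of_int (k $ i)\<bar> \<le> 4/3 * 2 ^ j"
      using component_le_norm_cart[of "wavevec k" i] lp_support_subset[OF eta, of j] k by (auto simp: freqs_def)
    also have "\<dots> \<le> 2 * 2 ^ j" by simp
    finally have "real_of_int \<bar>k $ i\<bar> \<le> real_of_int (int (2 * 2 ^ j))" by simp
    then show ?thesis by (simp only: of_int_le_iff)
  qed
  have "\<bar>tint (\<lambda>x. blk i (B $ p) x * (blk j (u $ q) (x + y) - blk j (u $ q) x) * blk l (B $ r) (x + y))\<bar>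
    \<le> 2 * real (2 * 2 ^ j) * (((2 powr \<alpha>) ^ i * X) * ((2 powr (- \<beta>)) ^ j * Y) * ((2 powr \<alpha>) ^ l * X)) * (\<Sum>i\<in>UNIV. \<bar>y $ i\<bar>)"
    by (rule translate_difference[OF L3_u trigpoly_lp_block[OF eta u] L3_B L3_le_shift[OF L3_B]]) (use N in \<open>simp_all only:, simp\<close>)
  also have "\<dots> = 4 * X\<^sup>2 * Y * (\<Sum>i\<in>UNIV. \<bar>y $ i\<bar>) * ((2 powr \<alpha>) ^ i * (2 ^ j * (2 powr (- \<beta>)) ^ j) * (2 powr \<alpha>) ^ l)"
    by (simp only: power2_eq_square of_nat_mult of_nat_power of_nat_numeral mult_ac)
  also have "(2::real) ^ j * (2 powr (- \<beta>)) ^ j = (2 powr (1 - \<beta>)) ^ j"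
  proof -
    have "2 * 2 powr (- \<beta>) = (2::real) powr (1 - \<beta>)" by (simp add: powr_diff powr_minus divide_inverse)
    then show ?thesis by (simp only: power_mult_distrib[symmetric])
  qed
  finally show ?thesis .
qed

text \<open>The product of \<open>b(x)\<close>, \<open>v(x)\<close> and \<open>b(x + y)\<close> is antisymmetric in the two values of \<open>b\<close>. Writing the kernel once as a mean
  of translations by \<open>y\<close> and once by \<open>- y\<close> and averaging therefore leaves only increments of \<open>v\<close>, which gain a factor \<open>1/n\<close>.\<close>

lemma low_frequency_flux:
  assumes \<alpha>: "0 < \<alpha>" and \<beta>: "\<beta> < 1" and n: "n \<ge> 1" and M: "M \<ge> 1" "4 * real n \<le> 3/8 * 2 ^ M"
  shows "\<bar>tint (\<lambda>x. triple (\<lambda>i. par M (B $ i) x) (\<lambda>i. par M (u $ i) x) (\<lambda>i. fourier_multiplier (jackson n) (B $ i) x))\<bar>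
     \<le> 684 * X\<^sup>2 * Y / ((2 powr \<alpha> - 1)\<^sup>2 * (2 powr (1 - \<beta>) - 1)) * (2 powr \<alpha>) ^ M * (2 powr \<alpha>) ^ M * (2 powr (1 - \<beta>)) ^ M / real n"
proof -
  obtain I \<kappa> and y :: "(3 \<Rightarrow> int) \<Rightarrow> real^3" where \<kappa>: "finite I" "\<forall>g. 0 \<le> \<kappa> g" "(\<Sum>g\<in>I. \<kappa> g) = 1"
    "\<forall>k. (\<forall>i. \<bar>k $ i\<bar> \<le> \<lceil>4/3 * 2 ^ M :: real\<rceil>) \<longrightarrow> (\<Sum>g\<in>I. of_real (\<kappa> g) * cis (wavevec k \<bullet> y g)) = of_real (jackson n k)"
    "(\<Sum>g\<in>I. \<kappa> g * (\<Sum>i\<in>UNIV. \<bar>y g $ i\<bar>)) \<le> 57 / real n"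
    by (rule jackson_mollifier[OF n])
  define b where "b = (\<lambda>x i. par M (B $ i) x)"
  define v where "v = (\<lambda>x i. par M (u $ i) x)"
  define R where "R = (\<lambda>x i. fourier_multiplier (jackson n) (B $ i) x)"
  have Rp: "R x = (\<lambda>i. \<Sum>g\<in>I. \<kappa> g * b (x + y g) i)" and Rm: "R x = (\<lambda>i. \<Sum>g\<in>I. \<kappa> g * b (x - y g) i)" for x
    unfolding R_def b_def using jackson_translates[OF eta B n M \<kappa>(4)] by auto
  have cb: "continuous_on UNIV (\<lambda>x. b x i)" and cv: "continuous_on UNIV (\<lambda>x. v x i)" for i
    unfolding b_def v_def using cont_par by auto
  have pb: "torus_periodic (\<lambda>x. b x i)" and pv: "torus_periodic (\<lambda>x. v x i)" for i
    unfolding b_def v_def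
    by (rule trigpoly_periodic[OF trigpoly_lp_partial[OF eta B]] trigpoly_periodic[OF trigpoly_lp_partial[OF eta u]])+
  note cs = cb cv continuous_on_shift[OF cb] continuous_on_shift[OF cv]
  let ?I = "tint (\<lambda>x. triple (b x) (v x) (R x))"
  let ?P = "\<lambda>g. tint (\<lambda>x. triple (b x) (v x) (b (x + y g)))"
  let ?Q = "\<lambda>g. tint (\<lambda>x. triple (b x) (v (x + y g)) (b (x + y g)))"
  let ?D = "\<lambda>g. tint (\<lambda>x. triple (b x) (\<lambda>i. v (x + y g) i - v x i) (b (x + y g)))"
  have c1: "continuous_on UNIV (\<lambda>x. \<kappa> g * triple (b x) (v x) (b (x + y g)))" for g
    by (intro continuous_on_mult continuous_on_const continuous_on_triple cs)
  have c2: "continuous_on UNIV (\<lambda>x. \<kappa> g * triple (b x) (v x) (b (x - y g)))" for g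
    using cs(3)[of "- y g"] by (intro continuous_on_mult continuous_on_const continuous_on_triple cs) simp
  have I1: "?I = (\<Sum>g\<in>I. \<kappa> g * ?P g)"
    unfolding Rp triple_sum3 by (subst tint_sum[OF c1]) (simp only: set_integral_mult_right)
  have "?I = (\<Sum>g\<in>I. \<kappa> g * tint (\<lambda>x. triple (b x) (v x) (b (x - y g))))"
    unfolding Rm triple_sum3 by (subst tint_sum[OF c2]) (simp only: set_integral_mult_right)
  \<comment> \<open>Shifting the variable by \<open>y g\<close> turns \<open>b (x - y g)\<close>
    into \<open>b x\<close>; exchanging the two values of \<open>b\<close> then costs a
    sign.\<close>
  also have "\<dots> = (\<Sum>g\<in>I. \<kappa> g * (- ?Q g))"
  proof (intro sum.cong refl arg_cong2[where f = "(*)"])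
    fix g
    have "tint (\<lambda>x. triple (b x) (v x) (b (x - y g))) = tint (\<lambda>x. triple (b (x + y g)) (v (x + y g)) (b (x + y g - y g)))"
    proof (rule tint_shift[symmetric, of "\<lambda>x. triple (b x) (v x) (b (x - y g))"])
      show "continuous_on UNIV (\<lambda>x. triple (b x) (v x) (b (x - y g)))"
        using cs(3)[of "- y g"] by (intro continuous_on_triple cs) simp
      have "b (x + axis i (2 * pi)) = b x" "v (x + axis i (2 * pi)) = v x" "b (x + axis i (2 * pi) - y g) = b (x - y g)" for x i
        using pb pv torus_periodic_shift[OF pb, of "- y g"] by (simp_all add: torus_periodic_def fun_eq_iff add.commute add_diff_eq diff_add_eq)
      then show "torus_periodic (\<lambda>x. triple (b x) (v x) (b (x - y g)))" unfolding torus_periodic_def by (simp only:) simp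
    qed
    also have "\<dots> = tint (\<lambda>x. - triple (b x) (v (x + y g)) (b (x + y g)))"
    proof -
      have "triple (b (x + y g)) (v (x + y g)) (b (x + y g - y g)) = - triple (b x) (v (x + y g)) (b (x + y g))" for x
        by (subst triple_antisym) simp
      then show ?thesis by (simp only:)
    qed
    also have "\<dots> = - ?Q g" unfolding set_lebesgue_integral_def by simp
    finally show "tint (\<lambda>x. triple (b x) (v x) (b (x - y g))) = - ?Q g" .
  qed
  finally have "2 * ?I = (\<Sum>g\<in>I. \<kappa> g * ?P g) + (\<Sum>g\<in>I. \<kappa> g * (- ?Q g))" using I1 by simp
  also have "\<dots> = - (\<Sum>g\<in>I. \<kappa> g * ?D g)"
  proof -
    have "?D g = ?Q g - ?P g" for g
      unfolding triple_diff2 by (intro tint_diff continuous_on_triple cs)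
    then show ?thesis by (simp add: sum_subtractf right_diff_distrib sum_negf)
  qed
  finally have "2 * \<bar>?I\<bar> = \<bar>\<Sum>g\<in>I. \<kappa> g * ?D g\<bar>" by linarith
  also have "\<dots> \<le> (\<Sum>g\<in>I. \<kappa> g * \<bar>?D g\<bar>)"
    using sum_abs[of "\<lambda>g. \<kappa> g * ?D g" I] \<kappa>(2) by (simp add: abs_mult)
  also have "\<dots> \<le> (\<Sum>g\<in>I. \<kappa> g * (6 * (4 * X\<^sup>2 * Y * (\<Sum>i\<in>UNIV. \<bar>y g $ i\<bar>) * ((\<Sum>i<M. (2 powr \<alpha>) ^ i) * (\<Sum>j<M. (2 powr (1 - \<beta>)) ^ j) * (\<Sum>l<M. (2 powr \<alpha>) ^ l)))))"
  proof (rule sum_mono, rule mult_left_mono, rule tint_triple_bound)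
    fix g p q r
    let ?s = "\<Sum>i\<in>UNIV. \<bar>y g $ i\<bar>"
    let ?t = "\<lambda>i j l x. blk i (B $ p) x * (blk j (u $ q) (x + y g) - blk j (u $ q) x) * blk l (B $ r) (x + y g)"
    have ct: "continuous_on UNIV (?t i j l)" for i j l
      by (intro continuous_intros cont_blk continuous_on_shift)
    have "tint (\<lambda>x. b x p * (v (x + y g) q - v x q) * b (x + y g) r) = tint (\<lambda>x. \<Sum>i<M. \<Sum>j<M. \<Sum>l<M. ?t i j l x)"
    proof (rule arg_cong[where f = tint], rule ext)
      fix x
      have "b x p * (v (x + y g) q - v x q) * b (x + y g) r
        = (\<Sum>i<M. blk i (B $ p) x) * (\<Sum>j<M. blk j (u $ q) (x + y g) - blk j (u $ q) x) * (\<Sum>l<M. blk l (B $ r) (x + y g))"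
        unfolding b_def v_def lp_partial_def[OF eta] by (simp only: sum_subtractf)
      then show "b x p * (v (x + y g) q - v x q) * b (x + y g) r = (\<Sum>i<M. \<Sum>j<M. \<Sum>l<M. ?t i j l x)"
        by (simp only: sum_distrib_left[symmetric] sum_distrib_right[symmetric])
    qed
    also have "\<dots> = (\<Sum>i<M. \<Sum>j<M. \<Sum>l<M. tint (?t i j l))"
      by (subst tint_sum, (intro continuous_on_sum ct), subst tint_sum, (intro continuous_on_sum ct), subst tint_sum[OF ct], rule refl)
    finally have "\<bar>tint (\<lambda>x. b x p * (v (x + y g) q - v x q) * b (x + y g) r)\<bar> \<le> (\<Sum>i<M. \<Sum>j<M. \<Sum>l<M. \<bar>tint (?t i j l)\<bar>)"
      by (simp only:) (intro order_trans[OF sum_abs] sum_mono order_refl)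
    also have "\<dots> \<le> (\<Sum>i<M. \<Sum>j<M. \<Sum>l<M. 4 * X\<^sup>2 * Y * ?s * ((2 powr \<alpha>) ^ i * (2 powr (1 - \<beta>)) ^ j * (2 powr \<alpha>) ^ l))"
      by (intro sum_mono blk_difference)
    also have "\<dots> = 4 * X\<^sup>2 * Y * ?s * ((\<Sum>i<M. (2 powr \<alpha>) ^ i) * (\<Sum>j<M. (2 powr (1 - \<beta>)) ^ j) * (\<Sum>l<M. (2 powr \<alpha>) ^ l))"
      by (simp only: sum_distrib_left[symmetric] sum_distrib_right[symmetric])
    finally show "\<bar>tint (\<lambda>x. b x p * (v (x + y g) q - v x q) * b (x + y g) r)\<bar> \<le> 4 * X\<^sup>2 * Y * ?s * ((\<Sum>i<M. (2 powr \<alpha>) ^ i) * (\<Sum>j<M. (2 powr (1 - \<beta>)) ^ j) * (\<Sum>l<M. (2 powr \<alpha>) ^ l))" .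
  qed (use \<kappa>(2) in \<open>auto intro!: continuous_intros cs\<close>)
  also have "\<dots> = 24 * X\<^sup>2 * Y * ((\<Sum>i<M. (2 powr \<alpha>) ^ i) * (\<Sum>j<M. (2 powr (1 - \<beta>)) ^ j) * (\<Sum>l<M. (2 powr \<alpha>) ^ l)) * (\<Sum>g\<in>I. \<kappa> g * (\<Sum>i\<in>UNIV. \<bar>y g $ i\<bar>))"
    unfolding sum_distrib_left[of _ _ I] by (intro sum.cong refl) (simp only: mult_ac)
  \<comment> \<open>Both \<open>\<alpha>\<close> and \<open>1 - \<beta>\<close> are positive, so
    each of the three geometric sums is governed by its top frequency.\<close>
  also have "\<dots> \<le> 24 * X\<^sup>2 * Y * (((2 powr \<alpha>) ^ M / (2 powr \<alpha> - 1)) * ((2 powr (1 - \<beta>)) ^ M / (2 powr (1 - \<beta>) - 1)) * ((2 powr \<alpha>) ^ M / (2 powr \<alpha> - 1))) * (57 / real n)"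
    using XY \<alpha> \<beta> \<kappa>(2)
    by (intro mult_mono \<kappa>(5) mult_left_mono geometric_sum_le) (auto intro!: sum_nonneg mult_nonneg_nonneg divide_nonneg_nonneg simp: ge_one_powr_ge_zero)
  \<comment> \<open>The product 24 * 57 is written as 2 * 684 because twice the integral is being
    estimated.\<close>
  also have "\<dots> = 2 * (684 * X\<^sup>2 * Y / ((2 powr \<alpha> - 1)\<^sup>2 * (2 powr (1 - \<beta>) - 1)) * (2 powr \<alpha>) ^ M * (2 powr \<alpha>) ^ M * (2 powr (1 - \<beta>)) ^ M / real n)"
    by (simp add: power2_eq_square mult_ac)
  finally show ?thesis unfolding b_def v_def R_def by linarith
qed

text \<open>The kernel acts on the blocks of \<open>B\<close> below \<open>M\<close> as a mean of
  translations, which preserves L^3 bounds, while \<open>f\<close> and \<open>g\<close> may have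
  arbitrarily high frequencies.\<close>

lemma jackson_product_bound:
  assumes f: "L3_le f a" and g: "L3_le g b" and n: "n \<ge> 1" and M: "M \<ge> 1" "4 * real n \<le> 3/8 * 2 ^ M"
  shows "\<bar>tint (\<lambda>x. f x * g x * fourier_multiplier (jackson n) (B $ r) x)\<bar> \<le> a * b * (X * (\<Sum>l<M. (2 powr \<alpha>) ^ l))"
proof -
  obtain I \<kappa> and y :: "(3 \<Rightarrow> int) \<Rightarrow> real^3" where \<kappa>: "finite I" "\<forall>g. 0 \<le> \<kappa> g" "(\<Sum>g\<in>I. \<kappa> g) = 1"
    "\<forall>k. (\<forall>i. \<bar>k $ i\<bar> \<le> \<lceil>4/3 * 2 ^ M :: real\<rceil>) \<longrightarrow> (\<Sum>g\<in>I. of_real (\<kappa> g) * cis (wavevec k \<bullet> y g)) = of_real (jackson n k)"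
    "(\<Sum>g\<in>I. \<kappa> g * (\<Sum>i\<in>UNIV. \<bar>y g $ i\<bar>)) \<le> 57 / real n"
    by (rule jackson_mollifier[OF n])
  note cont = L3_le_cont[OF f] L3_le_cont[OF g]
  let ?t = "\<lambda>h l x. f x * g x * blk l (B $ r) (x + y h)"
  have ct: "continuous_on UNIV (?t h l)" for h l
    by (intro continuous_intros cont cont_blk continuous_on_shift)
  have "tint (\<lambda>x. f x * g x * fourier_multiplier (jackson n) (B $ r) x) = tint (\<lambda>x. \<Sum>h\<in>I. \<Sum>l<M. \<kappa> h * ?t h l x)"
  proof (rule arg_cong[where f = tint], rule ext)
    fix x
    have "fourier_multiplier (jackson n) (B $ r) x = (\<Sum>h\<in>I. \<kappa> h * (\<Sum>l<M. blk l (B $ r) (x + y h)))"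
      using jackson_translates(1)[OF eta B n M \<kappa>(4), of r x] unfolding lp_partial_def[OF eta] by (simp only:)
    then show "f x * g x * fourier_multiplier (jackson n) (B $ r) x = (\<Sum>h\<in>I. \<Sum>l<M. \<kappa> h * ?t h l x)"
      by (simp only: sum_distrib_left mult_ac)
  qed
  also have "\<dots> = (\<Sum>h\<in>I. \<Sum>l<M. \<kappa> h * tint (?t h l))"
    by (subst tint_sum, (intro continuous_on_sum continuous_on_mult continuous_on_const ct),
        subst tint_sum, (intro continuous_on_mult continuous_on_const ct), simp only: set_integral_mult_right)
  finally have "\<bar>tint (\<lambda>x. f x * g x * fourier_multiplier (jackson n) (B $ r) x)\<bar> \<le> (\<Sum>h\<in>I. \<Sum>l<M. \<bar>\<kappa> h * tint (?t h l)\<bar>)"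
    by (simp only:) (intro order_trans[OF sum_abs] sum_mono order_refl)
  also have "\<dots> \<le> (\<Sum>h\<in>I. \<Sum>l<M. \<kappa> h * (a * b * ((2 powr \<alpha>) ^ l * X)))"
  proof (intro sum_mono)
    fix h l
    show "\<bar>\<kappa> h * tint (?t h l)\<bar> \<le> \<kappa> h * (a * b * ((2 powr \<alpha>) ^ l * X))"
      unfolding abs_mult abs_of_nonneg[OF \<kappa>(2)[rule_format]]
      by (intro mult_left_mono L3_le_Holder f g L3_le_shift[OF L3_B]) (use \<kappa>(2) in auto)
  qed
  also have "\<dots> = (\<Sum>h\<in>I. \<kappa> h * (a * b * (X * (\<Sum>l<M. (2 powr \<alpha>) ^ l))))"
    by (simp only: sum_distrib_left mult_ac)
  also have "\<dots> = (\<Sum>h\<in>I. \<kappa> h) * (a * b * (X * (\<Sum>l<M. (2 powr \<alpha>) ^ l)))"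
    by (rule sum_distrib_right[symmetric])
  finally show ?thesis using \<kappa>(3) by (simp only: mult_1_left)
qed

text \<open>The mollified field has frequencies at most \<open>4 n\<close>, so among the high blocks only neighbouring ones can interact with it.\<close>

lemma nonresonant_zero:
  assumes f: "torus_distribution f" and g: "torus_distribution g"
    and ij: "i + 2 \<le> j \<or> j + 2 \<le> i" "M \<le> i \<or> M \<le> j" and n: "96 * real n < 2 ^ M"
  shows "tint (\<lambda>x. blk i f x * blk j g x * fourier_multiplier (jackson n) (B $ r) x) = 0"
proof (rule trigpoly_triple_zero)
  show "trigpoly (lp_support \<eta> i) (blk i f)" "trigpoly (lp_support \<eta> j) (blk j g)"
    by (rule trigpoly_lp_block[OF eta f] trigpoly_lp_block[OF eta g])+
  show "trigpoly (freqs (4 * real n)) (fourier_multiplier (jackson n) (B $ r))"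
    by (rule trigpoly_jackson)
  have main: "k + l + m \<noteq> 0" if "a + 2 \<le> b" "M \<le> b" "k \<in> lp_support \<eta> a" "l \<in> lp_support \<eta> b" "m \<in> freqs (4 * real n)" for a b k l m
  proof
    assume "k + l + m = 0"
    then have "wavevec k + wavevec l + wavevec m = 0" by (simp flip: wavevec_add)
    moreover have "wavevec l = (wavevec k + wavevec l + wavevec m) - (wavevec k + wavevec m)" by simp
    ultimately have "wavevec l = - (wavevec k + wavevec m)" by simp
    then have "norm (wavevec l) \<le> norm (wavevec k) + norm (wavevec m)"
      using norm_triangle_ineq[of "wavevec k" "wavevec m"] by (simp only: norm_minus_cancel)
    moreover have "3/8 * 2 ^ b < norm (wavevec l)" using that lp_symbol_lower[OF eta, of b l] by (auto simp: lp_support_def[OF eta])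
    moreover have "norm (wavevec k) < 4/3 * 2 ^ a" using that lp_symbol_upper[OF eta, of a k] by (auto simp: lp_support_def[OF eta])
    moreover have "norm (wavevec m) \<le> 4 * real n" using that by (simp add: freqs_def)
    moreover have "4 * 2 ^ a \<le> (2::real) ^ b"
      using power_increasing[of "a + 2" b "2::real"] that by (simp add: power_add)
    moreover have "(2::real) ^ M \<le> 2 ^ b" using that by (intro power_increasing) auto
    \<comment> \<open>After subtraction of \<open>k\<close>, the shell of \<open>l\<close> leaves at
      least \<open>3/8 - 1/3 = 1/24\<close> of \<open>2 ^ b\<close>, and the hypothesis with the
      constant 96 says that \<open>4 * n\<close> is smaller than this.\<close>
    ultimately show False using n by linarith
  qed
  fix k l m assume k: "k \<in> lp_support \<eta> i" "l \<in> lp_support \<eta> j" "m \<in> freqs (4 * real n)"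
  show "k + l + m \<noteq> 0"
  proof (cases "i + 2 \<le> j")
    case True
    then have "M \<le> j" using ij(2) by linarith
    then show ?thesis by (rule main[OF True _ k])
  next
    case False
    then have "j + 2 \<le> i" "M \<le> i" using ij by auto
    then show ?thesis using main[OF _ _ k(2,1,3)] by (simp only: add.commute add.left_commute not_False_eq_True)
  qed
qed

text \<open>Raising the filter by one block adds the products in which at least one factor is block
  \<open>J\<close>. By \<open>nonresonant_zero\<close> its only possible partners are
  \<open>J\<close> and \<open>J - 1\<close>, so three integrals remain; the third factor enters
  through its low-frequency bound.\<close>

lemma scalar_increment:
  fixes r :: 3
  assumes \<alpha>: "0 < \<alpha>" and \<beta>: "\<beta> < 1" and n: "n \<ge> 1" "96 * real n < 2 ^ M" and J: "M \<le> J" "1 \<le> M"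
  defines "R \<equiv> fourier_multiplier (jackson n) (B $ r)"
  shows "\<bar>tint (\<lambda>x. par (Suc J) (B $ p) x * par (Suc J) (u $ q) x * R x) - tint (\<lambda>x. par J (B $ p) x * par J (u $ q) x * R x)\<bar>
    \<le> 4 * X\<^sup>2 * Y * (\<Sum>l<M. (2 powr \<alpha>) ^ l) * (2 powr (\<alpha> - \<beta>)) ^ J"
proof -
  define S where "S = X * (\<Sum>l<M. (2 powr \<alpha>) ^ l)"
  define a where "a = 2 powr \<alpha>"
  define d where "d = 2 powr (- \<beta>)"
  have S: "0 \<le> S" unfolding S_def using XY by (intro mult_nonneg_nonneg sum_nonneg) auto
  have a: "1 \<le> a" unfolding a_def using \<alpha> by (simp add: ge_one_powr_ge_zero)
  have d: "1/2 \<le> d" using powr_mono[of "-1" "- \<beta>" 2] \<beta> by (simp add: d_def powr_minus)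
  have M: "4 * real n \<le> 3/8 * 2 ^ M" using n by simp
  have cR: "continuous_on UNIV R" unfolding R_def by (rule cont_jackson)
  let ?t = "\<lambda>i j. tint (\<lambda>x. blk i (B $ p) x * blk j (u $ q) x * R x)"
  have ct: "continuous_on UNIV (\<lambda>x. blk i (B $ p) x * blk j (u $ q) x * R x)" for i j
    by (intro continuous_intros cont_blk cR)
  have b: "\<bar>?t i j\<bar> \<le> (a ^ i * X) * (d ^ j * Y) * S" for i j
    unfolding R_def S_def a_def d_def by (rule jackson_product_bound[OF L3_B L3_u n(1) J(2) M])
  have z: "?t i j = 0" if "i + 2 \<le> j \<or> j + 2 \<le> i" "J \<le> i \<or> J \<le> j" for i j
    unfolding R_def by (rule nonresonant_zero[OF B u that(1) _ n(2)]) (use that(2) J in auto)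
  obtain J' where J': "J = Suc J'" using J by (cases J) auto
  have "tint (\<lambda>x. par (Suc J) (B $ p) x * par (Suc J) (u $ q) x * R x) - tint (\<lambda>x. par J (B $ p) x * par J (u $ q) x * R x)
    = tint (\<lambda>x. par (Suc J) (B $ p) x * par (Suc J) (u $ q) x * R x - par J (B $ p) x * par J (u $ q) x * R x)"
    by (intro tint_diff[symmetric] continuous_intros cont_par cR)
  also have "\<dots> = tint (\<lambda>x. (\<Sum>j<Suc J. blk J (B $ p) x * blk j (u $ q) x * R x) + (\<Sum>i<J. blk i (B $ p) x * blk J (u $ q) x * R x))"
    unfolding lp_partial_def[OF eta] sum_distrib_left[symmetric] sum_distrib_right[symmetric]
    by (simp add: algebra_simps)
  also have "\<dots> = (\<Sum>j<Suc J. ?t J j) + (\<Sum>i<J. ?t i J)"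
    by (subst tint_add, (intro continuous_on_sum ct)+, subst tint_sum[OF ct], subst tint_sum[OF ct], rule refl)
  also have "(\<Sum>j<Suc J. ?t J j) = ?t J J' + ?t J J"
  proof -
    have "(\<Sum>j<Suc J. ?t J j) = (\<Sum>j\<in>{J', J}. ?t J j)"
      by (rule sum.mono_neutral_right) (auto simp: J' intro!: z)
    then show ?thesis using J' by simp
  qed
  also have "(\<Sum>i<J. ?t i J) = ?t J' J"
  proof -
    have "(\<Sum>i<J. ?t i J) = (\<Sum>i\<in>{J'}. ?t i J)"
      by (rule sum.mono_neutral_right) (auto simp: J' intro!: z)
    then show ?thesis by simp
  qed
  finally have "\<bar>tint (\<lambda>x. par (Suc J) (B $ p) x * par (Suc J) (u $ q) x * R x) - tint (\<lambda>x. par J (B $ p) x * par J (u $ q) x * R x)\<bar>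
    \<le> (a ^ J * X) * (d ^ J' * Y) * S + (a ^ J * X) * (d ^ J * Y) * S + (a ^ J' * X) * (d ^ J * Y) * S"
    using b[of J J'] b[of J J] b[of J' J] by linarith
  \<comment> \<open>Passing from \<open>J - 1\<close> to \<open>J\<close> costs nothing for the
    growing factor \<open>a\<close>, and a factor 2 for \<open>d\<close>, since
    \<open>d \<ge> 1/2\<close>. The total is 2 + 1 + 1 = 4.\<close>
  also have "\<dots> \<le> (a ^ J * X) * ((2 * d ^ J) * Y) * S + (a ^ J * X) * (d ^ J * Y) * S + (a ^ J * X) * (d ^ J * Y) * S"
  proof -
    have "d ^ J' \<le> 2 * d ^ J" using d mult_right_mono[of "1/2" d "d ^ J'"] by (simp add: J')
    moreover have "a ^ J' \<le> a ^ J" using a by (intro power_increasing) (auto simp: J')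
    ultimately show ?thesis using XY S a d by (intro add_mono mult_right_mono mult_left_mono order_refl mult_nonneg_nonneg zero_le_power) auto
  qed
  also have "\<dots> = 4 * X * Y * S * (a * d) ^ J" by (simp add: power_mult_distrib algebra_simps)
  also have "a * d = 2 powr (\<alpha> - \<beta>)" unfolding a_def d_def by (simp flip: powr_add)
  finally show ?thesis unfolding S_def by (simp add: power2_eq_square mult_ac)
qed

text \<open>The bound does not depend on \<open>J\<close>, as the passage to the Bony product
  requires. Up to the filter \<open>M\<close> the low-frequency estimate applies; beyond it the
  increments are dominated by a geometric series of ratio
  \<open>2 powr (\<alpha> - \<beta>) < 1\<close>, so that its first term, again at scale
  \<open>M\<close>, decides.\<close>

lemma flux_estimate:
  assumes \<alpha>: "0 < \<alpha>" "\<alpha> < \<beta>" and \<beta>: "\<beta> < 1" and J: "N + 7 \<le> J"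
  defines "r \<equiv> 2 powr (2 * \<alpha> - \<beta>)"
  shows "\<bar>tint (\<lambda>x. triple (\<lambda>i. par J (B $ i) x) (\<lambda>i. par J (u $ i) x) (\<lambda>i. fourier_multiplier (jackson (2 ^ N)) (B $ i) x))\<bar>
    \<le> (684 * 2 ^ 7 / ((2 powr \<alpha> - 1)\<^sup>2 * (2 powr (1 - \<beta>) - 1)) + 24 / ((2 powr \<alpha> - 1) * (1 - 2 powr (\<alpha> - \<beta>)))) * r ^ 7 * (X\<^sup>2 * Y) * r ^ N"
proof -
  \<comment> \<open>\<open>2 ^ 7 = 128\<close> is the first power of 2 above the constant 96 of
    \<open>nonresonant_zero\<close>; here \<open>n = 2 ^ N\<close>.\<close>
  define M where "M = N + 7"
  define n where "n = (2::nat) ^ N"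
  define a where "a = 2 powr \<alpha>"
  define e where "e = 2 powr (1 - \<beta>)"
  define q where "q = 2 powr (\<alpha> - \<beta>)"
  have a: "1 < a" using \<alpha> by (simp add: a_def)
  have e: "1 < e" using \<beta> by (simp add: e_def)
  have q: "0 < q" "q < 1" using \<alpha> by (simp_all add: q_def powr_less_one)
  have n: "n \<ge> 1" "real n = 2 ^ N" by (simp_all add: n_def)
  have M: "M \<ge> 1" "4 * real n \<le> 3/8 * 2 ^ M" "96 * real n < 2 ^ M" by (simp_all add: M_def n power_add)
  define R where "R = (\<lambda>i. fourier_multiplier (jackson n) (B $ i))"
  define T where "T = (\<lambda>J i j k. tint (\<lambda>x. par J (B $ i) x * par J (u $ j) x * R k x))"
  define I where "I = (\<lambda>J. tint (\<lambda>x. triple (\<lambda>i. par J (B $ i) x) (\<lambda>i. par J (u $ i) x) (\<lambda>i. R i x)))"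
  have cR: "continuous_on UNIV (R i)" for i unfolding R_def by (rule cont_jackson)
  have I: "I J = (T J 2 3 1 - T J 3 2 1) + (T J 3 1 2 - T J 1 3 2) + (T J 1 2 3 - T J 2 1 3)" for J
    unfolding I_def T_def by (rule tint_triple_expand) (intro cont_par cR)+
  define K where "K = 24 * X\<^sup>2 * Y * (\<Sum>l<M. a ^ l)"
  have K: "0 \<le> K" unfolding K_def using XY a by (intro mult_nonneg_nonneg sum_nonneg) auto
  have inc: "\<bar>I (Suc J) - I J\<bar> \<le> K * q ^ J" if "M \<le> J" for J
  proof -
    have "\<bar>T (Suc J) i j k - T J i j k\<bar> \<le> 4 * X\<^sup>2 * Y * (\<Sum>l<M. a ^ l) * q ^ J" for i j k
      unfolding T_def R_def a_def q_def by (rule scalar_increment[OF \<alpha>(1) \<beta> n(1) M(3) that M(1)])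
    from this[of 2 3 1] this[of 3 2 1] this[of 3 1 2] this[of 1 3 2] this[of 1 2 3] this[of 2 1 3]
    show ?thesis unfolding I K_def by linarith
  qed
  have "\<bar>I (M + k) - I M\<bar> \<le> K * q ^ M * (\<Sum>i<k. q ^ i)" for k
  proof (induction k)
    case (Suc k)
    have "\<bar>I (M + Suc k) - I M\<bar> \<le> \<bar>I (Suc (M + k)) - I (M + k)\<bar> + \<bar>I (M + k) - I M\<bar>" by simp
    also have "\<dots> \<le> K * q ^ (M + k) + K * q ^ M * (\<Sum>i<k. q ^ i)" by (intro add_mono inc Suc) simp
    finally show ?case by (simp add: power_add algebra_simps)
  qed simp
  from this[of "J - M"] have "\<bar>I J - I M\<bar> \<le> K * q ^ M * (\<Sum>i<J - M. q ^ i)" using J by (simp add: M_def)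
  also have "\<dots> \<le> K * q ^ M * (1 / (1 - q))"
  proof (intro mult_left_mono)
    have "(\<Sum>i<J - M. q ^ i) = (1 - q ^ (J - M)) / (1 - q)" using q by (subst sum_gp_strict) auto
    also have "\<dots> \<le> 1 / (1 - q)" using q by (intro divide_right_mono) auto
    finally show "(\<Sum>i<J - M. q ^ i) \<le> 1 / (1 - q)" .
  qed (use K q in auto)
  also have "\<dots> \<le> (24 * X\<^sup>2 * Y * (a ^ M / (a - 1))) * q ^ M * (1 / (1 - q))"
    unfolding K_def using XY q geometric_sum_le[OF a, of M] by (intro mult_right_mono mult_left_mono) auto
  finally have h: "\<bar>I J - I M\<bar> \<le> (24 * X\<^sup>2 * Y * (a ^ M / (a - 1))) * q ^ M * (1 / (1 - q))" .
  have l: "\<bar>I M\<bar> \<le> 684 * X\<^sup>2 * Y / ((a - 1)\<^sup>2 * (e - 1)) * a ^ M * a ^ M * e ^ M / real n"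
    unfolding I_def R_def a_def e_def by (rule low_frequency_flux[OF \<alpha>(1) \<beta> n(1) M(1,2)])
  have aq: "a ^ M * q ^ M = r ^ 7 * r ^ N"
  proof -
    have "a * q = r" unfolding a_def q_def r_def by (simp flip: powr_add)
    then show ?thesis by (simp add: M_def power_mult_distrib[symmetric] power_add[symmetric] add.commute)
  qed
  \<comment> \<open>\<open>a * a * e = 2 * r\<close>, and the resulting power \<open>2 ^ M\<close>
    is cancelled by \<open>1 / n\<close> up to the factor \<open>2 ^ 7\<close>: the kernel regains
    what Bernstein's inequality lost.\<close>
  have aae: "a ^ M * a ^ M * e ^ M / real n = 2 ^ 7 * r ^ 7 * r ^ N"
  proof -
    have "2 * r = 2 powr 1 * r" by simp
    also have "\<dots> = a * a * e" unfolding a_def e_def r_def by (simp only: powr_add[symmetric]) (simp add: algebra_simps)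
    finally have "a ^ M * a ^ M * e ^ M = (2 * r) ^ M" by (simp add: power_mult_distrib[symmetric])
    then show ?thesis by (simp add: n(2) M_def power_mult_distrib power_add)
  qed
  have alg: "684 * x * y / A * (2 ^ 7 * s * t) + 24 * x * y / E * (s * t) = (684 * 2 ^ 7 / A + 24 / E) * s * (x * y) * t" for x y A E s t :: real
    by (simp add: algebra_simps)
  have "\<bar>I J\<bar> \<le> \<bar>I M\<bar> + \<bar>I J - I M\<bar>" by simp
  also have "\<dots> \<le> 684 * X\<^sup>2 * Y / ((a - 1)\<^sup>2 * (e - 1)) * (a ^ M * a ^ M * e ^ M / real n) + 24 * X\<^sup>2 * Y / ((a - 1) * (1 - q)) * (a ^ M * q ^ M)"
    using l h by (simp add: mult.assoc)
  also have "\<dots> = (684 * 2 ^ 7 / ((a - 1)\<^sup>2 * (e - 1)) + 24 / ((a - 1) * (1 - q))) * r ^ 7 * (X\<^sup>2 * Y) * r ^ N"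
    unfolding aq aae by (rule alg)
  finally show ?thesis unfolding I_def R_def n_def a_def e_def q_def .
qed

end

section \<open>Weak derivatives in time\<close>

lemma integrable_bounded_support:
  fixes f :: "real \<Rightarrow> real"
  assumes "f \<in> borel_measurable lebesgue" "\<And>t. \<bar>f t\<bar> \<le> C" "\<And>t. t \<notin> {0<..<T} \<Longrightarrow> f t = 0"
  shows "integrable lebesgue f"
proof (rule integrableI_bounded_set[where A = "{0<..<T}" and B = C])
  show "emeasure lebesgue {0<..<T} < \<infinity>" by (cases "0 \<le> T") auto
qed (use assms in auto)

text \<open>Half-open intervals are stable under intersection and generate the Borel sets, so all
  integrals over Borel sets vanish. The induction runs on a Borel version of \<open>f\<close>, since
  intervals generate the Borel sets but not all Lebesgue sets.\<close>

lemma AE_zero_of_interval_integrals: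
  fixes f :: "real \<Rightarrow> real"
  assumes f: "integrable lebesgue f" and T: "\<And>t. t \<notin> {0<..<T} \<Longrightarrow> f t = 0"
    and z: "\<And>a b. (LINT t:{a<..b}|lebesgue. f t) = 0"
  shows "AE t in lebesgue. f t = 0"
proof -
  obtain f' where f': "f' \<in> borel_measurable lborel" and ae: "AE x in lborel. f x = f' x"
    using completion_ex_borel_measurable_real[of f lborel] f by (auto dest: borel_measurable_integrable)
  have aeL: "AE x in lebesgue. f x = f' x" using ae by (rule AE_completion)
  have m': "f' \<in> borel_measurable lebesgue" using f' by (rule measurable_completion)
  have i': "integrable lebesgue f'"
    using integrable_cong_AE[OF borel_measurable_integrable[OF f] m' aeL] f by simp
  then have i: "integrable lborel f'" using integrable_completion[OF f'] by simp
  have tr: "(LINT t:A|lborel. f' t) = (LINT t:A|lebesgue. f t)" if A: "A \<in> sets borel" for A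
  proof -
    have AL: "A \<in> sets lebesgue" using A by (intro sets_completionI_sets) simp
    have "(LINT t:A|lebesgue. f t) = (LINT t:A|lebesgue. f' t)"
      unfolding set_lebesgue_integral_def
      by (rule integral_cong_AE) (use aeL AL borel_measurable_integrable[OF f] m' in auto)
    also have "\<dots> = (LINT t:A|lborel. f' t)"
      unfolding set_lebesgue_integral_def using A f' by (intro integral_completion) auto
    finally show ?thesis by simp
  qed
  have si: "set_integrable lborel A f'" if "A \<in> sets borel" for A
    unfolding set_integrable_def using i that by (intro integrable_mult_indicator) auto
  have "(LINT t:A|lborel. f' t) = 0" if "A \<in> sets borel" for A
  proof -
    let ?G = "range (\<lambda>(a, b). {a <.. b::real})"
    have sg: "A \<in> sigma_sets UNIV ?G"
      using that unfolding borel_sigma_sets_Ioc by (subst (asm) sets_measure_of) auto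
    have st: "Int_stable ?G"
    proof (rule Int_stableI)
      fix a b assume "a \<in> ?G" "b \<in> ?G"
      then obtain p q r s where "a = {p<..q}" "b = {r<..s}" by auto
      then have "a \<inter> b = {max p r<..min q s}" by auto
      then show "a \<inter> b \<in> ?G" by auto
    qed
    have "?G \<subseteq> Pow UNIV" by simp
    from st this sg show ?thesis
    proof (induction rule: sigma_sets_induct_disjoint)
      case (basic A)
      then obtain a b where A: "A = {a<..b}" by auto
      then show ?case using tr[of A] z[of a b] by simp
    next
      case empty
      then show ?case by (simp add: set_lebesgue_integral_def)
    next
      case (compl A)
      have A: "A \<in> sets borel" using compl(1) unfolding borel_sigma_sets_Ioc by (subst sets_measure_of) auto
      have all: "(LINT t:UNIV|lborel. f' t) = 0"
      proof -
        have "(LINT t:UNIV|lebesgue. f t) = (LINT t:{0<..T}|lebesgue. f t)"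
        proof -
          have "indicat_real UNIV t *\<^sub>R f t = indicat_real {0<..T} t *\<^sub>R f t" for t
            by (cases "t \<in> {0<..<T}") (simp_all add: T)
          then show ?thesis unfolding set_lebesgue_integral_def by (simp only:)
        qed
        then show ?thesis using tr[of UNIV] z by simp
      qed
      have "(LINT t:A \<union> (UNIV - A)|lborel. f' t) = (LINT t:A|lborel. f' t) + (LINT t:UNIV - A|lborel. f' t)"
        by (rule set_integral_Un) (use A si in auto)
      then show ?case using all compl(2) by simp
    next
      case (union A)
      have A: "A i \<in> sets borel" for i using union(2) unfolding borel_sigma_sets_Ioc by (subst sets_measure_of) auto
      have "(LINT t:(\<Union>i. A i)|lborel. f' t) = (\<Sum>i. (LINT t:A i|lborel. f' t))"
        by (rule lebesgue_integral_countable_add) (use A union(1) si in \<open>auto simp: disjoint_family_on_def\<close>)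
      then show ?case using union(3) by simp
    qed
  qed
  then have "AE x in lborel. f' x = 0"
    by (intro density_unique_real[OF i]) (auto simp: set_lebesgue_integral_def)
  with ae have "AE x in lborel. f x = 0" by eventually_elim simp
  then show ?thesis by (rule AE_completion)
qed

section \<open>Test functions of time and the fundamental lemma\<close>

lemma tendsto_smooth_step:
  fixes \<theta> :: "real \<Rightarrow> real"
  assumes "\<And>r. r \<le> 0 \<Longrightarrow> \<theta> r = 1" "\<And>r. r \<ge> 4/3 \<Longrightarrow> \<theta> r = 0"
  shows "(\<lambda>n. \<theta> (real n * (t - b))) \<longlonglongrightarrow> (if t \<le> b then 1 else 0)"
proof (cases "t \<le> b")
  case True
  then have "\<theta> (real n * (t - b)) = 1" for n by (intro assms) (simp add: mult_nonneg_nonpos)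
  then show ?thesis using True by simp
next
  case False
  have "filterlim (\<lambda>n. real n * (t - b)) at_top sequentially"
    using False by (intro filterlim_at_top_mult_tendsto_pos[OF tendsto_const _ filterlim_real_sequentially]) auto
  then have "\<forall>\<^sub>F n in sequentially. 4/3 \<le> real n * (t - b)" unfolding filterlim_at_top by blast
  then have "\<forall>\<^sub>F n in sequentially. \<theta> (real n * (t - b)) = 0" by eventually_elim (rule assms)
  then show ?thesis using False by (simp add: tendsto_eventually)
qed

definition time_test :: "real \<Rightarrow> (real \<Rightarrow> real) \<Rightarrow> bool" where
  "time_test T \<psi> \<longleftrightarrow> smooth \<psi> \<and> (\<exists>a b. 0 < a \<and> b < T \<and> (\<forall>t. t \<notin> {a..b} \<longrightarrow> \<psi> t = 0))"

lemma time_test_step: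
  fixes \<theta> :: "real \<Rightarrow> real"
  assumes \<theta>: "smooth \<theta>" "\<And>r. r \<le> 0 \<Longrightarrow> \<theta> r = 1" "\<And>r. r \<ge> 4/3 \<Longrightarrow> \<theta> r = 0"
    and n: "0 < a" "a < b" "b < T" "0 < real n" "4/3 / real n < T - b"
  shows "time_test T (\<lambda>t. \<theta> (real n * (t - b)) - \<theta> (real n * (t - a)))"
proof -
  have "smooth (\<lambda>t. 1 * \<theta> (real n * t + (- real n * b)) + (-1) * \<theta> (real n * t + (- real n * a)))"
    by (intro smooth_linear smooth_affine \<theta>(1))
  then have "smooth (\<lambda>t. \<theta> (real n * (t - b)) - \<theta> (real n * (t - a)))" by (simp add: algebra_simps)
  moreover have "\<theta> (real n * (t - b)) - \<theta> (real n * (t - a)) = 0" if "t \<notin> {a..b + 4/3 / real n}" for t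
  proof (cases "t < a")
    case True
    then have "real n * (t - b) \<le> 0" "real n * (t - a) \<le> 0" using n by (auto intro: mult_nonneg_nonpos)
    then show ?thesis by (simp only: \<theta>(2))
  next
    case False
    then have t: "b + 4/3 / real n < t" using that by auto
    then have "4/3 \<le> real n * (t - b)" using n(4) by (simp add: field_simps)
    moreover have "real n * (t - b) \<le> real n * (t - a)" using n by (intro mult_left_mono) auto
    ultimately have "\<theta> (real n * (t - b)) = 0" "\<theta> (real n * (t - a)) = 0" by (auto intro!: \<theta>(3))
    then show ?thesis by simp
  qed
  ultimately show ?thesis unfolding time_test_def using n by (intro conjI exI[of _ a] exI[of _ "b + 4/3 / real n"]) auto
qed

text \<open>Differences of two rescaled smooth steps are test functions and converge boundedly to
  the indicator of \<open>{a<..b}\<close>, so dominated convergence gives the integrals of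
  \<open>f\<close> over intervals.\<close>

lemma fundamental_lemma:
  fixes f :: "real \<Rightarrow> real"
  assumes eta: "lp_cutoff \<eta>" and f: "f \<in> borel_measurable lebesgue" "\<And>t. \<bar>f t\<bar> \<le> C" "\<And>t. t \<notin> {0<..<T} \<Longrightarrow> f t = 0"
    and test: "\<And>\<psi>. time_test T \<psi> \<Longrightarrow> (LINT t|lebesgue. \<psi> t * f t) = 0"
  shows "AE t in lebesgue. f t = 0"
proof -
  \<comment> \<open>Continued by 1 to the left of the origin, the Littlewood-Paley cut-off becomes a
    smooth step from 1 to 0.\<close>
  define \<theta> where "\<theta> r = (if r \<ge> 0 then \<eta> r else 1)" for r
  have \<theta>: "smooth \<theta>" unfolding \<theta>_def[abs_def]
    by (rule smooth_glue_const) (use eta in \<open>auto simp: lp_cutoff_def\<close>)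
  have \<theta>1: "\<theta> r = 1" if "r \<le> 0" for r using that eta by (auto simp: \<theta>_def lp_cutoff_def)
  have \<theta>0: "\<theta> r = 0" if "r \<ge> 4/3" for r using that eta by (auto simp: \<theta>_def lp_cutoff_def)
  have \<theta>b: "0 \<le> \<theta> r" "\<theta> r \<le> 1" for r using eta by (auto simp: \<theta>_def lp_cutoff_def)
  have int: "integrable lebesgue f" by (rule integrable_bounded_support[OF f])
  have \<theta>m: "(\<lambda>t. \<theta> (real n * (t - b))) \<in> borel_measurable lebesgue" for n b
  proof -
    have "continuous_on UNIV (\<lambda>t. \<theta> (real n * (t - b)))"
      by (rule continuous_on_compose2[OF smooth_real_continuous[OF \<theta>]]) (auto intro!: continuous_intros)
    then show ?thesis by (intro measurable_completion) (simp add: borel_measurable_continuous_onI)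
  qed
  have step1: "(LINT t:{a<..b}|lebesgue. f t) = 0" if ab: "0 < a" "a < b" "b < T" for a b
  proof -
    let ?\<psi> = "\<lambda>n t. \<theta> (real n * (t - b)) - \<theta> (real n * (t - a))"
    have "(\<lambda>n. LINT t|lebesgue. ?\<psi> n t * f t) \<longlonglongrightarrow> (LINT t|lebesgue. indicator {a<..b} t * f t)"
    proof (rule integral_dominated_convergence[where w = "\<lambda>t. \<bar>f t\<bar>"])
      show "AE t in lebesgue. (\<lambda>n. ?\<psi> n t * f t) \<longlonglongrightarrow> indicator {a<..b} t * f t"
      proof (rule AE_I2)
        fix t
        have "(\<lambda>n. ?\<psi> n t) \<longlonglongrightarrow> (if t \<le> b then 1 else 0) - (if t \<le> a then 1 else 0)"
          by (intro tendsto_diff tendsto_smooth_step \<theta>1 \<theta>0)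
        also have "(if t \<le> b then 1 else 0) - (if t \<le> a then 1 else 0) = (indicator {a<..b} t :: real)"
          using ab by (auto simp: indicator_def)
        finally show "(\<lambda>n. ?\<psi> n t * f t) \<longlonglongrightarrow> indicator {a<..b} t * f t" by (intro tendsto_mult tendsto_const)
      qed
      show "AE t in lebesgue. norm (?\<psi> n t * f t) \<le> \<bar>f t\<bar>" for n
      proof (rule AE_I2)
        fix t
        have "\<bar>?\<psi> n t\<bar> \<le> 1" using \<theta>b[of "real n * (t - b)"] \<theta>b[of "real n * (t - a)"] by linarith
        then have "\<bar>?\<psi> n t\<bar> * \<bar>f t\<bar> \<le> 1 * \<bar>f t\<bar>" by (intro mult_right_mono) auto
        then show "norm (?\<psi> n t * f t) \<le> \<bar>f t\<bar>" by (simp add: abs_mult)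
      qed
      have "{a<..b} \<in> sets lebesgue" by (rule sets_completionI_sets) simp
      then show "(\<lambda>t. indicator {a<..b} t * f t) \<in> borel_measurable lebesgue"
        by (intro borel_measurable_times f(1) borel_measurable_indicator)
      show "(\<lambda>t. ?\<psi> n t * f t) \<in> borel_measurable lebesgue" for n
        by (intro borel_measurable_times borel_measurable_diff \<theta>m f(1))
      show "integrable lebesgue (\<lambda>t. \<bar>f t\<bar>)" by (rule integrable_abs[OF int])
    qed
    moreover have "\<forall>\<^sub>F n in sequentially. (LINT t|lebesgue. ?\<psi> n t * f t) = 0"
    proof -
      obtain n0 where n0: "4/3 / (T - b) < real n0" using reals_Archimedean2 by blast
      show ?thesis using eventually_ge_at_top[of n0]
      proof eventually_elim
        case (elim n)
        have "0 < 4/3 / (T - b)" using ab by simp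
        then have n: "4/3 / (T - b) < real n" "0 < real n" using n0 elim by linarith+
        then have "4/3 / real n < T - b" using ab by (simp add: field_simps)
        then show ?case by (intro test time_test_step \<theta> \<theta>1 \<theta>0 ab n)
      qed
    qed
    ultimately have "(LINT t|lebesgue. indicator {a<..b} t * f t) = 0"
      by (rule LIMSEQ_unique[OF _ tendsto_eventually])
    then show ?thesis by (simp add: set_lebesgue_integral_def)
  qed
  \<comment> \<open>Test functions vanish near 0 and \<open>T\<close>, so intervals that reach or
    pass these points are exhausted from inside.\<close>
  have "(LINT t:{a<..b}|lebesgue. f t) = 0" for a b
  proof -
    let ?a = "\<lambda>n. max a (1 / real (Suc n))" and ?b = "\<lambda>n. min b (T - 1 / real (Suc n))"
    have "(\<lambda>n. LINT t|lebesgue. indicator {?a n<..?b n} t * f t) \<longlonglongrightarrow> (LINT t|lebesgue. indicator {a<..b} t * f t)"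
    proof (rule integral_dominated_convergence[where w = "\<lambda>t. \<bar>f t\<bar>"])
      show "AE t in lebesgue. (\<lambda>n. indicator {?a n<..?b n} t * f t) \<longlonglongrightarrow> indicator {a<..b} t * f t"
      proof (rule AE_I2)
        fix t
        show "(\<lambda>n. indicator {?a n<..?b n} t * f t) \<longlonglongrightarrow> indicator {a<..b} t * f t"
        proof (cases "t \<in> {0<..<T}")
          case True
          have "(\<lambda>n. 1 / real (Suc n)) \<longlonglongrightarrow> 0" by (rule LIMSEQ_inverse_real_of_nat[unfolded inverse_eq_divide])
          then have "\<forall>\<^sub>F n in sequentially. 1 / real (Suc n) < min t (T - t)"
            using True by (intro order_tendstoD(2)) auto
          then have "\<forall>\<^sub>F n in sequentially. indicator {?a n<..?b n} t * f t = indicator {a<..b} t * f t"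
            by eventually_elim (auto simp: indicator_def)
          then show ?thesis by (rule tendsto_eventually)
        qed (simp add: f(3))
      qed
      have m: "{a<..b} \<in> sets lebesgue" for a b :: real by (rule sets_completionI_sets) simp
      then show "(\<lambda>t. indicator {a<..b} t * f t) \<in> borel_measurable lebesgue"
        by (intro borel_measurable_times f(1) borel_measurable_indicator)
      show "(\<lambda>t. indicator {?a n<..?b n} t * f t) \<in> borel_measurable lebesgue" for n
        by (intro borel_measurable_times f(1) borel_measurable_indicator m)
      show "integrable lebesgue (\<lambda>t. \<bar>f t\<bar>)" by (rule integrable_abs[OF int])
      show "AE t in lebesgue. norm (indicator {?a n<..?b n} t * f t) \<le> \<bar>f t\<bar>" for n
        by (rule AE_I2) (simp add: indicator_def)
    qed
    moreover have "(LINT t|lebesgue. indicator {?a n<..?b n} t * f t) = 0" for n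
    proof (cases "?a n < ?b n")
      case True
      have "0 < ?a n" "?b n < T" by (auto simp: less_max_iff_disj min_less_iff_disj)
      then show ?thesis using step1[OF _ True] by (simp add: set_lebesgue_integral_def)
    next
      case False
      then have e: "{?a n<..?b n} = {}" by (intro greaterThanAtMost_empty) linarith
      show ?thesis unfolding e by simp
    qed
    ultimately have "(LINT t|lebesgue. indicator {a<..b} t * f t) = 0"
      by (simp add: LIMSEQ_const_iff)
    then show ?thesis by (simp add: set_lebesgue_integral_def)
  qed
  then show ?thesis by (intro AE_zero_of_interval_integrals[OF int f(3)])
qed

section \<open>Bounded measurable functions of time and their Lipschitz primitives\<close>

definition bdd_meas :: "(real \<Rightarrow> real) \<Rightarrow> bool" where
  "bdd_meas f \<longleftrightarrow> f \<in> borel_measurable lebesgue \<and> (\<exists>C. \<forall>t. \<bar>f t\<bar> \<le> C)"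

lemma bdd_meas_integrable: "bdd_meas f \<Longrightarrow> f absolutely_integrable_on {s..t}"
proof -
  assume "bdd_meas f"
  then obtain C where C: "f \<in> borel_measurable lebesgue" "\<And>t. \<bar>f t\<bar> \<le> C" by (auto simp: bdd_meas_def)
  show ?thesis
    by (rule measurable_bounded_by_integrable_imp_absolutely_integrable[where g = "\<lambda>_. C"])
       (use C in \<open>auto intro: measurable_restrict_space1\<close>)
qed

lemma bdd_meas_integrable_on: "bdd_meas f \<Longrightarrow> f integrable_on {s..t}"
  using bdd_meas_integrable set_lebesgue_integral_eq_integral(1) by blast

lemma bdd_meas_mult: "bdd_meas f \<Longrightarrow> bdd_meas g \<Longrightarrow> bdd_meas (\<lambda>t. f t * g t)"
proof -
  assume a: "bdd_meas f" "bdd_meas g"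
  then obtain C D where "\<And>t. \<bar>f t\<bar> \<le> C" "\<And>t. \<bar>g t\<bar> \<le> D" by (auto simp: bdd_meas_def)
  then have "\<bar>f t * g t\<bar> \<le> C * D" for t unfolding abs_mult by (meson abs_ge_zero mult_mono order_trans)
  then show ?thesis using a by (auto simp: bdd_meas_def)
qed

lemma bdd_meas_add: "bdd_meas f \<Longrightarrow> bdd_meas g \<Longrightarrow> bdd_meas (\<lambda>t. f t + g t)"
proof -
  assume a: "bdd_meas f" "bdd_meas g"
  then obtain C D where "\<And>t. \<bar>f t\<bar> \<le> C" "\<And>t. \<bar>g t\<bar> \<le> D" by (auto simp: bdd_meas_def)
  then have "\<bar>f t + g t\<bar> \<le> C + D" for t by (meson abs_triangle_ineq add_mono order_trans)
  then show ?thesis using a by (auto simp: bdd_meas_def)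
qed

lemma bdd_meas_const: "bdd_meas (\<lambda>_. c)"
  by (auto simp: bdd_meas_def)

lemma integral_diff_bound:
  fixes f :: "real \<Rightarrow> real"
  assumes "0 \<le> C" "\<And>r. r \<in> {s..t} \<Longrightarrow> \<bar>f r\<bar> \<le> C" "f integrable_on {s..t}" "s \<le> t"
  shows "\<bar>integral {s..t} f\<bar> \<le> C * (t - s)"
proof -
  have "norm (integral (cbox s t) f) \<le> C * Henstock_Kurzweil_Integration.content (cbox s t)"
    by (rule has_integral_bound[OF assms(1)]) (use assms integrable_integral[OF assms(3)] in auto)
  then show ?thesis using assms(4) by simp
qed

text \<open>For \<open>t < 0\<close> the interval is empty and the value is 0, so that the primitive
  of a bounded measurable function is Lipschitz on the whole line.\<close>

definition primitive :: "(real \<Rightarrow> real) \<Rightarrow> real \<Rightarrow> real" where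
  "primitive g t = integral {0..t} g"

lemma primitive_diff: "bdd_meas g \<Longrightarrow> 0 \<le> s \<Longrightarrow> s \<le> t \<Longrightarrow> primitive g t - primitive g s = integral {s..t} g"
  using Henstock_Kurzweil_Integration.integral_combine[of 0 s t g] bdd_meas_integrable_on[of g 0 t] by (simp add: primitive_def)

lemma primitive_lipschitz:
  assumes g: "bdd_meas g" "\<And>t. \<bar>g t\<bar> \<le> C"
  shows "\<bar>primitive g t - primitive g s\<bar> \<le> C * \<bar>t - s\<bar>"
proof -
  have C: "0 \<le> C" using g(2)[of 0] by linarith
  have *: "\<bar>primitive g t - primitive g s\<bar> \<le> C * (t - s)" if "s \<le> t" for s t
  proof -
    consider "0 \<le> s" | "s < 0" "0 \<le> t" | "t < 0" by linarith
    then show ?thesis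
    proof cases
      case 1
      then show ?thesis using primitive_diff[OF g(1) 1 that] integral_diff_bound[OF C g(2) bdd_meas_integrable_on[OF g(1)] that] by simp
    next
      case 2
      then have "primitive g s = 0" by (simp add: primitive_def)
      moreover have "\<bar>primitive g t\<bar> \<le> C * (t - 0)"
        unfolding primitive_def by (rule integral_diff_bound[OF C g(2) bdd_meas_integrable_on[OF g(1)] 2(2)])
      moreover have "C * (t - 0) \<le> C * (t - s)" using 2 C by (intro mult_left_mono) auto
      ultimately show ?thesis by linarith
    next
      case 3
      then show ?thesis using that C by (simp add: primitive_def)
    qed
  qed
  show ?thesis using *[of s t] *[of t s] by (cases "s \<le> t") (auto simp: abs_minus_commute)
qed

lemma primitive_continuous: "bdd_meas g \<Longrightarrow> continuous_on UNIV (primitive g)"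
proof -
  assume g: "bdd_meas g"
  then obtain C where C: "\<And>t. \<bar>g t\<bar> \<le> C" by (auto simp: bdd_meas_def)
  have "C-lipschitz_on UNIV (primitive g)"
    using primitive_lipschitz[OF g C] C[of 0] by (intro lipschitz_onI) (auto simp: dist_real_def abs_minus_commute)
  then show ?thesis by (rule lipschitz_on_continuous_on)
qed

lemma bdd_meas_primitive:
  assumes g: "bdd_meas g"
  shows "bdd_meas (\<lambda>t. if t \<in> {0..T} then c + primitive g t else 0)"
proof -
  obtain C where C: "\<And>t. \<bar>g t\<bar> \<le> C" using g by (auto simp: bdd_meas_def)
  have "continuous_on UNIV (\<lambda>t. c + primitive g t)" by (intro continuous_intros primitive_continuous g)
  then have "(\<lambda>t. c + primitive g t) \<in> borel_measurable lebesgue"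
    by (intro measurable_completion) (simp add: borel_measurable_continuous_onI)
  then have "(\<lambda>t. if t \<in> {0..T} then c + primitive g t else 0) \<in> borel_measurable lebesgue"
    by (intro measurable_If_set) auto
  moreover have "\<bar>if t \<in> {0..T} then c + primitive g t else 0\<bar> \<le> \<bar>c\<bar> + C * \<bar>T\<bar>" for t
  proof -
    have "0 \<le> C" using C[of 0] by linarith
    moreover have "\<bar>primitive g t\<bar> \<le> C * \<bar>t\<bar>" using primitive_lipschitz[OF g C, of t 0] by (simp add: primitive_def)
    moreover have "C * \<bar>t\<bar> \<le> C * \<bar>T\<bar>" if "t \<in> {0..T}" using that \<open>0 \<le> C\<close> by (intro mult_left_mono) auto
    ultimately show ?thesis by auto
  qed
  ultimately show ?thesis unfolding bdd_meas_def by blast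
qed

lemma constant_if_quadratic:
  fixes D :: "real \<Rightarrow> real"
  assumes "\<And>s t. s \<in> {a..b} \<Longrightarrow> t \<in> {a..b} \<Longrightarrow> s \<le> t \<Longrightarrow> \<bar>D t - D s\<bar> \<le> K * (t - s)\<^sup>2"
    and "s \<in> {a..b}" "t \<in> {a..b}"
  shows "D s = D t"
proof -
  have q: "\<bar>D t - D s\<bar> \<le> K * (t - s)\<^sup>2" if "s \<in> {a..b}" "t \<in> {a..b}" for s t
    using assms(1)[of s t] assms(1)[of t s] that by (cases "s \<le> t") (auto simp: power2_commute abs_minus_commute)
  have "(D has_field_derivative 0) (at x within {a..b})" if x: "x \<in> {a..b}" for x
    unfolding has_field_derivative_iff
  proof (rule Lim_null_comparison)
    show "\<forall>\<^sub>F y in at x within {a..b}. norm ((D y - D x) / (y - x)) \<le> \<bar>K\<bar> * \<bar>y - x\<bar>"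
      unfolding eventually_at_topological
    proof (intro exI[of _ UNIV] conjI ballI impI open_UNIV UNIV_I)
      fix y assume y: "y \<noteq> x" "y \<in> {a..b}"
      have "\<bar>D y - D x\<bar> \<le> K * (y - x)\<^sup>2" by (rule q[OF x y(2)])
      also have "\<dots> \<le> \<bar>K\<bar> * (\<bar>y - x\<bar> * \<bar>y - x\<bar>)" by (simp add: power2_eq_square mult_right_mono)
      finally show "norm ((D y - D x) / (y - x)) \<le> \<bar>K\<bar> * \<bar>y - x\<bar>"
        using y by (simp add: field_simps)
    qed
    have "((\<lambda>y. \<bar>K\<bar> * \<bar>y - x\<bar>) \<longlongrightarrow> \<bar>K\<bar> * \<bar>x - x\<bar>) (at x within {a..b})" by (intro tendsto_intros)
    then show "((\<lambda>y. \<bar>K\<bar> * \<bar>y - x\<bar>) \<longlongrightarrow> 0) (at x within {a..b})" by simp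
  qed
  then obtain c where "\<And>x. x \<in> {a..b} \<Longrightarrow> D x = c"
    using has_field_derivative_zero_constant[of "{a..b}" D] by auto
  then show ?thesis using assms(2,3) by simp
qed

text \<open>Takes the place of almost everywhere differentiation: the defect \<open>W\<close> of the
  formula changes by at most a multiple of \<open>(q - p)\<^sup>2\<close> between \<open>p\<close>
  and \<open>q\<close>, so its derivative is 0 everywhere. Freezing \<open>H\<close> at the left and
  \<open>G\<close> at the right end leaves an integrand of order \<open>q - p\<close>.\<close>

lemma primitive_product_rule:
  fixes c d :: real
  assumes g: "bdd_meas g" and h: "bdd_meas h" and st: "0 \<le> s" "s \<le> t"
  defines "G \<equiv> \<lambda>t. c + primitive g t" and "H \<equiv> \<lambda>t. d + primitive h t"
  shows "G t * H t - G s * H s = integral {s..t} (\<lambda>r. g r * H r + G r * h r)"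
proof -
  obtain C where C: "\<And>t. \<bar>g t\<bar> \<le> C" using g by (auto simp: bdd_meas_def)
  obtain D where D: "\<And>t. \<bar>h t\<bar> \<le> D" using h by (auto simp: bdd_meas_def)
  have CD: "0 \<le> C" "0 \<le> D" using C[of 0] D[of 0] by linarith+
  let ?f = "\<lambda>r. g r * H r + G r * h r"
  have int: "?f integrable_on {p..q}" if "0 \<le> p" "q \<le> t" for p q
  proof -
    have "bdd_meas (\<lambda>r. g r * (if r \<in> {0..t} then H r else 0) + (if r \<in> {0..t} then G r else 0) * h r)"
      unfolding G_def H_def by (intro bdd_meas_add bdd_meas_mult bdd_meas_primitive g h)
    from bdd_meas_integrable_on[OF this, of p q] show ?thesis
      by (rule integrable_eq) (use that in auto)
  qed
  have ig: "g integrable_on {p..q}" and ih: "h integrable_on {p..q}" for p q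
    by (rule bdd_meas_integrable_on[OF g] bdd_meas_integrable_on[OF h])+
  define W where "W = (\<lambda>q. G q * H q - integral {s..q} ?f)"
  have "W s = W t"
  proof (rule constant_if_quadratic[of s t W "2 * (C * D)"])
    fix p q assume pq: "p \<in> {s..t}" "q \<in> {s..t}" "p \<le> q"
    have p0: "0 \<le> p" using pq st by auto
    have "integral {s..q} ?f - integral {s..p} ?f = integral {p..q} ?f"
      using Henstock_Kurzweil_Integration.integral_combine[of s p q ?f] int[of s q] pq st by auto
    moreover have "G q - G p = integral {p..q} g" "H q - H p = integral {p..q} h"
      unfolding G_def H_def using primitive_diff[OF g p0 pq(3)] primitive_diff[OF h p0 pq(3)] by auto
    moreover have "G q * H q - G p * H p = (G q - G p) * H p + G q * (H q - H p)" by (simp add: algebra_simps)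
    ultimately have "W q - W p = (G q - G p) * H p + G q * (H q - H p) - integral {p..q} ?f"
      and GH: "G q - G p = integral {p..q} g" "H q - H p = integral {p..q} h"
      unfolding W_def by linarith+
    then have "W q - W p = integral {p..q} g * H p + G q * integral {p..q} h - integral {p..q} ?f"
      by (simp only: GH)
    also have "\<dots> = integral {p..q} (\<lambda>r. g r * H p + G q * h r) - integral {p..q} ?f"
    proof -
      have "integral {p..q} (\<lambda>r. g r * H p + G q * h r) = integral {p..q} (\<lambda>r. g r * H p) + integral {p..q} (\<lambda>r. G q * h r)"
        by (intro Henstock_Kurzweil_Integration.integral_add integrable_on_mult_left integrable_on_mult_right ig ih)
      then show ?thesis by simp
    qed
    also have "\<dots> = integral {p..q} (\<lambda>r. (g r * H p + G q * h r) - ?f r)"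
      by (intro Henstock_Kurzweil_Integration.integral_diff[symmetric] integrable_add integrable_on_mult_left integrable_on_mult_right ig ih int) (use pq st in auto)
    finally have W: "W q - W p = integral {p..q} (\<lambda>r. g r * (H p - H r) + (G q - G r) * h r)"
      by (simp add: algebra_simps)
    have "(\<lambda>r. (g r * H p + G q * h r) - ?f r) integrable_on {p..q}"
      by (intro integrable_diff integrable_add integrable_on_mult_left integrable_on_mult_right ig ih int) (use pq st in auto)
    then have i: "(\<lambda>r. g r * (H p - H r) + (G q - G r) * h r) integrable_on {p..q}"
      by (simp add: algebra_simps)
    have "\<bar>W q - W p\<bar> \<le> (2 * (C * D) * (q - p)) * (q - p)"
      unfolding W
    proof (rule integral_diff_bound[OF _ _ i pq(3)])
        show "0 \<le> 2 * (C * D) * (q - p)" using CD pq by simp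
        fix r assume r: "r \<in> {p..q}"
        have "\<bar>H p - H r\<bar> \<le> D * (q - p)"
        proof -
          have "\<bar>H p - H r\<bar> \<le> D * \<bar>p - r\<bar>" unfolding H_def using primitive_lipschitz[OF h D, of p r] by simp
          also have "\<dots> \<le> D * (q - p)" using r CD by (intro mult_left_mono) auto
          finally show ?thesis .
        qed
        then have gh1: "\<bar>g r\<bar> * \<bar>H p - H r\<bar> \<le> C * (D * (q - p))" using C CD pq by (intro mult_mono) auto
        have "\<bar>G q - G r\<bar> \<le> C * (q - p)"
        proof -
          have "\<bar>G q - G r\<bar> \<le> C * \<bar>q - r\<bar>" unfolding G_def using primitive_lipschitz[OF g C, of q r] by simp
          also have "\<dots> \<le> C * (q - p)" using r CD by (intro mult_left_mono) auto
          finally show ?thesis .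
        qed
        then have gh2: "\<bar>G q - G r\<bar> * \<bar>h r\<bar> \<le> (C * (q - p)) * D" using D CD pq by (intro mult_mono) auto
        show "\<bar>g r * (H p - H r) + (G q - G r) * h r\<bar> \<le> 2 * (C * D) * (q - p)"
        proof -
          have "\<bar>g r * (H p - H r) + (G q - G r) * h r\<bar> \<le> \<bar>g r\<bar> * \<bar>H p - H r\<bar> + \<bar>G q - G r\<bar> * \<bar>h r\<bar>"
            unfolding abs_mult[symmetric] by (rule abs_triangle_ineq)
          moreover have "C * (D * (q - p)) + (C * (q - p)) * D = 2 * (C * D) * (q - p)" by (simp add: algebra_simps)
          ultimately show ?thesis using gh1 gh2 by linarith
        qed
    qed
    then show "\<bar>W q - W p\<bar> \<le> 2 * (C * D) * (q - p)\<^sup>2" by (simp add: power2_eq_square mult_ac)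
  qed (use st in auto)
  then show ?thesis unfolding W_def by simp
qed

section \<open>Weak time derivatives and the du Bois-Reymond lemma\<close>

lemma time_test_smooth: "time_test T \<psi> \<Longrightarrow> smooth \<psi>"
  by (simp add: time_test_def)

lemma time_test_linear:
  assumes "time_test T \<phi>" "time_test T \<psi>"
  shows "time_test T (\<lambda>t. c * \<phi> t + d * \<psi> t)"
proof -
  obtain a b a' b' where "0 < a" "b < T" "\<forall>t. t \<notin> {a..b} \<longrightarrow> \<phi> t = 0" "0 < a'" "b' < T" "\<forall>t. t \<notin> {a'..b'} \<longrightarrow> \<psi> t = 0"
    using assms unfolding time_test_def by blast
  note ab = this
  have "c * \<phi> t + d * \<psi> t = 0" if "t \<notin> {min a a'..max b b'}" for t
  proof -
    have "t \<notin> {a..b}" "t \<notin> {a'..b'}" using that by auto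
    then show ?thesis using ab by (simp del: atLeastAtMost_iff)
  qed
  moreover have "0 < min a a'" "max b b' < T" using ab by auto
  moreover have "smooth (\<lambda>t. c * \<phi> t + d * \<psi> t)"
    using assms unfolding time_test_def by (intro smooth_linear) auto
  ultimately show ?thesis unfolding time_test_def by blast
qed

lemma time_test_deriv:
  assumes "time_test T \<psi>"
  shows "time_test T (dir_deriv 1 \<psi>)"
proof -
  obtain a b where ab: "0 < a" "b < T" "\<And>t. t \<notin> {a..b} \<Longrightarrow> \<psi> t = 0" and s: "smooth \<psi>"
    using assms unfolding time_test_def by blast
  have "dir_deriv 1 \<psi> t = 0" if t: "t \<notin> {a..b}" for t
  proof -
    have "(\<psi> has_real_derivative 0) (at t)"
      by (rule has_field_derivative_transform_within_open[of "\<lambda>_. 0" 0 t "- {a..b}"])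
         (use ab(3) t in \<open>auto simp del: atLeastAtMost_iff\<close>)
    then show ?thesis using smooth_real_derivative[OF s] DERIV_unique by blast
  qed
  then show ?thesis unfolding time_test_def using ab smooth_dir_deriv[OF s, of 1] by auto
qed

lemma time_test_bdd_meas:
  assumes "time_test T \<psi>" shows "bdd_meas \<psi>"
proof -
  obtain a b where ab: "\<And>t. t \<notin> {a..b} \<Longrightarrow> \<psi> t = 0" and s: "smooth \<psi>"
    using assms unfolding time_test_def by blast
  have "bounded (\<psi> ` {a..b})"
    by (intro compact_imp_bounded compact_continuous_image smooth_real_continuous s) auto
  then obtain C where C: "\<forall>t\<in>{a..b}. \<bar>\<psi> t\<bar> \<le> C" by (auto simp: bounded_iff)
  have "\<bar>\<psi> t\<bar> \<le> \<bar>C\<bar>" for t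
  proof (cases "t \<in> {a..b}")
    case True
    then show ?thesis using C[rule_format, OF True] by linarith
  qed (simp add: ab)
  moreover have "\<psi> \<in> borel_measurable lebesgue"
    using smooth_real_continuous[OF s, of UNIV] by (intro measurable_completion) (simp add: borel_measurable_continuous_onI)
  ultimately show ?thesis unfolding bdd_meas_def by blast
qed

lemma bdd_meas_LINT:
  assumes "bdd_meas f"
  shows "(LINT t|lebesgue. indicator {0<..<T} t * f t) = integral {0..T} f"
    and "(LINT t|lebesgue_on {0<..<T}. f t) = integral {0..T} f"
    and "integrable (lebesgue_on {0<..<T}) f"
proof -
  have s: "set_integrable lebesgue {0<..<T} f"
    by (rule set_integrable_subset[OF bdd_meas_integrable[OF assms, of 0 T]]) auto
  have "(LINT t:{0<..<T}|lebesgue. f t) = integral {0<..<T} f"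
    by (rule set_lebesgue_integral_eq_integral[OF s])
  then show "(LINT t|lebesgue. indicator {0<..<T} t * f t) = integral {0..T} f"
    by (simp add: set_lebesgue_integral_def integral_open_interval_real)
  show i: "integrable (lebesgue_on {0<..<T}) f"
    using s by (simp add: set_integrable_def integrable_restrict_space)
  show "(LINT t|lebesgue_on {0<..<T}. f t) = integral {0..T} f"
    using lebesgue_integral_eq_integral[OF i] by (simp add: integral_open_interval_real)
qed

lemma bdd_meas_indicator_measurable:
  assumes "bdd_meas f"
  shows "(\<lambda>t. indicator {0<..<T} t * f t) \<in> borel_measurable lebesgue"
  using assms unfolding bdd_meas_def by (intro borel_measurable_times borel_measurable_indicator sets_completionI_sets) auto

lemma fundamental_lemma_on:
  assumes eta: "lp_cutoff \<eta>" and f: "bdd_meas f"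
    and test: "\<And>\<psi>. time_test T \<psi> \<Longrightarrow> integral {0..T} (\<lambda>t. \<psi> t * f t) = 0"
  shows "AE t in lebesgue. t \<in> {0<..<T} \<longrightarrow> f t = 0"
proof -
  obtain C where C: "\<And>t. \<bar>f t\<bar> \<le> C" using f by (auto simp: bdd_meas_def)
  have "AE t in lebesgue. indicator {0<..<T} t * f t = 0"
  proof (rule fundamental_lemma[OF eta bdd_meas_indicator_measurable[OF f], where C = C])
    show "\<bar>indicator {0<..<T} t * f t\<bar> \<le> C" for t
      using C[of t] order_trans[OF abs_ge_zero C[of t]] by (auto simp: indicator_def)
    fix \<psi> assume \<psi>: "time_test T \<psi>"
    have "(LINT t|lebesgue. \<psi> t * (indicator {0<..<T} t * f t)) = (LINT t|lebesgue. indicator {0<..<T} t * (\<psi> t * f t))"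
      by (simp only: mult.left_commute)
    also have "\<dots> = 0"
      using bdd_meas_LINT(1)[OF bdd_meas_mult[OF time_test_bdd_meas[OF \<psi>] f]] test[OF \<psi>] by simp
    finally show "(LINT t|lebesgue. \<psi> t * (indicator {0<..<T} t * f t)) = 0" .
  qed (auto simp: indicator_def)
  then show ?thesis by eventually_elim (auto simp: indicator_def split: if_splits)
qed

lemma time_test_primitive_deriv:
  assumes "time_test T \<chi>'" "t \<ge> 0"
  shows "primitive (dir_deriv 1 \<chi>') t = \<chi>' t"
proof -
  have s: "smooth \<chi>'" and z: "\<chi>' 0 = 0" using assms(1) unfolding time_test_def by auto
  have "(dir_deriv 1 \<chi>' has_integral \<chi>' t - \<chi>' 0) {0..t}"
    using assms(2) smooth_real_derivative[OF s]
    by (intro fundamental_theorem_of_calculus) (auto simp: has_real_derivative_iff_has_vector_derivative[symmetric] intro: has_field_derivative_at_within)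
  then show ?thesis by (simp add: primitive_def z integral_unique)
qed

text \<open>The mean value zero makes the primitive vanish to the right of the support, so that it
  is again a test function.\<close>

lemma time_test_antiderivative:
  assumes \<omega>: "time_test T \<omega>" and z: "integral {0..T} \<omega> = 0"
  shows "time_test T (primitive \<omega>)" "dir_deriv 1 (primitive \<omega>) = \<omega>"
proof -
  obtain a b where ab: "0 < a" "b < T" "\<And>t. t \<notin> {a..b} \<Longrightarrow> \<omega> t = 0" and s: "smooth \<omega>"
    using \<omega> unfolding time_test_def by blast
  note bm = time_test_bdd_meas[OF \<omega>]
  have low: "primitive \<omega> t = 0" if "t < a" for t
  proof -
    have "integral {0..t} \<omega> = integral {0..t} (\<lambda>_. 0)" by (rule integral_cong) (use that ab(3) in auto)
    then show ?thesis by (simp add: primitive_def)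
  qed
  have const: "primitive \<omega> t = primitive \<omega> s" if "max 0 b < s" "s \<le> t" for s t
  proof -
    have "primitive \<omega> t - primitive \<omega> s = integral {s..t} \<omega>" by (rule primitive_diff[OF bm]) (use that in auto)
    also have "\<dots> = integral {s..t} (\<lambda>_. 0)" by (rule integral_cong) (use that ab(3) in auto)
    finally show ?thesis by simp
  qed
  have high: "primitive \<omega> t = 0" if t: "b < t" for t
  proof (cases "0 < t \<and> 0 < T")
    case True
    have "primitive \<omega> T = 0" using z by (simp add: primitive_def)
    have m: "max 0 b < t" "max 0 b < T" using True t ab(2) by auto
    show ?thesis
    proof (cases "t \<le> T")
      case True
      show ?thesis using const[OF m(1) True] \<open>primitive \<omega> T = 0\<close> by simp
    next
      case False
      then show ?thesis using const[OF m(2), of t] \<open>primitive \<omega> T = 0\<close> by simp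
    qed
  next
    case False
    show ?thesis
    proof (cases "t < a")
      case False
      then have "0 < t" using ab(1) by linarith
      moreover have "b < a \<or> 0 < T" using ab by linarith
      \<comment> \<open>In this case \<open>T \<le> 0\<close>, the support interval is empty, and
        \<open>\<omega>\<close> vanishes identically.\<close>
      ultimately have "b < a" using \<open>\<not> (0 < t \<and> 0 < T)\<close> by auto
      then have "\<omega> = (\<lambda>_. 0)" by (intro ext ab(3)) auto
      then show ?thesis by (simp add: primitive_def)
    qed (rule low)
  qed
  have der: "(primitive \<omega> has_real_derivative \<omega> t) (at t)" for t
  proof (cases "t < a")
    case True
    then have t: "t \<in> {..<a}" by simp
    have "(primitive \<omega> has_real_derivative 0) (at t)"
      by (rule has_field_derivative_transform_within_open[OF DERIV_const[of 0] open_lessThan t]) (simp add: low)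
    moreover have "\<omega> t = 0" using True by (intro ab(3)) simp
    ultimately show ?thesis by (simp only:)
  next
    case False
    then have t: "0 < t" using ab(1) by simp
    have "((\<lambda>u. integral {0..u} \<omega>) has_real_derivative \<omega> t) (at t within {0..t+1})"
      by (rule integral_has_real_derivative) (use t smooth_real_continuous[OF s] in auto)
    moreover have "at t within {0..t+1} = at t" using t by (intro at_within_interior) simp
    ultimately show ?thesis unfolding primitive_def[abs_def] by (simp only:)
  qed
  show "dir_deriv 1 (primitive \<omega>) = \<omega>"
  proof
    fix t
    show "dir_deriv 1 (primitive \<omega>) t = \<omega> t"
      using dir_deriv_eqI[OF der[unfolded has_field_derivative_def], of 1 t] by simp
  qed
  have "smooth (primitive \<omega>)" by (rule smooth_antiderivative[OF s der])
  moreover have "primitive \<omega> t = 0" if "t \<notin> {a..b}" for t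
  proof (cases "t < a")
    case False
    then show ?thesis using that by (intro high) simp
  qed (rule low)
  ultimately show "time_test T (primitive \<omega>)" unfolding time_test_def using ab by blast
qed

text \<open>The function \<open>x + primitive g\<close> has weak derivative 0. A test function minus
  a suitable multiple of a fixed \<open>\<rho>\<close> with nonzero mean has mean zero and is a
  derivative; hence \<open>x + primitive g\<close> minus a constant is annihilated by all test
  functions.\<close>

lemma du_bois_reymond:
  assumes eta: "lp_cutoff \<eta>" and T: "0 < T" and x: "bdd_meas x" and g: "bdd_meas g"
    and weak: "\<And>\<psi>. time_test T \<psi> \<Longrightarrow> integral {0..T} (\<lambda>t. dir_deriv 1 \<psi> t * x t) = integral {0..T} (\<lambda>t. \<psi> t * g t)"
  shows "\<exists>c. AE t in lebesgue. t \<in> {0<..<T} \<longrightarrow> x t = c - primitive g t"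
proof -
  define P where "P = (\<lambda>t. if t \<in> {0..T} then 0 + primitive g t else 0)"
  have P: "bdd_meas P" unfolding P_def by (rule bdd_meas_primitive[OF g])
  define h where "h = (\<lambda>t. x t + P t)"
  have h: "bdd_meas h" unfolding h_def by (rule bdd_meas_add[OF x P])
  have int: "(\<lambda>t. \<psi> t * f t) integrable_on {0..T}" if "time_test T \<psi>" "bdd_meas f" for \<psi> f
    by (rule bdd_meas_integrable_on[OF bdd_meas_mult[OF time_test_bdd_meas[OF that(1)] that(2)]])
  have dh: "integral {0..T} (\<lambda>t. dir_deriv 1 \<psi> t * h t) = 0" if \<psi>: "time_test T \<psi>" for \<psi>
  proof -
    note d = time_test_deriv[OF \<psi>]
    have "\<psi> T = 0" "\<psi> 0 = 0" using \<psi> unfolding time_test_def by auto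
    then have "0 = integral {0..T} (\<lambda>r. dir_deriv 1 \<psi> r * (0 + primitive g r) + (0 + primitive (dir_deriv 1 \<psi>) r) * g r)"
      using primitive_product_rule[OF time_test_bdd_meas[OF d] g order_refl less_imp_le[OF T], of 0 0]
        time_test_primitive_deriv[OF \<psi>, of T] time_test_primitive_deriv[OF \<psi>, of 0] T by simp
    also have "\<dots> = integral {0..T} (\<lambda>r. dir_deriv 1 \<psi> r * P r + \<psi> r * g r)"
      by (rule integral_cong) (use time_test_primitive_deriv[OF \<psi>] in \<open>auto simp: P_def\<close>)
    also have "\<dots> = integral {0..T} (\<lambda>r. dir_deriv 1 \<psi> r * P r) + integral {0..T} (\<lambda>r. \<psi> r * g r)"
      by (intro Henstock_Kurzweil_Integration.integral_add int d \<psi> P g)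
    finally have "integral {0..T} (\<lambda>r. dir_deriv 1 \<psi> r * P r) = - integral {0..T} (\<lambda>r. \<psi> r * g r)" by linarith
    moreover have "integral {0..T} (\<lambda>t. dir_deriv 1 \<psi> t * h t) = integral {0..T} (\<lambda>t. dir_deriv 1 \<psi> t * x t) + integral {0..T} (\<lambda>t. dir_deriv 1 \<psi> t * P t)"
      unfolding h_def distrib_left by (intro Henstock_Kurzweil_Integration.integral_add int d x P)
    ultimately show ?thesis using weak[OF \<psi>] by simp
  qed
  \<comment> \<open>If all test functions had mean zero, the fundamental lemma applied to the
    constant 1 would make \<open>{0<..<T}\<close> a null set.\<close>
  have "\<exists>\<rho>. time_test T \<rho> \<and> integral {0..T} \<rho> \<noteq> 0"
  proof (rule ccontr)
    assume "\<not> ?thesis"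
    then have "AE t in lebesgue. t \<in> {0<..<T} \<longrightarrow> (1::real) = 0"
      by (intro fundamental_lemma_on[OF eta bdd_meas_const]) auto
    then have "AE t in lebesgue. t \<notin> {0<..<T}" by eventually_elim simp
    then have "{0<..<T} \<in> null_sets lebesgue" by (intro AE_iff_null_sets[THEN iffD2]) auto
    then have "emeasure lebesgue {0<..<T} = 0" by (rule null_setsD1)
    then show False using T by simp
  qed
  then obtain \<rho> where \<rho>: "time_test T \<rho>" "integral {0..T} \<rho> \<noteq> 0" by blast
  define c where "c = integral {0..T} (\<lambda>t. \<rho> t * h t) / integral {0..T} \<rho>"
  have "AE t in lebesgue. t \<in> {0<..<T} \<longrightarrow> h t + (- c) = 0"
  proof (rule fundamental_lemma_on[OF eta bdd_meas_add[OF h bdd_meas_const]])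
    fix \<psi> assume \<psi>: "time_test T \<psi>"
    define k where "k = integral {0..T} \<psi> / integral {0..T} \<rho>"
    let ?\<omega> = "\<lambda>t. 1 * \<psi> t + (- k) * \<rho> t"
    have \<omega>: "time_test T ?\<omega>" by (rule time_test_linear[OF \<psi> \<rho>(1)])
    have i: "\<psi> integrable_on {0..T}" "\<rho> integrable_on {0..T}"
      by (rule bdd_meas_integrable_on[OF time_test_bdd_meas[OF \<psi>]] bdd_meas_integrable_on[OF time_test_bdd_meas[OF \<rho>(1)]])+
    have "integral {0..T} ?\<omega> = 1 * integral {0..T} \<psi> + (- k) * integral {0..T} \<rho>"
      unfolding integral_mult_right[symmetric]
      by (intro Henstock_Kurzweil_Integration.integral_add integrable_on_mult_right i)
    then have z: "integral {0..T} ?\<omega> = 0" using \<rho>(2) by (simp add: k_def)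
    have "0 = integral {0..T} (\<lambda>t. ?\<omega> t * h t)"
      using dh[OF time_test_antiderivative(1)[OF \<omega> z]] time_test_antiderivative(2)[OF \<omega> z] by simp
    also have "\<dots> = integral {0..T} (\<lambda>t. \<psi> t * h t + (- k) * (\<rho> t * h t))"
      by (simp add: algebra_simps)
    also have "\<dots> = integral {0..T} (\<lambda>t. \<psi> t * h t) + (- k) * integral {0..T} (\<lambda>t. \<rho> t * h t)"
      unfolding integral_mult_right[symmetric]
      by (intro Henstock_Kurzweil_Integration.integral_add integrable_on_mult_right int \<psi> \<rho>(1) h)
    finally have "integral {0..T} (\<lambda>t. \<psi> t * h t) = c * integral {0..T} \<psi>" by (simp add: k_def c_def)
    moreover have "integral {0..T} (\<lambda>t. \<psi> t * (h t + (- c))) = integral {0..T} (\<lambda>t. \<psi> t * h t) + integral {0..T} (\<lambda>t. \<psi> t * (- c))"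
      unfolding distrib_left by (intro Henstock_Kurzweil_Integration.integral_add int \<psi> h bdd_meas_const)
    moreover have "integral {0..T} (\<lambda>t. \<psi> t * (- c)) = integral {0..T} \<psi> * (- c)" by (rule integral_mult_left)
    ultimately show "integral {0..T} (\<lambda>t. \<psi> t * (h t + (- c))) = 0" by simp
  qed
  then have "AE t in lebesgue. t \<in> {0<..<T} \<longrightarrow> x t = c - primitive g t"
    by eventually_elim (auto simp: h_def P_def)
  then show ?thesis by blast
qed

text \<open>The regularised helicity has this form. Its scalar ingredients are almost everywhere
  equal to Lipschitz primitives, so an almost everywhere bound on its production integrates to a
  bound on increments, outside a null set chosen before \<open>t1\<close> and
  \<open>t2\<close>.\<close>

lemma bilinear_increment_bound:
  fixes x y g h :: "'i \<Rightarrow> real \<Rightarrow> real" and w c d :: "'i \<Rightarrow> real"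
  assumes S: "finite S" and g: "\<And>j. j \<in> S \<Longrightarrow> bdd_meas (g j)" and h: "\<And>j. j \<in> S \<Longrightarrow> bdd_meas (h j)"
    and x: "\<And>j. j \<in> S \<Longrightarrow> AE t in lebesgue. t \<in> {0<..<T} \<longrightarrow> x j t = c j - primitive (g j) t"
    and y: "\<And>j. j \<in> S \<Longrightarrow> AE t in lebesgue. t \<in> {0<..<T} \<longrightarrow> y j t = d j - primitive (h j) t"
    and m: "m integrable_on {0..T}" "\<And>t. 0 \<le> m t"
    and bd: "AE t in lebesgue. t \<in> {0<..<T} \<longrightarrow> \<bar>\<Sum>j\<in>S. w j * (g j t * y j t + x j t * h j t)\<bar> \<le> m t"
  shows "\<exists>N\<in>null_sets lebesgue. \<forall>t1\<in>{0<..<T} - N. \<forall>t2\<in>{0<..<T} - N.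
     \<bar>(\<Sum>j\<in>S. w j * (x j t1 * y j t1)) - (\<Sum>j\<in>S. w j * (x j t2 * y j t2))\<bar> \<le> integral {0..T} m"
proof -
  have "AE t in lebesgue. t \<in> {0<..<T} \<longrightarrow> (\<forall>j\<in>S. x j t = c j - primitive (g j) t \<and> y j t = d j - primitive (h j) t)"
  proof -
    have "AE t in lebesgue. \<forall>j\<in>S. (t \<in> {0<..<T} \<longrightarrow> x j t = c j - primitive (g j) t) \<and> (t \<in> {0<..<T} \<longrightarrow> y j t = d j - primitive (h j) t)"
      by (rule AE_finite_allI[OF S]) (use x y in auto)
    then show ?thesis by eventually_elim blast
  qed
  then obtain N where N: "N \<in> null_sets lebesgue"
    "\<And>t. t \<in> space lebesgue - N \<Longrightarrow> t \<in> {0<..<T} \<longrightarrow> (\<forall>j\<in>S. x j t = c j - primitive (g j) t \<and> y j t = d j - primitive (h j) t)"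
    by (rule AE_E3) blast
  obtain N' where N': "N' \<in> null_sets lebesgue"
    "\<And>t. t \<in> space lebesgue - N' \<Longrightarrow> t \<in> {0<..<T} \<longrightarrow> \<bar>\<Sum>j\<in>S. w j * (g j t * y j t + x j t * h j t)\<bar> \<le> m t"
    using bd by (rule AE_E3) blast
  \<comment> \<open>The negatives of \<open>x\<close> and \<open>y\<close> have the form of a
    constant plus a primitive, as the product rule expects; the two signs cancel in the
    products.\<close>
  let ?X = "\<lambda>j t. - c j + primitive (g j) t" and ?Y = "\<lambda>j t. - d j + primitive (h j) t"
  let ?E = "\<lambda>t. \<Sum>j\<in>S. w j * (?X j t * ?Y j t)"
  let ?\<Phi> = "\<lambda>t. \<Sum>j\<in>S. w j * (g j t * ?Y j t + ?X j t * h j t)"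
  have xy: "x j t = - ?X j t" "y j t = - ?Y j t" if "t \<notin> N" "t \<in> {0<..<T}" "j \<in> S" for j t
    using N(2)[of t] that by auto
  have bd': "\<bar>\<Sum>j\<in>S. w j * (g j t * y j t + x j t * h j t)\<bar> \<le> m t" if "t \<notin> N'" "t \<in> {0<..<T}" for t
    using N'(2)[of t] that by auto
  have neg: "negligible (N \<union> N' \<union> {0, T})"
    using N(1) N'(1) by (auto simp: negligible_iff_null_sets)
  have main: "\<bar>?E t - ?E s\<bar> \<le> integral {0..T} m" if st: "0 \<le> s" "s \<le> t" "t \<le> T" for s t
  proof -
    have ij: "(\<lambda>r. g j r * ?Y j r + ?X j r * h j r) integrable_on {s..t}" if j: "j \<in> S" for j
    proof -
      have "bdd_meas (\<lambda>r. g j r * (if r \<in> {0..T} then ?Y j r else 0) + (if r \<in> {0..T} then ?X j r else 0) * h j r)"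
        by (intro bdd_meas_add bdd_meas_mult bdd_meas_primitive g h j)
      from bdd_meas_integrable_on[OF this, of s t] show ?thesis
        by (rule integrable_eq) (use st in auto)
    qed
    have "?E t - ?E s = (\<Sum>j\<in>S. w j * integral {s..t} (\<lambda>r. g j r * ?Y j r + ?X j r * h j r))"
      unfolding sum_subtractf[symmetric] right_diff_distrib[symmetric]
      by (intro sum.cong refl arg_cong2[where f = "(*)"] primitive_product_rule g h st)
    also have "\<dots> = integral {s..t} ?\<Phi>"
    proof -
      have "integral {s..t} ?\<Phi> = (\<Sum>j\<in>S. integral {s..t} (\<lambda>r. w j * (g j r * ?Y j r + ?X j r * h j r)))"
        by (rule Henstock_Kurzweil_Integration.integral_sum[OF S integrable_on_mult_right[OF ij]])
      then show ?thesis by (simp only: integral_mult_right)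
    qed
    finally have E: "?E t - ?E s = integral {s..t} ?\<Phi>" .
    have i\<Phi>: "?\<Phi> integrable_on {s..t}"
      by (rule integrable_sum[OF S integrable_on_mult_right[OF ij]])
    \<comment> \<open>Set to 0 on the exceptional null sets and at the end points, so that the bound
      by \<open>m\<close> holds at every point of the interval.\<close>
    let ?\<Psi> = "\<lambda>r. if r \<in> N \<union> N' \<union> {0, T} then 0 else ?\<Phi> r"
    have "?\<Psi> integrable_on {s..t}" by (rule integrable_spike[OF i\<Phi> neg]) auto
    moreover have "m integrable_on {s..t}" by (rule integrable_on_subinterval[OF m(1)]) (use st in auto)
    moreover have "norm (?\<Psi> r) \<le> m r" if r: "r \<in> {s..t}" for r
    proof (cases "r \<in> N \<union> N' \<union> {0, T}")
      case False
      then have r0: "r \<in> {0<..<T}" using r st by auto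
      have "?\<Phi> r = - (\<Sum>j\<in>S. w j * (g j r * y j r + x j r * h j r))"
        unfolding sum_negf[symmetric]
      proof (intro sum.cong refl)
        fix j assume j: "j \<in> S"
        have rN: "r \<notin> N" using False by simp
        show "w j * (g j r * ?Y j r + ?X j r * h j r) = - (w j * (g j r * y j r + x j r * h j r))"
          unfolding xy[OF rN r0 j] by (simp add: algebra_simps)
      qed
      moreover have "r \<notin> N'" using False by simp
      ultimately have "\<bar>?\<Phi> r\<bar> \<le> m r" using bd'[OF _ r0] by simp
      then show ?thesis unfolding real_norm_def if_not_P[OF False] .
    next
      case True
      then show ?thesis using m(2)[of r] by (simp only: if_True norm_zero)
    qed
    ultimately have "norm (integral {s..t} ?\<Psi>) \<le> integral {s..t} m"
      by (intro integral_norm_bound_integral)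
    moreover have "integral {s..t} ?\<Psi> = integral {s..t} ?\<Phi>"
      by (rule integral_spike[OF neg]) auto
    moreover have "integral {s..t} m \<le> integral {0..T} m"
      by (rule integral_subset_le) (use m st \<open>m integrable_on {s..t}\<close> in auto)
    ultimately show ?thesis unfolding E by simp
  qed
  have e: "(\<Sum>j\<in>S. w j * (x j t * y j t)) = ?E t" if "t \<in> {0<..<T} - N" for t
  proof (intro sum.cong refl)
    fix j assume j: "j \<in> S"
    have tN: "t \<notin> N" "t \<in> {0<..<T}" using that by auto
    show "w j * (x j t * y j t) = w j * (?X j t * ?Y j t)"
      unfolding xy[OF tN j] by (simp only: minus_mult_minus)
  qed
  show ?thesis
  proof (intro bexI[OF _ N(1)] ballI)
    fix t1 t2 assume t: "t1 \<in> {0<..<T} - N" "t2 \<in> {0<..<T} - N"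
    show "\<bar>(\<Sum>j\<in>S. w j * (x j t1 * y j t1)) - (\<Sum>j\<in>S. w j * (x j t2 * y j t2))\<bar> \<le> integral {0..T} m"
      unfolding e[OF t(1)] e[OF t(2)] using main[of t1 t2] main[of t2 t1] t by (cases "t1 \<le> t2") (auto simp: abs_minus_commute)
  qed
qed

section \<open>Helicity in Fourier modes\<close>

text \<open>The Boolean \<open>True\<close> stands for the cosine. All \<open>k\<close> serve as
  indices, not one out of each pair \<open>k\<close>, \<open>- k\<close>; this redundancy matches
  the sums over full balls of frequencies.\<close>

definition trigm :: "(int^3) \<times> bool \<Rightarrow> real^3 \<Rightarrow> real" where
  "trigm q = (if snd q then cosm (fst q) else sinm (fst q))"

lemma trigm_simps [simp]: "trigm (k, True) = cosm k" "trigm (k, False) = sinm k"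
  by (simp_all add: trigm_def)

lemma torus_test_trigm [simp]: "torus_test (trigm q)"
  by (cases q; cases "snd q") auto

lemma continuous_trigm: "continuous_on S (trigm q)"
  by (cases "snd q") (auto simp: trigm_def intro!: continuous_intros)

lemma sum_times_bool: "finite S \<Longrightarrow> (\<Sum>q\<in>S \<times> (UNIV :: bool set). F q) = (\<Sum>k\<in>S. F (k, True) + F (k, False))"
proof -
  have "(\<Sum>q\<in>S \<times> (UNIV :: bool set). F q) = (\<Sum>k\<in>S. \<Sum>b\<in>UNIV. F (k, b))"
    unfolding sum.cartesian_product by (simp add: split_def)
  then show ?thesis by (simp add: UNIV_bool add.commute)
qed

lemma fourier_multiplier_trigm:
  assumes "finite S" "\<And>k. k \<notin> S \<Longrightarrow> m k = 0"
  shows "fourier_multiplier m f x = (\<Sum>q\<in>S \<times> UNIV. m (fst q) / cellvol * f (trigm q) * trigm q x)"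
proof -
  have "fourier_multiplier m f x = (\<Sum>k\<in>S. m k / cellvol * (f (cosm k) * cosm k x + f (sinm k) * sinm k x))"
    by (rule fourier_multiplier_trig[OF assms])
  then show ?thesis unfolding sum_times_bool[OF assms(1)] fst_conv trigm_simps by (simp only: distrib_left mult.assoc)
qed

lemma fourier_coeff_dist_of:
  assumes "continuous_on UNIV h"
  shows "fourier_coeff (dist_of h) l = tint (\<lambda>x. complex_of_real (h x) * cism (- l) x) / of_real cellvol"
proof -
  have "tint (\<lambda>x. h x * sin (wavevec (- l) \<bullet> x)) = - tint (\<lambda>x. h x * sin (wavevec l \<bullet> x))"
    by (simp add: wavevec_minus set_lebesgue_integral_def)
  then show ?thesis
    unfolding tint_mult_cism[OF assms] fourier_coeff_def dist_of_def by (simp add: wavevec_minus)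
qed

lemma fourier_multiplier_dist_of_trig:
  assumes m: "\<And>k. m (- k) = m k"
  shows "fourier_multiplier m (dist_of (\<lambda>x. a * cosm k x + b * sinm k x)) = (\<lambda>x. m k * (a * cosm k x + b * sinm k x))"
proof
  fix x
  define z where "z = Complex a (- b)"
  let ?h = "\<lambda>x. a * cosm k x + b * sinm k x"
  have h: "complex_of_real (?h x) = (z / 2) * cism k x + (cnj z / 2) * cism (- k) x" for x
    by (simp add: z_def complex_eq_iff wavevec_minus field_simps)
  have c: "fourier_coeff (dist_of ?h) l = (if l = k then z / 2 else 0) + (if l = - k then cnj z / 2 else 0)" for l
  proof -
    have e: "complex_of_real (?h x) * cism (- l) x = (z / 2) * cism (k - l) x + (cnj z / 2) * cism (- k - l) x" for x
      unfolding h distrib_right mult.assoc cis_mult inner_add_left[symmetric] wavevec_add[symmetric] by simp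
    have "tint (\<lambda>x. complex_of_real (?h x) * cism (- l) x) = (z / 2) * tint (cism (k - l)) + (cnj z / 2) * tint (cism (- k - l))"
      unfolding e by (subst tint_add) (auto intro!: continuous_intros)
    moreover have "k - l = 0 \<longleftrightarrow> l = k" by auto
    moreover have "- k - l = 0 \<longleftrightarrow> l = - k" by (metis diff_eq_diff_eq diff_self eq_iff_diff_eq_0)
    moreover have "complex_of_real cellvol \<noteq> 0" by simp
    ultimately show ?thesis
      by (subst fourier_coeff_dist_of) (auto intro!: continuous_intros simp: tint_cism add_divide_distrib)
  qed
  have "fourier_multiplier m (dist_of ?h) x = (\<Sum>l\<in>{k, - k}. m l * Re (fourier_coeff (dist_of ?h) l * cism l x))"
  proof -
    have "fourier_multiplier m (dist_of ?h) x = (\<Sum>\<^sub>\<infinity>l\<in>{k, - k}. m l * Re (fourier_coeff (dist_of ?h) l * cism l x))"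
      unfolding fourier_multiplier_def by (rule infsum_cong_neutral) (auto simp: c)
    then show ?thesis by simp
  qed
  \<comment> \<open>Two separate deltas cover the case \<open>k = 0\<close> as well, in which both
    conditions hold at the single element of the set.\<close>
  also have "\<dots> = (\<Sum>l\<in>{k, - k}. (if l = k then m l * Re (z / 2 * cism l x) else 0) + (if l = - k then m l * Re (cnj z / 2 * cism l x) else 0))"
  proof -
    have "M * Re (((if P then u else 0) + (if Q then v else 0)) * w) = (if P then M * Re (u * w) else 0) + (if Q then M * Re (v * w) else 0)"
      for M :: real and u v w :: complex and P Q
      by (cases P; cases Q) (simp_all add: algebra_simps)
    then show ?thesis unfolding c by (simp only:)
  qed
  also have "\<dots> = m k * Re (z / 2 * cism k x) + m (- k) * Re (cnj z / 2 * cism (- k) x)"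
  proof -
    have "finite {k, - k}" by simp
    then show ?thesis by (simp only: sum.distrib sum.delta insertI1 insertI2 singletonI if_True)
  qed
  also have "\<dots> = m k * (a * cosm k x + b * sinm k x)"
    by (simp add: m z_def wavevec_minus algebra_simps)
  finally show "fourier_multiplier m (dist_of ?h) x = m k * ?h x" .
qed

lemma inv_neg_laplacian_trig:
  assumes "torus_distribution f"
  shows "inv_neg_laplacian f (\<lambda>x. c * cosm k x) = c * f (cosm k) / (norm (wavevec k))\<^sup>2"
    and "inv_neg_laplacian f (\<lambda>x. c * sinm k x) = c * f (sinm k) / (norm (wavevec k))\<^sup>2"
proof -
  let ?m = "\<lambda>k. if k = 0 then 0 else 1 / (norm (wavevec k))\<^sup>2"
  have m: "?m (- k) = ?m k" for k by (simp add: wavevec_minus)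
  have mk: "?m k = 1 / (norm (wavevec k))\<^sup>2" by simp
  have "inv_neg_laplacian f (\<lambda>x. c * cosm k x) = f (\<lambda>x. (?m k * c) * cosm k x)"
    unfolding inv_neg_laplacian_def using fourier_multiplier_dist_of_trig[where m = ?m and a = c and b = 0 and k = k, OF m]
    by (simp only: mult_zero_left add_0_right mult.assoc)
  also have "\<dots> = (?m k * c) * f (cosm k)" by (rule torus_distribution_scale[OF assms]) simp
  finally show "inv_neg_laplacian f (\<lambda>x. c * cosm k x) = c * f (cosm k) / (norm (wavevec k))\<^sup>2" unfolding mk by simp
  have "inv_neg_laplacian f (\<lambda>x. c * sinm k x) = f (\<lambda>x. (?m k * c) * sinm k x)"
    unfolding inv_neg_laplacian_def using fourier_multiplier_dist_of_trig[where m = ?m and a = 0 and b = c and k = k, OF m]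
    by (simp only: mult_zero_left add_0_left mult.assoc)
  also have "\<dots> = (?m k * c) * f (sinm k)" by (rule torus_distribution_scale[OF assms]) simp
  finally show "inv_neg_laplacian f (\<lambda>x. c * sinm k x) = c * f (sinm k) / (norm (wavevec k))\<^sup>2" unfolding mk by simp
qed

section \<open>Curl, magnetic potential and helicity on single modes\<close>

definition cross_k :: "int^3 \<Rightarrow> (3 \<Rightarrow> real) \<Rightarrow> 3 \<Rightarrow> real" where
  "cross_k k v i = of_int (k $ (i + 1)) * v (i + 2) - of_int (k $ (i + 2)) * v (i + 1)"

lemma magnetic_potential_trig:
  assumes "\<And>i. torus_distribution (B $ i)"
  shows "(magnetic_potential B $ i) (cosm k) = cross_k k (\<lambda>j. (B $ j) (sinm k)) i / (norm (wavevec k))\<^sup>2"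
    and "(magnetic_potential B $ i) (sinm k) = - cross_k k (\<lambda>j. (B $ j) (cosm k)) i / (norm (wavevec k))\<^sup>2"
  unfolding magnetic_potential_def curl_dist_def vec_lambda_beta dir_deriv_cosm dir_deriv_sinm inv_neg_laplacian_trig[OF assms] cross_k_def
  by (simp_all add: diff_divide_distrib add_divide_distrib)

text \<open>The contribution of the wave number \<open>k\<close> to the helicity; it vanishes for \<open>k = 0\<close> because of \<open>x / 0 = 0\<close>.\<close>

definition helicity_mode :: "vdist \<Rightarrow> int^3 \<Rightarrow> real" where
  "helicity_mode B k = 2 / (cellvol * (norm (wavevec k))\<^sup>2) * (\<Sum>i\<in>UNIV. (B $ i) (cosm k) * cross_k k (\<lambda>j. (B $ j) (sinm k)) i)"

lemma cross_k_antisym: "(\<Sum>i\<in>UNIV. p i * cross_k k q i) = - (\<Sum>i\<in>UNIV. q i * cross_k k p i)"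
  unfolding cross_k_def sum_3 ring_3 by (simp add: algebra_simps)

context
  fixes \<eta> :: "real \<Rightarrow> real"
  assumes eta: "lp_cutoff \<eta>"
begin

lemma lp_partial_trigm:
  "lp_partial \<eta> N f x = (\<Sum>q\<in>freqs (4/3 * 2 ^ N) \<times> UNIV. (\<Sum>j<N. lp_symbol \<eta> j (fst q)) / cellvol * f (trigm q) * trigm q x)"
proof -
  have "lp_block \<eta> j f x = (\<Sum>q\<in>freqs (4/3 * 2 ^ N) \<times> UNIV. lp_symbol \<eta> j (fst q) / cellvol * f (trigm q) * trigm q x)" if "j < N" for j
  proof -
    have "lp_symbol \<eta> j k = 0" if "k \<notin> freqs (4/3 * 2 ^ N)" for k
      using lp_support_freqs[OF eta, of j N] that \<open>j < N\<close> by (auto simp: lp_support_def[OF eta])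
    then show ?thesis unfolding lp_block_def by (rule fourier_multiplier_trigm[OF finite_freqs])
  qed
  then have "lp_partial \<eta> N f x = (\<Sum>j<N. \<Sum>q\<in>freqs (4/3 * 2 ^ N) \<times> UNIV. lp_symbol \<eta> j (fst q) / cellvol * f (trigm q) * trigm q x)"
    unfolding lp_partial_def[OF eta] by (intro sum.cong refl) simp
  also have "\<dots> = (\<Sum>q\<in>freqs (4/3 * 2 ^ N) \<times> UNIV. \<Sum>j<N. lp_symbol \<eta> j (fst q) / cellvol * f (trigm q) * trigm q x)"
    by (rule sum.swap)
  finally show ?thesis by (simp only: sum_distrib_right sum_divide_distrib)
qed

text \<open>The curl in the potential exchanges cosine and sine. The two mixed pairings contribute
  equally because \<open>cross_k\<close> is antisymmetric, which is the origin of the factor 2 in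
  \<open>helicity_mode\<close>.\<close>

lemma pairing_magnetic_partial:
  assumes B: "\<And>i. torus_distribution (B $ i)"
  shows "pairing B (\<lambda>x. \<chi> i. \<Sum>j<N. lp_block \<eta> j (magnetic_potential B $ i) x)
    = (\<Sum>k\<in>freqs (4/3 * 2 ^ N). (\<Sum>j<N. lp_symbol \<eta> j k) * helicity_mode B k)"
proof -
  let ?S = "freqs (4/3 * 2 ^ N)"
  let ?\<sigma> = "\<lambda>k. \<Sum>j<N. lp_symbol \<eta> j k"
  let ?A = "magnetic_potential B"
  let ?p = "\<lambda>k j. (B $ j) (cosm k)" and ?q = "\<lambda>k j. (B $ j) (sinm k)"
  have "pairing B (\<lambda>x. \<chi> i. \<Sum>j<N. lp_block \<eta> j (?A $ i) x) = (\<Sum>i\<in>UNIV. (B $ i) (\<lambda>x. \<Sum>q\<in>?S \<times> UNIV. (?\<sigma> (fst q) / cellvol * (?A $ i) (trigm q)) * trigm q x))"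
    unfolding pairing_def vec_lambda_beta lp_partial_def[OF eta, symmetric] lp_partial_trigm ..
  also have "\<dots> = (\<Sum>i\<in>UNIV. \<Sum>q\<in>?S \<times> UNIV. (?\<sigma> (fst q) / cellvol * (?A $ i) (trigm q)) * (B $ i) (trigm q))"
    by (intro sum.cong refl torus_distribution_sum B) simp
  also have "\<dots> = (\<Sum>i\<in>UNIV. \<Sum>k\<in>?S. ?\<sigma> k / (cellvol * (norm (wavevec k))\<^sup>2) * (?p k i * cross_k k (?q k) i - ?q k i * cross_k k (?p k) i))"
    unfolding sum_times_bool[OF finite_freqs] fst_conv trigm_simps magnetic_potential_trig[OF B]
    by (intro sum.cong refl) (simp add: algebra_simps)
  also have "\<dots> = (\<Sum>k\<in>?S. ?\<sigma> k / (cellvol * (norm (wavevec k))\<^sup>2) * ((\<Sum>i\<in>UNIV. ?p k i * cross_k k (?q k) i) - (\<Sum>i\<in>UNIV. ?q k i * cross_k k (?p k) i)))"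
    unfolding sum_subtractf[symmetric] sum_distrib_left by (rule sum.swap)
  also have "\<dots> = (\<Sum>k\<in>?S. ?\<sigma> k * helicity_mode B k)"
  proof (intro sum.cong refl)
    fix k
    show "?\<sigma> k / (cellvol * (norm (wavevec k))\<^sup>2) * ((\<Sum>i\<in>UNIV. ?p k i * cross_k k (?q k) i) - (\<Sum>i\<in>UNIV. ?q k i * cross_k k (?p k) i)) = ?\<sigma> k * helicity_mode B k"
      unfolding helicity_mode_def cross_k_antisym[of "?q k" k "?p k"] by simp
  qed
  finally show ?thesis .
qed

end

text \<open>Dominated convergence for the counting measure: all summation weights of this kind lead
  to the same limit. It is applied to the Littlewood-Paley weights of the bracket and to the Jackson
  weights.\<close>

lemma weighted_sum_tendsto:
  fixes F :: "'a \<Rightarrow> real" and w :: "nat \<Rightarrow> 'a \<Rightarrow> real"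
  assumes F: "integrable (count_space UNIV) F"
    and w: "\<And>n k. n \<ge> n0 \<Longrightarrow> \<bar>w n k\<bar> \<le> 1" "\<And>k. (\<lambda>n. w n k) \<longlonglongrightarrow> 1"
    and S: "\<And>n. finite (S n)" "\<And>n k. k \<notin> S n \<Longrightarrow> w n k = 0"
  shows "(\<lambda>n. \<Sum>k\<in>S n. w n k * F k) \<longlonglongrightarrow> integral\<^sup>L (count_space UNIV) F"
proof -
  have "(\<lambda>n. integral\<^sup>L (count_space UNIV) (\<lambda>k. w (n + n0) k * F k)) \<longlonglongrightarrow> integral\<^sup>L (count_space UNIV) F"
  proof (rule integral_dominated_convergence[where w = "\<lambda>k. \<bar>F k\<bar>"])
    show "AE k in count_space UNIV. (\<lambda>n. w (n + n0) k * F k) \<longlonglongrightarrow> F k"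
    proof (rule AE_I2)
      fix k
      have "(\<lambda>n. w (n + n0) k * F k) \<longlonglongrightarrow> 1 * F k"
        by (intro tendsto_mult tendsto_const LIMSEQ_ignore_initial_segment w(2))
      then show "(\<lambda>n. w (n + n0) k * F k) \<longlonglongrightarrow> F k" by simp
    qed
    show "AE k in count_space UNIV. norm (w (n + n0) k * F k) \<le> \<bar>F k\<bar>" for n
    proof (rule AE_I2)
      fix k
      show "norm (w (n + n0) k * F k) \<le> \<bar>F k\<bar>"
        using mult_right_mono[OF w(1)[of "n + n0" k], of "\<bar>F k\<bar>"] by (simp add: abs_mult)
    qed
  qed (use F in auto)
  moreover have "integral\<^sup>L (count_space UNIV) (\<lambda>k. w n k * F k) = (\<Sum>k\<in>S n. w n k * F k)" for n
  proof -
    have sub: "{k. w n k * F k \<noteq> 0} \<subseteq> S n" using S(2) by auto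
    then have "finite {k. w n k * F k \<noteq> 0}" by (rule finite_subset) (rule S)
    then have "integral\<^sup>L (count_space UNIV) (\<lambda>k. w n k * F k) = (\<Sum>k | w n k * F k \<noteq> 0. w n k * F k)"
      using lebesgue_integral_count_space_finite_support[of UNIV "\<lambda>k. w n k * F k"] by simp
    also have "\<dots> = (\<Sum>k\<in>S n. w n k * F k)"
      by (rule sum.mono_neutral_left[OF S(1) sub]) auto
    finally show ?thesis .
  qed
  ultimately have "(\<lambda>n. \<Sum>k\<in>S (n + n0). w (n + n0) k * F k) \<longlonglongrightarrow> integral\<^sup>L (count_space UNIV) F" by simp
  then show ?thesis by (rule LIMSEQ_offset)
qed

text \<open>The potential gains one derivative, so a mode is of the size of the squared coefficients
  of \<open>B\<close> divided by |k|. For \<open>a \<le> 1/2\<close> this is dominated by the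
  summable weight of the Sobolev space.\<close>

lemma helicity_mode_integrable:
  assumes B: "\<And>i. B $ i \<in> sobolev_space (- a)" and a: "0 \<le> a" "a \<le> 1/2"
  shows "integrable (count_space UNIV) (helicity_mode B)"
proof -
  let ?b = "\<lambda>i k. cmod (fourier_coeff (B $ i) k)"
  let ?W = "\<lambda>k. \<Sum>i\<in>UNIV. (1 + (norm (wavevec k))\<^sup>2) powr (- a) * (?b i k)\<^sup>2"
  have "?W summable_on UNIV"
    unfolding sum_3 by (intro summable_on_add) (use B in \<open>auto simp: sobolev_space_def\<close>)
  then have "(\<lambda>k. (24 * cellvol) * ?W k) summable_on UNIV" by (rule summable_on_cmult_right)
  then have I: "integrable (count_space UNIV) (\<lambda>k. (24 * cellvol) * ?W k)"
    unfolding abs_summable_on_def[symmetric] abs_summable_equivalent[symmetric]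
    by (rule summable_on_iff_abs_summable_on_real[THEN iffD1])
  have "\<bar>helicity_mode B k\<bar> \<le> (24 * cellvol) * ?W k" for k
  proof (cases "k = 0")
    case True
    then show ?thesis by (simp add: helicity_mode_def sum_nonneg)
  next
    case False
    let ?n = "norm (wavevec k)"
    have n1: "1 \<le> ?n"
    proof -
      obtain i where "k $ i \<noteq> 0" using False by (auto simp: vec_eq_iff)
      then have "1 \<le> \<bar>real_of_int (k $ i)\<bar>" by linarith
      also have "\<dots> \<le> ?n" using component_le_norm_cart[of "wavevec k" i] by simp
      finally show ?thesis .
    qed
    define Q where "Q = (\<Sum>i\<in>UNIV. (?b i k)\<^sup>2)"
    have bQ: "(?b i k)\<^sup>2 \<le> Q" for i unfolding Q_def by (rule member_le_sum) auto
    have pq: "\<bar>(B $ i) (cosm k)\<bar> \<le> cellvol * ?b i k" "\<bar>(B $ i) (sinm k)\<bar> \<le> cellvol * ?b i k" for i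
    proof -
      have "Complex ((B $ i) (cosm k)) (- (B $ i) (sinm k)) = of_real cellvol * fourier_coeff (B $ i) k"
        unfolding fourier_coeff_def by simp
      then have "cmod (Complex ((B $ i) (cosm k)) (- (B $ i) (sinm k))) = cellvol * ?b i k"
        by (simp only: norm_mult norm_of_real) simp
      then show "\<bar>(B $ i) (cosm k)\<bar> \<le> cellvol * ?b i k" "\<bar>(B $ i) (sinm k)\<bar> \<le> cellvol * ?b i k"
        using abs_Re_le_cmod[of "Complex ((B $ i) (cosm k)) (- (B $ i) (sinm k))"]
          abs_Im_le_cmod[of "Complex ((B $ i) (cosm k)) (- (B $ i) (sinm k))"] by simp_all
    qed
    have tm: "\<bar>(B $ i) (cosm k) * (of_int (k $ l) * (B $ j) (sinm k))\<bar> \<le> ?n * (cellvol\<^sup>2 * Q)" for i j l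
    proof -
      have "?b i k * ?b j k \<le> Q"
      proof -
        have "0 \<le> (?b i k - ?b j k)\<^sup>2" by simp
        then have "2 * (?b i k * ?b j k) \<le> (?b i k)\<^sup>2 + (?b j k)\<^sup>2" by (simp add: power2_diff)
        then show ?thesis using bQ[of i] bQ[of j] by linarith
      qed
      then have "cellvol\<^sup>2 * (?b i k * ?b j k) \<le> cellvol\<^sup>2 * Q" by (rule mult_left_mono) simp
      moreover have "\<bar>(B $ i) (cosm k)\<bar> * \<bar>(B $ j) (sinm k)\<bar> \<le> (cellvol * ?b i k) * (cellvol * ?b j k)"
        by (intro mult_mono pq) auto
      moreover have "(cellvol * ?b i k) * (cellvol * ?b j k) = cellvol\<^sup>2 * (?b i k * ?b j k)"
        by (simp only: power2_eq_square mult_ac)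
      ultimately have pr: "\<bar>(B $ i) (cosm k)\<bar> * \<bar>(B $ j) (sinm k)\<bar> \<le> cellvol\<^sup>2 * Q"
        by linarith
      have kl: "\<bar>real_of_int (k $ l)\<bar> \<le> ?n" using component_le_norm_cart[of "wavevec k" l] by simp
      have "\<bar>real_of_int (k $ l)\<bar> * (\<bar>(B $ i) (cosm k)\<bar> * \<bar>(B $ j) (sinm k)\<bar>) \<le> ?n * (cellvol\<^sup>2 * Q)"
        by (rule mult_mono[OF kl pr]) auto
      then show ?thesis by (simp only: abs_mult mult_ac)
    qed
    have "\<bar>\<Sum>i\<in>UNIV. (B $ i) (cosm k) * cross_k k (\<lambda>j. (B $ j) (sinm k)) i\<bar> \<le> 6 * (?n * (cellvol\<^sup>2 * Q))"
      unfolding cross_k_def right_diff_distrib sum_3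
      using tm[of 1 "1+1" "1+2"] tm[of 1 "1+2" "1+1"] tm[of 2 "2+1" "2+2"] tm[of 2 "2+2" "2+1"] tm[of 3 "3+1" "3+2"] tm[of 3 "3+2" "3+1"]
      by linarith
    then have "\<bar>helicity_mode B k\<bar> \<le> 2 / (cellvol * ?n\<^sup>2) * (6 * (?n * (cellvol\<^sup>2 * Q)))"
      unfolding helicity_mode_def abs_mult by (intro mult_mono) auto
    also have "\<dots> = 12 * cellvol * Q * (1 / ?n)" using n1 by (simp add: power2_eq_square field_simps)
    also have "1 / ?n \<le> 2 * (1 + ?n\<^sup>2) powr (- a)"
    proof -
      have "(1 + ?n\<^sup>2) powr a \<le> (1 + ?n\<^sup>2) powr (1/2)" using a by (intro powr_mono) auto
      also have "\<dots> = sqrt (1 + ?n\<^sup>2)" by (simp add: powr_half_sqrt)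
      also have "\<dots> \<le> sqrt ((2 * ?n)\<^sup>2)"
      proof (rule real_sqrt_le_mono)
        have "1 \<le> ?n\<^sup>2" using n1 by (rule one_le_power)
        then show "1 + ?n\<^sup>2 \<le> (2 * ?n)\<^sup>2" by (simp add: power_mult_distrib)
      qed
      also have "\<dots> = 2 * ?n" by (simp only: real_sqrt_abs) simp
      finally have "(1 + ?n\<^sup>2) powr a \<le> 2 * ?n" .
      moreover have "0 < (1 + ?n\<^sup>2) powr a"
      proof -
        have "0 < 1 + ?n\<^sup>2" by (intro add_pos_nonneg) auto
        then show ?thesis unfolding powr_gt_zero by (rule less_imp_neq[symmetric])
      qed
      moreover have "1 / y \<le> 2 * inverse P" if "P \<le> 2 * y" "0 < P" "1 \<le> y" for P y :: real
      proof -
        have "0 < y" using that by linarith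
        with that show ?thesis by (simp add: field_simps)
      qed
      ultimately show ?thesis unfolding powr_minus using n1 by blast
    qed
    finally have "\<bar>helicity_mode B k\<bar> \<le> 12 * cellvol * Q * (2 * (1 + ?n\<^sup>2) powr (- a))"
      by (simp add: Q_def sum_nonneg mult_left_mono)
    also have "\<dots> = (24 * cellvol) * ?W k" unfolding Q_def sum_distrib_left sum_distrib_right by (intro sum.cong refl) simp
    finally show ?thesis .
  qed
  then show ?thesis by (intro Bochner_Integration.integrable_bound[OF I]) (auto intro!: AE_I2 order_trans[OF _ abs_ge_self])
qed

section \<open>Helicity production\<close>

lemma cross_k_inner:
  "(\<Sum>i\<in>UNIV. cross_k k a i * cross_k k b i)
    = (norm (wavevec k))\<^sup>2 * (\<Sum>i\<in>UNIV. a i * b i) - (\<Sum>i\<in>UNIV. of_int (k $ i) * a i) * (\<Sum>i\<in>UNIV. of_int (k $ i) * b i)"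
  unfolding power2_norm_eq_inner inner_vec_def cross_k_def sum_3 ring_3 wavevec_nth inner_real_def
  by (simp add: algebra_simps)

lemma cross_k_adjoint: "(\<Sum>i\<in>UNIV. p i * cross_k k (cross_k k c) i) = - (\<Sum>i\<in>UNIV. cross_k k p i * cross_k k c i)"
  unfolding cross_k_def sum_3 ring_3 by (simp add: algebra_simps)

text \<open>Since the modes are divergence free, \<open>k \<times> (k \<times> _)\<close> acts on them as \<open>- \<bar>k\<bar>\<^sup>2\<close>; this removes the inverse Laplacian.\<close>

lemma helicity_production_mode:
  assumes p: "(\<Sum>i\<in>UNIV. of_int (k $ i) * p i) = 0" and q: "(\<Sum>i\<in>UNIV. of_int (k $ i) * q i) = 0"
    and z: "k = 0 \<Longrightarrow> (\<forall>i. p i = 0) \<and> (\<forall>i. q i = 0)"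
  shows "2 / (cellvol * (norm (wavevec k))\<^sup>2) * (\<Sum>i\<in>UNIV. cross_k k cs i * cross_k k q i + p i * (- cross_k k (cross_k k cc) i))
    = 2 / cellvol * (\<Sum>i\<in>UNIV. p i * cc i + q i * cs i)"
proof (cases "k = 0")
  case True
  then show ?thesis using z by simp
next
  case False
  then have n: "(norm (wavevec k))\<^sup>2 \<noteq> 0" by (auto simp: vec_eq_iff)
  have "(\<Sum>i\<in>UNIV. cross_k k cs i * cross_k k q i + p i * (- cross_k k (cross_k k cc) i))
    = (\<Sum>i\<in>UNIV. cross_k k cs i * cross_k k q i) - (\<Sum>i\<in>UNIV. p i * cross_k k (cross_k k cc) i)"
    by (simp add: sum_subtractf)
  also have "\<dots> = (\<Sum>i\<in>UNIV. cross_k k cs i * cross_k k q i) + (\<Sum>i\<in>UNIV. cross_k k p i * cross_k k cc i)"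
    unfolding cross_k_adjoint by simp
  also have "\<dots> = (norm (wavevec k))\<^sup>2 * ((\<Sum>i\<in>UNIV. cs i * q i) + (\<Sum>i\<in>UNIV. p i * cc i))"
    unfolding cross_k_inner p q by (simp add: distrib_left)
  also have "(\<Sum>i\<in>UNIV. cs i * q i) + (\<Sum>i\<in>UNIV. p i * cc i) = (\<Sum>i\<in>UNIV. p i * cc i + q i * cs i)"
    by (simp add: sum.distrib mult.commute)
  finally have e: "(\<Sum>i\<in>UNIV. cross_k k cs i * cross_k k q i + p i * (- cross_k k (cross_k k cc) i))
    = (norm (wavevec k))\<^sup>2 * (\<Sum>i\<in>UNIV. p i * cc i + q i * cs i)" .
  show ?thesis unfolding e using n by simp
qed

context
  fixes \<eta> :: "real \<Rightarrow> real" and B u :: vdist and a r :: real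
  assumes eta: "lp_cutoff \<eta>"
    and B: "\<And>i. B $ i \<in> sobolev_space (- a)" and u: "\<And>i. u $ i \<in> sobolev_space r" and ar: "0 \<le> a" "a \<le> r"
begin

lemma B_dist: "torus_distribution (B $ i)" and u_dist: "torus_distribution (u $ i)"
  using B u by (auto simp: sobolev_space_def)

lemma bony_product_tendsto:
  "(\<lambda>N. tint (\<lambda>x. lp_partial \<eta> N (B $ i) x * lp_partial \<eta> N (u $ j) x * trigm q x)) \<longlonglongrightarrow> bony_product \<eta> (B $ i) (u $ j) (trigm q)"
proof (cases "snd q")
  case True
  then show ?thesis using bony_product_limit(1)[OF eta B u ar, of i j 1 "fst q" 0] by (simp add: trigm_def)
next
  case False
  then show ?thesis using bony_product_limit(1)[OF eta B u ar, of i j 0 "fst q" 1] by (simp add: trigm_def)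
qed

lemma bony_product_bound:
  "\<bar>bony_product \<eta> (B $ i) (u $ j) (trigm q)\<bar> \<le> 12 * cellvol *
      ((sobolev_norm (- a) (B $ i))\<^sup>2 + (2 * (1 + (norm (wavevec (fst q)))\<^sup>2)) powr a * (sobolev_norm r (u $ j))\<^sup>2)"
proof (cases "snd q")
  case True
  then show ?thesis using bony_product_limit(2)[OF eta B u ar, of i j 1 "fst q" 0] by (simp add: trigm_def)
next
  case False
  then show ?thesis using bony_product_limit(2)[OF eta B u ar, of i j 0 "fst q" 1] by (simp add: trigm_def)
qed

text \<open>Linearity is obvious for the integrals of filtered products and passes to their
  limit.\<close>

lemma bony_product_trig_linear:
  "bony_product \<eta> (B $ i) (u $ j) (\<lambda>x. c * cosm k x + d * sinm k x)
    = c * bony_product \<eta> (B $ i) (u $ j) (cosm k) + d * bony_product \<eta> (B $ i) (u $ j) (sinm k)"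
proof (rule LIMSEQ_unique[OF bony_product_limit(1)[OF eta B u ar]])
  let ?F = "\<lambda>N x. lp_partial \<eta> N (B $ i) x * lp_partial \<eta> N (u $ j) x"
  have cF: "continuous_on UNIV (?F N)" for N
    by (intro continuous_intros continuous_lp_partial[OF eta] B_dist u_dist)
  have e: "tint (\<lambda>x. ?F N x * (c * cosm k x + d * sinm k x)) = c * tint (\<lambda>x. ?F N x * cosm k x) + d * tint (\<lambda>x. ?F N x * sinm k x)" for N
  proof -
    have "tint (\<lambda>x. ?F N x * (c * cosm k x + d * sinm k x)) = tint (\<lambda>x. c * (?F N x * cosm k x) + d * (?F N x * sinm k x))"
      by (rule arg_cong[where f = tint]) (simp add: fun_eq_iff distrib_left mult_ac)
    also have "\<dots> = tint (\<lambda>x. c * (?F N x * cosm k x)) + tint (\<lambda>x. d * (?F N x * sinm k x))"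
      by (intro tint_add continuous_on_mult continuous_on_const cF continuous_intros)
    finally show ?thesis by (simp only: set_integral_mult_right)
  qed
  show "(\<lambda>N. tint (\<lambda>x. ?F N x * (c * cosm k x + d * sinm k x))) \<longlonglongrightarrow> c * bony_product \<eta> (B $ i) (u $ j) (cosm k) + d * bony_product \<eta> (B $ i) (u $ j) (sinm k)"
    unfolding e using bony_product_tendsto[of i j "(k, True)"] bony_product_tendsto[of i j "(k, False)"]
    by (intro tendsto_add tendsto_mult tendsto_const) simp_all
qed

lemma bony_cross_trig_linear:
  "(bony_cross \<eta> B u $ i) (\<lambda>x. c * cosm k x + d * sinm k x)
    = c * (bony_cross \<eta> B u $ i) (cosm k) + d * (bony_cross \<eta> B u $ i) (sinm k)"
  unfolding bony_cross_def vec_lambda_beta bony_product_trig_linear by (simp add: algebra_simps)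

lemma flux_tendsto:
  assumes "finite S"
  shows "(\<lambda>N. tint (\<lambda>x. triple (\<lambda>i. lp_partial \<eta> N (B $ i) x) (\<lambda>i. lp_partial \<eta> N (u $ i) x) (\<lambda>i. \<Sum>q\<in>S. \<rho> i q * trigm q x)))
    \<longlonglongrightarrow> (\<Sum>i\<in>UNIV. \<Sum>q\<in>S. \<rho> i q * (bony_cross \<eta> B u $ i) (trigm q))"
proof -
  let ?T = "\<lambda>N i j k. tint (\<lambda>x. lp_partial \<eta> N (B $ i) x * lp_partial \<eta> N (u $ j) x * (\<Sum>q\<in>S. \<rho> k q * trigm q x))"
  let ?L = "\<lambda>i j k. \<Sum>q\<in>S. \<rho> k q * bony_product \<eta> (B $ i) (u $ j) (trigm q)"
  have c: "continuous_on UNIV (lp_partial \<eta> N (B $ i))" "continuous_on UNIV (lp_partial \<eta> N (u $ i))"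
    "continuous_on UNIV (\<lambda>x. \<Sum>q\<in>S. \<rho> i q * trigm q x)" for N i
    by (intro continuous_lp_partial[OF eta] B_dist u_dist continuous_on_sum continuous_on_mult continuous_on_const continuous_trigm)+
  have T: "(\<lambda>N. ?T N i j k) \<longlonglongrightarrow> ?L i j k" for i j k
  proof -
    have "?T N i j k = (\<Sum>q\<in>S. \<rho> k q * tint (\<lambda>x. lp_partial \<eta> N (B $ i) x * lp_partial \<eta> N (u $ j) x * trigm q x))" for N
    proof -
      have "?T N i j k = tint (\<lambda>x. \<Sum>q\<in>S. \<rho> k q * (lp_partial \<eta> N (B $ i) x * lp_partial \<eta> N (u $ j) x * trigm q x))"
        by (rule arg_cong[where f = tint]) (simp only: sum_distrib_left mult_ac)
      also have "\<dots> = (\<Sum>q\<in>S. tint (\<lambda>x. \<rho> k q * (lp_partial \<eta> N (B $ i) x * lp_partial \<eta> N (u $ j) x * trigm q x)))"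
        by (intro tint_sum continuous_on_mult continuous_on_const c continuous_trigm)
      finally show ?thesis by (simp only: set_integral_mult_right)
    qed
    then show ?thesis by (simp only:) (intro tendsto_sum tendsto_mult tendsto_const bony_product_tendsto)
  qed
  have "(\<lambda>N. (?T N 2 3 1 - ?T N 3 2 1) + (?T N 3 1 2 - ?T N 1 3 2) + (?T N 1 2 3 - ?T N 2 1 3))
    \<longlonglongrightarrow> (?L 2 3 1 - ?L 3 2 1) + (?L 3 1 2 - ?L 1 3 2) + (?L 1 2 3 - ?L 2 1 3)"
    by (intro tendsto_add tendsto_diff T)
  moreover have "(?L 2 3 1 - ?L 3 2 1) + (?L 3 1 2 - ?L 1 3 2) + (?L 1 2 3 - ?L 2 1 3) = (\<Sum>i\<in>UNIV. \<Sum>q\<in>S. \<rho> i q * (bony_cross \<eta> B u $ i) (trigm q))"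
    unfolding bony_cross_def vec_lambda_beta sum_3 ring_3 right_diff_distrib sum_subtractf by linarith
  ultimately show ?thesis
    unfolding tint_triple_expand[OF c] by (simp only:)
qed

text \<open>The sum is, up to sign, the time derivative of the regularised helicity. After
  \<open>helicity_production_mode\<close> it is twice the Bony product tested with the Jackson mean
  of \<open>B\<close>, and the flux estimate survives the limit because it is uniform in the filter
  from \<open>N + 7\<close> on.\<close>

lemma helicity_production_bound:
  fixes X Y \<alpha> \<beta> :: real
  assumes XY: "0 < X" "0 < Y"
    and LB: "\<And>i j. tint (\<lambda>x. \<bar>lp_block \<eta> j (B $ i) x\<bar> ^ 3) \<le> ((2 powr \<alpha>) ^ j * X) ^ 3"
    and Lu: "\<And>i j. tint (\<lambda>x. \<bar>lp_block \<eta> j (u $ i) x\<bar> ^ 3) \<le> ((2 powr (- \<beta>)) ^ j * Y) ^ 3"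
    and \<alpha>: "0 < \<alpha>" "\<alpha> < \<beta>" and \<beta>: "\<beta> < 1"
    and div: "\<And>q. (\<Sum>i\<in>UNIV. of_int (fst q $ i) * (B $ i) (trigm q)) = 0"
    and mean: "\<And>i. (B $ i) (\<lambda>x. 1) = 0"
  shows "\<bar>\<Sum>k\<in>freqs (4 * 2 ^ N). jackson (2 ^ N) k * (2 / (cellvol * (norm (wavevec k))\<^sup>2) *
      (\<Sum>i\<in>UNIV. cross_k k (\<lambda>j. (bony_cross \<eta> B u $ j) (sinm k)) i * cross_k k (\<lambda>j. (B $ j) (sinm k)) i
         + (B $ i) (cosm k) * (- cross_k k (cross_k k (\<lambda>j. (bony_cross \<eta> B u $ j) (cosm k))) i)))\<bar>
    \<le> 2 * ((684 * 2 ^ 7 / ((2 powr \<alpha> - 1)\<^sup>2 * (2 powr (1 - \<beta>) - 1)) + 24 / ((2 powr \<alpha> - 1) * (1 - 2 powr (\<alpha> - \<beta>))))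
       * (2 powr (2 * \<alpha> - \<beta>)) ^ 7 * (X\<^sup>2 * Y) * (2 powr (2 * \<alpha> - \<beta>)) ^ N)" (is "\<bar>?P\<bar> \<le> 2 * ?bd")
proof -
  let ?S = "freqs (4 * 2 ^ N)"
  let ?n = "(2::nat) ^ N"
  let ?\<rho> = "\<lambda>i q. jackson ?n (fst q) / cellvol * (B $ i) (trigm q)"
  let ?C = "\<lambda>i q. (bony_cross \<eta> B u $ i) (trigm q)"
  have sin0: "(B $ i) (\<lambda>x. 0) = 0" for i by (rule torus_distribution_zero[OF B_dist])
  have P: "?P = 2 * (\<Sum>i\<in>UNIV. \<Sum>q\<in>?S \<times> UNIV. ?\<rho> i q * ?C i q)"
  proof -
    have e: "2 / (cellvol * (norm (wavevec k))\<^sup>2) *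
      (\<Sum>i\<in>UNIV. cross_k k (\<lambda>j. (bony_cross \<eta> B u $ j) (sinm k)) i * cross_k k (\<lambda>j. (B $ j) (sinm k)) i
         + (B $ i) (cosm k) * (- cross_k k (cross_k k (\<lambda>j. (bony_cross \<eta> B u $ j) (cosm k))) i))
      = 2 / cellvol * (\<Sum>i\<in>UNIV. (B $ i) (cosm k) * ?C i (k, True) + (B $ i) (sinm k) * ?C i (k, False))" for k
      unfolding trigm_simps
    proof (rule helicity_production_mode)
      show "(\<Sum>i\<in>UNIV. of_int (k $ i) * (B $ i) (cosm k)) = 0" using div[of "(k, True)"] by simp
      show "(\<Sum>i\<in>UNIV. of_int (k $ i) * (B $ i) (sinm k)) = 0" using div[of "(k, False)"] by simp
      assume "k = 0"
      then show "(\<forall>i. (B $ i) (cosm k) = 0) \<and> (\<forall>i. (B $ i) (sinm k) = 0)" using mean sin0 by simp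
    qed
    have "?P = (\<Sum>k\<in>?S. jackson ?n k * (2 / cellvol * (\<Sum>i\<in>UNIV. (B $ i) (cosm k) * ?C i (k, True) + (B $ i) (sinm k) * ?C i (k, False))))"
      by (simp only: e)
    also have "\<dots> = (\<Sum>k\<in>?S. \<Sum>i\<in>UNIV. 2 * (?\<rho> i (k, True) * ?C i (k, True) + ?\<rho> i (k, False) * ?C i (k, False)))"
      unfolding sum_distrib_left by (intro sum.cong refl) (simp add: algebra_simps)
    also have "\<dots> = 2 * (\<Sum>i\<in>UNIV. \<Sum>k\<in>?S. ?\<rho> i (k, True) * ?C i (k, True) + ?\<rho> i (k, False) * ?C i (k, False))"
      unfolding sum_distrib_left by (rule sum.swap)
    finally show ?thesis unfolding sum_times_bool[OF finite_freqs] .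
  qed
  have R: "fourier_multiplier (jackson ?n) (B $ i) x = (\<Sum>q\<in>?S \<times> UNIV. ?\<rho> i q * trigm q x)" for i x
  proof (rule fourier_multiplier_trigm[OF finite_freqs])
    fix k assume "k \<notin> ?S"
    then have "\<not> norm (wavevec k) \<le> 4 * real ?n" by (simp add: freqs_def)
    then show "jackson ?n k = 0" using jackson_support by blast
  qed
  have "(\<lambda>J. tint (\<lambda>x. triple (\<lambda>i. lp_partial \<eta> J (B $ i) x) (\<lambda>i. lp_partial \<eta> J (u $ i) x) (\<lambda>i. \<Sum>q\<in>?S \<times> UNIV. ?\<rho> i q * trigm q x)))
    \<longlonglongrightarrow> (\<Sum>i\<in>UNIV. \<Sum>q\<in>?S \<times> UNIV. ?\<rho> i q * ?C i q)"
    by (rule flux_tendsto) simp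
  then have "(\<lambda>J. \<bar>tint (\<lambda>x. triple (\<lambda>i. lp_partial \<eta> J (B $ i) x) (\<lambda>i. lp_partial \<eta> J (u $ i) x) (\<lambda>i. fourier_multiplier (jackson ?n) (B $ i) x))\<bar>)
    \<longlonglongrightarrow> \<bar>\<Sum>i\<in>UNIV. \<Sum>q\<in>?S \<times> UNIV. ?\<rho> i q * ?C i q\<bar>"
    unfolding R by (rule tendsto_rabs)
  moreover have "\<bar>tint (\<lambda>x. triple (\<lambda>i. lp_partial \<eta> J (B $ i) x) (\<lambda>i. lp_partial \<eta> J (u $ i) x) (\<lambda>i. fourier_multiplier (jackson ?n) (B $ i) x))\<bar> \<le> ?bd"
    if "N + 7 \<le> J" for J
    by (rule flux_estimate[OF eta XY B_dist u_dist LB Lu \<alpha> \<beta> that])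
  ultimately have "\<bar>\<Sum>i\<in>UNIV. \<Sum>q\<in>?S \<times> UNIV. ?\<rho> i q * ?C i q\<bar> \<le> ?bd"
    by (intro LIMSEQ_le_const2[where a = ?bd]) blast+
  then show ?thesis unfolding P abs_mult by simp
qed

end

section \<open>Paths of distributions\<close>

lemma norm_fourier_coeff_bound: "\<bar>f (trigm q)\<bar> \<le> cellvol * cmod (fourier_coeff f (fst q))"
proof -
  let ?z = "Complex (f (cosm (fst q))) (- f (sinm (fst q)))"
  have "?z = of_real cellvol * fourier_coeff f (fst q)" unfolding fourier_coeff_def by simp
  then have "cmod ?z = cellvol * cmod (fourier_coeff f (fst q))"
    by (simp only: norm_mult norm_of_real) simp
  moreover have "\<bar>f (trigm q)\<bar> \<le> cmod ?z"
    using abs_Re_le_cmod[of ?z] abs_Im_le_cmod[of ?z] by (cases "snd q") (simp_all add: trigm_def)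
  ultimately show ?thesis by simp
qed

lemma sobolev_norm_nonneg: "0 \<le> sobolev_norm s f"
  unfolding sobolev_norm_def by (intro real_sqrt_ge_zero infsum_nonneg mult_nonneg_nonneg) auto

text \<open>Stated with summability instead of membership in the space, for application to
  differences of distributions as provided by \<open>sobolev_diff_summable\<close>.\<close>

lemma sobolev_coeff_bound:
  assumes "(\<lambda>k. (1 + (norm (wavevec k))\<^sup>2) powr s * (cmod (fourier_coeff f k))\<^sup>2) summable_on UNIV"
  shows "\<bar>f (trigm q)\<bar> \<le> cellvol * ((1 + (norm (wavevec (fst q)))\<^sup>2) powr (- (s / 2)) * sobolev_norm s f)"
proof -
  let ?k = "fst q"
  let ?w = "1 + (norm (wavevec ?k))\<^sup>2"
  let ?g = "\<lambda>k. (1 + (norm (wavevec k))\<^sup>2) powr s * (cmod (fourier_coeff f k))\<^sup>2"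
  have "sum ?g {?k} \<le> infsum ?g UNIV"
    by (rule finite_sum_le_infsum[OF assms]) auto
  then have "sqrt (?w powr s * (cmod (fourier_coeff f ?k))\<^sup>2) \<le> sobolev_norm s f"
    unfolding sobolev_norm_def by (intro real_sqrt_le_mono) simp
  moreover have "sqrt (?w powr s * (cmod (fourier_coeff f ?k))\<^sup>2) = ?w powr (s / 2) * cmod (fourier_coeff f ?k)"
  proof -
    have "?w powr s = (?w powr (s / 2))\<^sup>2" by (simp add: power2_eq_square flip: powr_add)
    then show ?thesis by (simp add: real_sqrt_mult)
  qed
  ultimately have "?w powr (- (s / 2)) * (?w powr (s / 2) * cmod (fourier_coeff f ?k)) \<le> ?w powr (- (s / 2)) * sobolev_norm s f"
    by (intro mult_left_mono) auto
  moreover have "?w powr (- (s / 2)) * (?w powr (s / 2) * y) = y" for y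
  proof -
    have "0 < ?w" by (intro add_pos_nonneg) auto
    then have "?w powr (- (s / 2)) * ?w powr (s / 2) = 1" by (simp flip: powr_add)
    then show ?thesis by (simp only: mult.assoc[symmetric] mult_1_left)
  qed
  ultimately have "cmod (fourier_coeff f ?k) \<le> ?w powr (- (s / 2)) * sobolev_norm s f" by simp
  then have "cellvol * cmod (fourier_coeff f ?k) \<le> cellvol * (?w powr (- (s / 2)) * sobolev_norm s f)"
    by (rule mult_left_mono) simp
  then show ?thesis using norm_fourier_coeff_bound[of f q] by linarith
qed

lemma sobolev_diff_summable:
  assumes "f \<in> sobolev_space s" "g \<in> sobolev_space s"
  shows "(\<lambda>k. (1 + (norm (wavevec k))\<^sup>2) powr s * (cmod (fourier_coeff (f - g) k))\<^sup>2) summable_on UNIV"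
proof -
  let ?w = "\<lambda>k. (1 + (norm (wavevec k))\<^sup>2) powr s"
  let ?h = "\<lambda>k. 2 * (?w k * (cmod (fourier_coeff f k))\<^sup>2) + 2 * (?w k * (cmod (fourier_coeff g k))\<^sup>2)"
  have "?h summable_on UNIV"
    by (intro summable_on_add summable_on_cmult_right) (use assms in \<open>auto simp: sobolev_space_def\<close>)
  then show ?thesis
  proof (rule summable_on_comparison_test)
    fix k
    have "fourier_coeff (f - g) k = fourier_coeff f k - fourier_coeff g k"
      unfolding fourier_coeff_def by (simp add: complex_eq_iff diff_divide_distrib)
    then have "cmod (fourier_coeff (f - g) k) \<le> cmod (fourier_coeff f k) + cmod (fourier_coeff g k)"
      using norm_triangle_ineq4 by metis
    then have "(cmod (fourier_coeff (f - g) k))\<^sup>2 \<le> (cmod (fourier_coeff f k) + cmod (fourier_coeff g k))\<^sup>2"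
      by (rule power_mono) simp
    also have "\<dots> \<le> 2 * (cmod (fourier_coeff f k))\<^sup>2 + 2 * (cmod (fourier_coeff g k))\<^sup>2"
      using zero_le_power2[of "cmod (fourier_coeff f k) - cmod (fourier_coeff g k)"] by (simp add: power2_sum power2_diff)
    finally have "?w k * (cmod (fourier_coeff (f - g) k))\<^sup>2 \<le> ?w k * (2 * (cmod (fourier_coeff f k))\<^sup>2 + 2 * (cmod (fourier_coeff g k))\<^sup>2)"
      by (rule mult_left_mono) simp
    then show "?w k * (cmod (fourier_coeff (f - g) k))\<^sup>2 \<le> ?h k" by (simp add: algebra_simps)
  qed auto
qed

lemma AE_lebesgue_on: "(AE t in lebesgue_on {0<..<T}. P t) \<longleftrightarrow> (AE t in lebesgue. t \<in> {0<..<T::real} \<longrightarrow> P t)"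
  by (rule AE_restrict_space_iff) auto

lemma component_le_vec_norm:
  assumes "\<And>i. 0 \<le> nrm (F $ i)"
  shows "nrm (F $ i) \<le> vec_norm nrm F"
  unfolding vec_norm_def by (rule member_le_sum) (use assms in auto)

text \<open>Testing with a mode is continuous in the Sobolev norm, so the tested simple approximants
  converge almost everywhere to the tested path. The function \<open>lim\<close> of a measurable
  sequence is measurable even where there is no convergence, and completeness of Lebesgue measure
  absorbs the null set.\<close>

lemma sobolev_path_measurable:
  assumes "strongly_measurable T (vec_space (sobolev_space s)) (vec_norm (sobolev_norm s)) f"
  shows "(\<lambda>t. indicator {0<..<T} t * (f t $ i) (trigm q)) \<in> borel_measurable lebesgue"
proof -
  obtain S where S: "\<And>n. simple_function (lebesgue_on {0<..<T}) (S n)" "\<And>n. range (S n) \<subseteq> vec_space (sobolev_space s)"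
      "AE t in lebesgue_on {0<..<T}. (\<lambda>n. vec_norm (sobolev_norm s) (S n t - f t)) \<longlonglongrightarrow> 0"
    and fX: "AE t in lebesgue_on {0<..<T}. f t \<in> vec_space (sobolev_space s)"
    using assms unfolding strongly_measurable_def by blast
  let ?F = "\<lambda>n t. indicator {0<..<T} t * (S n t $ i) (trigm q)"
  have m: "?F n \<in> borel_measurable lebesgue" for n
  proof -
    have "simple_function (lebesgue_on {0<..<T}) (\<lambda>t. (S n t $ i) (trigm q))"
      by (rule simple_function_compose1[OF S(1)])
    then have "(\<lambda>t. (S n t $ i) (trigm q)) \<in> borel_measurable (lebesgue_on {0<..<T})"
      by (rule borel_measurable_simple_function)
    then show ?thesis by (subst (asm) borel_measurable_restrict_space_iff) auto
  qed
  have "(\<lambda>t. lim (\<lambda>n. ?F n t)) \<in> borel_measurable lebesgue"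
    by (rule borel_measurable_lim_metric[OF m])
  moreover have "AE t in lebesgue. lim (\<lambda>n. ?F n t) = indicator {0<..<T} t * (f t $ i) (trigm q)"
    using S(3)[unfolded AE_lebesgue_on] fX[unfolded AE_lebesgue_on]
  proof eventually_elim
    case (elim t)
    show ?case
    proof (cases "t \<in> {0<..<T}")
      case True
      let ?c = "cellvol * (1 + (norm (wavevec (fst q)))\<^sup>2) powr (- (s / 2))"
      have l: "(\<lambda>n. vec_norm (sobolev_norm s) (S n t - f t)) \<longlonglongrightarrow> 0" and ft: "f t $ i \<in> sobolev_space s"
        using elim True by (auto simp: vec_space_def)
      have bd: "\<bar>(S n t $ i) (trigm q) - (f t $ i) (trigm q)\<bar> \<le> ?c * vec_norm (sobolev_norm s) (S n t - f t)" for n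
      proof -
        have "S n t $ i \<in> sobolev_space s" using S(2)[of n] by (auto simp: vec_space_def)
        from sobolev_coeff_bound[OF sobolev_diff_summable[OF this ft], of q]
        have "\<bar>(S n t $ i) (trigm q) - (f t $ i) (trigm q)\<bar> \<le> ?c * sobolev_norm s ((S n t - f t) $ i)"
          by (simp add: mult.assoc)
        also have "\<dots> \<le> ?c * vec_norm (sobolev_norm s) (S n t - f t)"
          by (intro mult_left_mono component_le_vec_norm sobolev_norm_nonneg) auto
        finally show ?thesis .
      qed
      have "(\<lambda>n. ?c * vec_norm (sobolev_norm s) (S n t - f t)) \<longlonglongrightarrow> ?c * 0" by (intro tendsto_mult tendsto_const l)
      then have "(\<lambda>n. ?c * vec_norm (sobolev_norm s) (S n t - f t)) \<longlonglongrightarrow> 0" by simp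
      then have "(\<lambda>n. (S n t $ i) (trigm q) - (f t $ i) (trigm q)) \<longlonglongrightarrow> 0"
        by (rule Lim_null_comparison[rotated]) (use bd in \<open>auto intro!: always_eventually\<close>)
      then have "(\<lambda>n. (S n t $ i) (trigm q)) \<longlonglongrightarrow> (f t $ i) (trigm q)" by (simp add: LIM_zero_iff)
      then show ?thesis using True by (simp add: limI)
    qed simp
  qed
  ultimately show ?thesis by (rule borel_measurable_AE)
qed

text \<open>Allows the integrands of the weak formulation, known only almost everywhere, to be
  replaced by functions in \<open>bdd_meas\<close>. Completeness of Lebesgue measure supplies the
  measurability of \<open>f\<close>.\<close>

lemma LINT_eq_integral_AE:
  assumes h: "bdd_meas h" and ae: "AE t in lebesgue. t \<in> {0<..<T} \<longrightarrow> f t = h t"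
  shows "(LINT t|lebesgue_on {0<..<T}. f t) = integral {0..T} h"
proof -
  have m: "(\<lambda>t. indicator {0<..<T} t * h t) \<in> borel_measurable lebesgue" by (rule bdd_meas_indicator_measurable[OF h])
  have ae': "AE t in lebesgue. indicator {0<..<T} t * h t = indicator {0<..<T} t * f t"
    using ae by eventually_elim (auto simp: indicator_def)
  have "(LINT t|lebesgue_on {0<..<T}. f t) = (LINT t|lebesgue. indicator {0<..<T} t * f t)"
    by (subst integral_restrict_space) auto
  also have "\<dots> = (LINT t|lebesgue. indicator {0<..<T} t * h t)"
    by (rule integral_cong_AE[OF borel_measurable_AE[OF m ae'] m]) (use ae' in \<open>auto elim!: eventually_mono\<close>)
  also have "\<dots> = integral {0..T} h" by (rule bdd_meas_LINT(1)[OF h])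
  finally show ?thesis .
qed

definition zero_vdist :: vdist where "zero_vdist = (\<chi> i. (\<lambda>\<phi>. 0))"

lemma zero_dist_sobolev: "(\<lambda>\<phi>. 0) \<in> sobolev_space s"
proof -
  have "torus_distribution (\<lambda>\<phi>. 0)" unfolding torus_distribution_def by (auto intro!: exI[of _ 0])
  moreover have "fourier_coeff (\<lambda>\<phi>. 0) k = 0" for k by (simp add: fourier_coeff_def complex_eq_iff)
  ultimately show ?thesis by (simp add: sobolev_space_def)
qed

lemma sobolev_norm_zero: "sobolev_norm s (\<lambda>\<phi>. 0) = 0"
proof -
  have "fourier_coeff (\<lambda>\<phi>. 0) k = 0" for k by (simp add: fourier_coeff_def complex_eq_iff)
  then show ?thesis by (simp add: sobolev_norm_def)
qed

text \<open>A path that is essentially bounded in a Sobolev space, modified on a null set so that all pointwise statements hold at every time.\<close>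

definition sobolev_path :: "real \<Rightarrow> (real \<Rightarrow> vdist) \<Rightarrow> bool" where
  "sobolev_path s f \<longleftrightarrow> (\<forall>t i. f t $ i \<in> sobolev_space s) \<and> (\<exists>C. \<forall>t i. sobolev_norm s (f t $ i) \<le> C) \<and>
     (\<forall>i q. (\<lambda>t. (f t $ i) (trigm q)) \<in> borel_measurable lebesgue)"

lemma sobolev_path_modification:
  assumes f: "Linf_sobolev T s f" and P: "AE t in lebesgue. t \<in> {0<..<T} \<longrightarrow> P t"
    and good: "\<And>t. P t \<Longrightarrow> f t \<in> vec_space (sobolev_space s) \<and> vec_norm (sobolev_norm s) (f t) \<le> C"
  shows "sobolev_path s (\<lambda>t. if t \<in> {0<..<T} \<and> P t then f t else zero_vdist)"
  unfolding sobolev_path_def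
proof (intro conjI allI exI[of _ "\<bar>C\<bar>"])
  let ?g = "\<lambda>t. if t \<in> {0<..<T} \<and> P t then f t else zero_vdist"
  fix t i
  show "?g t $ i \<in> sobolev_space s"
    using good[of t] zero_dist_sobolev by (auto simp: vec_space_def zero_vdist_def)
  show "sobolev_norm s (?g t $ i) \<le> \<bar>C\<bar>"
  proof (cases "t \<in> {0<..<T} \<and> P t")
    case True
    then have "sobolev_norm s (f t $ i) \<le> C"
      using good[of t] component_le_vec_norm[of "sobolev_norm s" "f t" i] sobolev_norm_nonneg by force
    then show ?thesis using True by auto
  next
    case False
    then show ?thesis by (auto simp: zero_vdist_def sobolev_norm_zero)
  qed
next
  fix i q
  have "strongly_measurable T (vec_space (sobolev_space s)) (vec_norm (sobolev_norm s)) f"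
    using f by (simp add: Linf_sobolev_def bochner_Linf_def)
  then have "(\<lambda>t. indicator {0<..<T} t * (f t $ i) (trigm q)) \<in> borel_measurable lebesgue"
    by (rule sobolev_path_measurable)
  moreover have "AE t in lebesgue. indicator {0<..<T} t * (f t $ i) (trigm q) = ((if t \<in> {0<..<T} \<and> P t then f t else zero_vdist) $ i) (trigm q)"
    using P by eventually_elim (auto simp: indicator_def zero_vdist_def)
  ultimately show "(\<lambda>t. ((if t \<in> {0<..<T} \<and> P t then f t else zero_vdist) $ i) (trigm q)) \<in> borel_measurable lebesgue"
    by (rule borel_measurable_AE)
qed

lemma sobolev_path_bdd_meas:
  assumes "sobolev_path s f"
  shows "bdd_meas (\<lambda>t. (f t $ i) (trigm q))"
proof -
  obtain C where C: "\<And>t i. sobolev_norm s (f t $ i) \<le> C" using assms unfolding sobolev_path_def by blast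
  have "\<bar>(f t $ i) (trigm q)\<bar> \<le> cellvol * ((1 + (norm (wavevec (fst q)))\<^sup>2) powr (- (s / 2)) * C)" for t
  proof -
    have "(\<lambda>k. (1 + (norm (wavevec k))\<^sup>2) powr s * (cmod (fourier_coeff (f t $ i) k))\<^sup>2) summable_on UNIV"
      using assms by (auto simp: sobolev_path_def sobolev_space_def)
    then have "\<bar>(f t $ i) (trigm q)\<bar> \<le> cellvol * ((1 + (norm (wavevec (fst q)))\<^sup>2) powr (- (s / 2)) * sobolev_norm s (f t $ i))"
      by (rule sobolev_coeff_bound)
    also have "\<dots> \<le> cellvol * ((1 + (norm (wavevec (fst q)))\<^sup>2) powr (- (s / 2)) * C)"
      by (intro mult_left_mono C) auto
    finally show ?thesis .
  qed
  then show ?thesis using assms unfolding bdd_meas_def sobolev_path_def by blast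
qed

lemma bdd_meas_scale: "bdd_meas f \<Longrightarrow> bdd_meas (\<lambda>t. c * f t)"
  by (rule bdd_meas_mult[OF bdd_meas_const])

lemma bdd_meas_diff: "bdd_meas f \<Longrightarrow> bdd_meas g \<Longrightarrow> bdd_meas (\<lambda>t. f t - g t)"
  using bdd_meas_add[OF _ bdd_meas_scale[of g "- 1"], of f] by simp

lemma bdd_meas_sum: "(\<And>i. i \<in> I \<Longrightarrow> bdd_meas (f i)) \<Longrightarrow> bdd_meas (\<lambda>t. \<Sum>i\<in>I. f i t)"
  by (induction I rule: infinite_finite_induct) (auto intro: bdd_meas_add bdd_meas_const)

text \<open>For a fixed filter the tested product is a finite bilinear expression in the modes of
  \<open>B\<close> and \<open>u\<close>, hence measurable in time. The limit exists at every time
  because a \<open>sobolev_path\<close> lies in its space at every time.\<close>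

lemma bony_product_bdd_meas:
  assumes eta: "lp_cutoff \<eta>" and B: "sobolev_path (- a) B" and u: "sobolev_path r u" and ar: "0 \<le> a" "a \<le> r"
  shows "bdd_meas (\<lambda>t. bony_product \<eta> (B t $ i) (u t $ j) (trigm q))"
proof -
  have Bs: "B t $ i \<in> sobolev_space (- a)" and us: "u t $ i \<in> sobolev_space r" for t i
    using B u by (auto simp: sobolev_path_def)
  let ?F = "\<lambda>N t. tint (\<lambda>x. lp_partial \<eta> N (B t $ i) x * lp_partial \<eta> N (u t $ j) x * trigm q x)"
  have "bdd_meas (?F N)" for N
  proof -
    let ?Q = "freqs (4/3 * 2 ^ N) \<times> (UNIV :: bool set)"
    let ?\<nu> = "\<lambda>p. (\<Sum>j<N. lp_symbol \<eta> j (fst p)) / cellvol"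
    have "?F N t = (\<Sum>p\<in>?Q. \<Sum>p'\<in>?Q. (?\<nu> p * ?\<nu> p' * tint (\<lambda>x. trigm p x * trigm p' x * trigm q x)) * ((B t $ i) (trigm p) * (u t $ j) (trigm p')))" for t
    proof -
      have "?F N t = tint (\<lambda>x. \<Sum>p\<in>?Q. \<Sum>p'\<in>?Q. (?\<nu> p * ?\<nu> p' * ((B t $ i) (trigm p) * (u t $ j) (trigm p'))) * (trigm p x * trigm p' x * trigm q x))"
        unfolding lp_partial_trigm[OF eta]
        unfolding sum_product
        unfolding sum_distrib_right
        by (intro arg_cong[where f = tint] ext sum.cong refl) (simp only: mult_ac)
      also have "\<dots> = (\<Sum>p\<in>?Q. \<Sum>p'\<in>?Q. tint (\<lambda>x. (?\<nu> p * ?\<nu> p' * ((B t $ i) (trigm p) * (u t $ j) (trigm p'))) * (trigm p x * trigm p' x * trigm q x)))"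
        by (subst tint_sum, (intro continuous_on_sum continuous_on_mult continuous_on_const continuous_trigm),
            subst tint_sum, (intro continuous_on_mult continuous_on_const continuous_trigm), rule refl)
      finally show ?thesis unfolding set_integral_mult_right by (simp only: mult_ac)
    qed
    then show ?thesis
      by (simp only:) (intro bdd_meas_sum bdd_meas_scale bdd_meas_mult sobolev_path_bdd_meas[OF B] sobolev_path_bdd_meas[OF u])
  qed
  then have "?F N \<in> borel_measurable lebesgue" for N by (simp add: bdd_meas_def)
  moreover have "(\<lambda>N. ?F N t) \<longlonglongrightarrow> bony_product \<eta> (B t $ i) (u t $ j) (trigm q)" for t
    by (rule bony_product_tendsto[OF eta Bs us ar])
  ultimately have m: "(\<lambda>t. bony_product \<eta> (B t $ i) (u t $ j) (trigm q)) \<in> borel_measurable lebesgue"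
    by (rule borel_measurable_LIMSEQ_real[rotated])
  obtain C where C: "\<And>t i. sobolev_norm (- a) (B t $ i) \<le> C" using B unfolding sobolev_path_def by blast
  obtain D where D: "\<And>t i. sobolev_norm r (u t $ i) \<le> D" using u unfolding sobolev_path_def by blast
  have "\<bar>bony_product \<eta> (B t $ i) (u t $ j) (trigm q)\<bar> \<le> 12 * cellvol * (C\<^sup>2 + (2 * (1 + (norm (wavevec (fst q)))\<^sup>2)) powr a * D\<^sup>2)" for t
  proof -
    have "\<bar>bony_product \<eta> (B t $ i) (u t $ j) (trigm q)\<bar> \<le> 12 * cellvol * ((sobolev_norm (- a) (B t $ i))\<^sup>2 + (2 * (1 + (norm (wavevec (fst q)))\<^sup>2)) powr a * (sobolev_norm r (u t $ j))\<^sup>2)"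
      by (rule bony_product_bound[OF eta Bs us ar])
    also have "\<dots> \<le> 12 * cellvol * (C\<^sup>2 + (2 * (1 + (norm (wavevec (fst q)))\<^sup>2)) powr a * D\<^sup>2)"
      by (intro mult_left_mono add_mono power_mono C D sobolev_norm_nonneg) auto
    finally show ?thesis .
  qed
  with m show ?thesis unfolding bdd_meas_def by blast
qed

lemma bony_cross_bdd_meas:
  assumes "lp_cutoff \<eta>" "sobolev_path (- a) B" "sobolev_path r u" "0 \<le> a" "a \<le> r"
  shows "bdd_meas (\<lambda>t. (bony_cross \<eta> (B t) (u t) $ i) (trigm q))"
  unfolding bony_cross_def vec_lambda_beta by (intro bdd_meas_diff bony_product_bdd_meas[OF assms])

section \<open>The differential operators of the weak formulation on single modes\<close>

lemma pairing_axis_trig: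
  assumes "\<And>i. torus_distribution (F $ i)"
  shows "pairing F (\<lambda>x. (z * (c * cosm k x + d * sinm k x)) *\<^sub>R axis a 1) = z * (c * (F $ a) (cosm k) + d * (F $ a) (sinm k))"
proof -
  have "(F $ i) (\<lambda>x. ((z * (c * cosm k x + d * sinm k x)) *\<^sub>R axis a 1) $ i) = (if i = a then z * (c * (F $ a) (cosm k) + d * (F $ a) (sinm k)) else 0)" for i
  proof (cases "i = a")
    case True
    have "(F $ a) (\<lambda>x. (z * c) * cosm k x + (z * d) * sinm k x) = (z * c) * (F $ a) (cosm k) + (z * d) * (F $ a) (sinm k)"
      by (rule torus_distribution_trig[OF assms])
    then show ?thesis using True by (simp add: axis_def algebra_simps)
  next
    case False
    then show ?thesis using torus_distribution_zero[OF assms] by (simp add: axis_def)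
  qed
  then show ?thesis unfolding pairing_def by simp
qed

lemma dir_deriv_scaled_trig:
  "dir_deriv v (\<lambda>y. z * (c * cosm k y + d * sinm k y)) = (\<lambda>x. (wavevec k \<bullet> v * z) * (d * cosm k x + (- c) * sinm k x))"
  using dir_deriv_trig[of v "z * c" "wavevec k" "z * d"] by (simp add: fun_eq_iff algebra_simps)

lemma curl_axis_trig:
  "curl (\<lambda>x. (z * (c * cosm k x + d * sinm k x)) *\<^sub>R axis a 1) x $ i
    = (if i = a + 1 then of_int (k $ (a + 2)) * z else if i = a + 2 then - of_int (k $ (a + 1)) * z else 0) * (d * cosm k x + (- c) * sinm k x)"
proof -
  have comp: "(\<lambda>y. ((z * (c * cosm k y + d * sinm k y)) *\<^sub>R axis a 1) $ j) = (\<lambda>y. (if j = a then z else 0) * (c * cosm k y + d * sinm k y))" for j :: 3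
    by (auto simp: axis_def)
  have e: "i + 2 = a \<longleftrightarrow> i = a + 1" "i + 1 = a \<longleftrightarrow> i = a + 2"
    using exhaust_3[of i] exhaust_3[of a] by (elim disjE; simp)+
  have e2: "a + 1 \<noteq> a + 2" "a + 1 + 1 = a + 2" "a + 2 + 2 = a + 1"
    using exhaust_3[of a] by (elim disjE; simp)+
  have "curl (\<lambda>x. (z * (c * cosm k x + d * sinm k x)) *\<^sub>R axis a 1) x $ i
    = (of_int (k $ (i + 1)) * (if i + 2 = a then z else 0) - of_int (k $ (i + 2)) * (if i + 1 = a then z else 0)) * (d * cosm k x + (- c) * sinm k x)"
    unfolding curl_def vec_lambda_beta comp dir_deriv_scaled_trig wavevec_inner_axis by (simp only: left_diff_distrib mult_1_right)
  also have "of_int (k $ (i + 1)) * (if i + 2 = a then z else 0) - of_int (k $ (i + 2)) * (if i + 1 = a then z else 0)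
    = (if i = a + 1 then of_int (k $ (a + 2)) * z else if i = a + 2 then - of_int (k $ (a + 1)) * z else 0)"
  proof -
    consider "i = a + 1" | "i = a + 2" | "i \<noteq> a + 1" "i \<noteq> a + 2" by blast
    then show ?thesis
    proof cases
      case 1
      then show ?thesis unfolding e by (simp only: e2 if_True if_False refl simp_thms)
    next
      case 2
      then show ?thesis unfolding e by (simp only: e2 e2(1)[symmetric] if_True if_False refl simp_thms)
    next
      case 3
      then show ?thesis unfolding e by (simp only: if_False)
    qed
  qed
  finally show ?thesis .
qed

lemma numerals_3: "(4::3) = 1" "(5::3) = 2"
  by simp_all

text \<open>The linearity assumption concerns only the two modes of one frequency; in this form
  \<open>bony_cross_trig_linear\<close> supplies it for the Bony product.\<close>

lemma pairing_curl_trig: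
  assumes lin: "\<And>i c d. (F $ i) (\<lambda>x. c * cosm k x + d * sinm k x) = c * (F $ i) (cosm k) + d * (F $ i) (sinm k)"
  shows "pairing F (curl (\<lambda>x. (z * (c * cosm k x + d * sinm k x)) *\<^sub>R axis a 1))
    = z * (c * cross_k k (\<lambda>j. (F $ j) (sinm k)) a - d * cross_k k (\<lambda>j. (F $ j) (cosm k)) a)"
proof -
  let ?w = "\<lambda>i. if i = a + 1 then of_int (k $ (a + 2)) * z else if i = a + 2 then - of_int (k $ (a + 1)) * z else 0"
  have "pairing F (curl (\<lambda>x. (z * (c * cosm k x + d * sinm k x)) *\<^sub>R axis a 1)) = (\<Sum>i\<in>UNIV. (F $ i) (\<lambda>x. (?w i * d) * cosm k x + (?w i * (- c)) * sinm k x))"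
    unfolding pairing_def curl_axis_trig by (simp only: distrib_left mult.assoc)
  also have "\<dots> = (\<Sum>i\<in>UNIV. ?w i * (d * (F $ i) (cosm k) - c * (F $ i) (sinm k)))"
    unfolding lin by (intro sum.cong refl) (simp only: mult.assoc mult_minus_left mult_minus_right right_diff_distrib add_uminus_conv_diff)
  also have "\<dots> = z * (c * cross_k k (\<lambda>j. (F $ j) (sinm k)) a - d * cross_k k (\<lambda>j. (F $ j) (cosm k)) a)"
    using exhaust_3[of a] by (elim disjE) (simp_all add: sum_3 cross_k_def ring_3 numerals_3 algebra_simps)
  finally show ?thesis .
qed

lemma pairing_gradient_trig:
  assumes "\<And>i. torus_distribution (F $ i)"
  shows "pairing F (gradient (\<lambda>x. z * (c * cosm k x + d * sinm k x)))
    = z * (d * (\<Sum>i\<in>UNIV. of_int (k $ i) * (F $ i) (cosm k)) - c * (\<Sum>i\<in>UNIV. of_int (k $ i) * (F $ i) (sinm k)))"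
proof -
  have "pairing F (gradient (\<lambda>x. z * (c * cosm k x + d * sinm k x))) = (\<Sum>i\<in>UNIV. (F $ i) (\<lambda>x. (of_int (k $ i) * z * d) * cosm k x + (of_int (k $ i) * z * (- c)) * sinm k x))"
    unfolding pairing_def gradient_def vec_lambda_beta dir_deriv_scaled_trig wavevec_inner_axis by (simp add: algebra_simps)
  also have "\<dots> = (\<Sum>i\<in>UNIV. (of_int (k $ i) * z * d) * (F $ i) (cosm k) + (of_int (k $ i) * z * (- c)) * (F $ i) (sinm k))"
    unfolding torus_distribution_trig[OF assms] ..
  also have "\<dots> = z * (d * (\<Sum>i\<in>UNIV. of_int (k $ i) * (F $ i) (cosm k)) - c * (\<Sum>i\<in>UNIV. of_int (k $ i) * (F $ i) (sinm k)))"
    by (simp add: sum_distrib_left sum.distrib sum_subtractf sum_negf algebra_simps)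
  finally show ?thesis .
qed

section \<open>Time evolution and conservation\<close>

text \<open>The weak formulation, tested with a time function times one mode in direction
  \<open>i\<close>, says that the weak time derivative of the tested \<open>B\<close> is minus a
  bounded measurable function; \<open>du_bois_reymond\<close> integrates this.\<close>

lemma weak_mode:
  assumes eta: "lp_cutoff \<eta>" and T: "0 < T"
    and weak: "functional_weak_solution \<eta> T \<alpha> u B"
    and B': "sobolev_path (- a) B'" and u': "sobolev_path r u'" and ar: "0 \<le> a" "a \<le> r"
    and eq: "AE t in lebesgue. t \<in> {0<..<T} \<longrightarrow> B t = B' t \<and> u t = u' t"
  shows "\<exists>c0. AE t in lebesgue. t \<in> {0<..<T} \<longrightarrow> c * (B' t $ i) (cosm k) + d * (B' t $ i) (sinm k)
      = c0 - primitive (\<lambda>t. c * cross_k k (\<lambda>j. (bony_cross \<eta> (B' t) (u' t) $ j) (sinm k)) i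
                          - d * cross_k k (\<lambda>j. (bony_cross \<eta> (B' t) (u' t) $ j) (cosm k)) i) t"
proof -
  have Bs: "B' t $ j \<in> sobolev_space (- a)" and us: "u' t $ j \<in> sobolev_space r" for t j
    using B' u' by (auto simp: sobolev_path_def)
  have Bd: "torus_distribution (B' t $ j)" for t j using Bs[of t j] by (simp add: sobolev_space_def)
  define x where "x = (\<lambda>t. c * (B' t $ i) (cosm k) + d * (B' t $ i) (sinm k))"
  define g where "g = (\<lambda>t. c * cross_k k (\<lambda>j. (bony_cross \<eta> (B' t) (u' t) $ j) (sinm k)) i
                          - d * cross_k k (\<lambda>j. (bony_cross \<eta> (B' t) (u' t) $ j) (cosm k)) i)"
  have bp: "bdd_meas (\<lambda>t. (B' t $ j) (cosm k))" "bdd_meas (\<lambda>t. (B' t $ j) (sinm k))" for j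
    using sobolev_path_bdd_meas[OF B', of j "(k, True)"] sobolev_path_bdd_meas[OF B', of j "(k, False)"] by simp_all
  have bc: "bdd_meas (\<lambda>t. (bony_cross \<eta> (B' t) (u' t) $ j) (cosm k))" "bdd_meas (\<lambda>t. (bony_cross \<eta> (B' t) (u' t) $ j) (sinm k))" for j
    using bony_cross_bdd_meas[OF eta B' u' ar, of j "(k, True)"] bony_cross_bdd_meas[OF eta B' u' ar, of j "(k, False)"] by simp_all
  have x: "bdd_meas x" unfolding x_def by (intro bdd_meas_add bdd_meas_scale bp)
  have g: "bdd_meas g" unfolding g_def cross_k_def by (intro bdd_meas_diff bdd_meas_scale bc)
  have "integral {0..T} (\<lambda>t. dir_deriv 1 \<psi> t * x t) = integral {0..T} (\<lambda>t. \<psi> t * g t)" if \<psi>: "time_test T \<psi>" for \<psi>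
  proof -
    let ?\<Psi> = "\<lambda>(t::real, x). (\<psi> t * (c * cosm k x + d * sinm k x)) *\<^sub>R (axis i 1 :: real^3)"
    have s: "smooth \<psi>" by (rule time_test_smooth[OF \<psi>])
    obtain p q where "0 < p" "q < T" "\<And>t. t \<notin> {p..q} \<Longrightarrow> \<psi> t = 0" using \<psi> unfolding time_test_def by blast
    then have st: "spacetime_test T ?\<Psi>" by (rule spacetime_test_trig[OF s])
    have "(LINT t|lebesgue_on {0<..<T}. pairing (B t) (\<lambda>x. dir_deriv (1, 0) ?\<Psi> (t, x)))
        = (LINT t|lebesgue_on {0<..<T}. pairing (bony_cross \<eta> (B t) (u t)) (curl (\<lambda>x. ?\<Psi> (t, x))))"
      using weak st unfolding functional_weak_solution_def by fastforce
    moreover have "(LINT t|lebesgue_on {0<..<T}. pairing (B t) (\<lambda>x. dir_deriv (1, 0) ?\<Psi> (t, x))) = integral {0..T} (\<lambda>t. dir_deriv 1 \<psi> t * x t)"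
    proof (rule LINT_eq_integral_AE)
      show "bdd_meas (\<lambda>t. dir_deriv 1 \<psi> t * x t)" by (intro bdd_meas_mult time_test_bdd_meas[OF time_test_deriv[OF \<psi>]] x)
      show "AE t in lebesgue. t \<in> {0<..<T} \<longrightarrow> pairing (B t) (\<lambda>x. dir_deriv (1, 0) ?\<Psi> (t, x)) = dir_deriv 1 \<psi> t * x t"
        using eq
      proof eventually_elim
        case (elim t)
        show ?case
        proof
          assume "t \<in> {0<..<T}"
          with elim have "B t = B' t" by blast
          then show "pairing (B t) (\<lambda>x. dir_deriv (1, 0) ?\<Psi> (t, x)) = dir_deriv 1 \<psi> t * x t"
            unfolding dir_deriv_spacetime_trig[OF s] x_def by (simp only: pairing_axis_trig[OF Bd])
        qed
      qed
    qed
    moreover have "(LINT t|lebesgue_on {0<..<T}. pairing (bony_cross \<eta> (B t) (u t)) (curl (\<lambda>x. ?\<Psi> (t, x)))) = integral {0..T} (\<lambda>t. \<psi> t * g t)"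
    proof (rule LINT_eq_integral_AE)
      show "bdd_meas (\<lambda>t. \<psi> t * g t)" by (intro bdd_meas_mult time_test_bdd_meas[OF \<psi>] g)
      have pw: "pairing (bony_cross \<eta> (B' t) (u' t)) (curl (\<lambda>x. ?\<Psi> (t, x))) = \<psi> t * g t" for t
        unfolding prod.case g_def by (rule pairing_curl_trig[OF bony_cross_trig_linear[OF eta Bs us ar]])
      show "AE t in lebesgue. t \<in> {0<..<T} \<longrightarrow> pairing (bony_cross \<eta> (B t) (u t)) (curl (\<lambda>x. ?\<Psi> (t, x))) = \<psi> t * g t"
        using eq
      proof eventually_elim
        case (elim t)
        show ?case
        proof
          assume "t \<in> {0<..<T}"
          with elim have "B t = B' t" "u t = u' t" by blast+
          then show "pairing (bony_cross \<eta> (B t) (u t)) (curl (\<lambda>x. ?\<Psi> (t, x))) = \<psi> t * g t"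
            using pw[of t] by (simp only:)
        qed
      qed
    qed
    ultimately show ?thesis by (simp only:)
  qed
  from du_bois_reymond[OF eta T x g this] show ?thesis unfolding x_def g_def .
qed

lemma weak_divergence:
  assumes eta: "lp_cutoff \<eta>" and weak: "functional_weak_solution \<eta> T \<alpha> u B"
    and B': "sobolev_path s B'" and eq: "AE t in lebesgue. t \<in> {0<..<T} \<longrightarrow> B t = B' t"
  shows "AE t in lebesgue. t \<in> {0<..<T} \<longrightarrow> (\<Sum>i\<in>UNIV. of_int (fst q $ i) * (B' t $ i) (trigm q)) = 0"
proof (rule fundamental_lemma_on[OF eta])
  have Bd: "torus_distribution (B' t $ j)" for t j using B' by (auto simp: sobolev_path_def sobolev_space_def)
  define f where "f = (\<lambda>t. \<Sum>i\<in>UNIV. of_int (fst q $ i) * (B' t $ i) (trigm q))"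
  have f: "bdd_meas f" unfolding f_def by (intro bdd_meas_sum bdd_meas_scale sobolev_path_bdd_meas[OF B'])
  then show "bdd_meas (\<lambda>t. \<Sum>i\<in>UNIV. of_int (fst q $ i) * (B' t $ i) (trigm q))" unfolding f_def .
  fix \<psi> assume \<psi>: "time_test T \<psi>"
  define k where "k = fst q"
  \<comment> \<open>The gradient exchanges the two modes, so the sine is inserted to reach the
    cosine mode and minus the cosine to reach the sine mode.\<close>
  define c where "c = (if snd q then 0 else (-1) :: real)"
  define d where "d = (if snd q then 1 else 0 :: real)"
  let ?\<phi> = "\<lambda>(t::real, x). (\<psi> t * (c * cosm k x + d * sinm k x)) *\<^sub>R (1::real)"
  have s: "smooth \<psi>" by (rule time_test_smooth[OF \<psi>])
  obtain a b where "0 < a" "b < T" "\<And>t. t \<notin> {a..b} \<Longrightarrow> \<psi> t = 0" using \<psi> unfolding time_test_def by blast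
  then have "spacetime_test T ?\<phi>" by (rule spacetime_test_trig[OF s])
  then have "(LINT t|lebesgue_on {0<..<T}. pairing (B t) (gradient (\<lambda>x. ?\<phi> (t, x)))) = 0"
    using weak unfolding functional_weak_solution_def by blast
  moreover have "(LINT t|lebesgue_on {0<..<T}. pairing (B t) (gradient (\<lambda>x. ?\<phi> (t, x)))) = integral {0..T} (\<lambda>t. \<psi> t * f t)"
  proof (rule LINT_eq_integral_AE)
    show "bdd_meas (\<lambda>t. \<psi> t * f t)" by (intro bdd_meas_mult time_test_bdd_meas[OF \<psi>] f)
    have pw: "pairing (B' t) (gradient (\<lambda>x. ?\<phi> (t, x))) = \<psi> t * f t" for t
      unfolding prod.case real_scaleR_def mult_1_right pairing_gradient_trig[OF Bd]
      by (simp add: f_def c_def d_def k_def trigm_def)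
    show "AE t in lebesgue. t \<in> {0<..<T} \<longrightarrow> pairing (B t) (gradient (\<lambda>x. ?\<phi> (t, x))) = \<psi> t * f t"
      using eq
    proof eventually_elim
      case (elim t)
      show ?case
      proof
        assume "t \<in> {0<..<T}"
        with elim have "B t = B' t" by blast
        then show "pairing (B t) (gradient (\<lambda>x. ?\<phi> (t, x))) = \<psi> t * f t"
          using pw[of t] by (simp only:)
      qed
    qed
  qed
  ultimately show "integral {0..T} (\<lambda>t. \<psi> t * (\<Sum>i\<in>UNIV. of_int (fst q $ i) * (B' t $ i) (trigm q))) = 0"
    unfolding f_def by (simp only:)
qed

text \<open>Flattens the mixed product into a weighted sum of products of two scalars, the form that
  \<open>bilinear_increment_bound\<close> requires. The Boolean selects one of the two terms in a
  component of \<open>cross_k\<close>.\<close>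

lemma cross_k_bilinear_sum:
  assumes "finite S"
  shows "(\<Sum>(k, i, s)\<in>S \<times> (UNIV :: 3 set) \<times> (UNIV :: bool set). W k * (if s then of_int (k $ (i + 1)) else - of_int (k $ (i + 2))) * (X k i * Y k (if s then i + 2 else i + 1)))
    = (\<Sum>k\<in>S. W k * (\<Sum>i\<in>UNIV. X k i * cross_k k (Y k) i))"
proof -
  have "(\<Sum>(k, i, s)\<in>S \<times> (UNIV :: 3 set) \<times> (UNIV :: bool set). W k * (if s then of_int (k $ (i + 1)) else - of_int (k $ (i + 2))) * (X k i * Y k (if s then i + 2 else i + 1)))
    = (\<Sum>k\<in>S. \<Sum>i\<in>UNIV. \<Sum>s\<in>UNIV. W k * (if s then of_int (k $ (i + 1)) else - of_int (k $ (i + 2))) * (X k i * Y k (if s then i + 2 else i + 1)))"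
    by (simp only: sum.cartesian_product split_def)
  also have "\<dots> = (\<Sum>k\<in>S. W k * (\<Sum>i\<in>UNIV. X k i * cross_k k (Y k) i))"
    unfolding sum_distrib_left UNIV_bool by (intro sum.cong refl) (simp add: cross_k_def algebra_simps)
  finally show ?thesis .
qed

text \<open>The bracket is defined by Littlewood-Paley sums, whereas the evolution is computed with
  Jackson weights. Both converge to the sum of the absolutely convergent series of modes.\<close>

lemma dual_bracket_helicity:
  assumes eta: "lp_cutoff \<eta>" and B: "\<And>i. B $ i \<in> sobolev_space (- a)" and a: "0 \<le> a" "a \<le> 1/2"
  shows "(\<lambda>N. \<Sum>k\<in>freqs (4 * 2 ^ N). jackson (2 ^ N) k * helicity_mode B k) \<longlonglongrightarrow> dual_bracket \<eta> B (magnetic_potential B)"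
proof -
  have Bd: "torus_distribution (B $ i)" for i using B[of i] by (simp add: sobolev_space_def)
  note I = helicity_mode_integrable[OF B a]
  have "(\<lambda>N. \<Sum>k\<in>freqs (4/3 * 2 ^ N). (\<Sum>j<N. lp_symbol \<eta> j k) * helicity_mode B k) \<longlonglongrightarrow> integral\<^sup>L (count_space UNIV) (helicity_mode B)"
  proof (rule weighted_sum_tendsto[OF I, where ?n0.0 = 0])
    show "\<bar>\<Sum>j<n. lp_symbol \<eta> j k\<bar> \<le> 1" for n k
      using sum_lp_symbol_bounds[OF eta, of k n] by simp
    show "(\<lambda>n. \<Sum>j<n. lp_symbol \<eta> j k) \<longlonglongrightarrow> 1" for k by (rule sum_lp_symbol_tendsto[OF eta])
    show "(\<Sum>j<n. lp_symbol \<eta> j k) = 0" if "k \<notin> freqs (4/3 * 2 ^ n)" for n k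
    proof (rule sum.neutral, rule ballI)
      fix j assume "j \<in> {..<n}"
      then show "lp_symbol \<eta> j k = 0" using lp_support_freqs[OF eta, of j n] that by (auto simp: lp_support_def[OF eta])
    qed
  qed simp
  then have "dual_bracket \<eta> B (magnetic_potential B) = integral\<^sup>L (count_space UNIV) (helicity_mode B)"
    unfolding dual_bracket_def pairing_magnetic_partial[OF eta Bd] by (rule limI)
  moreover have "(\<lambda>N. \<Sum>k\<in>freqs (4 * 2 ^ N). jackson (2 ^ N) k * helicity_mode B k) \<longlonglongrightarrow> integral\<^sup>L (count_space UNIV) (helicity_mode B)"
  proof (rule weighted_sum_tendsto[OF I, where ?n0.0 = 0])
    show "\<bar>jackson (2 ^ n) k\<bar> \<le> 1" for n k using jackson_bounds[of "2 ^ n" k] by simp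
    have "strict_mono (\<lambda>n. (2::nat) ^ n)" by (rule strict_monoI) simp
    from LIMSEQ_subseq_LIMSEQ[OF jackson_tendsto this] show "(\<lambda>n. jackson (2 ^ n) k) \<longlonglongrightarrow> 1" for k by (simp add: o_def)
    show "jackson (2 ^ n) k = 0" if "k \<notin> freqs (4 * 2 ^ n)" for n k
    proof -
      have "\<not> norm (wavevec k) \<le> 4 * real (2 ^ n)" using that by (simp add: freqs_def)
      then show ?thesis using jackson_support by blast
    qed
  qed simp
  ultimately show ?thesis by simp
qed

lemma square_mult_le_cubes:
  fixes x y :: real
  assumes "0 \<le> x" "0 \<le> y"
  shows "x\<^sup>2 * y \<le> x ^ 3 + y ^ 3"
proof (cases "x \<le> y")
  case True
  then have "x\<^sup>2 * y \<le> y\<^sup>2 * y" using assms by (intro mult_right_mono power_mono) auto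
  then show ?thesis using assms by (simp add: power2_eq_square power3_eq_cube add_increasing)
next
  case False
  then have "x\<^sup>2 * y \<le> x\<^sup>2 * x" using assms by (intro mult_left_mono) auto
  then show ?thesis using assms by (simp add: power2_eq_square power3_eq_cube add_increasing2)
qed

lemma cube_add_one_le:
  fixes x :: real
  assumes "0 \<le> x"
  shows "(x + 1) ^ 3 \<le> 4 * (x ^ 3 + 1)"
proof -
  have "4 * (x ^ 3 + 1) - (x + 1) ^ 3 = 3 * ((x + 1) * (x - 1)\<^sup>2)"
    by (simp add: power2_eq_square power3_eq_cube algebra_simps)
  moreover have "0 \<le> (x + 1) * (x - 1)\<^sup>2" using assms by simp
  ultimately show ?thesis by linarith
qed

text \<open>The factor \<open>2 powr s\<close> comes from the numbering of blocks: block
  \<open>j\<close> carries the weight of the index \<open>j - 1\<close>.\<close>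

lemma besov_vec_block_bound:
  assumes eta: "lp_cutoff \<eta>" and F: "F \<in> vec_space (besov_space \<eta> s 3)"
  shows "tint (\<lambda>x. \<bar>lp_block \<eta> j (F $ i) x\<bar> ^ 3) \<le> (2 powr s * (2 powr (- s)) ^ j * vec_norm (besov_norm \<eta> s 3) F) ^ 3"
    and "0 \<le> vec_norm (besov_norm \<eta> s 3) F"
proof -
  have Fi: "F $ i \<in> besov_space \<eta> s 3" for i using F by (simp add: vec_space_def)
  have nn: "0 \<le> besov_norm \<eta> s 3 (F $ i)" for i by (rule besov_block_bound(2)[OF eta Fi])
  show "0 \<le> vec_norm (besov_norm \<eta> s 3) F" unfolding vec_norm_def by (intro sum_nonneg nn)
  have e: "2 powr (- s * (real j - 1)) = 2 powr s * (2 powr (- s)) ^ j"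
  proof -
    have "2 powr (- s * (real j - 1)) = 2 powr (s + - s * real j)" by (simp add: algebra_simps)
    then show ?thesis by (simp only: powr_add powr_mult_nat)
  qed
  have "tint (\<lambda>x. \<bar>lp_block \<eta> j (F $ i) x\<bar> ^ 3) \<le> (2 powr (- s * (real j - 1)) * besov_norm \<eta> s 3 (F $ i)) ^ 3"
    by (rule besov_block_bound(1)[OF eta Fi])
  also have "\<dots> \<le> (2 powr (- s * (real j - 1)) * vec_norm (besov_norm \<eta> s 3) F) ^ 3"
    by (intro power_mono mult_left_mono component_le_vec_norm nn mult_nonneg_nonneg) auto
  finally show "tint (\<lambda>x. \<bar>lp_block \<eta> j (F $ i) x\<bar> ^ 3) \<le> (2 powr s * (2 powr (- s)) ^ j * vec_norm (besov_norm \<eta> s 3) F) ^ 3"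
    unfolding e .
qed

text \<open>Needed to have the divergence condition for all modes at once, outside a single null set
  of times.\<close>

lemma countable_trigm_index: "countable (UNIV :: ((int^3) \<times> bool) set)"
proof -
  have "(UNIV :: (int^3) set) \<subseteq> (\<Union>n::nat. freqs (real n))"
  proof
    fix k :: "int^3"
    obtain n :: nat where "norm (wavevec k) \<le> real n" using real_arch_simple by blast
    then show "k \<in> (\<Union>n::nat. freqs (real n))" unfolding freqs_def by (intro UN_I[where a = n] CollectI UNIV_I)
  qed
  then have "countable (UNIV :: (int^3) set)"
    by (rule countable_subset) (simp add: countable_finite)
  then show ?thesis using countable_SIGMA[of "UNIV :: (int^3) set" "\<lambda>_. UNIV :: bool set"] by (simp add: countable_finite)
qed

theorem theorem6p3:
  fixes \<alpha> \<beta> T :: real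
    and \<eta> :: "real \<Rightarrow> real"
    and u B A :: "real \<Rightarrow> vdist"
  assumes "0 < T"
    and "0 < 3 * \<alpha>" and "3 * \<alpha> < \<beta>" and "\<beta> < 1"
    and "lp_cutoff \<eta>"
    and "\<exists>\<epsilon>>0. Linf_sobolev T (\<alpha> + \<epsilon>) u"
    and "L3_besov \<eta> T \<beta> u"
    and "AE t in lebesgue_on {0<..<T}. divergence_free (u t)"
    and "functional_weak_solution \<eta> T \<alpha> u B"
    and "L3_besov \<eta> T (- \<alpha>) B"
    and "AE t in lebesgue_on {0<..<T}. mean_free (B t)"
    and "\<And>t. A t = magnetic_potential (B t)"
  shows "\<exists>N \<in> null_sets lebesgue. \<forall>t1 \<in> {0<..<T} - N. \<forall>t2 \<in> {0<..<T} - N.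
           dual_bracket \<eta> (B t1) (A t1) = dual_bracket \<eta> (B t2) (A t2)"
proof -
  have eta: "lp_cutoff \<eta>" by fact
  have T: "0 < T" by fact
  \<comment> \<open>The relation \<open>2 * \<alpha> < \<beta>\<close> makes the flux decay in
    \<open>N\<close>, and \<open>\<alpha> \<le> 1/2\<close> makes the series of helicity modes
    converge absolutely.\<close>
  have \<alpha>: "0 < \<alpha>" "\<alpha> < \<beta>" "\<beta> < 1" "2 * \<alpha> < \<beta>" "\<alpha> \<le> 1/2" using assms(2-4) by linarith+
  obtain \<epsilon> where \<epsilon>: "0 < \<epsilon>" "Linf_sobolev T (\<alpha> + \<epsilon>) u" using assms(6) by blast
  have BL: "Linf_sobolev T (- \<alpha>) B" using assms(9) by (simp add: functional_weak_solution_def)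
  let ?nB = "\<lambda>t. vec_norm (besov_norm \<eta> (- \<alpha>) 3) (B t)" and ?nu = "\<lambda>t. vec_norm (besov_norm \<eta> \<beta> 3) (u t)"
  obtain CB where CB: "AE t in lebesgue_on {0<..<T}. vec_norm (sobolev_norm (- \<alpha>)) (B t) \<le> CB"
    using BL unfolding Linf_sobolev_def bochner_Linf_def by blast
  obtain Cu where Cu: "AE t in lebesgue_on {0<..<T}. vec_norm (sobolev_norm (\<alpha> + \<epsilon>)) (u t) \<le> Cu"
    using \<epsilon>(2) unfolding Linf_sobolev_def bochner_Linf_def by blast
  define P where "P t \<longleftrightarrow> B t \<in> vec_space (sobolev_space (- \<alpha>)) \<and> vec_norm (sobolev_norm (- \<alpha>)) (B t) \<le> CB \<and>
    u t \<in> vec_space (sobolev_space (\<alpha> + \<epsilon>)) \<and> vec_norm (sobolev_norm (\<alpha> + \<epsilon>)) (u t) \<le> Cu \<and>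
    B t \<in> vec_space (besov_space \<eta> (- \<alpha>) 3) \<and> u t \<in> vec_space (besov_space \<eta> \<beta> 3) \<and> mean_free (B t)" for t
  have "AE t in lebesgue_on {0<..<T}. P t"
  proof -
    have "AE t in lebesgue_on {0<..<T}. B t \<in> vec_space (sobolev_space (- \<alpha>))"
      "AE t in lebesgue_on {0<..<T}. u t \<in> vec_space (sobolev_space (\<alpha> + \<epsilon>))"
      "AE t in lebesgue_on {0<..<T}. B t \<in> vec_space (besov_space \<eta> (- \<alpha>) 3)"
      "AE t in lebesgue_on {0<..<T}. u t \<in> vec_space (besov_space \<eta> \<beta> 3)"
      using BL \<epsilon>(2) assms(7,10)
      unfolding Linf_sobolev_def bochner_Linf_def L3_besov_def bochner_L_def strongly_measurable_def by blast+
    with CB Cu assms(11) show ?thesis unfolding P_def by eventually_elim blast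
  qed
  then have P: "AE t in lebesgue. t \<in> {0<..<T} \<longrightarrow> P t" unfolding AE_lebesgue_on .
  \<comment> \<open>Put to zero at the exceptional times, the paths lie in their spaces at every
    time; the integrals of the weak formulation do not see the change.\<close>
  define B' where "B' t = (if t \<in> {0<..<T} \<and> P t then B t else zero_vdist)" for t
  define u' where "u' t = (if t \<in> {0<..<T} \<and> P t then u t else zero_vdist)" for t
  have good: "B' t = B t" "u' t = u t" if "t \<in> {0<..<T}" "P t" for t
    using that by (simp_all add: B'_def u'_def)
  have B': "sobolev_path (- \<alpha>) B'" unfolding B'_def[abs_def]
    by (rule sobolev_path_modification[OF BL P, of CB]) (simp add: P_def)
  have u': "sobolev_path (\<alpha> + \<epsilon>) u'" unfolding u'_def[abs_def]
    by (rule sobolev_path_modification[OF \<epsilon>(2) P, of Cu]) (simp add: P_def)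
  have ar: "0 \<le> \<alpha>" "\<alpha> \<le> \<alpha> + \<epsilon>" using \<alpha> \<epsilon> by auto
  have eq: "AE t in lebesgue. t \<in> {0<..<T} \<longrightarrow> B t = B' t \<and> u t = u' t"
    using P by eventually_elim (use good in auto)
  then have eqB: "AE t in lebesgue. t \<in> {0<..<T} \<longrightarrow> B t = B' t" by eventually_elim blast
  have Bs: "B' t $ i \<in> sobolev_space (- \<alpha>)" and us: "u' t $ i \<in> sobolev_space (\<alpha> + \<epsilon>)" for t i
    using B' u' by (auto simp: sobolev_path_def)

  define p where "p k i t = (B' t $ i) (cosm k)" for k i t
  define q where "q k i t = (B' t $ i) (sinm k)" for k i t
  define cc where "cc k t = (\<lambda>j. (bony_cross \<eta> (B' t) (u' t) $ j) (cosm k))" for k t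
  define cs where "cs k t = (\<lambda>j. (bony_cross \<eta> (B' t) (u' t) $ j) (sinm k))" for k t
  \<comment> \<open>The coefficient pairs (1, 0) and (0, 1) isolate the two modes. The cosine mode
    of \<open>B\<close> is driven by the sine mode of the Bony product, and conversely.\<close>
  have pm: "\<exists>c0. AE t in lebesgue. t \<in> {0<..<T} \<longrightarrow> p k i t = c0 - primitive (\<lambda>t. cross_k k (cs k t) i) t" for k i
    using weak_mode[OF eta T assms(9) B' u' ar eq, of 1 i k 0] by (simp add: p_def cs_def)
  have qm: "\<exists>c0. AE t in lebesgue. t \<in> {0<..<T} \<longrightarrow> q k i t = c0 - primitive (\<lambda>t. - cross_k k (cc k t) i) t" for k i
    using weak_mode[OF eta T assms(9) B' u' ar eq, of 0 i k 1] by (simp add: q_def cc_def)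
  obtain cp where cp: "\<And>k i. AE t in lebesgue. t \<in> {0<..<T} \<longrightarrow> p k i t = cp k i - primitive (\<lambda>t. cross_k k (cs k t) i) t"
    using pm by metis
  obtain cq where cq: "\<And>k i. AE t in lebesgue. t \<in> {0<..<T} \<longrightarrow> q k i t = cq k i - primitive (\<lambda>t. - cross_k k (cc k t) i) t"
    using qm by metis
  have bm: "bdd_meas (\<lambda>t. cross_k k (cs k t) i)" "bdd_meas (\<lambda>t. - cross_k k (cc k t) i)" for k i
  proof -
    have b: "bdd_meas (\<lambda>t. cc k t j)" "bdd_meas (\<lambda>t. cs k t j)" for j
      using bony_cross_bdd_meas[OF eta B' u' ar, of j "(k, True)"] bony_cross_bdd_meas[OF eta B' u' ar, of j "(k, False)"]
      by (simp_all add: cc_def cs_def)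
    show "bdd_meas (\<lambda>t. cross_k k (cs k t) i)" unfolding cross_k_def by (intro bdd_meas_diff bdd_meas_scale b)
    have "bdd_meas (\<lambda>t. (- 1) * cross_k k (cc k t) i)" unfolding cross_k_def by (intro bdd_meas_diff bdd_meas_scale b)
    then show "bdd_meas (\<lambda>t. - cross_k k (cc k t) i)" by simp
  qed
  have div: "AE t in lebesgue. t \<in> {0<..<T} \<longrightarrow> (\<forall>q. (\<Sum>i\<in>UNIV. of_int (fst q $ i) * (B' t $ i) (trigm q)) = 0)"
  proof -
    have "AE t in lebesgue. \<forall>q\<in>UNIV. t \<in> {0<..<T} \<longrightarrow> (\<Sum>i\<in>UNIV. of_int (fst q $ i) * (B' t $ i) (trigm q)) = 0"
      by (rule AE_ball_countable'[OF weak_divergence[OF eta assms(9) B' eqB] countable_trigm_index])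
    then show ?thesis by eventually_elim blast
  qed

  define r where "r = 2 powr (2 * \<alpha> - \<beta>)"
  have r: "0 \<le> r" "r < 1" using \<alpha> by (simp_all add: r_def powr_less_one)
  define K where "K = 2 * (684 * 2 ^ 7 / ((2 powr \<alpha> - 1)\<^sup>2 * (2 powr (1 - \<beta>) - 1)) + 24 / ((2 powr \<alpha> - 1) * (1 - 2 powr (\<alpha> - \<beta>)))) * r ^ 7"
  have K: "0 \<le> K"
  proof -
    have "1 < 2 powr \<alpha>" "1 < 2 powr (1 - \<beta>)" "2 powr (\<alpha> - \<beta>) < 1"
      using \<alpha> by (simp_all add: powr_less_one)
    then show ?thesis unfolding K_def using r by (intro mult_nonneg_nonneg add_nonneg_nonneg divide_nonneg_nonneg) auto
  qed
  \<comment> \<open>Integrable majorant of the flux in time. The flux is cubic in the Besov norms,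
    which is where integrability to the third power in time enters; the 2 collects the ones added to
    the two norms below.\<close>
  define \<rho> where "\<rho> t = ?nB t powr 3 + ?nu t powr 3 + 2" for t
  have \<rho>0: "0 \<le> \<rho> t" for t unfolding \<rho>_def by (intro add_nonneg_nonneg powr_ge_zero) auto
  have \<rho>i: "\<rho> integrable_on {0..T}"
  proof -
    have "integrable (lebesgue_on {0<..<T}) (\<lambda>t. ?nB t powr 3)" "integrable (lebesgue_on {0<..<T}) (\<lambda>t. ?nu t powr 3)"
      using assms(7,10) by (simp_all add: L3_besov_def bochner_L_def)
    then have "(\<lambda>t. ?nB t powr 3) integrable_on {0<..<T}" "(\<lambda>t. ?nu t powr 3) integrable_on {0<..<T}"
      by (auto intro: integrable_on_lebesgue_on)
    then have "(\<lambda>t. ?nB t powr 3) integrable_on {0..T}" "(\<lambda>t. ?nu t powr 3) integrable_on {0..T}"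
      by (simp_all add: integrable_on_open_interval_real)
    then show ?thesis unfolding \<rho>_def[abs_def] by (intro integrable_add integrable_const_ivl)
  qed

  let ?S = "\<lambda>N. freqs (4 * 2 ^ N)"
  let ?W = "\<lambda>N k. jackson (2 ^ N) k * (2 / (cellvol * (norm (wavevec k))\<^sup>2))"
  have prod: "\<bar>\<Sum>k\<in>?S N. ?W N k * (\<Sum>i\<in>UNIV. cross_k k (cs k t) i * cross_k k (\<lambda>j. q k j t) i + p k i t * (- cross_k k (cross_k k (cc k t)) i))\<bar>
      \<le> K * 16 * r ^ N * \<rho> t"
    if t: "t \<in> {0<..<T}" "P t" and dv: "\<And>q. (\<Sum>i\<in>UNIV. of_int (fst q $ i) * (B' t $ i) (trigm q)) = 0" for t N
  proof -
    \<comment> \<open>The added 1 makes the block bounds strictly positive. The factor 2 in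
      \<open>Y\<close> absorbs the \<open>2 powr \<beta>\<close> that stems from the numbering of
      blocks.\<close>
    define X where "X = ?nB t + 1"
    define Y where "Y = 2 * (?nu t + 1)"
    have BB: "B' t \<in> vec_space (besov_space \<eta> (- \<alpha>) 3)" and uu: "u' t \<in> vec_space (besov_space \<eta> \<beta> 3)"
      using t good by (simp_all add: P_def)
    note bB = besov_vec_block_bound[OF eta BB] and bu = besov_vec_block_bound[OF eta uu]
    have n0: "0 \<le> ?nB t" "0 \<le> ?nu t" using bB(2) bu(2) good[OF t] by simp_all
    have XY: "0 < X" "0 < Y" using n0 by (simp_all add: X_def Y_def)
    have LB: "tint (\<lambda>x. \<bar>lp_block \<eta> j (B' t $ i) x\<bar> ^ 3) \<le> ((2 powr \<alpha>) ^ j * X) ^ 3" for i j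
    proof -
      have "2 powr (- \<alpha>) \<le> 1" using \<alpha> powr_mono[of "- \<alpha>" 0 2] by simp
      then have "2 powr (- \<alpha>) * (2 powr \<alpha>) ^ j * ?nB t \<le> 1 * (2 powr \<alpha>) ^ j * X"
        using n0 by (intro mult_mono) (auto simp: X_def)
      then have "(2 powr (- \<alpha>) * (2 powr \<alpha>) ^ j * ?nB t) ^ 3 \<le> ((2 powr \<alpha>) ^ j * X) ^ 3"
        using n0 by (intro power_mono) auto
      with bB(1)[of j i] show ?thesis unfolding good[OF t] by simp
    qed
    have Lu: "tint (\<lambda>x. \<bar>lp_block \<eta> j (u' t $ i) x\<bar> ^ 3) \<le> ((2 powr (- \<beta>)) ^ j * Y) ^ 3" for i j
    proof -
      have "2 powr \<beta> \<le> 2" using \<alpha> powr_mono[of \<beta> 1 2] by simp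
      then have "2 powr \<beta> * (2 powr (- \<beta>)) ^ j * ?nu t \<le> 2 * (2 powr (- \<beta>)) ^ j * (?nu t + 1)"
        using n0 by (intro mult_mono) auto
      also have "\<dots> = (2 powr (- \<beta>)) ^ j * Y" by (simp add: Y_def)
      finally have "(2 powr \<beta> * (2 powr (- \<beta>)) ^ j * ?nu t) ^ 3 \<le> ((2 powr (- \<beta>)) ^ j * Y) ^ 3"
        using n0 by (intro power_mono) auto
      with bu(1)[of j i] show ?thesis unfolding good[OF t] by simp
    qed
    have mean: "(B' t $ i) (\<lambda>x. 1) = 0" for i using t good by (simp add: P_def mean_free_def)
    have "\<bar>\<Sum>k\<in>?S N. ?W N k * (\<Sum>i\<in>UNIV. cross_k k (cs k t) i * cross_k k (\<lambda>j. q k j t) i + p k i t * (- cross_k k (cross_k k (cc k t)) i))\<bar>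
      \<le> K * (X\<^sup>2 * Y) * r ^ N"
      using helicity_production_bound[OF eta Bs us ar XY LB Lu \<alpha>(1-3) dv mean, of N]
      unfolding p_def q_def cs_def cc_def K_def r_def by (simp only: mult.assoc)
    also have "X\<^sup>2 * Y \<le> 16 * \<rho> t"
    proof -
      have double: "2 * z \<le> 8 * (a + b + 2)" if "z \<le> 4 * (a + 1) + 4 * (b + 1)" for a b z :: real
        using that by simp
      have "X\<^sup>2 * (?nu t + 1) \<le> X ^ 3 + (?nu t + 1) ^ 3" using XY n0 by (intro square_mult_le_cubes) auto
      also have "\<dots> \<le> 4 * (?nB t ^ 3 + 1) + 4 * (?nu t ^ 3 + 1)"
        unfolding X_def by (intro add_mono cube_add_one_le n0)
      finally have "2 * (X\<^sup>2 * (?nu t + 1)) \<le> 8 * (?nB t ^ 3 + ?nu t ^ 3 + 2)" by (rule double)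
      moreover have "X\<^sup>2 * Y = 2 * (X\<^sup>2 * (?nu t + 1))" by (simp only: Y_def mult.left_commute)
      ultimately have "X\<^sup>2 * Y \<le> 8 * (?nB t ^ 3 + ?nu t ^ 3 + 2)" by (simp only:)
      also have "?nB t ^ 3 + ?nu t ^ 3 + 2 = \<rho> t"
        unfolding \<rho>_def using n0 by (simp add: powr_numeral)
      finally show ?thesis using \<rho>0[of t] by linarith
    qed
    then have "K * (X\<^sup>2 * Y) * r ^ N \<le> K * (16 * \<rho> t) * r ^ N" using K r by (intro mult_right_mono mult_left_mono) auto
    finally show ?thesis by (simp add: mult_ac)
  qed

  define E where "E N t = (\<Sum>k\<in>?S N. jackson (2 ^ N) k * helicity_mode (B' t) k)" for N t
  \<comment> \<open>Up to a null set depending on \<open>N\<close>, the regularised helicity varies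
    over the whole time interval by an amount of order \<open>r ^ N\<close>.\<close>
  have "\<exists>M\<in>null_sets lebesgue. \<forall>t1\<in>{0<..<T} - M. \<forall>t2\<in>{0<..<T} - M. \<bar>E N t1 - E N t2\<bar> \<le> K * 16 * r ^ N * integral {0..T} \<rho>" for N
  proof -
    let ?J = "?S N \<times> (UNIV :: 3 set) \<times> (UNIV :: bool set)"
    let ?w = "\<lambda>(k, i, s). ?W N k * (if s then of_int (k $ (i + 1)) else - of_int (k $ (i + 2)))"
    let ?x = "\<lambda>(k, i :: 3, s :: bool). p k i" and ?y = "\<lambda>(k, i, s). q k (if s then i + 2 else i + 1)"
    let ?g = "\<lambda>(k, i, s :: bool) t. cross_k k (cs k t) i" and ?h = "\<lambda>(k, i, s) t. - cross_k k (cc k t) (if s then i + 2 else i + 1)"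
    have E: "E N t = (\<Sum>j\<in>?J. ?w j * (?x j t * ?y j t))" for t
    proof -
      have "(\<Sum>j\<in>?J. ?w j * (?x j t * ?y j t)) = (\<Sum>(k, i, s)\<in>?J. ?W N k * (if s then of_int (k $ (i + 1)) else - of_int (k $ (i + 2))) * (p k i t * q k (if s then i + 2 else i + 1) t))"
        by (simp only: split_def)
      also have "\<dots> = (\<Sum>k\<in>?S N. ?W N k * (\<Sum>i\<in>UNIV. p k i t * cross_k k (\<lambda>j. q k j t) i))"
        by (rule cross_k_bilinear_sum[OF finite_freqs])
      also have "\<dots> = E N t" unfolding E_def helicity_mode_def p_def q_def by (simp only: mult.assoc)
      finally show ?thesis by simp
    qed
    have "\<exists>M\<in>null_sets lebesgue. \<forall>t1\<in>{0<..<T} - M. \<forall>t2\<in>{0<..<T} - M.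
       \<bar>(\<Sum>j\<in>?J. ?w j * (?x j t1 * ?y j t1)) - (\<Sum>j\<in>?J. ?w j * (?x j t2 * ?y j t2))\<bar> \<le> integral {0..T} (\<lambda>t. K * 16 * r ^ N * \<rho> t)"
    proof (rule bilinear_increment_bound[where g = ?g and h = ?h and c = "\<lambda>(k, i, s). cp k i" and d = "\<lambda>(k, i, s). cq k (if s then i + 2 else i + 1)"])
      show "AE t in lebesgue. t \<in> {0<..<T} \<longrightarrow> \<bar>\<Sum>j\<in>?J. ?w j * (?g j t * ?y j t + ?x j t * ?h j t)\<bar> \<le> K * 16 * r ^ N * \<rho> t"
        using P div
      proof eventually_elim
        case (elim t)
        show ?case
        proof
          assume t: "t \<in> {0<..<T}"
          have "(\<Sum>j\<in>?J. ?w j * (?g j t * ?y j t + ?x j t * ?h j t))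
            = (\<Sum>(k, i, s)\<in>?J. ?W N k * (if s then of_int (k $ (i + 1)) else - of_int (k $ (i + 2))) * (cross_k k (cs k t) i * q k (if s then i + 2 else i + 1) t))
            + (\<Sum>(k, i, s)\<in>?J. ?W N k * (if s then of_int (k $ (i + 1)) else - of_int (k $ (i + 2))) * (p k i t * - cross_k k (cc k t) (if s then i + 2 else i + 1)))"
            unfolding sum.distrib[symmetric] by (simp only: split_def distrib_left)
          also have "\<dots> = (\<Sum>k\<in>?S N. ?W N k * (\<Sum>i\<in>UNIV. cross_k k (cs k t) i * cross_k k (\<lambda>j. q k j t) i))
            + (\<Sum>k\<in>?S N. ?W N k * (\<Sum>i\<in>UNIV. p k i t * cross_k k (\<lambda>j. - cross_k k (cc k t) j) i))"
            by (intro arg_cong2[where f = "(+)"] cross_k_bilinear_sum[OF finite_freqs])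
          also have "\<dots> = (\<Sum>k\<in>?S N. ?W N k * (\<Sum>i\<in>UNIV. cross_k k (cs k t) i * cross_k k (\<lambda>j. q k j t) i + p k i t * (- cross_k k (cross_k k (cc k t)) i)))"
          proof -
            have "cross_k k (\<lambda>j. - cross_k k (cc k t) j) i = - cross_k k (cross_k k (cc k t)) i" for k i
              unfolding cross_k_def[of k "\<lambda>j. - cross_k k (cc k t) j"] cross_k_def[of k "cross_k k (cc k t)"] by simp
            then show ?thesis by (simp only: sum.distrib distrib_left)
          qed
          finally show "\<bar>\<Sum>j\<in>?J. ?w j * (?g j t * ?y j t + ?x j t * ?h j t)\<bar> \<le> K * 16 * r ^ N * \<rho> t"
            by (rule ssubst[where P = "\<lambda>x. \<bar>x\<bar> \<le> K * 16 * r ^ N * \<rho> t"]) (rule prod[OF t elim(1)[THEN mp, OF t] elim(2)[THEN mp, OF t, THEN spec]])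
        qed
      qed
    qed (use cp cq bm \<rho>0 K r in \<open>auto intro!: integrable_on_mult_right \<rho>i mult_nonneg_nonneg\<close>)
    then show ?thesis unfolding E integral_mult_right .
  qed
  then obtain M where M: "\<And>N. M N \<in> null_sets lebesgue"
    "\<And>N t1 t2. t1 \<in> {0<..<T} - M N \<Longrightarrow> t2 \<in> {0<..<T} - M N \<Longrightarrow> \<bar>E N t1 - E N t2\<bar> \<le> K * 16 * r ^ N * integral {0..T} \<rho>"
    by metis
  obtain M' where M': "M' \<in> null_sets lebesgue" "\<And>t. t \<in> space lebesgue - M' \<Longrightarrow> t \<in> {0<..<T} \<longrightarrow> P t"
    using P by (rule AE_E3) blast
  have lim: "(\<lambda>N. E N t) \<longlonglongrightarrow> dual_bracket \<eta> (B t) (A t)" if t: "t \<in> {0<..<T}" "P t" for t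
    using dual_bracket_helicity[OF eta Bs ar(1) \<alpha>(5), of t] good[OF t] unfolding E_def assms(12) by simp
  \<comment> \<open>The union of the countably many null sets is null. Off it, the increments of the
    regularised helicities tend to 0, while the helicities themselves converge to the
    brackets.\<close>
  show ?thesis
  proof (intro bexI[where x = "(\<Union>N. M N) \<union> M'"] ballI)
    show "(\<Union>N. M N) \<union> M' \<in> null_sets lebesgue" by (intro null_sets.Un null_sets_UN M(1) M'(1))
    fix t1 t2 assume t: "t1 \<in> {0<..<T} - ((\<Union>N. M N) \<union> M')" "t2 \<in> {0<..<T} - ((\<Union>N. M N) \<union> M')"
    then have P12: "P t1" "P t2" using M'(2) by auto
    have "(\<lambda>N. \<bar>E N t1 - E N t2\<bar>) \<longlonglongrightarrow> \<bar>dual_bracket \<eta> (B t1) (A t1) - dual_bracket \<eta> (B t2) (A t2)\<bar>"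
      using t P12 by (intro tendsto_rabs tendsto_diff lim) auto
    moreover have "(\<lambda>N. K * 16 * r ^ N * integral {0..T} \<rho>) \<longlonglongrightarrow> K * 16 * 0 * integral {0..T} \<rho>"
      using r by (intro tendsto_mult tendsto_const LIMSEQ_power_zero) simp
    moreover have "\<bar>E N t1 - E N t2\<bar> \<le> K * 16 * r ^ N * integral {0..T} \<rho>" for N
      by (rule M(2)) (use t in auto)
    ultimately have "\<bar>dual_bracket \<eta> (B t1) (A t1) - dual_bracket \<eta> (B t2) (A t2)\<bar> \<le> K * 16 * 0 * integral {0..T} \<rho>"
      by (intro LIMSEQ_le) auto
    then show "dual_bracket \<eta> (B t1) (A t1) = dual_bracket \<eta> (B t2) (A t2)" by simp
  qed
qed

end
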